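(* Assume the setting in the context, with $p\in\mathbb{N}$, $p\ge2$, $\alpha\in\big(\frac{p-2}{2(p-1)},\frac{p}{2(p-1)}\big)$ and $\beta=\frac{\alpha}{2}-\frac{(1-\alpha)(p-2)}{2p}$. Let $\gamma>0$, and for $N\in\mathbb{N}$, $N\ge2$, set $$M_N=\lfloor N^{2\beta}\rfloor,\qquad m_N=(d+1)\,5^N N^{2\beta N}.$$ Let $(\hat u_N)_{N\ge2}$ be surrogates in $\mathcal{S}$ ($\hat u_N$ being obtained with a number of training points of order $m_N$) whose error decays polynomially: $e(\hat u_N)=O(m_N^{-\gamma})$ as $N\to\infty$. Let $\breve{\mathbf u}$ and $\breve{\mathbf U}_{N,M_N}$ be the defect vector and the full-history MLP estimator associated with $\hat u_N$. Then the error bound improves from $O(m_N^{-\gamma})$ to $$\sup_{(t,x)\in[0,T)\times\mathbb{R}^d}\ \max_{\varsigma\in\{1,\dots,d+1\}}\Big\|\big(\breve{\mathbf U}_{N,M_N}(t,x)-\breve{\mathbf u}(t,x)\big)_\varsigma\Big\|_{L^2(\Omega)}=O\big(m_N^{-\gamma-\frac12+o(1)}\big)\qquad(N\to\infty).$$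
   Context: $\mathbb{N}=\{1,2,\dots\}$, $T\in(0,\infty)$, $d\in\mathbb{N}$, $\sigma\in\mathbb{R}\setminus\{0\}$ a scalar; all fixed. PDE. $F:\mathbb{R}\times\mathbb{R}^d\to\mathbb{R}$ and $g:\mathbb{R}^d\to\mathbb{R}$ are Borel and Lipschitz: $|F(v_1,z_1)-F(v_2,z_2)|\le L(|v_1-v_2|+\|z_1-z_2\|_1)$ and $|g(x)-g(y)|\le K\|x-y\|_1$ for some $L,K\ge0$. $u\in C^{1,2}([0,T]\times\mathbb{R}^d,\mathbb{R})$ satisfies $\partial_tu+\frac{\sigma^2}{2}\Delta_xu+F(u,\sigma\nabla_xu)=0$ on $[0,T)\times\mathbb{R}^d$, $u(T,\cdot)=g$. Surrogates. $\mathcal{S}$ is a set of functions $\hat u\in C^{1,2}([0,T]\times\mathbb{R}^d,\mathbb{R})$ with an error measure $e:\mathcal{S}\to[0,\infty)$. For $\hat u\in\mathcal{S}$ put $\breve u=u-\hat u$, $\breve{\mathbf u}=(\breve u,\sigma\nabla_x\breve u)\in\mathbb{R}^{1+d}$, $\breve g=g-\hat u(T,\cdot)$, $\epsilon=\partial_t\hat u+\frac{\sigma^2}{2}\Delta_x\hat u+F(\hat u,\sigma\nabla_x\hat u)$, and $\breve F(v,z,t,x)=F(\hat u(t,x)+v,\sigma\nabla_x\hat u(t,x)+z)-F(\hat u(t,x),\sigma\nabla_x\hat u(t,x))+\epsilon(t,x)$. Assume every $\hat u\in\mathcal{S}$ satisfies: (i) $|\hat u(T,x)-\hat u(T,y)|\le\hat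 K\|x-y\|_1$ for some $\hat K\in[0,\infty)$; (ii) $\sup_{t\in[0,T]}\|\breve u(t,\cdot)\|_{W^{1,\infty}(\mathbb{R}^d)}<\infty$, and with constants $C_{F,1},C_{F,2}>0$ independent of $\hat u$: $\sup_{(t,x)\in[0,T]\times\mathbb{R}^d}|\epsilon(t,x)|\le C_{F,1}e(\hat u)$ and $\sup_{t\in[0,T]}\|\breve u(t,\cdot)\|_{W^{1,\infty}(\mathbb{R}^d)}\le C_{F,2}e(\hat u)$, where $\|\phi\|_{W^{1,\infty}}=\sum_{|a|\le1}\|D^a\phi\|_{L^\infty}$; (iii) for all $t\in[0,T)$, $x\in\mathbb{R}^d$, $q\in[1,p)$: $\int_0^1 \frac{dr}{r^{q/2}\rho(r)^{q-1}}+\sup_{s\in[t,T)}\mathbb{E}\big[|\epsilon(t,x+\sigma W_s-\sigma W_t)|^q\big]<\infty$, with $W$ a standard $d$-dimensional Brownian motion and $\rho(r)=(1-\alpha)r^{-\alpha}$ on $(0,1)$. Full-history multilevel Picard (MLP) estimator. Let $\Theta=\bigcup_{n\ge1}\mathbb{Z}^n$, and let $W^\theta$ ($\theta\in\Theta$) be standard $d$-dimensional Brownian motions and $\mathfrak r^\theta$ ($\theta\in\Theta$) random variables on $(0,1)$ with density $\rho$, all independent, on a probability space $\Omega$. Let $\varrho(t,r)=\frac1{T-t}\rho\big(\frac{r-t}{T-t}\big)$. For $M\in\mathbb{N}$, $\theta\in\Theta$ set $\breve{\mathbf U}^\theta_{0,M}=\mathbf 0_{d+1}$, and for $n\in\mathbb{N}$,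 $(t,x)\in[0,T)\times\mathbb{R}^d$, $$\breve{\mathbf U}^\theta_{n,M}(t,x)=(\breve g(x),\mathbf 0_d)+\frac1{M^n}\sum_{i=1}^{M^n}\Big(\breve g\big(x+\sigma(W^{(\theta,0,-i)}_T-W^{(\theta,0,-i)}_t)\big)-\breve g(x)\Big)\Big(1,\tfrac{W^{(\theta,0,-i)}_T-W^{(\theta,0,-i)}_t}{T-t}\Big)$$ $$+\sum_{l=0}^{n-1}\frac1{M^{n-l}}\sum_{i=1}^{M^{n-l}}\frac{\breve F\big(\breve{\mathbf U}^{(\theta,l,i)}_{l,M}(R,Y),R,Y\big)-\mathbf 1_{\{l\ge1\}}\breve F\big(\breve{\mathbf U}^{(\theta,-l,i)}_{l-1,M}(R,Y),R,Y\big)}{\varrho(t,R)}\Big(1,\tfrac{W^{(\theta,l,i)}_R-W^{(\theta,l,i)}_t}{R-t}\Big),$$ where in the $(l,i)$ summand $R=t+(T-t)\mathfrak r^{(\theta,l,i)}$ and $Y=x+\sigma(W^{(\theta,l,i)}_R-W^{(\theta,l,i)}_t)$. $\breve{\mathbf U}_{N,M}$ denotes $\breve{\mathbf U}^{\theta}_{N,M}$ for a fixed $\theta\in\mathbb{Z}$. Interpretation of $m_N$: it is the total number of points used; $d(5M_N)^N\le m_N$ is the number of points counted for one evaluation of $\breve{\mathbf U}_{N,M_N}$. The corrected solution $\hat u_N+(\breve{\mathbf U}_{N,M_N})_1$ has the error $(\breve{\mathbf U}_{N,M_N}-\breve{\mathbf u})_1$. *)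

theory Defs
  imports "HOL-Probability.Probability" "HOL-Library.Landau_Symbols"
begin

section \<open>Function spaces on \<open>[0,T] \<times> \<real>\<^sup>d\<close>\<close>

definition l1_norm :: "real ^ 'd \<Rightarrow> real" where
  "l1_norm x = (\<Sum>i\<in>UNIV. \<bar>x $ i\<bar>)"

definition partial_deriv :: "'d \<Rightarrow> (real ^ 'd \<Rightarrow> real) \<Rightarrow> real ^ 'd \<Rightarrow> real" where
  "partial_deriv i \<phi> x = deriv (\<lambda>h. \<phi> (x + h *\<^sub>R axis i 1)) 0"

definition grad :: "(real ^ 'd \<Rightarrow> real) \<Rightarrow> real ^ 'd \<Rightarrow> real ^ 'd" where
  "grad \<phi> x = (\<chi> i. partial_deriv i \<phi> x)"

definition laplacian :: "(real ^ 'd \<Rightarrow> real) \<Rightarrow> real ^ 'd \<Rightarrow> real" where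
  "laplacian \<phi> x = (\<Sum>i\<in>UNIV. partial_deriv i (partial_deriv i \<phi>) x)"

text \<open>The time derivative is one-sided at the end points \<open>0\<close> and \<open>T\<close>; in particular, nothing below
  depends on the values of a space-time function at times outside \<open>[0,T]\<close>.\<close>

definition time_deriv :: "real \<Rightarrow> (real \<Rightarrow> real ^ 'd \<Rightarrow> real) \<Rightarrow> real \<Rightarrow> real ^ 'd \<Rightarrow> real" where
  "time_deriv T v t x = vector_derivative (\<lambda>s. v s x) (at t within {0..T})"

definition C12 :: "real \<Rightarrow> (real \<Rightarrow> real ^ 'd \<Rightarrow> real) \<Rightarrow> bool" where
  "C12 T v \<longleftrightarrow>
     (\<forall>t\<in>{0..T}. \<forall>x. (\<lambda>s. v s x) differentiable (at t within {0..T})) \<and>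
     (\<forall>t\<in>{0..T}. \<forall>x i. (\<lambda>h. v t (x + h *\<^sub>R axis i 1)) field_differentiable (at 0)) \<and>
     (\<forall>t\<in>{0..T}. \<forall>x i j.
        (\<lambda>h. partial_deriv i (v t) (x + h *\<^sub>R axis j 1)) field_differentiable (at 0)) \<and>
     continuous_on ({0..T} \<times> UNIV) (\<lambda>(t, x). v t x) \<and>
     continuous_on ({0..T} \<times> UNIV) (\<lambda>(t, x). time_deriv T v t x) \<and>
     (\<forall>i. continuous_on ({0..T} \<times> UNIV) (\<lambda>(t, x). partial_deriv i (v t) x)) \<and>
     (\<forall>i j. continuous_on ({0..T} \<times> UNIV) (\<lambda>(t, x). partial_deriv j (partial_deriv i (v t)) x))"

text \<open>The norm of \<open>W\<^sup>1\<^sup>,\<^sup>\<infinity>(\<real>\<^sup>d)\<close>, with value \<open>\<infinity>\<close> allowed. It is only applied to continuously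
  differentiable functions, whose weak derivatives are the classical partial derivatives.\<close>

definition W1inf_norm :: "(real ^ 'd \<Rightarrow> real) \<Rightarrow> ereal" where
  "W1inf_norm \<phi> = esssup lborel (\<lambda>x. ereal \<bar>\<phi> x\<bar>)
     + (\<Sum>i\<in>UNIV. esssup lborel (\<lambda>x. ereal \<bar>partial_deriv i \<phi> x\<bar>))"

text \<open>The value \<open>\<infinity>\<close> is assigned to functions that are not (measurable and) square integrable.\<close>

definition L2_norm_rv :: "'w measure \<Rightarrow> ('w \<Rightarrow> real) \<Rightarrow> ennreal" where
  "L2_norm_rv \<Omega> X =
     (if X \<in> borel_measurable \<Omega> \<and> integrable \<Omega> (\<lambda>\<omega>. (X \<omega>)\<^sup>2)
      then ennreal (sqrt (\<integral>\<omega>. (X \<omega>)\<^sup>2 \<partial>\<Omega>)) else \<infinity>)"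


section \<open>Brownian motions and the random input\<close>

text \<open>Standard \<open>d\<close>-dimensional Brownian motion on the time interval \<open>[0,T]\<close>.\<close>

definition std_brownian_motion :: "'w measure \<Rightarrow> real \<Rightarrow> (real \<Rightarrow> 'w \<Rightarrow> real ^ 'd) \<Rightarrow> bool" where
  "std_brownian_motion \<Omega> T B \<longleftrightarrow>
     (\<forall>t\<in>{0..T}. B t \<in> borel_measurable \<Omega>) \<and>
     (AE \<omega> in \<Omega>. B 0 \<omega> = 0) \<and>
     (\<forall>\<omega>\<in>space \<Omega>. continuous_on {0..T} (\<lambda>t. B t \<omega>)) \<and>
     (\<forall>s t. 0 \<le> s \<and> s < t \<and> t \<le> T \<longrightarrow>
        distributed \<Omega> lborel (\<lambda>\<omega>. B t \<omega> - B s \<omega>)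
          (\<lambda>y. ennreal (\<Prod>i\<in>UNIV. normal_density 0 (sqrt (t - s)) (y $ i)))) \<and>
     (\<forall>n (\<tau> :: nat \<Rightarrow> real). (\<forall>k\<le>n. \<tau> k \<in> {0..T}) \<and> (\<forall>k<n. \<tau> k < \<tau> (Suc k)) \<longrightarrow>
        prob_space.indep_vars \<Omega> (\<lambda>_. borel) (\<lambda>k \<omega>. B (\<tau> (Suc k)) \<omega> - B (\<tau> k) \<omega>) {..<n})"

definition rho :: "real \<Rightarrow> real \<Rightarrow> real" where
  "rho \<alpha> r = (1 - \<alpha>) * r powr (- \<alpha>)"

definition varrho :: "real \<Rightarrow> real \<Rightarrow> real \<Rightarrow> real \<Rightarrow> real" where
  "varrho \<alpha> T t r = rho \<alpha> ((r - t) / (T - t)) / (T - t)"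

text \<open>The index set \<open>\<Theta>\<close> of all nonempty finite integer tuples, represented as lists;
  \<open>(\<theta>, l, i)\<close> is \<open>\<theta> @ [l, i]\<close>.\<close>

definition Theta :: "int list set" where
  "Theta = {\<theta>. \<theta> \<noteq> []}"

text \<open>The family of all processes \<open>W\<^sup>\<theta>\<close> and all variables \<open>\<rr>\<^sup>\<theta>\<close> is independent: the generated
  \<open>\<sigma>\<close>-algebras, indexed by the disjoint sum of two copies of \<open>\<Theta>\<close>, are independent.\<close>

definition mlp_random_input ::
  "'w measure \<Rightarrow> real \<Rightarrow> real \<Rightarrow> (int list \<Rightarrow> real \<Rightarrow> 'w \<Rightarrow> real ^ 'd) \<Rightarrow> (int list \<Rightarrow> 'w \<Rightarrow> real) \<Rightarrow> bool"
  where
  "mlp_random_input \<Omega> T \<alpha> W \<rr> \<longleftrightarrow>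
     (\<forall>\<theta>\<in>Theta. std_brownian_motion \<Omega> T (W \<theta>)) \<and>
     (\<forall>\<theta>\<in>Theta. (\<forall>\<omega>\<in>space \<Omega>. \<rr> \<theta> \<omega> \<in> {0<..<1}) \<and>
        distributed \<Omega> lborel (\<rr> \<theta>) (\<lambda>r. ennreal (rho \<alpha> r) * indicator {0<..<1} r)) \<and>
     prob_space.indep_sets \<Omega>
       (case_sum
          (\<lambda>\<theta>. sigma_sets (space \<Omega>) {W \<theta> s -` A \<inter> space \<Omega> | s A. s \<in> {0..T} \<and> A \<in> sets borel})
          (\<lambda>\<theta>. {\<rr> \<theta> -` A \<inter> space \<Omega> | A. A \<in> sets borel}))
       (Theta <+> Theta)"


section \<open>Defect equation of a surrogate\<close>

text \<open>Vectors in \<open>\<real>\<^sup>1\<^sup>+\<^sup>d\<close> have type \<open>real \<times> (real ^ 'd)\<close>; their \<open>d + 1\<close> coordinates are the inner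
  products with the elements of \<open>Basis\<close>.\<close>

definition sol_vec :: "real \<Rightarrow> (real \<Rightarrow> real ^ 'd \<Rightarrow> real) \<Rightarrow> real \<Rightarrow> real ^ 'd \<Rightarrow> real \<times> (real ^ 'd)" where
  "sol_vec \<sigma> v t x = (v t x, \<sigma> *\<^sub>R grad (v t) x)"

definition pde_residual ::
  "real \<Rightarrow> real \<Rightarrow> (real \<times> (real ^ 'd) \<Rightarrow> real) \<Rightarrow> (real \<Rightarrow> real ^ 'd \<Rightarrow> real) \<Rightarrow> real \<Rightarrow> real ^ 'd \<Rightarrow> real" where
  "pde_residual T \<sigma> F v t x =
     time_deriv T v t x + \<sigma>\<^sup>2 / 2 * laplacian (v t) x + F (sol_vec \<sigma> v t x)"

definition defect ::
  "(real \<Rightarrow> real ^ 'd \<Rightarrow> real) \<Rightarrow> (real \<Rightarrow> real ^ 'd \<Rightarrow> real) \<Rightarrow> real \<Rightarrow> real ^ 'd \<Rightarrow> real" where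
  "defect u uh t x = u t x - uh t x"

definition defect_g ::
  "real \<Rightarrow> (real ^ 'd \<Rightarrow> real) \<Rightarrow> (real \<Rightarrow> real ^ 'd \<Rightarrow> real) \<Rightarrow> real ^ 'd \<Rightarrow> real" where
  "defect_g T g uh x = g x - uh T x"

definition defect_F ::
  "real \<Rightarrow> real \<Rightarrow> (real \<times> (real ^ 'd) \<Rightarrow> real) \<Rightarrow> (real \<Rightarrow> real ^ 'd \<Rightarrow> real)
    \<Rightarrow> real \<times> (real ^ 'd) \<Rightarrow> real \<Rightarrow> real ^ 'd \<Rightarrow> real" where
  "defect_F T \<sigma> F uh w t x =
     F (sol_vec \<sigma> uh t x + w) - F (sol_vec \<sigma> uh t x) + pde_residual T \<sigma> F uh t x"


section \<open>The full-history multilevel Picard estimator\<close>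

text \<open>\<open>mlp T \<sigma> \<alpha> W \<rr> g F M n \<theta> t x \<omega>\<close> is the \<open>n\<close>-th estimator with basis \<open>M\<close> for terminal value \<open>g\<close>
  and nonlinearity \<open>F\<close>. With \<open>g = defect_g \<dots>\<close> and \<open>F = defect_F \<dots>\<close> it estimates
  \<open>sol_vec \<sigma> (defect u uh) t x\<close>.\<close>

fun mlp ::
  "real \<Rightarrow> real \<Rightarrow> real \<Rightarrow> (int list \<Rightarrow> real \<Rightarrow> 'w \<Rightarrow> real ^ 'd) \<Rightarrow> (int list \<Rightarrow> 'w \<Rightarrow> real)
    \<Rightarrow> (real ^ 'd \<Rightarrow> real) \<Rightarrow> (real \<times> (real ^ 'd) \<Rightarrow> real \<Rightarrow> real ^ 'd \<Rightarrow> real)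
    \<Rightarrow> nat \<Rightarrow> nat \<Rightarrow> int list \<Rightarrow> real \<Rightarrow> real ^ 'd \<Rightarrow> 'w \<Rightarrow> real \<times> (real ^ 'd)"
  where
  "mlp T \<sigma> \<alpha> W \<rr> g F M n \<theta> t x \<omega> =
    (if n = 0 then 0 else
      (g x, 0)
      + (1 / real M ^ n) *\<^sub>R (\<Sum>i=1..M ^ n.
          let \<Delta> = W (\<theta> @ [0, - int i]) T \<omega> - W (\<theta> @ [0, - int i]) t \<omega>
          in (g (x + \<sigma> *\<^sub>R \<Delta>) - g x) *\<^sub>R (1, (1 / (T - t)) *\<^sub>R \<Delta>))
      + (\<Sum>l<n. (1 / real M ^ (n - l)) *\<^sub>R (\<Sum>i=1..M ^ (n - l).
          let R = t + (T - t) * \<rr> (\<theta> @ [int l, int i]) \<omega>;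
              \<Delta> = W (\<theta> @ [int l, int i]) R \<omega> - W (\<theta> @ [int l, int i]) t \<omega>;
              Y = x + \<sigma> *\<^sub>R \<Delta>
          in ((F (mlp T \<sigma> \<alpha> W \<rr> g F M l (\<theta> @ [int l, int i]) R Y \<omega>) R Y
                - (if l \<ge> 1 then F (mlp T \<sigma> \<alpha> W \<rr> g F M (l - 1) (\<theta> @ [- int l, int i]) R Y \<omega>) R Y
                   else 0))
               / varrho \<alpha> T t R) *\<^sub>R (1, (1 / (R - t)) *\<^sub>R \<Delta>))))"

declare mlp.simps [simp del]

end

theory Submission
  imports Defs "HOL-Real_Asymp.Real_Asymp"
begin

text \<open>The defect \<open>w = u - uh\<close> solves a semilinear heat equation whose right-hand side at zero, terminal value and
  solution are all of size \<open>e(uh)\<close>. Integrating \<open>w\<close> against the Gaussian kernel and against its gradient gives the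
  Feynman-Kac and Bismut-Elworthy-Li formulas for \<open>w\<close> and \<open>\<sigma>\<nabla>w\<close>; hence the expectation of the \<open>n\<close>-th estimator
  telescopes to the Picard map applied to the \<open>(n-1)\<close>-st one, and its variance is the sum of the variances of the
  independent samples. With \<open>a\<^sub>n(t)\<close> the supremum over \<open>x\<close> of the mean square error this yields
  \<open>a\<^sub>n(t) \<le> c e\<^sup>2 M\<^sup>-\<^sup>n + c \<Sum>\<^sub>l M\<^sup>l\<^sup>+\<^sup>1\<^sup>-\<^sup>n \<integral> (s - t)\<^sup>\<alpha>\<^sup>-\<^sup>1 a\<^sub>l(s) ds\<close>, \<open>l < n\<close>. Measured with the weight \<open>exp (\<kappa>(T - t))\<close>, where
  \<open>\<kappa>\<close> is of order \<open>M powr (1/\<alpha>)\<close>, it follows that \<open>a\<^sub>n \<le> c e\<^sup>2 (2/M)\<^sup>n exp (\<kappa> T)\<close>. As \<open>2\<beta> \<le> \<alpha>\<close>, the choice \<open>M = N powr (2\<beta>)\<close>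
  gives \<open>\<kappa> = O(N)\<close>, and factors \<open>exp (O(N))\<close> are absorbed by \<open>m\<^sub>N powr o(1)\<close>.\<close>

section \<open>The Gaussian kernel\<close>

text \<open>Second derivatives of the defect need not be bounded one by one; only the combination
  \<open>vt + 1/2 * (\<Sum>i. vii i)\<close> is. The kernel formulas are therefore derived for a
  cut-off defect. Two integrations by parts collect its second derivatives in that combination, and
  the cutoff is removed in the limit. The exact solution is written as a mean of the very samples
  that the estimator averages, with the solution in place of the nested estimator. The bias is then
  the mean of a difference of two samples at the same random point, where the Lipschitz bound of the
  nonlinearity acts pointwise. In a second moment the sampling density cancels one of two divisions
  by \<open>varrho\<close>; what remains is of order (s - t)^\<alpha>, and the squared gradient
  weight costs 1 / (s - t). This is the exponent \<alpha> - 1. A difference of consecutive levels is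
  governed by the coarser one, which loses a factor M against the rate (2/M)^n. It has to be paid by
  the gain \<kappa>^(-\<alpha>), whence the order of \<kappa>. The means telescope only because
  nested estimators with different tuples have equal laws; this and all independence claims rest on
  tracking which inputs an object uses.\<close>

definition gauss :: "real \<Rightarrow> real ^ 'd \<Rightarrow> real" where
  "gauss s z = (\<Prod>i\<in>UNIV. normal_density 0 (sqrt s) (z $ i))"

lemma gauss_nonneg: "0 \<le> gauss s z"
  unfolding gauss_def by (intro prod_nonneg) simp

lemma measurable_vec_nth [measurable]: "(\<lambda>x::real^'d. x $ i) \<in> borel_measurable borel"
  by (intro borel_measurable_continuous_onI continuous_intros)

lemma gauss_measurable2:
  "(\<lambda>q::real \<times> (real ^ 'd). gauss (fst q) (snd q)) \<in> borel_measurable borel"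
  unfolding gauss_def normal_density_def
  by (subst borel_prod[symmetric]) measurable

lemma gauss_measurable_comp [measurable (raw)]:
  assumes "f \<in> borel_measurable M" "h \<in> borel_measurable M"
  shows "(\<lambda>x. gauss (f x) (h x :: real^'d)) \<in> borel_measurable M"
proof -
  have "(\<lambda>x. (f x, h x)) \<in> borel_measurable M"
    using assms by (rule borel_measurable_Pair)
  from measurable_compose[OF this gauss_measurable2] show ?thesis by simp
qed

text \<open>With the normalising factor inside the exponential, derivatives in \<open>s\<close> and
  joint continuity are those of elementary functions, and the power d/2 needs no distinction between
  even and odd dimensions.\<close>

lemma gauss_exp:
  fixes z :: "real ^ 'd"
  assumes "0 < s"
  shows "gauss s z = exp (- (real CARD('d) / 2) * ln (2 * pi * s) - (norm z)\<^sup>2 / (2 * s))"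
proof -
  have [simp]: "sqrt s * sqrt s = s" "(sqrt s)\<^sup>2 = s" using assms by auto
  have *: "1 / sqrt (2 * pi * s) = exp (- (1/2) * ln (2 * pi * s))"
  proof -
    have "sqrt (2 * pi * s) = exp ((1/2) * ln (2 * pi * s))"
      using assms by (simp add: powr_half_sqrt[symmetric] powr_def)
    thus ?thesis by (simp add: exp_minus inverse_eq_divide)
  qed
  have "gauss s z = (\<Prod>i\<in>UNIV. exp (- (1/2) * ln (2 * pi * s)) * exp (- (z $ i)\<^sup>2 / (2 * s)))"
    unfolding gauss_def normal_density_def using * by simp
  also have "\<dots> = (\<Prod>i\<in>(UNIV::'d set). exp (- (1/2) * ln (2 * pi * s) - (z $ i)\<^sup>2 / (2 * s)))"
    by (simp add: exp_add[symmetric])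
  also have "\<dots> = exp (\<Sum>i\<in>(UNIV::'d set). - (1/2) * ln (2 * pi * s) - (z $ i)\<^sup>2 / (2 * s))"
    by (simp add: exp_sum)
  also have "(\<Sum>i\<in>(UNIV::'d set). - (1/2) * ln (2 * pi * s) - (z $ i)\<^sup>2 / (2 * s))
     = - (real CARD('d) / 2) * ln (2 * pi * s) - (\<Sum>i\<in>UNIV. (z $ i)\<^sup>2) / (2 * s)"
    by (simp add: sum_subtractf sum_divide_distrib sum_negf)
  also have "(\<Sum>i\<in>UNIV. (z $ i)\<^sup>2) = (norm z)\<^sup>2"
    by (simp add: norm_vec_def L2_set_def sum_nonneg)
  finally show ?thesis .
qed

section \<open>Moments of the Gaussian kernel\<close>

lemma prod_Basis_vec: "(\<Prod>b\<in>(Basis::(real^'d) set). h b) = (\<Prod>i\<in>UNIV. h (axis i 1))"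
proof -
  have B: "(Basis::(real^'d) set) = (\<lambda>i. axis i 1) ` UNIV"
    by (auto simp: Basis_vec_def)
  have "inj (\<lambda>i. axis i 1 :: real^'d)"
    by (auto simp: inj_on_def axis_eq_axis)
  thus ?thesis unfolding B by (subst prod.reindex) auto
qed

text \<open>Density and monomial factor over the coordinates, so the integral is a product of
  one-dimensional moments: order \<open>2 * m\<close> in direction \<open>k\<close> and total mass 1
  elsewhere. The cases \<open>m = 0, 1, 2\<close> give the normalisation and the moments of the
  weights.\<close>

lemma gauss_moment:
  fixes k :: "'d::finite"
  assumes s: "0 < s"
  shows "(\<integral>\<^sup>+z. ennreal ((z $ k) ^ (2 * m) * gauss s (z :: real^'d)) \<partial>lborel)
           = ennreal (fact (2 * m) / ((2 / s) ^ m * fact m))"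
proof -
  define h :: "real^'d \<Rightarrow> real \<Rightarrow> ennreal" where
    "h b y = ennreal (normal_density 0 (sqrt s) y * y ^ (if b = axis k 1 then 2 * m else 0))" for b y
  have nn: "0 \<le> y ^ (if b = axis k 1 then 2 * m else 0)" for b :: "real^'d" and y :: real
    by (auto simp: power_mult)
  have norm: "(\<integral>\<^sup>+y. ennreal (normal_density 0 (sqrt s) y * y ^ (2*j)) \<partial>lborel)
      = ennreal (fact (2 * j) / ((2 / s) ^ j * fact j))" for j
  proof -
    have "has_bochner_integral lborel (\<lambda>x. normal_density 0 (sqrt s) x * (x - 0) ^ (2 * j))
            (fact (2 * j) / ((2 / (sqrt s)\<^sup>2) ^ j * fact j))"
      using s by (intro normal_moment_even) auto
    hence "has_bochner_integral lborel (\<lambda>x. normal_density 0 (sqrt s) x * x ^ (2 * j))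
            (fact (2 * j) / ((2 / s) ^ j * fact j))" using s by simp
    thus ?thesis using s
      by (subst nn_integral_eq_integral) (auto simp: power_mult has_bochner_integral_iff)
  qed
  have pt: "ennreal ((z $ k) ^ (2 * m) * gauss s z) = (\<Prod>b\<in>Basis. h b (z \<bullet> b))" for z
  proof -
    have "(\<Prod>b\<in>Basis. h b (z \<bullet> b)) = (\<Prod>i\<in>UNIV. h (axis i 1) (z $ i))"
      by (simp add: prod_Basis_vec inner_axis)
    also have "\<dots> = (\<Prod>i\<in>UNIV. ennreal (normal_density 0 (sqrt s) (z$i) * (z$i) ^ (if i = k then 2 * m else 0)))"
      unfolding h_def by (intro prod.cong refl) (auto simp: axis_eq_axis)
    also have "\<dots> = ennreal (\<Prod>i\<in>UNIV. (normal_density 0 (sqrt s) (z$i) * (z$i) ^ (if i = k then 2 * m else 0)))"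
      by (intro prod_ennreal) (auto simp: power_mult)
    also have "(\<Prod>i\<in>UNIV. (normal_density 0 (sqrt s) (z$i) * (z$i) ^ (if i = k then 2 * m else 0)))
       = gauss s z * (\<Prod>i\<in>UNIV. if i = k then (z$i) ^ (2 * m) else 1)"
      unfolding gauss_def prod.distrib by (intro arg_cong2[where f="(*)"] refl prod.cong) auto
    also have "\<dots> = (z $ k) ^ (2 * m) * gauss s z" by simp
    finally show ?thesis ..
  qed
  have "(\<integral>\<^sup>+z. ennreal ((z $ k) ^ (2 * m) * gauss s (z :: real^'d)) \<partial>lborel)
      = (\<Prod>b\<in>Basis. \<integral>\<^sup>+y. h b y \<partial>lborel)"
    unfolding pt by (rule nn_integral_lborel_prod) (auto simp: h_def)
  also have "\<dots> = (\<Prod>i\<in>UNIV. \<integral>\<^sup>+y. h (axis i 1) y \<partial>lborel)" by (rule prod_Basis_vec)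
  also have "\<dots> = (\<Prod>i\<in>UNIV. if i = k then ennreal (fact (2 * m) / ((2 / s) ^ m * fact m)) else 1)"
  proof (intro prod.cong refl)
    fix i
    show "(\<integral>\<^sup>+y. h (axis i 1) y \<partial>lborel) = (if i = k then ennreal (fact (2 * m) / ((2 / s) ^ m * fact m)) else 1)"
      using norm[of m] norm[of 0] by (auto simp: h_def axis_eq_axis)
  qed
  also have "\<dots> = ennreal (fact (2 * m) / ((2 / s) ^ m * fact m))" by simp
  finally show ?thesis .
qed

lemma gauss_nn_integral:
  assumes "0 < s" shows "(\<integral>\<^sup>+z. ennreal (gauss s (z :: real^'d)) \<partial>lborel) = 1"
  using gauss_moment[OF assms, where m=0] by simp

lemma gauss_moment2:
  assumes "0 < s" shows "(\<integral>\<^sup>+z. ennreal ((z $ k)\<^sup>2 * gauss s (z :: real^'d)) \<partial>lborel) = ennreal s"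
  using gauss_moment[OF assms, of k 1] by (simp add: fact_numeral)

lemma gauss_moment4:
  assumes "0 < s" shows "(\<integral>\<^sup>+z. ennreal ((z $ k)^4 * gauss s (z :: real^'d)) \<partial>lborel) = ennreal (3 * s\<^sup>2)"
  using gauss_moment[OF assms, of k 2] assms by (simp add: fact_numeral power_divide)

lemma norm_sq_sum: "(norm (z::real^'d))\<^sup>2 = (\<Sum>i\<in>UNIV. (z $ i)\<^sup>2)"
  by (simp add: norm_vec_def L2_set_def sum_nonneg)

lemma gauss_norm_moment2:
  assumes "0 < s"
  shows "(\<integral>\<^sup>+z. ennreal ((norm z)\<^sup>2 * gauss s (z :: real^'d)) \<partial>lborel) = ennreal (real CARD('d) * s)"
proof -
  have "(\<integral>\<^sup>+z. ennreal ((norm z)\<^sup>2 * gauss s (z :: real^'d)) \<partial>lborel)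
      = (\<integral>\<^sup>+z. (\<Sum>i\<in>UNIV. ennreal ((z$i)\<^sup>2 * gauss s (z :: real^'d))) \<partial>lborel)"
    by (intro nn_integral_cong) (simp add: norm_sq_sum sum_distrib_right sum_ennreal gauss_nonneg)
  also have "\<dots> = (\<Sum>i\<in>(UNIV::'d set). ennreal s)"
    by (subst nn_integral_sum) (auto simp: gauss_moment2[OF assms])
  also have "\<dots> = ennreal (real CARD('d) * s)"
    using assms by (simp add: sum_ennreal ennreal_of_nat_eq_real_of_nat ennreal_mult)
  finally show ?thesis .
qed

text \<open>Cauchy-Schwarz over the coordinates reduces the fourth power of the norm to coordinate
  moments. The exact value is d (d + 2) s^2; only the order in \<open>s\<close> matters
  later.\<close>

lemma gauss_norm_moment4:
  assumes "0 < s"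
  shows "(\<integral>\<^sup>+z. ennreal ((norm z)^4 * gauss s (z :: real^'d)) \<partial>lborel) \<le> ennreal (3 * real CARD('d) ^ 2 * s\<^sup>2)"
proof -
  have "(norm z)^4 \<le> real CARD('d) * (\<Sum>i\<in>UNIV. (z$i)^4)" for z :: "real^'d"
  proof -
    have "(norm z)^4 = (\<Sum>i\<in>UNIV. (z $ i)\<^sup>2)\<^sup>2" by (simp flip: norm_sq_sum)
    also have "\<dots> \<le> (\<Sum>i\<in>(UNIV::'d set). ((z $ i)\<^sup>2)\<^sup>2) * (real CARD('d))"
      using sum_squared_le_sum_of_squares[of "\<lambda>i. (z $ i)\<^sup>2" "UNIV::'d set"] by simp
    finally show ?thesis by (simp add: mult.commute)
  qed
  hence "(\<integral>\<^sup>+z. ennreal ((norm z)^4 * gauss s (z :: real^'d)) \<partial>lborel)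
      \<le> (\<integral>\<^sup>+z. ennreal (real CARD('d)) * (\<Sum>i\<in>UNIV. ennreal ((z$i)^4 * gauss s (z :: real^'d))) \<partial>lborel)"
    by (intro nn_integral_mono)
      (auto simp: sum_ennreal gauss_nonneg sum_distrib_right[symmetric] ennreal_mult[symmetric] sum_nonneg
          mult_right_mono intro!: ennreal_leI simp flip: mult.assoc)
  also have "\<dots> = ennreal (real CARD('d)) * (\<Sum>i\<in>(UNIV::'d set). ennreal (3 * s\<^sup>2))"
    by (subst nn_integral_cmult, measurable, subst nn_integral_sum) (auto simp: gauss_moment4[OF assms])
  also have "\<dots> = ennreal (3 * real CARD('d) ^ 2 * s\<^sup>2)"
    using assms by (simp add: ennreal_of_nat_eq_real_of_nat ennreal_mult[symmetric] power2_eq_square ac_simps)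
  finally show ?thesis .
qed

lemma gauss_borel_measurable [measurable]: "gauss s \<in> borel_measurable borel"
  using gauss_measurable_comp[of "\<lambda>_. s" borel "\<lambda>z. z"] by simp

lemma gauss_integrable:
  assumes "0 < s" shows "integrable lborel (gauss s :: real^'d \<Rightarrow> real)"
proof (rule integrableI_nonneg)
  show "(\<integral>\<^sup>+ x. ennreal (gauss s (x::real^'d)) \<partial>lborel) < \<infinity>"
    unfolding gauss_nn_integral[OF assms] by simp
qed (simp_all add: gauss_nonneg)

lemma gauss_integral:
  assumes "0 < s" shows "(\<integral>z. gauss s (z::real^'d) \<partial>lborel) = 1"
proof -
  have "(\<integral>z. gauss s (z::real^'d) \<partial>lborel) = enn2real (\<integral>\<^sup>+z. ennreal (gauss s (z::real^'d)) \<partial>lborel)"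
    by (rule integral_eq_nn_integral) (simp_all add: gauss_nonneg)
  thus ?thesis by (simp add: gauss_nn_integral[OF assms])
qed

lemma gauss_norm2_integrable:
  assumes "0 < s" shows "integrable lborel (\<lambda>z::real^'d. (norm z)\<^sup>2 * gauss s z)"
proof (rule integrableI_nonneg)
  show "(\<integral>\<^sup>+ x. ennreal ((norm (x::real^'d))\<^sup>2 * gauss s x) \<partial>lborel) < \<infinity>"
    unfolding gauss_norm_moment2[OF assms] by simp
qed (simp_all add: gauss_nonneg)

lemma gauss_norm2_integral:
  assumes "0 < s" shows "(\<integral>z. (norm z)\<^sup>2 * gauss s (z::real^'d) \<partial>lborel) = real CARD('d) * s"
proof -
  have "(\<integral>z. (norm z)\<^sup>2 * gauss s (z::real^'d) \<partial>lborel)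
      = enn2real (\<integral>\<^sup>+z. ennreal ((norm z)\<^sup>2 * gauss s (z::real^'d)) \<partial>lborel)"
    by (rule integral_eq_nn_integral) (simp_all add: gauss_nonneg)
  thus ?thesis using assms by (simp add: gauss_norm_moment2[OF assms])
qed

text \<open>This is the mass of the gradient kernel; its singularity at \<open>s = 0\<close> is
  integrable in time. The first absolute moment is dominated by even ones, so only the moments above
  are used.\<close>

lemma gauss_abs_coord:
  assumes s: "0 < s"
  shows "(\<integral>\<^sup>+z. ennreal (\<bar>(z $ k) / s * gauss s (z :: real^'d)\<bar>) \<partial>lborel) \<le> ennreal (s powr (-1/2))"
proof -
  have p: "s powr (-1/2) = 1 / sqrt s" 
    using powr_minus_divide[of s "1/2"] s by (simp add: powr_half_sqrt)
  have *: "\<bar>z $ k\<bar> / s \<le> 1/2 / sqrt s + (z$k)\<^sup>2 * (1/2 / (s * sqrt s))" for z :: "real^'d"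
  proof -
    \<comment> \<open>Young's inequality at the scale of the standard deviation: |a| is at most r/2
      + a^2/(2r).\<close>
    define r where "r = sqrt s"
    have r: "0 < r" "s = r * r" using s by (auto simp: r_def)
    have "0 \<le> (\<bar>z$k\<bar> - r)\<^sup>2" by simp
    hence "0 \<le> (\<bar>z$k\<bar> - r)\<^sup>2 / (2 * r * r * r)" using r(1) by (intro divide_nonneg_pos) auto
    also have "\<dots> = (1/2 / r + (z$k)\<^sup>2 * (1/2 / (s * r))) - \<bar>z$k\<bar> / s"
      using r(1) unfolding r(2) by (simp add: power2_diff diff_divide_distrib add_divide_distrib) (simp add: power2_eq_square)
    finally show ?thesis unfolding r_def by simp
  qed
  have "(\<integral>\<^sup>+z. ennreal (\<bar>(z $ k) / s * gauss s (z :: real^'d)\<bar>) \<partial>lborel)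
     \<le> (\<integral>\<^sup>+z. ennreal (1/2 / sqrt s) * ennreal (gauss s (z::real^'d))
          + ennreal (1/2 / (s * sqrt s)) * ennreal ((z$k)\<^sup>2 * gauss s z) \<partial>lborel)"
  proof (intro nn_integral_mono)
    fix z :: "real^'d"
    have "\<bar>(z $ k) / s * gauss s z\<bar> = \<bar>z$k\<bar> / s * gauss s z"
      using s by (simp add: abs_mult gauss_nonneg)
    also have "\<dots> \<le> (1/2 / sqrt s + (z$k)\<^sup>2 * (1/2 / (s * sqrt s))) * gauss s z"
      by (intro mult_right_mono * gauss_nonneg)
    also have "\<dots> = (1/2 / sqrt s) * gauss s z + (1/2 / (s * sqrt s)) * ((z$k)\<^sup>2 * gauss s z)"
      by (simp add: algebra_simps)
    finally show "ennreal \<bar>(z $ k) / s * gauss s z\<bar> \<le> ennreal (1/2 / sqrt s) * ennreal (gauss s z)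
          + ennreal (1/2 / (s * sqrt s)) * ennreal ((z$k)\<^sup>2 * gauss s z)"
      using s by (simp add: gauss_nonneg ennreal_mult[symmetric] ennreal_plus[symmetric] del: ennreal_plus)
  qed
  also have "\<dots> = ennreal (1/2 / sqrt s) + ennreal (1/2 / (s * sqrt s)) * ennreal s"
    using s by (simp add: nn_integral_add nn_integral_cmult gauss_nn_integral gauss_moment2)
  also have "\<dots> = ennreal (s powr (-1/2))"
    unfolding p using s by (simp add: ennreal_mult[symmetric] ennreal_plus[symmetric] del: ennreal_plus)
  finally show ?thesis .
qed

section \<open>Derivatives of the Gaussian kernel in time and space\<close>

lemma norm_sq_line: "(norm (z + h *\<^sub>R axis i 1 :: real^'d))\<^sup>2 = (norm z)\<^sup>2 + 2 * h * z $ i + h\<^sup>2"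
proof -
  have "(norm (z + h *\<^sub>R axis i 1))\<^sup>2 = z \<bullet> z + 2 * (h * (z \<bullet> axis i 1)) + h * (h * (axis i 1 \<bullet> axis i (1::real)))"
    by (simp add: power2_norm_eq_inner inner_add_left inner_add_right inner_commute)
  thus ?thesis by (simp add: power2_norm_eq_inner[of z] inner_axis power2_eq_square[of h])
qed

lemma gauss_deriv_time:
  fixes z :: "real^'d"
  assumes s: "0 < s"
  shows "((\<lambda>s. gauss s z) has_real_derivative
     ((norm z)\<^sup>2 / (2 * s\<^sup>2) - real CARD('d) / (2 * s)) * gauss s z) (at s)"
proof -
  have "((\<lambda>s. exp (- (real CARD('d) / 2) * ln (2 * pi * s) - (norm z)\<^sup>2 / (2 * s))) has_real_derivative
     ((norm z)\<^sup>2 / (2 * s\<^sup>2) - real CARD('d) / (2 * s)) * exp (- (real CARD('d) / 2) * ln (2 * pi * s) - (norm z)\<^sup>2 / (2 * s))) (at s)"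
    using s by (auto intro!: derivative_eq_intros simp: field_simps power2_eq_square)
  moreover have "\<forall>\<^sub>F s in nhds s. gauss s z = exp (- (real CARD('d) / 2) * ln (2 * pi * s) - (norm z)\<^sup>2 / (2 * s))"
    using eventually_nhds_in_open[of "{0<..}" s] s
    by (auto elim!: eventually_mono simp: gauss_exp)
  ultimately show ?thesis using s
    by (subst DERIV_cong_ev[OF refl _ refl, where g="\<lambda>s. exp (- (real CARD('d) / 2) * ln (2 * pi * s) - (norm z)\<^sup>2 / (2 * s))"])
       (auto simp: gauss_exp)
qed

lemma gauss_deriv_space:
  fixes z :: "real^'d"
  assumes s: "0 < s"
  shows "((\<lambda>h. gauss s (z + h *\<^sub>R axis i 1)) has_real_derivative - (z $ i / s) * gauss s z) (at 0)"
  unfolding gauss_exp[OF s] norm_sq_line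
  using s by (auto intro!: derivative_eq_intros simp: field_simps)

lemma gauss_continuous:
  "continuous_on ({0<..} \<times> UNIV) (\<lambda>q::real\<times>(real^'d). gauss (fst q) (snd q))"
proof -
  have "continuous_on ({0<..} \<times> UNIV) (\<lambda>q::real\<times>(real^'d). 
     exp (- (real CARD('d) / 2) * ln (2 * pi * fst q) - (norm (snd q))\<^sup>2 / (2 * fst q)))"
    by (intro continuous_intros) auto
  thus ?thesis by (rule continuous_on_eq) (auto simp: gauss_exp)
qed

section \<open>Cutoff functions and integration by parts\<close>

text \<open>The two smooth branches meet at 0, where the difference quotient is bounded by a
  positive power of the increment. The exponent starts at 2 because the positive part itself has a
  kink.\<close>

lemma DERIV_pos_part_power:
  "((\<lambda>a::real. (max 0 a) ^ Suc (Suc n)) has_real_derivative real (Suc (Suc n)) * (max 0 a) ^ Suc n) (at a)"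
proof -
  consider "a > 0" | "a < 0" | "a = 0" by linarith
  thus ?thesis
  proof cases
    case 1
    have "((\<lambda>a::real. a ^ Suc (Suc n)) has_real_derivative real (Suc (Suc n)) * a ^ Suc n) (at a)"
      by (rule DERIV_pow[THEN DERIV_cong]) simp
    moreover have "\<forall>\<^sub>F x in nhds a. (max 0 x) ^ Suc (Suc n) = x ^ Suc (Suc n)"
      using eventually_nhds_in_open[of "{0<..}" a] 1 by (auto elim!: eventually_mono)
    ultimately show ?thesis using 1 by (subst DERIV_cong_ev) auto
  next
    case 2
    have "((\<lambda>a::real. 0) has_real_derivative real (Suc (Suc n)) * (max 0 a) ^ Suc n) (at a)"
      using 2 by simp
    moreover have "\<forall>\<^sub>F x in nhds a. (max 0 x) ^ Suc (Suc n) = 0"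
      using eventually_nhds_in_open[of "{..<0}" a] 2 by (auto elim!: eventually_mono)
    ultimately show ?thesis by (subst DERIV_cong_ev) auto
  next
    case 3
    have "((\<lambda>h::real. (max 0 h) ^ Suc n) \<longlongrightarrow> (max 0 0) ^ Suc n) (at 0)"
      by (intro tendsto_intros)
    hence lim: "((\<lambda>h::real. (max 0 h) ^ Suc n) \<longlongrightarrow> 0) (at 0)" by simp
    have "norm ((max 0 (0 + h) ^ Suc (Suc n) - max 0 0 ^ Suc (Suc n)) / h) \<le> norm ((max 0 h) ^ Suc n) * 1" for h :: real
      by (cases "h > 0") (auto simp: max_def)
    hence "((\<lambda>h::real. (max 0 (0 + h) ^ Suc (Suc n) - max 0 0 ^ Suc (Suc n)) / h) \<longlongrightarrow> 0) (at 0)"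
      by (intro tendsto_0_le[OF lim, where K=1] always_eventually) blast
    thus ?thesis unfolding 3 DERIV_def by simp
  qed
qed

text \<open>The cube is the smallest whole power of the positive part with continuous second
  derivatives. The polynomial form gives explicit derivatives that scale like negative powers of
  \<open>R\<close>.\<close>

definition cutoff :: "real \<Rightarrow> real ^ 'd \<Rightarrow> real" where
  "cutoff R z = (max 0 (1 - (norm z)\<^sup>2 / R\<^sup>2)) ^ 3"

definition cutoff1 :: "'d \<Rightarrow> real \<Rightarrow> real ^ 'd \<Rightarrow> real" where
  "cutoff1 i R z = - (6 * z $ i / R\<^sup>2) * (max 0 (1 - (norm z)\<^sup>2 / R\<^sup>2))\<^sup>2"

text \<open>Mixed second derivatives are left out since only the Laplacian of the cutoff
  occurs.\<close>

definition cutoff2 :: "'d \<Rightarrow> real \<Rightarrow> real ^ 'd \<Rightarrow> real" where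
  "cutoff2 i R z = - (6 / R\<^sup>2) * (max 0 (1 - (norm z)\<^sup>2 / R\<^sup>2))\<^sup>2
     + 24 * (z $ i / R\<^sup>2)\<^sup>2 * max 0 (1 - (norm z)\<^sup>2 / R\<^sup>2)"

lemma cutoff_inner_deriv:
  "((\<lambda>h. 1 - (norm (z + h *\<^sub>R axis i 1 :: real^'d))\<^sup>2 / R\<^sup>2) has_real_derivative - (2 * z $ i / R\<^sup>2)) (at 0)"
proof -
  have "((\<lambda>h. (norm z)\<^sup>2 + 2 * h * z $ i + h\<^sup>2) has_real_derivative 2 * z $ i) (at 0)"
    by (auto intro!: derivative_eq_intros)
  from DERIV_diff[OF DERIV_const[of 1] DERIV_cdivide[OF this, of "R\<^sup>2"]]
  show ?thesis unfolding norm_sq_line by simp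
qed

lemma cutoff_pow_deriv:
  "((\<lambda>h. (max 0 (1 - (norm (z + h *\<^sub>R axis i 1 :: real^'d))\<^sup>2 / R\<^sup>2)) ^ Suc (Suc n)) has_real_derivative
     (real (Suc (Suc n)) * (max 0 (1 - (norm z)\<^sup>2 / R\<^sup>2)) ^ Suc n) * - (2 * z $ i / R\<^sup>2)) (at 0)"
proof -
  have "((\<lambda>a. (max 0 a) ^ Suc (Suc n)) has_real_derivative real (Suc (Suc n)) * (max 0 (1 - (norm z)\<^sup>2 / R\<^sup>2)) ^ Suc n)
     (at (1 - (norm (z + 0 *\<^sub>R axis i (1::real)))\<^sup>2 / R\<^sup>2))"
    unfolding scaleR_zero_left add_0_right by (rule DERIV_pos_part_power)
  from DERIV_chain2[OF this cutoff_inner_deriv] show ?thesis .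
qed

lemma cutoff_deriv:
  "((\<lambda>h. cutoff R (z + h *\<^sub>R axis i 1 :: real^'d)) has_real_derivative cutoff1 i R z) (at 0)"
proof -
  have *: "3 = Suc (Suc 1)" "2 = Suc 1" by simp_all
  show ?thesis unfolding cutoff_def *(1)
    by (rule DERIV_cong[OF cutoff_pow_deriv]) (simp add: cutoff1_def power2_eq_square)
qed

lemma cutoff1_deriv:
  "((\<lambda>h. cutoff1 i R (z + h *\<^sub>R axis i 1 :: real^'d)) has_real_derivative cutoff2 i R z) (at 0)"
proof -
  have *: "2 = Suc (Suc 0)" by simp
  have "((\<lambda>h. z $ i + h) has_real_derivative 1) (at 0)"
    by (auto intro!: derivative_eq_intros)
  from DERIV_cmult[OF this, of "- 6 / R\<^sup>2"]
  have "((\<lambda>h. - (6 * (z + h *\<^sub>R axis i 1) $ i / R\<^sup>2)) has_real_derivative - (6 / R\<^sup>2)) (at 0)"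
    by simp
  from DERIV_mult[OF this cutoff_pow_deriv[of z i _ 0]]
  show ?thesis unfolding cutoff1_def cutoff2_def
    by (simp add: algebra_simps power2_eq_square)
qed

lemma cutoff_continuous: "continuous_on A (cutoff R)" "continuous_on A (cutoff1 i R)" "continuous_on A (cutoff2 i R)"
  unfolding cutoff_def[abs_def] cutoff1_def[abs_def] cutoff2_def[abs_def] divide_inverse
  by (intro continuous_intros)+

lemma cutoff_support:
  assumes "0 < R" "R \<le> norm z"
  shows "cutoff R z = 0" "cutoff1 i R z = 0" "cutoff2 i R z = 0"
proof -
  have "R\<^sup>2 \<le> (norm z)\<^sup>2" using assms by (intro power_mono) auto
  hence "max 0 (1 - (norm z)\<^sup>2 / R\<^sup>2) = 0" using assms by (auto simp: field_simps)
  thus "cutoff R z = 0" "cutoff1 i R z = 0" "cutoff2 i R z = 0" by (auto simp: cutoff_def cutoff1_def cutoff2_def)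
qed

text \<open>On the support the coordinates are at most \<open>R\<close>, so every derivative gains a
  factor 1/R. The last bound is quadratic in the norm in order to be absorbed by Gaussian second
  moments.\<close>

lemma cutoff_bounds:
  fixes z :: "real^'d"
  assumes "0 < R"
  shows "0 \<le> cutoff R z" "cutoff R z \<le> 1" "\<bar>cutoff1 i R z\<bar> \<le> 6 / R" "\<bar>cutoff2 i R z\<bar> \<le> 30 / R\<^sup>2"
    "1 - cutoff R z \<le> 3 * (norm z)\<^sup>2 / R\<^sup>2"
proof -
  define a where "a = max 0 (1 - (norm z)\<^sup>2 / R\<^sup>2)"
  have a: "0 \<le> a" "a \<le> 1" by (auto simp: a_def)
  have a2: "0 \<le> a\<^sup>2" "a\<^sup>2 \<le> 1" using a by (auto simp: power_le_one)
  show "0 \<le> cutoff R z" "cutoff R z \<le> 1" using a by (auto simp: cutoff_def a_def[symmetric] power_le_one)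
  \<comment> \<open>Bernoulli's inequality for the cube of 1 + (a - 1); here \<open>a - 1\<close> is
    at least minus the squared relative radius.\<close>
  have "1 + 3 * (a - 1) \<le> a ^ 3"
    using Bernoulli_inequality[of "a - 1" 3] a by simp
  moreover have "a \<ge> 1 - (norm z)\<^sup>2 / R\<^sup>2" by (simp add: a_def)
  ultimately have "1 - 3 * ((norm z)\<^sup>2 / R\<^sup>2) \<le> a ^ 3" by argo
  thus "1 - cutoff R z \<le> 3 * (norm z)\<^sup>2 / R\<^sup>2" unfolding cutoff_def a_def[symmetric] by simp
  show "\<bar>cutoff1 i R z\<bar> \<le> 6 / R"
  proof (cases "R \<le> norm z")
    case False
    have "\<bar>z $ i\<bar> \<le> R" using False component_le_norm_cart[of z i] by linarith
    hence "\<bar>cutoff1 i R z\<bar> \<le> (6 * R / R\<^sup>2) * 1"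
      unfolding cutoff1_def a_def[symmetric] abs_mult using a2 assms
      by (intro mult_mono) (auto simp: divide_right_mono)
    thus ?thesis using assms by (simp add: power2_eq_square)
  qed (use assms in \<open>auto simp: cutoff_support\<close>)
  show "\<bar>cutoff2 i R z\<bar> \<le> 30 / R\<^sup>2"
  proof (cases "R \<le> norm z")
    case False
    have "\<bar>z $ i\<bar> \<le> R" using False component_le_norm_cart[of z i] by linarith
    hence "(z $ i)\<^sup>2 \<le> R\<^sup>2" using assms by (metis abs_le_square_iff abs_of_pos)
    hence "(z $ i)\<^sup>2 / (R\<^sup>2)\<^sup>2 \<le> R\<^sup>2 / (R\<^sup>2)\<^sup>2" by (intro divide_right_mono) auto
    hence z2: "(z $ i / R\<^sup>2)\<^sup>2 \<le> 1 / R\<^sup>2"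
      using assms unfolding power_divide by (simp add: power2_eq_square)
    have "\<bar>cutoff2 i R z\<bar> \<le> \<bar>(6 / R\<^sup>2) * a\<^sup>2\<bar> + \<bar>24 * (z $ i / R\<^sup>2)\<^sup>2 * a\<bar>"
      unfolding cutoff2_def a_def[symmetric] by (simp add: abs_if)
    also have "\<dots> = (6 / R\<^sup>2) * a\<^sup>2 + 24 * (z $ i / R\<^sup>2)\<^sup>2 * a" using a by (simp add: abs_mult)
    also have "\<dots> \<le> (6 / R\<^sup>2) * 1 + 24 * (1 / R\<^sup>2) * 1"
      using a a2 z2 by (intro add_mono mult_mono) auto
    finally show ?thesis by simp
  qed (use assms in \<open>auto simp: cutoff_support\<close>)
qed

section \<open>Vanishing of the integral of a partial derivative\<close>

lemma integrable_compact_support: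
  fixes f :: "real^'d \<Rightarrow> real"
  assumes "continuous_on UNIV f" "\<And>z. R \<le> norm z \<Longrightarrow> f z = 0"
  shows "integrable lborel f"
proof -
  have "integrable lborel (\<lambda>z. indicator (cball 0 R) z *\<^sub>R f z)"
    by (intro borel_integrable_compact continuous_on_subset[OF assms(1)]) auto
  also have "(\<lambda>z. indicator (cball 0 R) z *\<^sub>R f z) = f"
    using assms(2) by (auto simp: indicator_def fun_eq_iff)
  finally show ?thesis .
qed

text \<open>The integral of a difference quotient vanishes by translation invariance.\<close>

lemma integral_partial_zero:
  fixes h h' :: "real^'d \<Rightarrow> real"
  assumes R: "0 < R"
    and der: "\<And>z. ((\<lambda>e. h (z + e *\<^sub>R axis i 1)) has_real_derivative h' z) (at 0)"
    and cont: "continuous_on UNIV h" "continuous_on UNIV h'"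
    and supp: "\<And>z. R \<le> norm z \<Longrightarrow> h z = 0" "\<And>z. R \<le> norm z \<Longrightarrow> h' z = 0"
  shows "(\<integral>z. h' z \<partial>lborel) = 0"
proof -
  define e :: "nat \<Rightarrow> real" where "e n = inverse (real (Suc n))" for n
  have e: "0 < e n" "e n \<le> 1" for n by (auto simp: e_def field_simps)
  define q where "q n z = (h (z + e n *\<^sub>R axis i 1) - h z) / e n" for n z
  have "\<exists>D. \<forall>z\<in>cball 0 R. \<bar>h' z\<bar> \<le> D"
    using compact_imp_bounded[OF compact_continuous_image[OF continuous_on_subset[OF cont(2)] compact_cball[of 0 R]]]
    by (auto simp: bounded_iff)
  then obtain D where D0: "\<And>z. norm z \<le> R \<Longrightarrow> \<bar>h' z\<bar> \<le> D" by (metis mem_cball_0)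
  hence D: "\<bar>h' z\<bar> \<le> D" for z
    using supp(2)[of z] supp(2)[of 0] R
    by (smt (verit) norm_zero)
  have line: "((\<lambda>e. h (z + e *\<^sub>R axis i 1)) has_real_derivative h' (z + x *\<^sub>R axis i 1)) (at x)" for z x
    using DERIV_shift[of "\<lambda>e. h (z + e *\<^sub>R axis i 1)" _ 0 x] der[of "z + x *\<^sub>R axis i 1"]
    by (simp add: algebra_simps)
  \<comment> \<open>The mean value theorem supplies the majorant for dominated convergence. It needs
    the derivative along a whole segment, which \<open>line\<close> obtains from derivatives at 0 of
    shifted points.\<close>
  have qb: "\<bar>q n z\<bar> \<le> D" for n z
  proof -
    have "\<exists>x>0. x < e n \<and> h (z + e n *\<^sub>R axis i 1) - h (z + 0 *\<^sub>R axis i 1) = (e n - 0) * h' (z + x *\<^sub>R axis i 1)"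
      by (intro MVT2 e line)
    then obtain x where "h (z + e n *\<^sub>R axis i 1) - h z = e n * h' (z + x *\<^sub>R axis i 1)" by auto
    hence "q n z = h' (z + x *\<^sub>R axis i 1)" using e[of n] by (simp add: q_def)
    thus ?thesis using D by simp
  qed
  \<comment> \<open>Increments of length at most 1 keep all difference quotients inside one fixed
    ball.\<close>
  have qs: "q n z = 0" if "R + 1 \<le> norm z" for n z
  proof -
    have "norm z \<le> norm (z + e n *\<^sub>R axis i 1) + norm (e n *\<^sub>R axis i (1::real))"
      by (metis add_diff_cancel_right' norm_triangle_ineq4)
    also have "norm (e n *\<^sub>R axis i (1::real)) \<le> 1" using e[of n] by (simp add: norm_axis_1)
    finally show ?thesis using that supp(1) by (simp add: q_def)
  qed
  have hint: "integrable lborel h" by (rule integrable_compact_support[OF cont(1) supp(1)])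
  have hc: "h \<in> borel_measurable borel" using cont(1) by (rule borel_measurable_continuous_onI)
  have h'c: "h' \<in> borel_measurable borel" using cont(2) by (rule borel_measurable_continuous_onI)
  have shift: "integrable lborel (\<lambda>z. h (z + c))" "(\<integral>z. h (z + c) \<partial>lborel) = (\<integral>z. h z \<partial>lborel)" for c
  proof -
    have "integrable (distr lborel borel ((+) c)) h" "(\<integral>z. h z \<partial>distr lborel borel ((+) c)) = (\<integral>z. h z \<partial>lborel)"
      using hint lborel_distr_plus[of c] by simp_all
    thus "integrable lborel (\<lambda>z. h (z + c))" "(\<integral>z. h (z + c) \<partial>lborel) = (\<integral>z. h z \<partial>lborel)"
      using hc by (simp_all add: integrable_distr_eq integral_distr add.commute)
  qed
  have q0: "(\<integral>z. q n z \<partial>lborel) = 0" for n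
    unfolding q_def using shift hint by simp
  have "(\<lambda>n. \<integral>z. q n z \<partial>lborel) \<longlonglongrightarrow> (\<integral>z. h' z \<partial>lborel)"
  proof (rule integral_dominated_convergence[where w="\<lambda>z. indicator (cball 0 (R + 1)) z *\<^sub>R D"])
    show "integrable lborel (\<lambda>z::real^'d. indicator (cball 0 (R + 1)) z *\<^sub>R D)"
      by (intro borel_integrable_compact) auto
    show "AE z in lborel. (\<lambda>n. q n z) \<longlonglongrightarrow> h' z"
    proof (rule AE_I2)
      fix z
      have "((\<lambda>e. (h (z + e *\<^sub>R axis i 1) - h z) / e) \<longlongrightarrow> h' z) (at 0)"
        using der[of z] unfolding DERIV_def by simp
      moreover have "filterlim e (at 0) sequentially"
        unfolding filterlim_at using e LIMSEQ_inverse_real_of_nat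
        by (auto simp: e_def[abs_def] intro!: always_eventually)
      ultimately show "(\<lambda>n. q n z) \<longlonglongrightarrow> h' z"
        unfolding q_def by (rule filterlim_compose)
    qed
    show "AE z in lborel. norm (q n z) \<le> indicator (cball 0 (R + 1)) z *\<^sub>R D" for n
      using qb[of n] qs[of _ n] by (intro AE_I2) (auto simp: indicator_def)
  qed (use hc h'c in \<open>auto simp: q_def[abs_def]\<close>)
  thus ?thesis unfolding q0 by (rule LIMSEQ_const_iff[THEN iffD1, symmetric])
qed

text \<open>A Gaussian of variance \<open>s n\<close> has second moment d times \<open>s n\<close>,
  so an error of size D |z|^2 contributes an amount that tends to 0. Thus \<open>close\<close> asks
  for smallness near the origin only; a bounded error elsewhere is hidden in the quadratic
  term.\<close>

lemma gauss_concentration: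
  fixes w :: "nat \<Rightarrow> real^'d \<Rightarrow> real"
  assumes meas: "\<And>n. w n \<in> borel_measurable borel"
    and s: "\<And>n. 0 < s n" "s \<longlonglongrightarrow> 0"
    and bd: "\<And>n z. \<bar>w n z\<bar> \<le> B"
    and close: "\<And>\<epsilon>. 0 < \<epsilon> \<Longrightarrow> \<exists>D. \<forall>\<^sub>F n in sequentially. \<forall>z. \<bar>w n z - L\<bar> \<le> \<epsilon> + D * (norm z)\<^sup>2"
  shows "(\<lambda>n. \<integral>z. w n z * gauss (s n) z \<partial>lborel) \<longlonglongrightarrow> L"
proof (rule LIMSEQ_I)
  fix r :: real assume r: "0 < r"
  then obtain D where D: "\<forall>\<^sub>F n in sequentially. \<forall>z. \<bar>w n z - L\<bar> \<le> r / 2 + D * (norm z)\<^sup>2"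
    using close[of "r/2"] by auto
  have "(\<lambda>n. D * (real CARD('d) * s n)) \<longlonglongrightarrow> D * (real CARD('d) * 0)"
    by (intro tendsto_intros s)
  hence "\<forall>\<^sub>F n in sequentially. D * (real CARD('d) * s n) < r / 2"
    using r by (intro order_tendstoD) auto
  with D have "\<forall>\<^sub>F n in sequentially. norm ((\<integral>z. w n z * gauss (s n) z \<partial>lborel) - L) < r"
  proof eventually_elim
    case (elim n)
    note [measurable] = meas[of n]
    have i1: "integrable lborel (\<lambda>z. w n z * gauss (s n) z)"
    proof (rule Bochner_Integration.integrable_bound)
      show "integrable lborel (\<lambda>z::real^'d. B * gauss (s n) z)"
        by (intro integrable_mult_right gauss_integrable s)
      show "AE z in lborel. norm (w n z * gauss (s n) z) \<le> norm (B * gauss (s n) z)"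
      proof (rule AE_I2)
        fix z
        have "\<bar>w n z\<bar> * gauss (s n) z \<le> \<bar>B\<bar> * gauss (s n) z"
          using bd[of n z] by (intro mult_right_mono gauss_nonneg) auto
        thus "norm (w n z * gauss (s n) z) \<le> norm (B * gauss (s n) z)"
          by (simp add: abs_mult gauss_nonneg)
      qed
    qed measurable
    have i2: "integrable lborel (\<lambda>z. L * gauss (s n) (z::real^'d))"
      by (intro integrable_mult_right gauss_integrable s)
    have "(\<integral>z. w n z * gauss (s n) z \<partial>lborel) - L = (\<integral>z. w n z * gauss (s n) z \<partial>lborel) - (\<integral>z. L * gauss (s n) (z::real^'d) \<partial>lborel)"
      using gauss_integral[OF s(1)[of n], where 'd='d] by simp
    also have "\<dots> = (\<integral>z. w n z * gauss (s n) z - L * gauss (s n) z \<partial>lborel)"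
      using i1 i2 by simp
    finally have "norm ((\<integral>z. w n z * gauss (s n) z \<partial>lborel) - L)
       \<le> (\<integral>z. norm (w n z * gauss (s n) z - L * gauss (s n) z) \<partial>lborel)"
      by (simp only: integral_norm_bound)
    also have "\<dots> \<le> (\<integral>z. r / 2 * gauss (s n) z + D * ((norm z)\<^sup>2 * gauss (s n) (z::real^'d)) \<partial>lborel)"
    proof (rule integral_mono)
      show "integrable lborel (\<lambda>z. norm (w n z * gauss (s n) z - L * gauss (s n) z))"
        using i1 i2 by auto
      show "integrable lborel (\<lambda>z. r / 2 * gauss (s n) z + D * ((norm z)\<^sup>2 * gauss (s n) (z::real^'d)))"
        by (intro Bochner_Integration.integrable_add integrable_mult_right gauss_integrable gauss_norm2_integrable s)
      fix z :: "real^'d"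
      have "norm (w n z * gauss (s n) z - L * gauss (s n) z) = \<bar>w n z - L\<bar> * gauss (s n) z"
        by (simp add: left_diff_distrib[symmetric] abs_mult gauss_nonneg)
      also have "\<dots> \<le> (r / 2 + D * (norm z)\<^sup>2) * gauss (s n) z"
        using elim(1) by (intro mult_right_mono gauss_nonneg) auto
      finally show "norm (w n z * gauss (s n) z - L * gauss (s n) z) \<le> r / 2 * gauss (s n) z + D * ((norm z)\<^sup>2 * gauss (s n) z)"
        by (simp add: algebra_simps)
    qed
    also have "\<dots> = r / 2 + D * (real CARD('d) * s n)"
      by (subst Bochner_Integration.integral_add)
         (simp_all add: gauss_integral[OF s(1)] gauss_norm2_integral[OF s(1)] gauss_integrable[OF s(1)] gauss_norm2_integrable[OF s(1)])
    finally show ?case using elim(2) by simp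
  qed
  thus "\<exists>no. \<forall>n\<ge>no. norm ((\<integral>z. w n z * gauss (s n) z \<partial>lborel) - L) < r"
    by (simp add: eventually_sequentially)
qed

section \<open>Duhamel and Bismut formulas for the heat equation\<close>

lemma continuous_on_snd_slice:
  assumes "continuous_on (A \<times> UNIV) (\<lambda>q. w (fst q) (snd q))" "s \<in> A"
  shows "continuous_on UNIV (w s)"
proof -
  have "continuous_on UNIV (\<lambda>z. (s, z))" by (intro continuous_intros)
  from continuous_on_compose2[OF assms(1) this] assms(2) show ?thesis by auto
qed

lemma continuous_on_fst_slice:
  assumes "continuous_on (A \<times> UNIV) (\<lambda>q. w (fst q) (snd q))"
  shows "continuous_on A (\<lambda>s. w s z)"
proof -
  have "continuous_on A (\<lambda>s. (s, z))" by (intro continuous_intros)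
  from continuous_on_compose2[OF assms(1) this] show ?thesis by auto
qed

text \<open>Time is counted from the point of evaluation: the terminal data sit at
  \<open>s = \<tau>\<close> and the value sought at \<open>(0, 0)\<close>. \<open>f_bd\<close>
  bounds only the combination of derivatives that the equation controls.\<close>

locale heat_sol =
  fixes \<tau> B :: real
    and v vt :: "real \<Rightarrow> real^'d \<Rightarrow> real" and vi vii :: "'d \<Rightarrow> real \<Rightarrow> real^'d \<Rightarrow> real"
  assumes tau: "0 < \<tau>"
    and v_time: "\<And>s z. s \<in> {0..\<tau>} \<Longrightarrow> ((\<lambda>s. v s z) has_vector_derivative vt s z) (at s within {0..\<tau>})"
    and v_space: "\<And>s z i. s \<in> {0..\<tau>} \<Longrightarrow> ((\<lambda>h. v s (z + h *\<^sub>R axis i 1)) has_real_derivative vi i s z) (at 0)"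
    and v_space2: "\<And>s z i. s \<in> {0..\<tau>} \<Longrightarrow> ((\<lambda>h. vi i s (z + h *\<^sub>R axis i 1)) has_real_derivative vii i s z) (at 0)"
    and v_cont: "continuous_on ({0..\<tau>} \<times> UNIV) (\<lambda>q. v (fst q) (snd q))"
    and vt_cont: "continuous_on ({0..\<tau>} \<times> UNIV) (\<lambda>q. vt (fst q) (snd q))"
    and vi_cont: "\<And>i. continuous_on ({0..\<tau>} \<times> UNIV) (\<lambda>q. vi i (fst q) (snd q))"
    and vii_cont: "\<And>i. continuous_on ({0..\<tau>} \<times> UNIV) (\<lambda>q. vii i (fst q) (snd q))"
    and v_bd: "\<And>s z. s \<in> {0..\<tau>} \<Longrightarrow> \<bar>v s z\<bar> \<le> B"
    and vi_bd: "\<And>s z i. s \<in> {0..\<tau>} \<Longrightarrow> \<bar>vi i s z\<bar> \<le> B"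
    and f_bd: "\<And>s z. s \<in> {0..\<tau>} \<Longrightarrow> \<bar>vt s z + 1/2 * (\<Sum>i\<in>UNIV. vii i s z)\<bar> \<le> B"

text \<open>The kernel \<open>k\<close> will be the Gaussian for the value of the solution, and \<open>z\<^sub>j / s\<close> times the Gaussian for
  its gradient; both solve the heat equation.\<close>

locale heat_pair = heat_sol \<tau> B v vt vi vii
  for \<tau> B :: real
    and v vt :: "real \<Rightarrow> real^'d \<Rightarrow> real" and vi vii :: "'d \<Rightarrow> real \<Rightarrow> real^'d \<Rightarrow> real" +
  fixes k ks :: "real \<Rightarrow> real^'d \<Rightarrow> real" and ki kii :: "'d \<Rightarrow> real \<Rightarrow> real^'d \<Rightarrow> real"
  assumes k_time: "\<And>s z. 0 < s \<Longrightarrow> ((\<lambda>s. k s z) has_real_derivative ks s z) (at s)"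
    and k_space: "\<And>s z i. 0 < s \<Longrightarrow> ((\<lambda>h. k s (z + h *\<^sub>R axis i 1)) has_real_derivative ki i s z) (at 0)"
    and k_space2: "\<And>s z i. 0 < s \<Longrightarrow> ((\<lambda>h. ki i s (z + h *\<^sub>R axis i 1)) has_real_derivative kii i s z) (at 0)"
    and k_cont: "continuous_on ({0<..} \<times> UNIV) (\<lambda>q. k (fst q) (snd q))"
    and ki_cont: "\<And>i. continuous_on ({0<..} \<times> UNIV) (\<lambda>q. ki i (fst q) (snd q))"
    and kii_cont: "\<And>i. continuous_on ({0<..} \<times> UNIV) (\<lambda>q. kii i (fst q) (snd q))"
    and k_heat: "\<And>s z. 0 < s \<Longrightarrow> ks s z = 1/2 * (\<Sum>i\<in>UNIV. kii i s z)"
    and k_int: "\<And>s. 0 < s \<Longrightarrow> (\<integral>\<^sup>+z. ennreal \<bar>k s z\<bar> \<partial>lborel) \<le> ennreal (1 + s powr (-1/2))"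
begin

lemma slice_cont:
  "s \<in> {0..\<tau>} \<Longrightarrow> continuous_on UNIV (v s)" "s \<in> {0..\<tau>} \<Longrightarrow> continuous_on UNIV (vt s)"
  "s \<in> {0..\<tau>} \<Longrightarrow> continuous_on UNIV (vi i s)" "s \<in> {0..\<tau>} \<Longrightarrow> continuous_on UNIV (vii i s)"
  by (rule continuous_on_snd_slice[OF v_cont] continuous_on_snd_slice[OF vt_cont] continuous_on_snd_slice[OF vi_cont]
      continuous_on_snd_slice[OF vii_cont]; assumption)+

lemma slice_cont_k:
  "0 < s \<Longrightarrow> continuous_on UNIV (k s)"
  "0 < s \<Longrightarrow> continuous_on UNIV (ki i s)" "0 < s \<Longrightarrow> continuous_on UNIV (kii i s)"
  by (rule continuous_on_snd_slice[OF k_cont] continuous_on_snd_slice[OF ki_cont] continuous_on_snd_slice[OF kii_cont]; simp)+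

text \<open>\<open>Psi\<close> is the time derivative of \<open>cutoff * v * k\<close>. Two integrations by parts, encoded in the flux
  \<open>cutoff * v * \<partial>\<^sub>i k - k * \<partial>\<^sub>i (cutoff * v)\<close> with divergence \<open>flux'\<close>, turn it into \<open>Lo\<close>, in which no derivative
  of \<open>k\<close> occurs.\<close>

definition Psi :: "real \<Rightarrow> real \<Rightarrow> real^'d \<Rightarrow> real" where
  "Psi R s z = cutoff R z * (vt s z * k s z + v s z * (1/2 * (\<Sum>i\<in>UNIV. kii i s z)))"

definition Lo :: "real \<Rightarrow> real \<Rightarrow> real^'d \<Rightarrow> real" where
  "Lo R s z = k s z * (cutoff R z * (vt s z + 1/2 * (\<Sum>i\<in>UNIV. vii i s z))
      + (\<Sum>i\<in>UNIV. cutoff1 i R z * vi i s z + 1/2 * v s z * cutoff2 i R z))"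

definition flux' :: "'d \<Rightarrow> real \<Rightarrow> real \<Rightarrow> real^'d \<Rightarrow> real" where
  "flux' i R s z = cutoff R z * v s z * kii i s z
     - k s z * (cutoff2 i R z * v s z + 2 * cutoff1 i R z * vi i s z + cutoff R z * vii i s z)"

lemma Psi_eq: "Psi R s z = Lo R s z + 1/2 * (\<Sum>i\<in>UNIV. flux' i R s z)"
  unfolding Psi_def Lo_def flux'_def
  by (simp add: sum.distrib sum_subtractf sum_distrib_left algebra_simps sum_divide_distrib)

text \<open>When the flux is differentiated, the products of two first derivatives cancel, which
  leaves exactly \<open>flux'\<close>; the cutoff makes everything compactly supported.\<close>

lemma flux_integral:
  assumes R: "0 < R" and s: "0 < s" "s \<le> \<tau>"
  shows "(\<integral>z. flux' i R s z \<partial>lborel) = 0" "integrable lborel (flux' i R s)"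
proof -
  have s': "s \<in> {0..\<tau>}" using s by auto
  have cont': "continuous_on UNIV (flux' i R s)"
    unfolding flux'_def[abs_def]
    by (intro continuous_intros cutoff_continuous slice_cont slice_cont_k s s')
  have supp': "R \<le> norm z \<Longrightarrow> flux' i R s z = 0" for z
    using R by (simp add: flux'_def cutoff_support)
  show "integrable lborel (flux' i R s)" by (rule integrable_compact_support[OF cont' supp'])
  show "(\<integral>z. flux' i R s z \<partial>lborel) = 0"
  proof (rule integral_partial_zero[OF R _ _ cont' _ supp',
      where h="\<lambda>z. cutoff R z * v s z * ki i s z - k s z * (cutoff1 i R z * v s z + cutoff R z * vi i s z)"])
    show "continuous_on UNIV (\<lambda>z. cutoff R z * v s z * ki i s z - k s z * (cutoff1 i R z * v s z + cutoff R z * vi i s z))"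
      by (intro continuous_intros cutoff_continuous slice_cont slice_cont_k s s')
    fix z
    show "((\<lambda>e. cutoff R (z + e *\<^sub>R axis i 1) * v s (z + e *\<^sub>R axis i 1) * ki i s (z + e *\<^sub>R axis i 1) -
           k s (z + e *\<^sub>R axis i 1) * (cutoff1 i R (z + e *\<^sub>R axis i 1) * v s (z + e *\<^sub>R axis i 1) +
            cutoff R (z + e *\<^sub>R axis i 1) * vi i s (z + e *\<^sub>R axis i 1))) has_real_derivative flux' i R s z) (at 0)"
      by (rule DERIV_cong[OF DERIV_diff[OF DERIV_mult[OF DERIV_mult[OF cutoff_deriv v_space[OF s']] k_space2[OF s(1)]]
          DERIV_mult[OF k_space[OF s(1)] DERIV_add[OF DERIV_mult[OF cutoff1_deriv v_space[OF s']]
             DERIV_mult[OF cutoff_deriv v_space2[OF s']]]]]])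
        (simp add: flux'_def algebra_simps)
  qed (use R in \<open>simp_all add: cutoff_support\<close>)
qed

lemma Lo_integrable:
  assumes R: "0 < R" and s: "0 < s" "s \<le> \<tau>"
  shows "integrable lborel (Lo R s)"
proof (rule integrable_compact_support)
  have s': "s \<in> {0..\<tau>}" using s by auto
  show "continuous_on UNIV (Lo R s)"
    unfolding Lo_def[abs_def]
    by (intro continuous_intros cutoff_continuous slice_cont slice_cont_k s s')
  show "R \<le> norm z \<Longrightarrow> Lo R s z = 0" for z
    using R by (simp add: Lo_def cutoff_support)
qed

lemma Psi_integral:
  assumes "0 < R" "0 < s" "s \<le> \<tau>"
  shows "(\<integral>z. Psi R s z \<partial>lborel) = (\<integral>z. Lo R s z \<partial>lborel)"
proof -
  have "(\<integral>z. Psi R s z \<partial>lborel) = (\<integral>z. Lo R s z \<partial>lborel) + (\<integral>z. 1/2 * (\<Sum>i\<in>UNIV. flux' i R s z) \<partial>lborel)"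
    unfolding Psi_eq
    by (intro Bochner_Integration.integral_add Lo_integrable assms integrable_mult_right
        Bochner_Integration.integrable_sum flux_integral)
  also have "(\<integral>z. 1/2 * (\<Sum>i\<in>UNIV. flux' i R s z) \<partial>lborel) = 1/2 * (\<Sum>i\<in>UNIV. \<integral>z. flux' i R s z \<partial>lborel)"
    using assms by (simp add: Bochner_Integration.integral_sum flux_integral)
  finally show ?thesis using assms by (simp add: flux_integral)
qed

lemma pair_cont_v:
  assumes "0 < s0"
  shows "continuous_on ({s0..\<tau>} \<times> A) (\<lambda>q. v (fst q) (snd q))" "continuous_on ({s0..\<tau>} \<times> A) (\<lambda>q. vt (fst q) (snd q))"
    "continuous_on ({s0..\<tau>} \<times> A) (\<lambda>q. vi i (fst q) (snd q))" "continuous_on ({s0..\<tau>} \<times> A) (\<lambda>q. vii i (fst q) (snd q))"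
    "continuous_on ({s0..\<tau>} \<times> A) (\<lambda>q. k (fst q) (snd q))" "continuous_on ({s0..\<tau>} \<times> A) (\<lambda>q. kii i (fst q) (snd q))"
    "continuous_on ({s0..\<tau>} \<times> A) (\<lambda>q. cutoff R (snd q))" "continuous_on ({s0..\<tau>} \<times> A) (\<lambda>q. cutoff1 i R (snd q))"
    "continuous_on ({s0..\<tau>} \<times> A) (\<lambda>q. cutoff2 i R (snd q))"
  using assms
  by (auto intro!: continuous_on_subset[OF v_cont] continuous_on_subset[OF vt_cont] continuous_on_subset[OF vi_cont]
    continuous_on_subset[OF vii_cont] continuous_on_subset[OF k_cont] continuous_on_subset[OF kii_cont]
    continuous_on_compose2[OF cutoff_continuous(1)] continuous_on_compose2[OF cutoff_continuous(2)]
    continuous_on_compose2[OF cutoff_continuous(3)] continuous_intros)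

text \<open>Fubini for \<open>Psi\<close> on a slab. Integrated in space first, it may be replaced
  by \<open>Lo\<close>; integrated in time first, it is the fundamental theorem of calculus. The
  positive initial time \<open>s0\<close> avoids the singularity of the kernel, and the cutoff makes
  both orders legitimate.\<close>

lemma cutoff_identity:
  assumes R: "0 < R" and s0: "0 < s0" "s0 \<le> \<tau>"
  shows "(\<integral>z. cutoff R z * v \<tau> z * k \<tau> z \<partial>lborel) - (\<integral>z. cutoff R z * v s0 z * k s0 z \<partial>lborel)
    = (\<integral>q. indicator ({s0..\<tau>} \<times> UNIV) q * Lo R (fst q) (snd q) \<partial>lborel)"
    and "integrable lborel (\<lambda>q. indicator ({s0..\<tau>} \<times> UNIV) q * Lo R (fst q) (snd q))"
proof -
  define I where "I = {s0..\<tau>}"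
  define C where "C = cball (0::real^'d) R"
  have K: "compact (I \<times> C)" unfolding I_def C_def by (intro compact_Times) auto
  have cP: "continuous_on (I \<times> C) (\<lambda>q. Psi R (fst q) (snd q))"
    unfolding Psi_def[abs_def] I_def by (intro continuous_intros pair_cont_v s0)
  have cL: "continuous_on (I \<times> C) (\<lambda>q. Lo R (fst q) (snd q))"
    unfolding Lo_def[abs_def] I_def by (intro continuous_intros pair_cont_v s0)
  have Lsupp: "indicator (I \<times> C) q *\<^sub>R Lo R (fst q) (snd q) = indicator ({s0..\<tau>} \<times> UNIV) q * Lo R (fst q) (snd q)" for q
    using R by (cases q) (auto simp: indicator_def I_def C_def Lo_def cutoff_support)
  have iP: "integrable (lborel \<Otimes>\<^sub>M lborel) (\<lambda>q. indicator (I \<times> C) q *\<^sub>R Psi R (fst q) (snd q))"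
    unfolding lborel_prod by (rule borel_integrable_compact[OF K cP])
  have iL: "integrable (lborel \<Otimes>\<^sub>M lborel) (\<lambda>q. indicator (I \<times> C) q *\<^sub>R Lo R (fst q) (snd q))"
    unfolding lborel_prod by (rule borel_integrable_compact[OF K cL])
  show "integrable lborel (\<lambda>q. indicator ({s0..\<tau>} \<times> UNIV) q * Lo R (fst q) (snd q))"
    using iL unfolding Lsupp lborel_prod .
  have ind: "indicator (I \<times> C) (s, z) *\<^sub>R a = indicator I s *\<^sub>R (indicator C z *\<^sub>R a)" for s z and a :: real
    by (auto simp: indicator_def)
  have Cv: "indicator C z *\<^sub>R Psi R s z = Psi R s z" "indicator C z *\<^sub>R Lo R s z = Lo R s z"
    "indicator C z *\<^sub>R (cutoff R z * x) = cutoff R z * x" for s z x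
    using R by (auto simp: indicator_def C_def Psi_def Lo_def cutoff_support)
  have "(\<integral>q. indicator (I \<times> C) q *\<^sub>R Psi R (fst q) (snd q) \<partial>(lborel \<Otimes>\<^sub>M lborel))
     = (\<integral>s. (\<integral>z. indicator (I \<times> C) (s, z) *\<^sub>R Psi R s z \<partial>lborel) \<partial>lborel)"
    using lborel_pair.integral_fst[of "\<lambda>s z. indicator (I \<times> C) (s, z) *\<^sub>R Psi R s z"] iP
    by (simp add: case_prod_unfold)
  also have "\<dots> = (\<integral>s. indicator I s *\<^sub>R (\<integral>z. Psi R s z \<partial>lborel) \<partial>lborel)"
    unfolding ind Cv by simp
  also have "\<dots> = (\<integral>s. indicator I s *\<^sub>R (\<integral>z. Lo R s z \<partial>lborel) \<partial>lborel)"
    using s0 by (intro Bochner_Integration.integral_cong refl)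
       (auto simp: indicator_def I_def Psi_integral[OF R])
  also have "\<dots> = (\<integral>s. (\<integral>z. indicator (I \<times> C) (s, z) *\<^sub>R Lo R s z \<partial>lborel) \<partial>lborel)"
    unfolding ind Cv by simp
  also have "\<dots> = (\<integral>q. indicator (I \<times> C) q *\<^sub>R Lo R (fst q) (snd q) \<partial>(lborel \<Otimes>\<^sub>M lborel))"
    using lborel_pair.integral_fst[of "\<lambda>s z. indicator (I \<times> C) (s, z) *\<^sub>R Lo R s z"] iL
    by (simp add: case_prod_unfold)
  also have "\<dots> = (\<integral>q. indicator ({s0..\<tau>} \<times> UNIV) q * Lo R (fst q) (snd q) \<partial>lborel)"
    unfolding Lsupp lborel_prod ..
  finally have 1: "(\<integral>q. indicator (I \<times> C) q *\<^sub>R Psi R (fst q) (snd q) \<partial>(lborel \<Otimes>\<^sub>M lborel))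
     = (\<integral>q. indicator ({s0..\<tau>} \<times> UNIV) q * Lo R (fst q) (snd q) \<partial>lborel)" .
  have FTC: "(\<integral>s. indicator I s *\<^sub>R Psi R s z \<partial>lborel) = cutoff R z * v \<tau> z * k \<tau> z - cutoff R z * v s0 z * k s0 z" for z
    unfolding I_def
  proof (rule integral_FTC_atLeastAtMost[OF s0(2)])
    have "continuous_on ({s0..\<tau>} \<times> UNIV) (\<lambda>q. Psi R (fst q) (snd q))"
      unfolding Psi_def[abs_def] by (intro continuous_intros pair_cont_v s0)
    thus "continuous_on {s0..\<tau>} (\<lambda>s. Psi R s z)" by (rule continuous_on_fst_slice)
    fix s assume s: "s0 \<le> s" "s \<le> \<tau>"
    have a: "((\<lambda>s. v s z) has_real_derivative vt s z) (at s within {s0..\<tau>})"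
      using has_vector_derivative_within_subset[OF v_time, of s "{s0..\<tau>}"] s s0
      by (auto simp: has_real_derivative_iff_has_vector_derivative)
    have b: "((\<lambda>s. k s z) has_real_derivative ks s z) (at s within {s0..\<tau>})"
      using k_time[of s z] s s0 by (auto intro: has_field_derivative_at_within)
    have "((\<lambda>s. cutoff R z * (v s z * k s z)) has_real_derivative cutoff R z * (vt s z * k s z + ks s z * v s z)) (at s within {s0..\<tau>})"
      by (intro DERIV_cmult DERIV_mult a b)
    moreover have "cutoff R z * (vt s z * k s z + ks s z * v s z) = Psi R s z"
      using s s0 by (simp add: Psi_def k_heat algebra_simps)
    ultimately show "((\<lambda>s. cutoff R z * v s z * k s z) has_vector_derivative Psi R s z) (at s within {s0..\<tau>})"
      by (simp add: has_real_derivative_iff_has_vector_derivative mult.assoc)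
  qed
  have "(\<integral>q. indicator (I \<times> C) q *\<^sub>R Psi R (fst q) (snd q) \<partial>(lborel \<Otimes>\<^sub>M lborel))
     = (\<integral>z. (\<integral>s. indicator (I \<times> C) (s, z) *\<^sub>R Psi R s z \<partial>lborel) \<partial>lborel)"
    using lborel_pair.integral_snd[of "\<lambda>s z. indicator (I \<times> C) (s, z) *\<^sub>R Psi R s z"] iP
    by (simp add: case_prod_unfold)
  also have "\<dots> = (\<integral>z. cutoff R z * v \<tau> z * k \<tau> z - cutoff R z * v s0 z * k s0 z \<partial>lborel)"
    unfolding ind Cv FTC by simp
  also have "\<dots> = (\<integral>z. cutoff R z * v \<tau> z * k \<tau> z \<partial>lborel) - (\<integral>z. cutoff R z * v s0 z * k s0 z \<partial>lborel)"
  proof (rule Bochner_Integration.integral_diff)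
    have "integrable lborel (\<lambda>z. cutoff R z * v s z * k s z)" if s: "0 < s" "s \<le> \<tau>" for s
    proof (rule integrable_compact_support)
      have s': "s \<in> {0..\<tau>}" using s by auto
      show "continuous_on UNIV (\<lambda>z. cutoff R z * v s z * k s z)"
        by (intro continuous_intros cutoff_continuous slice_cont slice_cont_k s s')
      show "R \<le> norm z \<Longrightarrow> cutoff R z * v s z * k s z = 0" for z
        using R by (simp add: cutoff_support)
    qed
    thus "integrable lborel (\<lambda>z. cutoff R z * v \<tau> z * k \<tau> z)" "integrable lborel (\<lambda>z. cutoff R z * v s0 z * k s0 z)"
      using s0 tau by auto
  qed
  finally show "(\<integral>z. cutoff R z * v \<tau> z * k \<tau> z \<partial>lborel) - (\<integral>z. cutoff R z * v s0 z * k s0 z \<partial>lborel)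
    = (\<integral>q. indicator ({s0..\<tau>} \<times> UNIV) q * Lo R (fst q) (snd q) \<partial>lborel)"
    using 1 by simp
qed

lemma B_nonneg: "0 \<le> B" using v_bd[of 0 0] tau by force

lemma k_integrable: "0 < s \<Longrightarrow> integrable lborel (k s)"
proof -
  assume s: "0 < s"
  have "k s \<in> borel_measurable borel" by (rule borel_measurable_continuous_onI[OF slice_cont_k(1)[OF s]])
  thus ?thesis using k_int[OF s] by (auto simp: integrable_iff_bounded intro: le_less_trans)
qed

lemma k_pair_measurable [measurable]:
  "(\<lambda>q. indicator ({0<..\<tau>} \<times> UNIV) q * k (fst q) (snd q)) \<in> borel_measurable borel"
proof -
  have "continuous_on ({0<..\<tau>} \<times> UNIV) (\<lambda>q. k (fst q) (snd q))"
    by (rule continuous_on_subset[OF k_cont]) auto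
  from borel_measurable_continuous_on_indicator[OF _ this]
  show ?thesis by (simp add: borel_Times)
qed

text \<open>The spatial mass of the kernel is integrable in time down to 0. This provides the
  majorant for removing the cutoff and the positive initial time.\<close>

lemma k_pair_integrable:
  "integrable lborel (\<lambda>q. indicator ({0<..\<tau>} \<times> UNIV) q * \<bar>k (fst q) (snd q)\<bar>)"
proof -
  have hi: "((\<lambda>s. 1 + s powr (-1/2)) has_integral (\<tau> + \<tau> powr (-1/2+1) / (-1/2+1))) {0..\<tau>}"
    using has_integral_add[OF has_integral_const_real[of 1 0 \<tau>] has_integral_powr_from_0[of "-1/2" \<tau>]] tau by simp
  have meas: "(\<lambda>q. indicator ({0<..\<tau>} \<times> UNIV) q * \<bar>k (fst q) (snd q)\<bar>) \<in> borel_measurable borel"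
  proof -
    have "(\<lambda>q. \<bar>indicator ({0<..\<tau>} \<times> UNIV) q * k (fst q) (snd q)\<bar>) \<in> borel_measurable borel"
      by measurable
    thus ?thesis by (simp add: abs_mult)
  qed
  have meas2: "(\<lambda>q. ennreal (indicator ({0<..\<tau>} \<times> UNIV) q * \<bar>k (fst q) (snd q)\<bar>)) \<in> borel_measurable (lborel \<Otimes>\<^sub>M lborel)"
    using meas by (simp add: lborel_prod)
  have "(\<integral>\<^sup>+q. ennreal (indicator ({0<..\<tau>} \<times> UNIV) q * \<bar>k (fst q) (snd q)\<bar>) \<partial>lborel)
     = (\<integral>\<^sup>+s. \<integral>\<^sup>+z. ennreal (indicator ({0<..\<tau>} \<times> UNIV) (s, z) * \<bar>k s z\<bar>) \<partial>lborel \<partial>lborel)"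
    using lborel.nn_integral_fst[OF meas2] by (simp add: lborel_prod)
  also have "\<dots> \<le> (\<integral>\<^sup>+s. ennreal (1 + s powr (-1/2)) * indicator {0..\<tau>} s \<partial>lborel)"
  proof (intro nn_integral_mono)
    fix s :: real
    show "(\<integral>\<^sup>+z. ennreal (indicator ({0<..\<tau>} \<times> UNIV) (s, z) * \<bar>k s z\<bar>) \<partial>lborel) \<le> ennreal (1 + s powr (-1/2)) * indicator {0..\<tau>} s"
      using k_int[of s] by (cases "s \<in> {0<..\<tau>}") (auto simp: indicator_def)
  qed
  also have "\<dots> = ennreal (\<tau> + \<tau> powr (-1/2+1) / (-1/2+1))"
    by (rule nn_integral_has_integral_lebesgue'[OF _ hi]) simp
  finally have "(\<integral>\<^sup>+q. ennreal (indicator ({0<..\<tau>} \<times> UNIV) q * \<bar>k (fst q) (snd q)\<bar>) \<partial>lborel) < \<infinity>"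
    by (rule le_less_trans) simp
  thus ?thesis using meas by (intro integrableI_nonneg) auto
qed

text \<open>The radius \<open>n + 1\<close> tends to infinity and the initial time
  \<open>\<tau> / (n + 1)\<close> to 0 in the same limit, so that one dominated convergence suffices
  for the source term. The initial trace \<open>L\<close> is left as an assumption because the two
  kernels differ there: one yields the value at the origin, the other the gradient.\<close>

lemma duhamel:
  assumes L: "(\<lambda>n. \<integral>z. cutoff (real n + 1) z * v (\<tau> / (real n + 1)) z * k (\<tau> / (real n + 1)) z \<partial>lborel) \<longlonglongrightarrow> L"
  shows "integrable lborel (\<lambda>q. indicator ({0<..\<tau>} \<times> UNIV) q
           * ((vt (fst q) (snd q) + 1/2 * (\<Sum>i\<in>UNIV. vii i (fst q) (snd q))) * k (fst q) (snd q)))" (is "integrable lborel ?G")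
    and "(\<integral>z. v \<tau> z * k \<tau> z \<partial>lborel) - L = (\<integral>q. indicator ({0<..\<tau>} \<times> UNIV) q
           * ((vt (fst q) (snd q) + 1/2 * (\<Sum>i\<in>UNIV. vii i (fst q) (snd q))) * k (fst q) (snd q)) \<partial>lborel)"
proof -
  define s where "s n = \<tau> / (real n + 1)" for n
  have s: "0 < s n" "s n \<le> \<tau>" for n using tau by (auto simp: s_def field_simps)
  have s0: "s \<longlonglongrightarrow> 0"
    unfolding s_def[abs_def] using tau by real_asymp
  define R where "R n = real n + 1" for n
  have R: "0 < R n" "1 \<le> R n" for n by (auto simp: R_def)
  have inf: "filterlim R at_top sequentially" unfolding R_def[abs_def] by real_asymp
  have cutoff_lim: "(\<lambda>n. cutoff (R n) z) \<longlonglongrightarrow> 1" for z :: "real^'d"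
  proof (rule real_tendsto_sandwich[of "\<lambda>n. 1 - 3 * (norm z)\<^sup>2 / (R n)\<^sup>2" _ _ "\<lambda>_. 1"])
    show "(\<lambda>n. 1 - 3 * (norm z)\<^sup>2 / (R n)\<^sup>2) \<longlonglongrightarrow> 1" unfolding R_def by real_asymp
    show "\<forall>\<^sub>F n in sequentially. 1 - 3 * (norm z)\<^sup>2 / (R n)\<^sup>2 \<le> cutoff (R n) z"
      using cutoff_bounds(5)[OF R(1), where z=z] by (intro always_eventually) (auto simp: algebra_simps)
  qed (use cutoff_bounds(2)[OF R(1)] in \<open>auto intro!: always_eventually\<close>)
  have cutoff1_lim: "(\<lambda>n. cutoff1 i (R n) z) \<longlonglongrightarrow> 0" for i and z :: "real^'d"
  proof (rule tendsto_rabs_zero_cancel, rule real_tendsto_sandwich[of "\<lambda>_. 0" _ _ "\<lambda>n. 6 / R n"])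
    show "(\<lambda>n. 6 / R n) \<longlonglongrightarrow> 0" unfolding R_def by real_asymp
  qed (use cutoff_bounds(3)[OF R(1)] in \<open>auto intro!: always_eventually\<close>)
  have cutoff2_lim: "(\<lambda>n. cutoff2 i (R n) z) \<longlonglongrightarrow> 0" for i and z :: "real^'d"
  proof (rule tendsto_rabs_zero_cancel, rule real_tendsto_sandwich[of "\<lambda>_. 0" _ _ "\<lambda>n. 30 / (R n)\<^sup>2"])
    show "(\<lambda>n. 30 / (R n)\<^sup>2) \<longlonglongrightarrow> 0" unfolding R_def by real_asymp
  qed (use cutoff_bounds(4)[OF R(1)] in \<open>auto intro!: always_eventually\<close>)
  have vtau: "v \<tau> \<in> borel_measurable borel" "k \<tau> \<in> borel_measurable borel" "cutoff (R n) \<in> borel_measurable borel" for n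
    using tau by (auto intro!: borel_measurable_continuous_onI slice_cont slice_cont_k cutoff_continuous)
  have A: "(\<lambda>n. \<integral>z. cutoff (R n) z * v \<tau> z * k \<tau> z \<partial>lborel) \<longlonglongrightarrow> (\<integral>z. v \<tau> z * k \<tau> z \<partial>lborel)"
  proof (rule integral_dominated_convergence[where w="\<lambda>z. B * \<bar>k \<tau> z\<bar>"])
    show "integrable lborel (\<lambda>z. B * \<bar>k \<tau> z\<bar>)"
      using k_integrable[OF tau] by auto
    show "AE z in lborel. (\<lambda>n. cutoff (R n) z * v \<tau> z * k \<tau> z) \<longlonglongrightarrow> v \<tau> z * k \<tau> z"
    proof (rule AE_I2)
      fix z
      have "(\<lambda>n. cutoff (R n) z * v \<tau> z * k \<tau> z) \<longlonglongrightarrow> 1 * v \<tau> z * k \<tau> z"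
        by (intro tendsto_intros cutoff_lim)
      thus "(\<lambda>n. cutoff (R n) z * v \<tau> z * k \<tau> z) \<longlonglongrightarrow> v \<tau> z * k \<tau> z" by simp
    qed
    show "AE z in lborel. norm (cutoff (R n) z * v \<tau> z * k \<tau> z) \<le> B * \<bar>k \<tau> z\<bar>" for n
    proof (rule AE_I2)
      fix z
      have "\<bar>cutoff (R n) z\<bar> * \<bar>v \<tau> z\<bar> * \<bar>k \<tau> z\<bar> \<le> 1 * B * \<bar>k \<tau> z\<bar>"
        using cutoff_bounds(1,2)[OF R(1)[of n], of z] v_bd[of \<tau> z] tau B_nonneg
        by (intro mult_mono) auto
      thus "norm (cutoff (R n) z * v \<tau> z * k \<tau> z) \<le> B * \<bar>k \<tau> z\<bar>" by (simp add: abs_mult)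
    qed
  qed (auto intro!: borel_measurable_times vtau)
  define g where "g q = vt (fst q) (snd q) + 1/2 * (\<Sum>i\<in>UNIV. vii i (fst q) (snd q))" for q
  \<comment> \<open>For a radius of at least 1 the first derivative of the cutoff is at most 6 and
    half of the second at most 15; each multiplies a quantity bounded by \<open>B\<close>.\<close>
  define C where "C = B + real CARD('d) * (6 * B + 15 * B)"
  have bound: "norm (indicator ({s n..\<tau>} \<times> UNIV) q * Lo (R n) (fst q) (snd q)) \<le> C * (indicator ({0<..\<tau>} \<times> UNIV) q * \<bar>k (fst q) (snd q)\<bar>)" for n q
  proof (cases "q \<in> {s n..\<tau>} \<times> UNIV")
    case True
    then obtain r z where q: "q = (r, z)" "s n \<le> r" "r \<le> \<tau>" by auto
    have r: "r \<in> {0..\<tau>}" "0 < r" using q s[of n] by auto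
    have "\<bar>cutoff1 i (R n) z * vi i r z + 1/2 * v r z * cutoff2 i (R n) z\<bar> \<le> 6 * B + 15 * B" for i
    proof -
      have "6 / R n \<le> 6" "30 / (R n)\<^sup>2 \<le> 30" using R(2)[of n] by (auto simp: field_simps power2_eq_square mult_ge1_I)
      hence c: "\<bar>cutoff1 i (R n) z\<bar> \<le> 6" "\<bar>cutoff2 i (R n) z\<bar> \<le> 30"
        using cutoff_bounds(3,4)[OF R(1)[of n], of i z] by linarith+
      have "\<bar>cutoff1 i (R n) z\<bar> * \<bar>vi i r z\<bar> \<le> 6 * B" "\<bar>v r z\<bar> * \<bar>cutoff2 i (R n) z\<bar> \<le> B * 30"
        using c vi_bd[OF r(1), of i z] v_bd[OF r(1), of z] by (auto intro!: mult_mono)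
      moreover have "\<bar>cutoff1 i (R n) z * vi i r z + 1/2 * v r z * cutoff2 i (R n) z\<bar>
          \<le> \<bar>cutoff1 i (R n) z\<bar> * \<bar>vi i r z\<bar> + 1/2 * (\<bar>v r z\<bar> * \<bar>cutoff2 i (R n) z\<bar>)"
        using abs_triangle_ineq[of "cutoff1 i (R n) z * vi i r z" "1/2 * v r z * cutoff2 i (R n) z"] by (simp add: abs_mult)
      ultimately show ?thesis by linarith
    qed
    hence "\<bar>\<Sum>i\<in>UNIV. cutoff1 i (R n) z * vi i r z + 1/2 * v r z * cutoff2 i (R n) z\<bar> \<le> (\<Sum>i\<in>(UNIV::'d set). 6 * B + 15 * B)"
      by (intro order_trans[OF sum_abs] sum_mono) auto
    also have "\<dots> = real CARD('d) * (6 * B + 15 * B)" by simp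
    finally have S: "\<bar>\<Sum>i\<in>UNIV. cutoff1 i (R n) z * vi i r z + 1/2 * v r z * cutoff2 i (R n) z\<bar> \<le> real CARD('d) * (6 * B + 15 * B)" .
    have "\<bar>cutoff (R n) z * (vt r z + 1/2 * (\<Sum>i\<in>UNIV. vii i r z))\<bar> \<le> 1 * B"
      unfolding abs_mult using cutoff_bounds(1,2)[OF R(1)[of n], of z] f_bd[OF r(1), of z]
      by (intro mult_mono) auto
    hence "\<bar>cutoff (R n) z * (vt r z + 1/2 * (\<Sum>i\<in>UNIV. vii i r z)) + (\<Sum>i\<in>UNIV. cutoff1 i (R n) z * vi i r z + 1/2 * v r z * cutoff2 i (R n) z)\<bar> \<le> C"
      unfolding C_def using abs_triangle_ineq S by (smt (verit))
    hence "\<bar>Lo (R n) r z\<bar> \<le> \<bar>k r z\<bar> * C"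
      unfolding Lo_def abs_mult by (intro mult_left_mono) auto
    thus ?thesis using True r q by (simp add: mult.commute)
  next
    case False
    have "0 \<le> C" using B_nonneg by (simp add: C_def)
    thus ?thesis using False by simp
  qed
  have m: "(\<lambda>q. indicator ({s n..\<tau>} \<times> UNIV) q * Lo (R n) (fst q) (snd q)) \<in> borel_measurable lborel" for n
    using cutoff_identity(2)[OF R(1) s] by (rule borel_measurable_integrable)
  have lim: "(\<lambda>n. indicator ({s n..\<tau>} \<times> UNIV) q * Lo (R n) (fst q) (snd q)) \<longlonglongrightarrow> indicator ({0<..\<tau>} \<times> UNIV) q * (g q * k (fst q) (snd q))" for q
  proof -
    obtain r z where q: "q = (r, z)" by force
    have "(\<lambda>n. Lo (R n) r z) \<longlonglongrightarrow> k r z * (1 * (vt r z + 1/2 * (\<Sum>i\<in>UNIV. vii i r z))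
       + (\<Sum>i\<in>UNIV. 0 * vi i r z + 1/2 * v r z * 0))"
      unfolding Lo_def by (intro tendsto_intros cutoff_lim cutoff1_lim cutoff2_lim)
    hence 1: "(\<lambda>n. Lo (R n) r z) \<longlonglongrightarrow> g q * k r z" by (simp add: q g_def mult.commute)
    have "(\<lambda>n. indicator ({s n..\<tau>} \<times> UNIV) q :: real) \<longlonglongrightarrow> indicator ({0<..\<tau>} \<times> UNIV) q"
    proof (rule tendsto_eventually)
      show "\<forall>\<^sub>F n in sequentially. indicator ({s n..\<tau>} \<times> UNIV) q = (indicator ({0<..\<tau>} \<times> UNIV) q :: real)"
      proof (cases "0 < r")
        case True
        have "\<forall>\<^sub>F n in sequentially. s n < r" using s0 True by (rule order_tendstoD)
        thus ?thesis by (rule eventually_mono) (use True in \<open>auto simp: q indicator_def\<close>)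
      next
        case False
        hence "\<not> s n \<le> r" for n using s(1)[of n] by linarith
        thus ?thesis using False by (auto simp: q indicator_def)
      qed
    qed
    from tendsto_mult[OF this 1] show ?thesis by (simp add: q)
  qed
  have meas_lim: "(\<lambda>q. indicator ({0<..\<tau>} \<times> UNIV) q * (g q * k (fst q) (snd q))) \<in> borel_measurable lborel"
    by (rule borel_measurable_LIMSEQ_real[OF lim m])
  have w: "integrable lborel (\<lambda>q. C * (indicator ({0<..\<tau>} \<times> UNIV) q * \<bar>k (fst q) (snd q)\<bar>))"
    by (intro integrable_mult_right k_pair_integrable)
  note dct = meas_lim m w AE_I2[OF lim] AE_I2[OF bound]
  show "integrable lborel ?G"
    using integrable_dominated_convergence[OF dct] by (simp add: g_def)
  have "(\<lambda>n. \<integral>q. indicator ({s n..\<tau>} \<times> UNIV) q * Lo (R n) (fst q) (snd q) \<partial>lborel)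
     \<longlonglongrightarrow> (\<integral>q. indicator ({0<..\<tau>} \<times> UNIV) q * (g q * k (fst q) (snd q)) \<partial>lborel)"
    by (rule integral_dominated_convergence[OF dct])
  moreover have "(\<lambda>n. \<integral>q. indicator ({s n..\<tau>} \<times> UNIV) q * Lo (R n) (fst q) (snd q) \<partial>lborel)
     \<longlonglongrightarrow> (\<integral>z. v \<tau> z * k \<tau> z \<partial>lborel) - L"
    unfolding cutoff_identity(1)[OF R(1) s, symmetric]
    using A L unfolding R_def s_def by (intro tendsto_diff)
  ultimately show "(\<integral>z. v \<tau> z * k \<tau> z \<partial>lborel) - L = (\<integral>q. ?G q \<partial>lborel)"
    unfolding g_def using LIMSEQ_unique by blast
qed

end

section \<open>Initial traces and the formulas for value and gradient\<close>

context heat_sol begin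

text \<open>The kernel concentrates at the origin while the time argument of \<open>y\<close> tends
  to 0, hence joint continuity at \<open>(0, 0)\<close> is what counts. The function
  \<open>y\<close> is general because it will be both \<open>v\<close> and
  \<open>vi j\<close>.\<close>

lemma cutoff_gauss_limit:
  assumes y: "continuous_on ({0..\<tau>} \<times> UNIV) (\<lambda>q. y (fst q) (snd q :: real^'d))"
    "\<And>s z. s \<in> {0..\<tau>} \<Longrightarrow> \<bar>y s z\<bar> \<le> B"
  shows "(\<lambda>n. \<integral>z. cutoff (real n + 1) z * y (\<tau> / (real n + 1)) z * gauss (\<tau> / (real n + 1)) z \<partial>lborel) \<longlonglongrightarrow> y 0 0"
proof (rule gauss_concentration[where B = B])
  have s: "0 < \<tau> / (real n + 1)" "\<tau> / (real n + 1) \<le> \<tau>" for n using tau by (auto simp: field_simps)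
  have s0: "(\<lambda>n. \<tau> / (real n + 1)) \<longlonglongrightarrow> 0" using tau by real_asymp
  show "(\<lambda>n. \<tau> / (real n + 1)) \<longlonglongrightarrow> 0" by (rule s0)
  show "0 < \<tau> / (real n + 1)" for n by (rule s)
  have sI: "\<tau> / (real n + 1) \<in> {0..\<tau>}" for n using s[of n] by simp
  have B: "0 \<le> B" using y(2)[of 0 0] tau by force
  show "(\<lambda>z. cutoff (real n + 1) z * y (\<tau> / (real n + 1)) z) \<in> borel_measurable borel" for n
    by (intro borel_measurable_continuous_onI continuous_intros cutoff_continuous continuous_on_snd_slice[OF y(1) sI])
  have c: "0 \<le> cutoff (real n + 1) z" "cutoff (real n + 1) z \<le> 1" "1 - cutoff (real n + 1) z \<le> 3 * (norm z)\<^sup>2" for n and z :: "real^'d"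
  proof -
    show "0 \<le> cutoff (real n + 1) z" "cutoff (real n + 1) z \<le> 1" by (auto intro!: cutoff_bounds)
    have "1 * 1 \<le> (real n + 1) * (real n + 1)" by (intro mult_mono) auto
    hence "3 * (norm z)\<^sup>2 / (real n + 1)\<^sup>2 \<le> 3 * (norm z)\<^sup>2 / 1" by (intro divide_left_mono) (auto simp: power2_eq_square)
    thus "1 - cutoff (real n + 1) z \<le> 3 * (norm z)\<^sup>2" using cutoff_bounds(5)[of "real n + 1" z] by simp
  qed
  show "\<bar>cutoff (real n + 1) z * y (\<tau> / (real n + 1)) z\<bar> \<le> B" for n z
  proof -
    have "\<bar>cutoff (real n + 1) z\<bar> * \<bar>y (\<tau> / (real n + 1)) z\<bar> \<le> 1 * B"
      using c(1,2)[of n z] y(2)[OF sI, of n z] by (intro mult_mono) auto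
    thus ?thesis by (simp add: abs_mult)
  qed
  fix \<epsilon> :: real assume \<epsilon>: "0 < \<epsilon>"
  have "(0, 0) \<in> {0..\<tau>} \<times> (UNIV :: (real^'d) set)" using tau by auto
  with y(1) \<epsilon> obtain \<delta> where \<delta>: "0 < \<delta>"
    and close: "\<And>q. q \<in> {0..\<tau>} \<times> UNIV \<Longrightarrow> dist q (0, 0) < \<delta> \<Longrightarrow> dist (y (fst q) (snd q)) (y 0 0) < \<epsilon>"
    unfolding continuous_on_iff by (metis fst_conv snd_conv)
  \<comment> \<open>Where the norm is at least \<open>\<delta> / 2\<close>, the factor
    (2/\<delta>)^2 |z|^2 is at least 1 and pays for the oscillation \<open>2 * B\<close>. The
    summand \<open>3 * B\<close> pays for replacing the cutoff by 1.\<close>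
  define D where "D = 2 * B * (2 / \<delta>)\<^sup>2 + 3 * B"
  have "\<forall>\<^sub>F n in sequentially. \<tau> / (real n + 1) < \<delta> / 2"
    using order_tendstoD(2)[OF s0, of "\<delta> / 2"] \<delta> by simp
  hence "\<forall>\<^sub>F n in sequentially. \<forall>z. \<bar>cutoff (real n + 1) z * y (\<tau> / (real n + 1)) z - y 0 0\<bar> \<le> \<epsilon> + D * (norm z)\<^sup>2"
  proof (rule eventually_mono, intro allI)
    fix n z assume n: "\<tau> / (real n + 1) < \<delta> / 2"
    define s' where "s' = \<tau> / (real n + 1)"
    have y1: "\<bar>y s' z - y 0 0\<bar> \<le> \<epsilon> + 2 * B * (2 / \<delta>)\<^sup>2 * (norm z)\<^sup>2"
    proof (cases "norm z < \<delta> / 2")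
      case True
      have "dist (s', z) (0, 0) \<le> dist s' 0 + dist z 0"
        unfolding dist_prod_def fst_conv snd_conv by (rule sqrt_sum_squares_le_sum) auto
      also have "dist s' 0 + dist z 0 = s' + norm z" using s[of n] by (simp add: s'_def dist_norm)
      also have "s' + norm z < \<delta>" using n True unfolding s'_def by linarith
      finally have "\<bar>y s' z - y 0 0\<bar> < \<epsilon>"
        using close[of "(s', z)"] sI[of n] by (simp add: s'_def dist_real_def)
      moreover have "0 \<le> 2 * B * (2 / \<delta>)\<^sup>2 * (norm z)\<^sup>2" using B by simp
      ultimately show ?thesis by linarith
    next
      case False
      have "1 \<le> 2 / \<delta> * norm z" using False \<delta> by (simp add: field_simps)
      hence "1 \<le> (2 / \<delta> * norm z)\<^sup>2" by (simp add: one_le_power)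
      hence "2 * B * 1 \<le> 2 * B * (2 / \<delta> * norm z)\<^sup>2" using B by (intro mult_left_mono) auto
      moreover have "\<bar>y s' z - y 0 0\<bar> \<le> 2 * B"
        using y(2)[OF sI, of n z] y(2)[of 0 0] tau unfolding s'_def by (auto simp: abs_le_iff)
      moreover have "2 * B * (2 / \<delta> * norm z)\<^sup>2 = 2 * B * (2 / \<delta>)\<^sup>2 * (norm z)\<^sup>2"
        unfolding power_mult_distrib by simp
      ultimately show ?thesis using \<epsilon> by linarith
    qed
    have "cutoff (real n + 1) z * y s' z - y 0 0 = cutoff (real n + 1) z * (y s' z - y 0 0) - (1 - cutoff (real n + 1) z) * y 0 0"
      by (simp add: algebra_simps)
    hence "\<bar>cutoff (real n + 1) z * y s' z - y 0 0\<bar> \<le> \<bar>cutoff (real n + 1) z\<bar> * \<bar>y s' z - y 0 0\<bar> + \<bar>1 - cutoff (real n + 1) z\<bar> * \<bar>y 0 0\<bar>"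
      by (metis abs_mult abs_triangle_ineq4)
    also have "\<dots> \<le> 1 * (\<epsilon> + 2 * B * (2 / \<delta>)\<^sup>2 * (norm z)\<^sup>2) + 3 * (norm z)\<^sup>2 * B"
      using c[of n z] y1 y(2)[of 0 0] tau by (intro add_mono mult_mono) auto
    also have "\<dots> = \<epsilon> + D * (norm z)\<^sup>2" by (simp add: D_def algebra_simps)
    finally show "\<bar>cutoff (real n + 1) z * y (\<tau> / (real n + 1)) z - y 0 0\<bar> \<le> \<epsilon> + D * (norm z)\<^sup>2"
      unfolding s'_def .
  qed
  thus "\<exists>D. \<forall>\<^sub>F n in sequentially. \<forall>z. \<bar>cutoff (real n + 1) z * y (\<tau> / (real n + 1)) z - y 0 0\<bar> \<le> \<epsilon> + D * (norm z)\<^sup>2" ..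
qed

text \<open>This is the boundary term of the gradient formula. The derivative of the cutoff is of
  order 1/R uniformly in space, so the integrand itself tends to 0 and the quadratic term of
  \<open>gauss_concentration\<close> can be taken as 0.\<close>

lemma cutoff1_gauss_limit:
  assumes y: "continuous_on ({0..\<tau>} \<times> UNIV) (\<lambda>q. y (fst q) (snd q :: real^'d))"
    "\<And>s z. s \<in> {0..\<tau>} \<Longrightarrow> \<bar>y s z\<bar> \<le> B"
  shows "(\<lambda>n. \<integral>z. cutoff1 i (real n + 1) z * y (\<tau> / (real n + 1)) z * gauss (\<tau> / (real n + 1)) z \<partial>lborel) \<longlonglongrightarrow> 0"
proof (rule gauss_concentration[where B = "6 * B"])
  have s: "0 < \<tau> / (real n + 1)" "\<tau> / (real n + 1) \<le> \<tau>" for n using tau by (auto simp: field_simps)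
  show "(\<lambda>n. \<tau> / (real n + 1)) \<longlonglongrightarrow> 0" using tau by real_asymp
  show "0 < \<tau> / (real n + 1)" for n by (rule s)
  have sI: "\<tau> / (real n + 1) \<in> {0..\<tau>}" for n using s[of n] by simp
  have B: "0 \<le> B" using y(2)[of 0 0] tau by force
  show "(\<lambda>z. cutoff1 i (real n + 1) z * y (\<tau> / (real n + 1)) z) \<in> borel_measurable borel" for n
    by (intro borel_measurable_continuous_onI continuous_intros cutoff_continuous continuous_on_snd_slice[OF y(1) sI])
  have bd: "\<bar>cutoff1 i (real n + 1) z * y (\<tau> / (real n + 1)) z\<bar> \<le> 6 / (real n + 1) * B" for n z
    unfolding abs_mult using cutoff_bounds(3)[of "real n + 1" i z] y(2)[OF sI, of n z] by (intro mult_mono) auto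
  show "\<bar>cutoff1 i (real n + 1) z * y (\<tau> / (real n + 1)) z\<bar> \<le> 6 * B" for n z
  proof (rule order_trans[OF bd])
    have "6 / (real n + 1) \<le> 6" by (simp add: field_simps)
    thus "6 / (real n + 1) * B \<le> 6 * B" using B by (intro mult_right_mono)
  qed
  fix \<epsilon> :: real assume \<epsilon>: "0 < \<epsilon>"
  have "(\<lambda>n. 6 / (real n + 1) * B) \<longlonglongrightarrow> 0" by real_asymp
  from order_tendstoD(2)[OF this \<epsilon>]
  have "\<forall>\<^sub>F n in sequentially. \<forall>z. \<bar>cutoff1 i (real n + 1) z * y (\<tau> / (real n + 1)) z - 0\<bar> \<le> \<epsilon> + 0 * (norm z)\<^sup>2"
  proof (rule eventually_mono, intro allI)
    fix n z assume "6 / (real n + 1) * B < \<epsilon>"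
    with bd[of n z] show "\<bar>cutoff1 i (real n + 1) z * y (\<tau> / (real n + 1)) z - 0\<bar> \<le> \<epsilon> + 0 * (norm z)\<^sup>2" by simp
  qed
  thus "\<exists>D. \<forall>\<^sub>F n in sequentially. \<forall>z. \<bar>cutoff1 i (real n + 1) z * y (\<tau> / (real n + 1)) z - 0\<bar> \<le> \<epsilon> + D * (norm z)\<^sup>2" ..
qed

text \<open>The backward heat operator applied to \<open>v\<close>. In the application it equals
  minus the nonlinearity.\<close>

definition src :: "real \<times> (real^'d) \<Rightarrow> real" where
  "src q = vt (fst q) (snd q) + 1/2 * (\<Sum>i\<in>UNIV. vii i (fst q) (snd q))"

lemma duhamel_value:
  shows "integrable lborel (\<lambda>q. indicator ({0<..\<tau>} \<times> UNIV) q * (src q * gauss (fst q) (snd q)))"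
    and "(\<integral>z. v \<tau> z * gauss \<tau> z \<partial>lborel) - v 0 0
      = (\<integral>q. indicator ({0<..\<tau>} \<times> UNIV) q * (src q * gauss (fst q) (snd q)) \<partial>lborel)"
proof -
  interpret heat_pair \<tau> B v vt vi vii gauss
    "\<lambda>s z. ((norm z)\<^sup>2 / (2 * s\<^sup>2) - real CARD('d) / (2 * s)) * gauss s z"
    "\<lambda>i s z. - (z $ i / s) * gauss s z" "\<lambda>i s z. ((z $ i)\<^sup>2 / s\<^sup>2 - 1 / s) * gauss s z"
  proof unfold_locales
    fix s :: real and z :: "real^'d" and i assume s: "0 < s"
    have "((\<lambda>h. - ((z + h *\<^sub>R axis i 1) $ i / s)) has_real_derivative - (1 / s)) (at 0)"
      using s by (auto intro!: derivative_eq_intros)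
    from DERIV_mult[OF this gauss_deriv_space[OF s, of z i]]
    show "((\<lambda>h. - ((z + h *\<^sub>R axis i 1) $ i / s) * gauss s (z + h *\<^sub>R axis i 1)) has_real_derivative
            ((z $ i)\<^sup>2 / s\<^sup>2 - 1 / s) * gauss s z) (at 0)"
      by (rule DERIV_cong) (simp add: algebra_simps power2_eq_square)
    show "((norm z)\<^sup>2 / (2 * s\<^sup>2) - real CARD('d) / (2 * s)) * gauss s z =
            1 / 2 * (\<Sum>i\<in>UNIV. ((z $ i)\<^sup>2 / s\<^sup>2 - 1 / s) * gauss s z)"
      unfolding sum_distrib_right[symmetric] norm_sq_sum
      by (simp add: sum_subtractf sum_divide_distrib[symmetric] algebra_simps)
    have "(\<integral>\<^sup>+ z. ennreal \<bar>gauss s (z::real^'d)\<bar> \<partial>lborel) = 1"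
      using gauss_nn_integral[OF s, where 'd='d] by (simp add: gauss_nonneg)
    thus "(\<integral>\<^sup>+ z. ennreal \<bar>gauss s (z::real^'d)\<bar> \<partial>lborel) \<le> ennreal (1 + s powr (- 1 / 2))"
      by (simp add: ennreal_1[symmetric] del: ennreal_1)
  qed (use gauss_deriv_time gauss_deriv_space in \<open>auto intro!: gauss_continuous continuous_intros\<close>)
  note D = duhamel[OF cutoff_gauss_limit[OF v_cont v_bd]]
  show "integrable lborel (\<lambda>q. indicator ({0<..\<tau>} \<times> UNIV) q * (src q * gauss (fst q) (snd q)))"
    using D(1) by (simp add: src_def)
  show "(\<integral>z. v \<tau> z * gauss \<tau> z \<partial>lborel) - v 0 0
      = (\<integral>q. indicator ({0<..\<tau>} \<times> UNIV) q * (src q * gauss (fst q) (snd q)) \<partial>lborel)"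
    using D(2) by (simp add: src_def)
qed

text \<open>The kernel is minus the \<open>j\<close>-th derivative of the Gaussian and hence again a
  solution of the heat equation. The derivative of \<open>v\<close> enters through the initial trace
  alone. Together with the weight \<open>z $ j / s\<close> this is the Bismut-Elworthy-Li
  formula.\<close>

lemma duhamel_gradient:
  shows "integrable lborel (\<lambda>q. indicator ({0<..\<tau>} \<times> UNIV) q * (src q * (snd q $ j / fst q * gauss (fst q) (snd q))))"
    and "(\<integral>z. v \<tau> z * (z $ j / \<tau> * gauss \<tau> z) \<partial>lborel) - vi j 0 0
      = (\<integral>q. indicator ({0<..\<tau>} \<times> UNIV) q * (src q * (snd q $ j / fst q * gauss (fst q) (snd q))) \<partial>lborel)"
proof -
  have if_cont: "continuous_on A (\<lambda>q. if b then c q else 0)" if "continuous_on A c" for A b and c :: "real \<times> (real^'d) \<Rightarrow> real"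
    using that by (cases b) auto
  interpret heat_pair \<tau> B v vt vi vii "\<lambda>s z. z $ j / s * gauss s z"
    "\<lambda>s z. (- (z $ j) / s\<^sup>2 + z $ j / s * ((norm z)\<^sup>2 / (2 * s\<^sup>2) - real CARD('d) / (2 * s))) * gauss s z"
    "\<lambda>i s z. ((if i = j then 1 / s else 0) - z $ j * z $ i / s\<^sup>2) * gauss s z"
    "\<lambda>i s z. (- ((if i = j then z $ i else 0) + z $ j) / s\<^sup>2 - ((if i = j then 1 / s else 0) - z $ j * z $ i / s\<^sup>2) * (z $ i / s)) * gauss s z"
  proof unfold_locales
    fix s :: real and z :: "real^'d" and i assume s: "0 < s"
    have "((\<lambda>s. z $ j / s) has_real_derivative - (z $ j) / s\<^sup>2) (at s)"
      using s by (auto intro!: derivative_eq_intros simp: power2_eq_square)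
    from DERIV_mult[OF this gauss_deriv_time[OF s, of z]]
    show "((\<lambda>s. z $ j / s * gauss s z) has_real_derivative
        (- (z $ j) / s\<^sup>2 + z $ j / s * ((norm z)\<^sup>2 / (2 * s\<^sup>2) - real CARD('d) / (2 * s))) * gauss s z) (at s)"
      by (rule DERIV_cong) (simp add: algebra_simps)
    have c: "((\<lambda>h. (z + h *\<^sub>R axis i 1) $ l) has_real_derivative (if i = l then 1 else 0)) (at 0)" for l
      by (auto intro!: derivative_eq_intros simp: axis_def)
    from DERIV_mult[OF DERIV_cdivide[OF c[of j], of s] gauss_deriv_space[OF s, of z i]]
    show "((\<lambda>h. (z + h *\<^sub>R axis i 1) $ j / s * gauss s (z + h *\<^sub>R axis i 1)) has_real_derivative
        ((if i = j then 1 / s else 0) - z $ j * z $ i / s\<^sup>2) * gauss s z) (at 0)"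
      by (rule DERIV_cong) (simp add: algebra_simps power2_eq_square)
    from DERIV_mult[OF DERIV_diff[OF DERIV_const[of "if i = j then 1 / s else 0"]
          DERIV_cdivide[OF DERIV_mult[OF c[of j] c[of i]], of "s\<^sup>2"]] gauss_deriv_space[OF s, of z i]]
    show "((\<lambda>h. ((if i = j then 1 / s else 0) - (z + h *\<^sub>R axis i 1) $ j * (z + h *\<^sub>R axis i 1) $ i / s\<^sup>2) *
            gauss s (z + h *\<^sub>R axis i 1)) has_real_derivative
        (- ((if i = j then z $ i else 0) + z $ j) / s\<^sup>2 - ((if i = j then 1 / s else 0) - z $ j * z $ i / s\<^sup>2) * (z $ i / s)) * gauss s z) (at 0)"
      by (rule DERIV_cong) (simp add: algebra_simps add_divide_distrib)
    \<comment> \<open>The index \<open>i = j\<close> contributes twice, from differentiating the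
      product of coordinates and from the remaining factor \<open>z $ i / s\<close>; the sum over
      all \<open>i\<close> contributes the dimension.\<close>
    have S: "(\<Sum>i\<in>UNIV. - ((if i = j then z $ i else 0) + z $ j) / s\<^sup>2 - ((if i = j then 1 / s else 0) - z $ j * z $ i / s\<^sup>2) * (z $ i / s))
        = - (2 * z $ j + real CARD('d) * z $ j) / s\<^sup>2 + z $ j / s ^ 3 * (norm z)\<^sup>2"
    proof -
      have "(\<Sum>i\<in>UNIV. - ((if i = j then z $ i else 0) + z $ j) / s\<^sup>2 - ((if i = j then 1 / s else 0) - z $ j * z $ i / s\<^sup>2) * (z $ i / s))
        = (\<Sum>i\<in>UNIV. - (2 / s\<^sup>2) * (if i = j then z $ j else 0) - z $ j / s\<^sup>2 + z $ j / s ^ 3 * (z $ i)\<^sup>2)"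
        by (intro sum.cong refl) (auto simp: algebra_simps add_divide_distrib power2_eq_square power3_eq_cube)
      also have "\<dots> = - (2 / s\<^sup>2) * z $ j - real CARD('d) * (z $ j / s\<^sup>2) + z $ j / s ^ 3 * (\<Sum>i\<in>UNIV. (z $ i)\<^sup>2)"
      proof -
        have e1: "(\<Sum>i\<in>UNIV. - (2 / s\<^sup>2) * (if i = j then z $ j else 0)) = - (2 / s\<^sup>2) * z $ j"
          by (subst sum_distrib_left[symmetric]) simp
        show ?thesis unfolding sum.distrib sum_subtractf e1 sum_distrib_left[symmetric] by simp
      qed
      finally show ?thesis unfolding norm_sq_sum by (rule trans) (simp add: diff_divide_distrib)
    qed
    show "(- (z $ j) / s\<^sup>2 + z $ j / s * ((norm z)\<^sup>2 / (2 * s\<^sup>2) - real CARD('d) / (2 * s))) * gauss s z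
      = 1 / 2 * (\<Sum>i\<in>UNIV. (- ((if i = j then z $ i else 0) + z $ j) / s\<^sup>2 - ((if i = j then 1 / s else 0) - z $ j * z $ i / s\<^sup>2) * (z $ i / s)) * gauss s z)"
      unfolding sum_distrib_right[symmetric] S mult.assoc[symmetric] using s
      by (intro arg_cong2[where f="(*)"] refl) (simp add: field_simps power2_eq_square power3_eq_cube)
    show "(\<integral>\<^sup>+ z. ennreal \<bar>z $ j / s * gauss s (z::real^'d)\<bar> \<partial>lborel) \<le> ennreal (1 + s powr (- 1 / 2))"
      by (rule order_trans[OF gauss_abs_coord[OF s]]) (auto intro: ennreal_leI)
  qed (auto intro!: gauss_continuous continuous_intros if_cont)
  \<comment> \<open>One integration by parts at a small positive time moves the derivative from the
    kernel to the product of cutoff and \<open>v\<close>. The part on the cutoff vanishes and the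
    other one tends to the derivative at the origin.\<close>
  have lim: "(\<lambda>n. \<integral>z. cutoff (real n + 1) z * v (\<tau> / (real n + 1)) z * (z $ j / (\<tau> / (real n + 1)) * gauss (\<tau> / (real n + 1)) z) \<partial>lborel) \<longlonglongrightarrow> vi j 0 0"
  proof -
    have "(\<integral>z. cutoff (real n + 1) z * v (\<tau> / (real n + 1)) z * (z $ j / (\<tau> / (real n + 1)) * gauss (\<tau> / (real n + 1)) z) \<partial>lborel)
      = (\<integral>z. cutoff1 j (real n + 1) z * v (\<tau> / (real n + 1)) z * gauss (\<tau> / (real n + 1)) z \<partial>lborel)
        + (\<integral>z. cutoff (real n + 1) z * vi j (\<tau> / (real n + 1)) z * gauss (\<tau> / (real n + 1)) z \<partial>lborel)" for n
    proof -
      define s where "s = \<tau> / (real n + 1)"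
      define R where "R = real n + 1"
      have R: "0 < R" by (simp add: R_def)
      have s: "0 < s" "s \<in> {0..\<tau>}" using tau by (auto simp: s_def field_simps)
      have gc: "continuous_on UNIV (gauss s :: real^'d \<Rightarrow> real)"
        using continuous_on_snd_slice[OF gauss_continuous] s by simp
      have zc: "continuous_on UNIV (\<lambda>z::real^'d. z $ j / s)" by (intro continuous_intros) (use s in auto)
      have i: "integrable lborel (\<lambda>z. cutoff1 j R z * v s z * gauss s z)"
        "integrable lborel (\<lambda>z. cutoff R z * vi j s z * gauss s z)"
        "integrable lborel (\<lambda>z. cutoff R z * v s z * (z $ j / s * gauss s z))"
        using R s(1) by (auto intro!: integrable_compact_support[of _ R] continuous_intros cutoff_continuous slice_cont s gc zc simp: cutoff_support)
      have "(\<integral>z. (cutoff1 j R z * v s z * gauss s z + cutoff R z * vi j s z * gauss s z) - cutoff R z * v s z * (z $ j / s * gauss s z) \<partial>lborel) = 0"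
      proof (rule integral_partial_zero[OF R, where h="\<lambda>z. cutoff R z * v s z * gauss s z" and i=j])
        fix z
        show "((\<lambda>e. cutoff R (z + e *\<^sub>R axis j 1) * v s (z + e *\<^sub>R axis j 1) * gauss s (z + e *\<^sub>R axis j 1)) has_real_derivative
           (cutoff1 j R z * v s z * gauss s z + cutoff R z * vi j s z * gauss s z) - cutoff R z * v s z * (z $ j / s * gauss s z)) (at 0)"
          by (rule DERIV_cong[OF DERIV_mult[OF DERIV_mult[OF cutoff_deriv v_space[OF s(2)]] gauss_deriv_space[OF s(1)]]])
            (simp add: algebra_simps)
      qed (use R s(1) in \<open>auto intro!: continuous_intros cutoff_continuous slice_cont s gc zc simp: cutoff_support\<close>)
      hence "(\<integral>z. cutoff1 j R z * v s z * gauss s z \<partial>lborel) + (\<integral>z. cutoff R z * vi j s z * gauss s z \<partial>lborel)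
         - (\<integral>z. cutoff R z * v s z * (z $ j / s * gauss s z) \<partial>lborel) = 0"
        using i by (simp add: Bochner_Integration.integral_diff Bochner_Integration.integral_add)
      thus ?thesis unfolding s_def R_def by simp
    qed
    moreover have "(\<lambda>n. (\<integral>z. cutoff1 j (real n + 1) z * v (\<tau> / (real n + 1)) z * gauss (\<tau> / (real n + 1)) z \<partial>lborel)
        + (\<integral>z. cutoff (real n + 1) z * vi j (\<tau> / (real n + 1)) z * gauss (\<tau> / (real n + 1)) z \<partial>lborel)) \<longlonglongrightarrow> 0 + vi j 0 0"
      by (intro tendsto_add cutoff1_gauss_limit cutoff_gauss_limit v_cont v_bd vi_cont vi_bd)
    ultimately show ?thesis by simp
  qed
  note D = duhamel[OF lim]
  show "integrable lborel (\<lambda>q. indicator ({0<..\<tau>} \<times> UNIV) q * (src q * (snd q $ j / fst q * gauss (fst q) (snd q))))"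
    using D(1) by (simp add: src_def)
  show "(\<integral>z. v \<tau> z * (z $ j / \<tau> * gauss \<tau> z) \<partial>lborel) - vi j 0 0
      = (\<integral>q. indicator ({0<..\<tau>} \<times> UNIV) q * (src q * (snd q $ j / fst q * gauss (fst q) (snd q))) \<partial>lborel)"
    using D(2) by (simp add: src_def)
qed

end

section \<open>Freezing independent random inputs\<close>

text \<open>By independence, \<open>X\<close> and the identity, seen as a map into the coarser space
  \<open>B\<close>, have a product law; Tonelli's theorem does the rest. Keeping the whole sample
  point as second argument lets \<Phi> contain a random field that is evaluated at
  \<open>X\<close>.\<close>

lemma (in prob_space) nn_integral_freeze:
  assumes A: "subalgebra M A" and B: "subalgebra M B"
    and ind: "\<And>a b. a \<in> sets A \<Longrightarrow> b \<in> sets B \<Longrightarrow> prob (a \<inter> b) = prob a * prob b"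
    and X: "X \<in> measurable A N" and \<Phi>: "\<Phi> \<in> borel_measurable (N \<Otimes>\<^sub>M B)"
  shows "(\<integral>\<^sup>+\<omega>. \<Phi> (X \<omega>, \<omega>) \<partial>M) = (\<integral>\<^sup>+\<omega>'. (\<integral>\<^sup>+\<omega>. \<Phi> (X \<omega>', \<omega>) \<partial>M) \<partial>M)"
proof -
  define MB where "MB = distr M B (\<lambda>\<omega>. \<omega>)"
  have XM: "X \<in> measurable M N"
    using measurable_from_subalg[OF A X] .
  have idM: "(\<lambda>\<omega>. \<omega>) \<in> measurable M B"
    using B by (auto simp: measurable_def subalgebra_def dest: sets.sets_into_space)
  have p1: "prob_space (distr M N X)" by (rule prob_space_distr[OF XM])
  have p2: "prob_space MB" unfolding MB_def by (rule prob_space_distr[OF idM])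
  interpret P1: prob_space "distr M N X" by (rule p1)
  interpret P2: prob_space MB by (rule p2)
  have pair: "(\<lambda>\<omega>. (X \<omega>, \<omega>)) \<in> measurable M (N \<Otimes>\<^sub>M B)"
    using XM idM by (rule measurable_Pair)
  have sB: "sets MB = sets B" by (simp add: MB_def)
  have eq: "distr M N X \<Otimes>\<^sub>M MB = distr M (N \<Otimes>\<^sub>M B) (\<lambda>\<omega>. (X \<omega>, \<omega>))"
  proof (rule pair_measure_eqI)
    show "sets (distr M N X \<Otimes>\<^sub>M MB) = sets (distr M (N \<Otimes>\<^sub>M B) (\<lambda>\<omega>. (X \<omega>, \<omega>)))"
      by (simp add: MB_def cong: sets_pair_measure_cong)
    fix a b assume "a \<in> sets (distr M N X)" "b \<in> sets MB"
    hence ab: "a \<in> sets N" "b \<in> sets B" by (auto simp: MB_def)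
    have sp: "space M = space A" "space M = space B" using A B by (auto simp: subalgebra_def)
    have "X -` a \<inter> space M \<in> sets A" using measurable_sets[OF X ab(1)] sp by simp
    moreover have "b \<inter> space M = b" using ab(2) sp sets.sets_into_space by fastforce
    moreover have "(\<lambda>\<omega>. (X \<omega>, \<omega>)) -` (a \<times> b) \<inter> space M = (X -` a \<inter> space M) \<inter> b"
      using calculation(2) by auto
    ultimately show "emeasure (distr M N X) a * emeasure MB b = emeasure (distr M (N \<Otimes>\<^sub>M B) (\<lambda>\<omega>. (X \<omega>, \<omega>))) (a \<times> b)"
      using ab XM idM pair ind[of "X -` a \<inter> space M" b] unfolding MB_def
      by (subst (1 2 3) emeasure_distr)
        (auto simp: emeasure_eq_measure ennreal_mult' intro!: pair_measureI)
  qed (unfold_locales)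
  have \<Phi>2: "\<Phi> \<in> borel_measurable (distr M N X \<Otimes>\<^sub>M MB)"
    using \<Phi> by (simp add: MB_def cong: measurable_cong_sets sets_pair_measure_cong)
  have "(\<integral>\<^sup>+\<omega>. \<Phi> (X \<omega>, \<omega>) \<partial>M) = (\<integral>\<^sup>+q. \<Phi> q \<partial>(distr M N X \<Otimes>\<^sub>M MB))"
    unfolding eq using pair \<Phi> by (subst nn_integral_distr) auto
  also have "\<dots> = (\<integral>\<^sup>+x. \<integral>\<^sup>+\<omega>. \<Phi> (x, \<omega>) \<partial>MB \<partial>distr M N X)"
    using P2.nn_integral_fst[OF \<Phi>2] by simp
  also have "\<dots> = (\<integral>\<^sup>+\<omega>'. (\<integral>\<^sup>+\<omega>. \<Phi> (X \<omega>', \<omega>) \<partial>MB) \<partial>M)"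
  proof (rule nn_integral_distr[OF XM])
    show "(\<lambda>x. \<integral>\<^sup>+ \<omega>. \<Phi> (x, \<omega>) \<partial>MB) \<in> borel_measurable (distr M N X)"
      using P2.borel_measurable_nn_integral_fst[OF \<Phi>2] by simp
  qed
  also have "\<dots> = (\<integral>\<^sup>+\<omega>'. (\<integral>\<^sup>+\<omega>. \<Phi> (X \<omega>', \<omega>) \<partial>M) \<partial>M)"
  proof (rule nn_integral_cong)
    fix \<omega>' assume "\<omega>' \<in> space M"
    hence "X \<omega>' \<in> space N" using XM by (auto dest: measurable_space)
    hence "(\<lambda>\<omega>. \<Phi> (X \<omega>', \<omega>)) \<in> borel_measurable B"
      using \<Phi> by (auto intro: measurable_Pair2[of \<Phi> N])
    thus "(\<integral>\<^sup>+\<omega>. \<Phi> (X \<omega>', \<omega>) \<partial>MB) = (\<integral>\<^sup>+\<omega>. \<Phi> (X \<omega>', \<omega>) \<partial>M)"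
      unfolding MB_def by (intro nn_integral_distr[OF idM]) simp
  qed
  finally show ?thesis .
qed

section \<open>Sigma-algebras generated by sets of random inputs\<close>

locale mlp_input = prob_space \<Omega> for \<Omega> :: "'w measure" +
  fixes T \<alpha> \<sigma> :: real and W :: "int list \<Rightarrow> real \<Rightarrow> 'w \<Rightarrow> real ^ 'd" and \<rr> :: "int list \<Rightarrow> 'w \<Rightarrow> real"
  assumes T_pos: "0 < T" and alpha: "0 < \<alpha>" "\<alpha> < 1"
    and input: "mlp_random_input \<Omega> T \<alpha> W \<rr>"
begin

definition gen :: "int list + int list \<Rightarrow> 'w set set" where
  "gen = case_sum
          (\<lambda>\<theta>. sigma_sets (space \<Omega>) {W \<theta> s -` A \<inter> space \<Omega> | s A. s \<in> {0..T} \<and> A \<in> sets borel})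
          (\<lambda>\<theta>. {\<rr> \<theta> -` A \<inter> space \<Omega> | A. A \<in> sets borel})"

text \<open>Measurability with respect to this space expresses dependence on the inputs in
  \<open>J\<close> only, so that independence turns into disjointness of index sets.\<close>

definition sigma_of :: "(int list + int list) set \<Rightarrow> 'w measure" where
  "sigma_of J = sigma (space \<Omega>) (\<Union>j\<in>J. gen j)"

abbreviation "Ind \<equiv> Theta <+> Theta"

lemma indep_gen: "indep_sets gen Ind"
  using input unfolding mlp_random_input_def gen_def by blast

lemma gen_Pow: "gen j \<subseteq> Pow (space \<Omega>)"
proof (cases j)
  case (Inl \<theta>)
  have "sigma_sets (space \<Omega>) {W \<theta> s -` A \<inter> space \<Omega> | s A. s \<in> {0..T} \<and> A \<in> sets borel} \<subseteq> Pow (space \<Omega>)"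
    by (intro subsetI PowI sigma_sets_into_sp) auto
  thus ?thesis using Inl by (simp add: gen_def)
qed (auto simp: gen_def)

lemma gen_events: "j \<in> Ind \<Longrightarrow> gen j \<subseteq> events"
  using indep_gen unfolding indep_sets_def by blast

lemma Int_stable_gen: "Int_stable (gen j)"
proof (cases j)
  case (Inl \<theta>)
  interpret S: sigma_algebra "space \<Omega>" "gen j"
    unfolding Inl gen_def sum.case by (rule sigma_algebra_sigma_sets) auto
  show ?thesis by (rule S.Int_stable)
next
  case (Inr \<theta>)
  show ?thesis
  proof (rule Int_stableI)
    fix a b assume "a \<in> gen j" "b \<in> gen j"
    then obtain A B where "A \<in> sets borel" "B \<in> sets borel" "a = \<rr> \<theta> -` A \<inter> space \<Omega>" "b = \<rr> \<theta> -` B \<inter> space \<Omega>"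
      by (auto simp: gen_def Inr)
    thus "a \<inter> b \<in> gen j" unfolding gen_def Inr sum.case
      by (intro CollectI exI[of _ "A \<inter> B"]) auto
  qed
qed

lemma space_SA [simp]: "space (sigma_of J) = space \<Omega>"
  by (simp add: sigma_of_def space_measure_of_conv)

lemma sets_SA: "sets (sigma_of J) = sigma_sets (space \<Omega>) (\<Union>j\<in>J. gen j)"
  unfolding sigma_of_def using gen_Pow by (intro sets_measure_of) auto

lemma sigma_of_subalgebra: "J \<subseteq> Ind \<Longrightarrow> subalgebra \<Omega> (sigma_of J)"
  unfolding subalgebra_def sets_SA using gen_events by (intro conjI sets.sigma_sets_subset) auto

lemma sigma_of_mono: "J \<subseteq> J' \<Longrightarrow> subalgebra (sigma_of J') (sigma_of J)"
  unfolding subalgebra_def sets_SA by (auto intro!: sigma_sets_mono')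

lemma sigma_of_measurable_events: "X \<in> measurable (sigma_of J) N \<Longrightarrow> J \<subseteq> Ind \<Longrightarrow> X \<in> measurable \<Omega> N"
  using measurable_from_subalg[OF sigma_of_subalgebra] .

lemma sigma_of_indep_sets:
  assumes "\<And>k. k \<in> K \<Longrightarrow> J k \<subseteq> Ind" "disjoint_family_on J K"
  shows "indep_sets (\<lambda>k. sets (sigma_of (J k))) K"
  unfolding sets_SA
  using assms by (intro indep_sets_collect_sigma indep_sets_mono_index[OF _ indep_gen] Int_stable_gen) auto

lemma sigma_of_indep:
  assumes J: "J1 \<subseteq> Ind" "J2 \<subseteq> Ind" "J1 \<inter> J2 = {}" and ab: "a \<in> sets (sigma_of J1)" "b \<in> sets (sigma_of J2)"
  shows "prob (a \<inter> b) = prob a * prob b"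
proof -
  have "indep_sets (\<lambda>k. sets (sigma_of (case_bool J1 J2 k))) UNIV"
    using J by (intro sigma_of_indep_sets) (auto simp: disjoint_family_on_def split: bool.splits)
  hence "indep_set (sets (sigma_of J1)) (sets (sigma_of J2))"
    unfolding indep_set_def by (rule back_subst[of "\<lambda>f. indep_sets f UNIV"]) (auto simp: fun_eq_iff split: bool.splits)
  from indep_setD[OF this ab] show ?thesis .
qed

lemma sigma_of_freeze:
  assumes "J1 \<subseteq> Ind" "J2 \<subseteq> Ind" "J1 \<inter> J2 = {}"
    and "X \<in> measurable (sigma_of J1) N" "\<Phi> \<in> borel_measurable (N \<Otimes>\<^sub>M sigma_of J2)"
  shows "(\<integral>\<^sup>+\<omega>. \<Phi> (X \<omega>, \<omega>) \<partial>\<Omega>) = (\<integral>\<^sup>+\<omega>'. (\<integral>\<^sup>+\<omega>. \<Phi> (X \<omega>', \<omega>) \<partial>\<Omega>) \<partial>\<Omega>)"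
  using assms by (intro nn_integral_freeze[OF sigma_of_subalgebra sigma_of_subalgebra]) (auto intro: sigma_of_indep)

text \<open>Nothing is known about \<open>W \<theta>\<close> outside \<open>[0,T]\<close>; freezing time there makes it jointly measurable.\<close>

definition Wc :: "int list \<Rightarrow> real \<Rightarrow> 'w \<Rightarrow> real ^ 'd" where
  "Wc \<theta> s = W \<theta> (max 0 (min T s))"

lemma Wc_eq: "s \<in> {0..T} \<Longrightarrow> Wc \<theta> s = W \<theta> s"
  by (simp add: Wc_def)

lemma Wc_slice: "Inl \<theta> \<in> J \<Longrightarrow> Wc \<theta> s \<in> measurable (sigma_of J) borel"
proof (rule measurableI)
  fix A :: "(real^'d) set" assume A: "A \<in> sets borel" and J: "Inl \<theta> \<in> J"
  have "max 0 (min T s) \<in> {0..T}" using T_pos by auto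
  hence "Wc \<theta> s -` A \<inter> space \<Omega> \<in> gen (Inl \<theta>)"
    using A unfolding gen_def Wc_def sum.case by (intro sigma_sets.Basic) blast
  thus "Wc \<theta> s -` A \<inter> space (sigma_of J) \<in> sets (sigma_of J)"
    using J unfolding sets_SA space_SA by (intro sigma_sets.Basic) auto
qed auto

lemma r_measurable: "Inr \<theta> \<in> J \<Longrightarrow> \<rr> \<theta> \<in> borel_measurable (sigma_of J)"
proof (rule measurableI)
  fix A :: "real set" assume A: "A \<in> sets borel" and J: "Inr \<theta> \<in> J"
  hence "\<rr> \<theta> -` A \<inter> space \<Omega> \<in> gen (Inr \<theta>)" by (auto simp: gen_def)
  thus "\<rr> \<theta> -` A \<inter> space (sigma_of J) \<in> sets (sigma_of J)"
    using J unfolding sets_SA space_SA by (intro sigma_sets.Basic) auto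
qed auto

text \<open>Rounding the time down to multiples of 1/(n + 1) leaves countably many times, at each of
  which the map is measurable; continuity of the paths gives the limit. Joint measurability is what
  allows a path to be read at a random time.\<close>

lemma Wc_pair:
  assumes "\<theta> \<in> Theta" "Inl \<theta> \<in> J"
  shows "(\<lambda>q. Wc \<theta> (fst q) (snd q)) \<in> borel_measurable (borel \<Otimes>\<^sub>M sigma_of J)"
proof (rule borel_measurable_LIMSEQ_metric)
  show "(\<lambda>q. Wc \<theta> (real_of_int \<lfloor>real (Suc n) * fst q\<rfloor> / real (Suc n)) (snd q)) \<in> borel_measurable (borel \<Otimes>\<^sub>M sigma_of J)" for n
  proof (rule measurable_compose_countable[where f="\<lambda>i q. Wc \<theta> (real_of_int i / real (Suc n)) (snd q)" and g="\<lambda>q. \<lfloor>real (Suc n) * fst q\<rfloor>"])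
    show "(\<lambda>q. Wc \<theta> (real_of_int i / real (Suc n)) (snd q)) \<in> borel_measurable (borel \<Otimes>\<^sub>M sigma_of J)" for i
      by (rule measurable_compose[OF measurable_snd Wc_slice[OF assms(2)]])
  qed measurable
  fix q :: "real \<times> 'w" assume "q \<in> space (borel \<Otimes>\<^sub>M sigma_of J)"
  then obtain s \<omega> where q: "q = (s, \<omega>)" "\<omega> \<in> space \<Omega>" by (auto simp: space_pair_measure)
  have "std_brownian_motion \<Omega> T (W \<theta>)" using input assms by (auto simp: mlp_random_input_def)
  hence "continuous_on {0..T} (\<lambda>t. W \<theta> t \<omega>)" using q by (auto simp: std_brownian_motion_def)
  hence "continuous_on UNIV (\<lambda>t. W \<theta> (max 0 (min T t)) \<omega>)"
    by (rule continuous_on_compose2) (use T_pos in \<open>auto intro!: continuous_intros\<close>)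
  hence c: "isCont (\<lambda>t. Wc \<theta> t \<omega>) s"
    by (simp add: Wc_def continuous_on_eq_continuous_at)
  have "(\<lambda>n. real_of_int \<lfloor>real (Suc n) * s\<rfloor> / real (Suc n)) \<longlonglongrightarrow> s"
  proof (rule real_tendsto_sandwich[of "\<lambda>n. s - 1 / real (Suc n)" _ _ "\<lambda>_. s"])
    have le: "s - 1 / real (Suc n) \<le> real_of_int \<lfloor>real (Suc n) * s\<rfloor> / real (Suc n)" "real_of_int \<lfloor>real (Suc n) * s\<rfloor> / real (Suc n) \<le> s" for n
    proof -
      have "real (Suc n) * s - 1 \<le> real_of_int \<lfloor>real (Suc n) * s\<rfloor>" "real_of_int \<lfloor>real (Suc n) * s\<rfloor> \<le> real (Suc n) * s" by linarith+
      hence "(real (Suc n) * s - 1) / real (Suc n) \<le> real_of_int \<lfloor>real (Suc n) * s\<rfloor> / real (Suc n)"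
        "real_of_int \<lfloor>real (Suc n) * s\<rfloor> / real (Suc n) \<le> (real (Suc n) * s) / real (Suc n)"
        by (intro divide_right_mono; simp)+
      thus "s - 1 / real (Suc n) \<le> real_of_int \<lfloor>real (Suc n) * s\<rfloor> / real (Suc n)" "real_of_int \<lfloor>real (Suc n) * s\<rfloor> / real (Suc n) \<le> s"
        by (simp_all add: diff_divide_distrib)
    qed
    show "\<forall>\<^sub>F n in sequentially. s - 1 / real (Suc n) \<le> real_of_int \<lfloor>real (Suc n) * s\<rfloor> / real (Suc n)"
      "\<forall>\<^sub>F n in sequentially. real_of_int \<lfloor>real (Suc n) * s\<rfloor> / real (Suc n) \<le> s"
      by (intro always_eventually allI le)+
    show "(\<lambda>n. s - 1 / real (Suc n)) \<longlonglongrightarrow> s" by real_asymp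
  qed simp
  from isCont_tendsto_compose[OF c this]
  show "(\<lambda>n. Wc \<theta> (real_of_int \<lfloor>real (Suc n) * fst q\<rfloor> / real (Suc n)) (snd q)) \<longlonglongrightarrow> Wc \<theta> (fst q) (snd q)"
    by (simp add: q)
qed

lemma Wc_increment_distributed:
  assumes "\<theta> \<in> Theta" "0 \<le> t" "t < s" "s \<le> T"
  shows "distributed \<Omega> lborel (\<lambda>\<omega>. Wc \<theta> s \<omega> - Wc \<theta> t \<omega>) (\<lambda>y. ennreal (gauss (s - t) y))"
proof -
  have "std_brownian_motion \<Omega> T (W \<theta>)" using input assms by (auto simp: mlp_random_input_def)
  thus ?thesis unfolding std_brownian_motion_def gauss_def using assms Wc_eq[of s \<theta>] Wc_eq[of t \<theta>] by simp
qed

lemma r_distributed: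
  assumes "\<theta> \<in> Theta"
  shows "distributed \<Omega> lborel (\<rr> \<theta>) (\<lambda>r. ennreal (rho \<alpha> r) * indicator {0<..<1} r)"
    and "\<omega> \<in> space \<Omega> \<Longrightarrow> 0 < \<rr> \<theta> \<omega>" "\<omega> \<in> space \<Omega> \<Longrightarrow> \<rr> \<theta> \<omega> < 1"
  using input assms unfolding mlp_random_input_def by auto

definition Rt :: "real \<Rightarrow> int list \<Rightarrow> 'w \<Rightarrow> real" where
  "Rt t \<theta> \<omega> = t + (T - t) * \<rr> \<theta> \<omega>"

definition Dt :: "real \<Rightarrow> int list \<Rightarrow> 'w \<Rightarrow> real ^ 'd" where
  "Dt t \<theta> \<omega> = Wc \<theta> (Rt t \<theta> \<omega>) \<omega> - Wc \<theta> t \<omega>"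

abbreviation Yt :: "real ^ 'd \<Rightarrow> real \<Rightarrow> int list \<Rightarrow> 'w \<Rightarrow> real ^ 'd" where
  "Yt x t \<theta> \<omega> \<equiv> x + \<sigma> *\<^sub>R Dt t \<theta> \<omega>"

lemma Rt_bounds:
  assumes "\<theta> \<in> Theta" "t \<in> {0..<T}" "\<omega> \<in> space \<Omega>"
  shows "t < Rt t \<theta> \<omega>" "Rt t \<theta> \<omega> < T"
proof -
  have r: "0 < \<rr> \<theta> \<omega>" "\<rr> \<theta> \<omega> < 1" using r_distributed[OF assms(1)] assms(3) by auto
  have "0 < (T - t) * \<rr> \<theta> \<omega>" using r assms by simp
  moreover have "(T - t) * \<rr> \<theta> \<omega> < (T - t) * 1" using r assms by (intro mult_strict_left_mono) auto
  ultimately show "t < Rt t \<theta> \<omega>" "Rt t \<theta> \<omega> < T" by (auto simp: Rt_def)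
qed

lemma Rt_measurable: "Inr \<theta> \<in> J \<Longrightarrow> Rt t \<theta> \<in> borel_measurable (sigma_of J)"
  unfolding Rt_def using r_measurable[of \<theta> J] by measurable

lemma Dt_measurable:
  assumes "\<theta> \<in> Theta" "Inr \<theta> \<in> J" "Inl \<theta> \<in> J"
  shows "Dt t \<theta> \<in> borel_measurable (sigma_of J)"
proof -
  have "(\<lambda>\<omega>. (Rt t \<theta> \<omega>, \<omega>)) \<in> measurable (sigma_of J) (borel \<Otimes>\<^sub>M sigma_of J)"
    using Rt_measurable[OF assms(2)] by measurable
  from measurable_compose[OF this Wc_pair[OF assms(1,3)]]
  have "(\<lambda>\<omega>. Wc \<theta> (Rt t \<theta> \<omega>) \<omega>) \<in> borel_measurable (sigma_of J)" by simp
  thus ?thesis unfolding Dt_def by (rule borel_measurable_diff) (rule Wc_slice[OF assms(3)])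
qed

text \<open>The law of the increment depends on the random time, so freezing takes two stages: first
  the time against everything else, then the increment over a now deterministic interval against the
  inputs in \<open>J\<close>.\<close>

lemma sample_formula:
  assumes \<theta>: "\<theta> \<in> Theta" and t: "t \<in> {0..<T}"
    and J: "J \<subseteq> Ind" "Inl \<theta> \<notin> J" "Inr \<theta> \<notin> J"
    and \<Phi>: "\<Phi> \<in> borel_measurable (borel \<Otimes>\<^sub>M sigma_of J)"
  shows "(\<integral>\<^sup>+\<omega>. \<Phi> ((Rt t \<theta> \<omega>, Dt t \<theta> \<omega>), \<omega>) \<partial>\<Omega>)
    = (\<integral>\<^sup>+q. ennreal (rho \<alpha> q) * indicator {0<..<1} q *
        (\<integral>\<^sup>+z. ennreal (gauss ((T - t) * q) z) * (\<integral>\<^sup>+\<omega>. \<Phi> ((t + (T - t) * q, z), \<omega>) \<partial>\<Omega>) \<partial>lborel) \<partial>lborel)"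
proof -
  have ThI: "Inl \<theta> \<in> Ind" "Inr \<theta> \<in> Ind" using \<theta> by auto
  \<comment> \<open>In the first stage the Brownian motion still belongs to the random
    remainder.\<close>
  let ?J = "insert (Inl \<theta>) J"
  have \<Phi>': "\<Phi> \<in> borel_measurable (borel \<Otimes>\<^sub>M sigma_of ?J)"
  proof (rule measurable_from_subalg[OF _ \<Phi>])
    show "subalgebra (borel \<Otimes>\<^sub>M sigma_of ?J) (borel \<Otimes>\<^sub>M sigma_of J)"
      unfolding subalgebra_def
    proof
      show "sets (borel \<Otimes>\<^sub>M sigma_of J) \<subseteq> sets (borel \<Otimes>\<^sub>M sigma_of ?J)"
        using sigma_of_mono[of J ?J] unfolding subalgebra_def by (intro sets_pair_in_sets) auto
    qed (simp add: space_pair_measure)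
  qed
  note W1 = Wc_pair[OF \<theta>, of ?J] and W2 = Wc_slice[of \<theta> ?J]
  define \<Psi> where "\<Psi> p = \<Phi> ((t + (T - t) * fst p, Wc \<theta> (t + (T - t) * fst p) (snd p) - Wc \<theta> t (snd p)), snd p)" for p
  have m1: "(\<lambda>p. Wc \<theta> (t + (T - t) * fst p) (snd p)) \<in> borel_measurable (borel \<Otimes>\<^sub>M sigma_of ?J)"
  proof -
    have "(\<lambda>p. (t + (T - t) * fst p, snd p)) \<in> measurable (borel \<Otimes>\<^sub>M sigma_of ?J) (borel \<Otimes>\<^sub>M sigma_of ?J)" by measurable
    from measurable_compose[OF this W1] show ?thesis by simp
  qed
  have m2: "(\<lambda>p. Wc \<theta> t (snd p)) \<in> borel_measurable (borel \<Otimes>\<^sub>M sigma_of ?J)"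
    by (rule measurable_compose[OF measurable_snd W2]) simp
  have "(\<lambda>p. ((t + (T - t) * fst p, Wc \<theta> (t + (T - t) * fst p) (snd p) - Wc \<theta> t (snd p)), snd p))
      \<in> measurable (borel \<Otimes>\<^sub>M sigma_of ?J) (borel \<Otimes>\<^sub>M sigma_of ?J)"
    by (intro measurable_Pair borel_measurable_Pair borel_measurable_diff m1 m2 measurable_snd) measurable
  from measurable_compose[OF this \<Phi>'] have \<Psi>: "\<Psi> \<in> borel_measurable (borel \<Otimes>\<^sub>M sigma_of ?J)"
    unfolding \<Psi>_def .
  have "(\<integral>\<^sup>+\<omega>. \<Phi> ((Rt t \<theta> \<omega>, Dt t \<theta> \<omega>), \<omega>) \<partial>\<Omega>) = (\<integral>\<^sup>+\<omega>. \<Psi> (\<rr> \<theta> \<omega>, \<omega>) \<partial>\<Omega>)"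
    by (simp add: \<Psi>_def Rt_def Dt_def)
  also have "\<dots> = (\<integral>\<^sup>+\<omega>'. (\<integral>\<^sup>+\<omega>. \<Psi> (\<rr> \<theta> \<omega>', \<omega>) \<partial>\<Omega>) \<partial>\<Omega>)"
    using J ThI by (intro sigma_of_freeze[where ?J1.0="{Inr \<theta>}" and ?J2.0="?J" and N=borel] \<Psi> r_measurable) auto
  also have "\<dots> = (\<integral>\<^sup>+q. ennreal (rho \<alpha> q) * indicator {0<..<1} q * (\<integral>\<^sup>+\<omega>. \<Psi> (q, \<omega>) \<partial>\<Omega>) \<partial>lborel)"
  proof (rule distributed_nn_integral[OF r_distributed(1)[OF \<theta>], symmetric])
    have "subalgebra (borel \<Otimes>\<^sub>M \<Omega>) (borel \<Otimes>\<^sub>M sigma_of ?J)"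
      unfolding subalgebra_def
    proof
      show "sets (borel \<Otimes>\<^sub>M sigma_of ?J) \<subseteq> sets (borel \<Otimes>\<^sub>M \<Omega>)"
        using sigma_of_subalgebra[of ?J] J ThI unfolding subalgebra_def by (intro sets_pair_in_sets) auto
    qed (simp add: space_pair_measure)
    from measurable_from_subalg[OF this \<Psi>] have "\<Psi> \<in> borel_measurable (borel \<Otimes>\<^sub>M \<Omega>)" .
    thus "(\<lambda>q. \<integral>\<^sup>+\<omega>. \<Psi> (q, \<omega>) \<partial>\<Omega>) \<in> borel_measurable lborel"
      using borel_measurable_nn_integral_fst[of \<Psi> borel] by simp
  qed
  also have "\<dots> = (\<integral>\<^sup>+q. ennreal (rho \<alpha> q) * indicator {0<..<1} q *
        (\<integral>\<^sup>+z. ennreal (gauss ((T - t) * q) z) * (\<integral>\<^sup>+\<omega>. \<Phi> ((t + (T - t) * q, z), \<omega>) \<partial>\<Omega>) \<partial>lborel) \<partial>lborel)"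
  proof (intro nn_integral_cong)
    fix q :: real
    show "ennreal (rho \<alpha> q) * indicator {0<..<1} q * (\<integral>\<^sup>+\<omega>. \<Psi> (q, \<omega>) \<partial>\<Omega>) =
      ennreal (rho \<alpha> q) * indicator {0<..<1} q *
        (\<integral>\<^sup>+z. ennreal (gauss ((T - t) * q) z) * (\<integral>\<^sup>+\<omega>. \<Phi> ((t + (T - t) * q, z), \<omega>) \<partial>\<Omega>) \<partial>lborel)"
    proof (cases "q \<in> {0<..<1}")
      case True
      define s where "s = t + (T - t) * q"
      have "0 < (T - t) * q" using True t by simp
      moreover have "(T - t) * q < (T - t) * 1" using True t by (intro mult_strict_left_mono) auto
      ultimately have s: "t < s" "s \<le> T" by (auto simp: s_def)
      have st: "s - t = (T - t) * q" by (simp add: s_def)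
      define X where "X \<omega> = Wc \<theta> s \<omega> - Wc \<theta> t \<omega>" for \<omega>
      define \<Phi>s where "\<Phi>s p = \<Phi> ((s, fst p), snd p)" for p
      have "(\<lambda>p::(real^'d) \<times> 'w. ((s, fst p), snd p)) \<in> measurable (borel \<Otimes>\<^sub>M sigma_of J) (borel \<Otimes>\<^sub>M sigma_of J)"
        by (intro measurable_Pair borel_measurable_Pair measurable_snd measurable_fst borel_measurable_const)
      from measurable_compose[OF this \<Phi>] have \<Phi>s: "\<Phi>s \<in> borel_measurable (borel \<Otimes>\<^sub>M sigma_of J)"
        unfolding \<Phi>s_def .
      have "(\<integral>\<^sup>+\<omega>. \<Psi> (q, \<omega>) \<partial>\<Omega>) = (\<integral>\<^sup>+\<omega>. \<Phi>s (X \<omega>, \<omega>) \<partial>\<Omega>)"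
        by (simp add: \<Psi>_def \<Phi>s_def X_def s_def)
      also have "\<dots> = (\<integral>\<^sup>+\<omega>'. (\<integral>\<^sup>+\<omega>. \<Phi>s (X \<omega>', \<omega>) \<partial>\<Omega>) \<partial>\<Omega>)"
      proof (rule sigma_of_freeze[where ?J1.0="{Inl \<theta>}" and ?J2.0="J" and N=borel])
        show "X \<in> borel_measurable (sigma_of {Inl \<theta>})"
          unfolding X_def using Wc_slice[of \<theta> "{Inl \<theta>}"] by measurable
      qed (use J ThI \<Phi>s in auto)
      also have "\<dots> = (\<integral>\<^sup>+z. ennreal (gauss (s - t) z) * (\<integral>\<^sup>+\<omega>. \<Phi>s (z, \<omega>) \<partial>\<Omega>) \<partial>lborel)"
      proof (rule distributed_nn_integral[symmetric])
        show "distributed \<Omega> lborel X (\<lambda>y. ennreal (gauss (s - t) y))"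
          unfolding X_def using s t by (intro Wc_increment_distributed \<theta>) auto
        have "subalgebra (borel \<Otimes>\<^sub>M \<Omega>) (borel \<Otimes>\<^sub>M sigma_of J)"
          unfolding subalgebra_def
        proof
          show "sets (borel \<Otimes>\<^sub>M sigma_of J) \<subseteq> sets (borel \<Otimes>\<^sub>M \<Omega>)"
            using sigma_of_subalgebra[of J] J unfolding subalgebra_def by (intro sets_pair_in_sets) auto
        qed (simp add: space_pair_measure)
        from measurable_from_subalg[OF this \<Phi>s] have "\<Phi>s \<in> borel_measurable (borel \<Otimes>\<^sub>M \<Omega>)" .
        thus "(\<lambda>z. \<integral>\<^sup>+\<omega>. \<Phi>s (z, \<omega>) \<partial>\<Omega>) \<in> borel_measurable lborel"
          using borel_measurable_nn_integral_fst[of \<Phi>s borel] by simp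
      qed
      finally show ?thesis unfolding st by (simp add: \<Phi>s_def s_def)
    qed simp
  qed
  finally show ?thesis .
qed

end

section \<open>Sums of independent vectors\<close>

context prob_space begin

text \<open>The last claim is Jensen's inequality, read off from the nonnegativity of the variance.
  The others pass from the extended integral, for which bounds are proved, to real-valued
  expectations.\<close>

lemma square_integrable_bound:
  fixes X :: "'a \<Rightarrow> 'e::euclidean_space"
  assumes X: "X \<in> borel_measurable M" and B: "(\<integral>\<^sup>+\<omega>. ennreal ((norm (X \<omega>))\<^sup>2) \<partial>M) \<le> ennreal b" "0 \<le> b"
  shows "integrable M X" "integrable M (\<lambda>\<omega>. (norm (X \<omega>))\<^sup>2)" "(\<integral>\<omega>. (norm (X \<omega>))\<^sup>2 \<partial>M) \<le> b"
    "(norm (\<integral>\<omega>. X \<omega> \<partial>M))\<^sup>2 \<le> b"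
proof -
  note [measurable] = X
  show i2: "integrable M (\<lambda>\<omega>. (norm (X \<omega>))\<^sup>2)"
    using B by (intro integrableI_nonneg) (auto intro: le_less_trans)
  show i1: "integrable M X"
  proof (rule Bochner_Integration.integrable_bound)
    show "integrable M (\<lambda>\<omega>. 1 + (norm (X \<omega>))\<^sup>2)" using i2 by auto
    have "a \<le> 1 + a\<^sup>2" for a :: real
      using zero_le_power2[of "a - 1/2"] by (simp add: power2_diff power_divide)
    thus "AE \<omega> in M. norm (X \<omega>) \<le> norm (1 + (norm (X \<omega>))\<^sup>2)" by (intro AE_I2) (simp add: abs_of_nonneg)
  qed measurable
  have "ennreal (\<integral>\<omega>. (norm (X \<omega>))\<^sup>2 \<partial>M) = (\<integral>\<^sup>+\<omega>. ennreal ((norm (X \<omega>))\<^sup>2) \<partial>M)"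
    by (rule nn_integral_eq_integral[symmetric, OF i2]) simp
  thus le: "(\<integral>\<omega>. (norm (X \<omega>))\<^sup>2 \<partial>M) \<le> b" using B by (metis ennreal_le_iff)
  define m where "m = (\<integral>\<omega>. X \<omega> \<partial>M)"
  have "0 \<le> (\<integral>\<omega>. (norm (X \<omega> - m))\<^sup>2 \<partial>M)" by simp
  also have "(\<lambda>\<omega>. (norm (X \<omega> - m))\<^sup>2) = (\<lambda>\<omega>. (norm (X \<omega>))\<^sup>2 - 2 * (X \<omega> \<bullet> m) + m \<bullet> m)"
    by (auto simp: power2_norm_eq_inner inner_diff_left inner_diff_right inner_commute algebra_simps)
  also have "(\<integral>\<omega>. (norm (X \<omega>))\<^sup>2 - 2 * (X \<omega> \<bullet> m) + m \<bullet> m \<partial>M) = (\<integral>\<omega>. (norm (X \<omega>))\<^sup>2 \<partial>M) - 2 * (m \<bullet> m) + m \<bullet> m"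
    using i1 i2 by (simp add: m_def prob_space)
  finally have "m \<bullet> m \<le> (\<integral>\<omega>. (norm (X \<omega>))\<^sup>2 \<partial>M)" by simp
  thus "(norm (\<integral>\<omega>. X \<omega> \<partial>M))\<^sup>2 \<le> b" using le by (simp add: power2_norm_eq_inner m_def)
qed

text \<open>Decomposition into variance and squared bias. Cross terms of centred summands vanish by
  independence, and every variance is at most the second moment, so that \<open>b k\<close> can be
  found without knowing the means.\<close>

lemma indep_sum_square_bound:
  fixes X :: "'k \<Rightarrow> 'a \<Rightarrow> 'e::euclidean_space"
  assumes K: "finite K" and ind: "indep_vars (\<lambda>_. borel) X K"
    and B: "\<And>k. k \<in> K \<Longrightarrow> (\<integral>\<^sup>+\<omega>. ennreal ((norm (X k \<omega>))\<^sup>2) \<partial>M) \<le> ennreal (b k)" "\<And>k. k \<in> K \<Longrightarrow> 0 \<le> b k"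
  shows "(\<integral>\<^sup>+\<omega>. ennreal ((norm (c + (\<Sum>k\<in>K. X k \<omega>) - u))\<^sup>2) \<partial>M)
     \<le> ennreal ((\<Sum>k\<in>K. b k) + (norm (c + (\<Sum>k\<in>K. \<integral>\<omega>. X k \<omega> \<partial>M) - u))\<^sup>2)"
proof -
  have rv: "X k \<in> borel_measurable M" if "k \<in> K" for k
    using ind that by (auto simp: indep_vars_def)
  note sq = square_integrable_bound[OF rv B]
  define Y where "Y k \<omega> = X k \<omega> - (\<integral>\<omega>. X k \<omega> \<partial>M)" for k \<omega>
  define v where "v = c + (\<Sum>k\<in>K. \<integral>\<omega>. X k \<omega> \<partial>M) - u"
  have Yint: "integrable M (Y k)" "(\<integral>\<omega>. Y k \<omega> \<partial>M) = 0" if "k \<in> K" for k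
    unfolding Y_def using sq(1)[OF that that that] by (simp_all add: prob_space)
  have cross: "integrable M (\<lambda>\<omega>. Y k \<omega> \<bullet> Y j \<omega>) \<and> (\<integral>\<omega>. Y k \<omega> \<bullet> Y j \<omega> \<partial>M) = 0" if kj: "k \<in> K" "j \<in> K" "k \<noteq> j" for k j
  proof -
    \<comment> \<open>Expectations of products factor for real variables; the inner product is
      treated as a sum over the coordinates in \<open>Basis\<close>.\<close>
    have iv: "indep_vars (\<lambda>_. borel) (\<lambda>i \<omega>. Y i \<omega> \<bullet> b) {k, j}" for b
      unfolding Y_def using kj by (intro indep_vars_compose2[OF indep_vars_subset[OF ind]]) auto
    have i: "integrable M (\<lambda>\<omega>. Y k \<omega> \<bullet> b)" "integrable M (\<lambda>\<omega>. Y j \<omega> \<bullet> b)" for b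
      using Yint kj by auto
    have ii: "integrable M (\<lambda>\<omega>. Y l \<omega> \<bullet> b)" if "l \<in> {k, j}" for l b
      using i that by auto
    have z: "(\<integral>\<omega>. Y k \<omega> \<bullet> b \<partial>M) = 0" for b
      using Yint[OF kj(1)] by simp
    have "integrable M (\<lambda>\<omega>. (Y k \<omega> \<bullet> b) * (Y j \<omega> \<bullet> b))" "(\<integral>\<omega>. (Y k \<omega> \<bullet> b) * (Y j \<omega> \<bullet> b) \<partial>M) = 0" for b
      using indep_vars_integrable[OF _ iv ii] indep_vars_lebesgue_integral[OF _ iv ii] z kj by auto
    note prod = this
    have "(\<lambda>\<omega>. Y k \<omega> \<bullet> Y j \<omega>) = (\<lambda>\<omega>. \<Sum>b\<in>Basis. (Y k \<omega> \<bullet> b) * (Y j \<omega> \<bullet> b))"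
      by (rule ext) (rule euclidean_inner)
    thus ?thesis using prod by (simp only: Bochner_Integration.integrable_sum Bochner_Integration.integral_sum prod sum.neutral_const)
  qed
  have diag: "integrable M (\<lambda>\<omega>. Y k \<omega> \<bullet> Y k \<omega>) \<and> (\<integral>\<omega>. Y k \<omega> \<bullet> Y k \<omega> \<partial>M) \<le> b k" if k: "k \<in> K" for k
  proof -
    define m where "m = (\<integral>\<omega>. X k \<omega> \<partial>M)"
    have e: "Y k \<omega> \<bullet> Y k \<omega> = (norm (X k \<omega>))\<^sup>2 - 2 * (X k \<omega> \<bullet> m) + m \<bullet> m" for \<omega>
      by (auto simp: Y_def m_def power2_norm_eq_inner inner_diff_left inner_diff_right inner_commute algebra_simps)
    have "integrable M (\<lambda>\<omega>. Y k \<omega> \<bullet> Y k \<omega>)"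
      unfolding e using sq(1,2)[OF k k k] by auto
    moreover have "(\<integral>\<omega>. Y k \<omega> \<bullet> Y k \<omega> \<partial>M) = (\<integral>\<omega>. (norm (X k \<omega>))\<^sup>2 \<partial>M) - m \<bullet> m"
      unfolding e using sq(1,2)[OF k k k] by (simp add: prob_space m_def)
    ultimately show ?thesis using sq(3)[OF k k k] inner_ge_zero[of m] by linarith
  qed
  have int2: "integrable M (\<lambda>\<omega>. Y k \<omega> \<bullet> Y j \<omega>)" if "k \<in> K" "j \<in> K" for k j
    using cross[OF that] diag[OF that(1)] by (cases "k = j") auto
  have ex: "(norm (c + (\<Sum>k\<in>K. X k \<omega>) - u))\<^sup>2 = (\<Sum>k\<in>K. \<Sum>j\<in>K. Y k \<omega> \<bullet> Y j \<omega>) + 2 * (\<Sum>k\<in>K. Y k \<omega> \<bullet> v) + v \<bullet> v" for \<omega>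
  proof -
    have "c + (\<Sum>k\<in>K. X k \<omega>) - u = (\<Sum>k\<in>K. Y k \<omega>) + v" by (simp add: Y_def v_def sum_subtractf)
    hence "(norm (c + (\<Sum>k\<in>K. X k \<omega>) - u))\<^sup>2 = ((\<Sum>k\<in>K. Y k \<omega>) + v) \<bullet> ((\<Sum>k\<in>K. Y k \<omega>) + v)"
      by (simp only: power2_norm_eq_inner)
    also have "\<dots> = (\<Sum>k\<in>K. Y k \<omega>) \<bullet> (\<Sum>k\<in>K. Y k \<omega>) + 2 * ((\<Sum>k\<in>K. Y k \<omega>) \<bullet> v) + v \<bullet> v"
      unfolding inner_add_left inner_add_right inner_commute[of v "\<Sum>k\<in>K. Y k \<omega>"] by simp
    also have "(\<Sum>k\<in>K. Y k \<omega>) \<bullet> (\<Sum>k\<in>K. Y k \<omega>) = (\<Sum>k\<in>K. \<Sum>j\<in>K. Y k \<omega> \<bullet> Y j \<omega>)"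
      unfolding inner_sum_left inner_sum_right by (rule sum.swap)
    also have "(\<Sum>k\<in>K. Y k \<omega>) \<bullet> v = (\<Sum>k\<in>K. Y k \<omega> \<bullet> v)" by (rule inner_sum_left)
    finally show ?thesis .
  qed
  have I: "integrable M (\<lambda>\<omega>. (norm (c + (\<Sum>k\<in>K. X k \<omega>) - u))\<^sup>2)"
    unfolding ex using Yint int2 by auto
  have "(\<integral>\<omega>. (norm (c + (\<Sum>k\<in>K. X k \<omega>) - u))\<^sup>2 \<partial>M)
     = (\<Sum>k\<in>K. \<Sum>j\<in>K. \<integral>\<omega>. Y k \<omega> \<bullet> Y j \<omega> \<partial>M) + 2 * (\<Sum>k\<in>K. (\<integral>\<omega>. Y k \<omega> \<bullet> v \<partial>M)) + v \<bullet> v"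
    unfolding ex using Yint int2 by (simp add: Bochner_Integration.integral_sum prob_space)
  also have "(\<Sum>k\<in>K. (\<integral>\<omega>. Y k \<omega> \<bullet> v \<partial>M)) = 0"
    using Yint by (intro sum.neutral) auto
  also have "(\<Sum>k\<in>K. \<Sum>j\<in>K. \<integral>\<omega>. Y k \<omega> \<bullet> Y j \<omega> \<partial>M) = (\<Sum>k\<in>K. \<integral>\<omega>. Y k \<omega> \<bullet> Y k \<omega> \<partial>M)"
  proof (intro sum.cong refl)
    fix k assume k: "k \<in> K"
    have "(\<Sum>j\<in>K. \<integral>\<omega>. Y k \<omega> \<bullet> Y j \<omega> \<partial>M) = (\<Sum>j\<in>K. if j = k then \<integral>\<omega>. Y k \<omega> \<bullet> Y k \<omega> \<partial>M else 0)"
      using cross[OF k] by (intro sum.cong refl) auto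
    thus "(\<Sum>j\<in>K. \<integral>\<omega>. Y k \<omega> \<bullet> Y j \<omega> \<partial>M) = (\<integral>\<omega>. Y k \<omega> \<bullet> Y k \<omega> \<partial>M)" using k K by simp
  qed
  also have "\<dots> \<le> (\<Sum>k\<in>K. b k)" using diag by (intro sum_mono) auto
  finally have "(\<integral>\<omega>. (norm (c + (\<Sum>k\<in>K. X k \<omega>) - u))\<^sup>2 \<partial>M) \<le> (\<Sum>k\<in>K. b k) + (norm v)\<^sup>2"
    by (simp add: power2_norm_eq_inner)
  thus ?thesis unfolding v_def
    by (subst nn_integral_eq_integral[OF I]) (auto intro: ennreal_leI)
qed

text \<open>The joint law of independent variables is the product of the marginals, and the sum is a
  measurable function of the whole family; equal marginals therefore suffice.\<close>

lemma distr_sum_indep_eq: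
  fixes X X' :: "'k \<Rightarrow> 'a \<Rightarrow> 'e::euclidean_space"
  assumes K: "finite K" "K \<noteq> {}" and ind: "indep_vars (\<lambda>_. borel) X K" "indep_vars (\<lambda>_. borel) X' K"
    and eq: "\<And>k. k \<in> K \<Longrightarrow> distr M borel (X k) = distr M borel (X' k)"
  shows "distr M borel (\<lambda>\<omega>. c + (\<Sum>k\<in>K. X k \<omega>)) = distr M borel (\<lambda>\<omega>. c + (\<Sum>k\<in>K. X' k \<omega>))"
proof -
  have gen: "distr M borel (\<lambda>\<omega>. c + (\<Sum>k\<in>K. Z k \<omega>))
     = distr (PiM K (\<lambda>k. distr M borel (Z k))) borel (\<lambda>f. c + (\<Sum>k\<in>K. f k))"
    if Z: "indep_vars (\<lambda>_. borel) Z K" for Z :: "'k \<Rightarrow> 'a \<Rightarrow> 'e"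
  proof -
    have rv: "Z k \<in> borel_measurable M" if "k \<in> K" for k using Z that by (auto simp: indep_vars_def)
    have 1: "distr M (PiM K (\<lambda>_. borel)) (\<lambda>x. \<lambda>i\<in>K. Z i x) = PiM K (\<lambda>k. distr M borel (Z k))"
      using indep_vars_iff_distr_eq_PiM'[where I=K and M'="\<lambda>_. borel" and X=Z] K rv Z by auto
    have m: "(\<lambda>x. \<lambda>i\<in>K. Z i x) \<in> measurable M (PiM K (\<lambda>_. borel))"
      using rv by (intro measurable_restrict)
    have "distr (PiM K (\<lambda>k. distr M borel (Z k))) borel (\<lambda>f. c + (\<Sum>k\<in>K. f k))
        = distr M borel ((\<lambda>f. c + (\<Sum>k\<in>K. f k)) \<circ> (\<lambda>x. \<lambda>i\<in>K. Z i x))"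
      unfolding 1[symmetric] by (rule distr_distr[OF _ m]) measurable
    also have "((\<lambda>f. c + (\<Sum>k\<in>K. f k)) \<circ> (\<lambda>x. \<lambda>i\<in>K. Z i x)) = (\<lambda>\<omega>. c + (\<Sum>k\<in>K. Z k \<omega>))"
      by (auto simp: fun_eq_iff intro!: sum.cong)
    finally show ?thesis ..
  qed
  have "PiM K (\<lambda>k. distr M borel (X k)) = PiM K (\<lambda>k. distr M borel (X' k))"
    by (intro PiM_cong refl eq)
  thus ?thesis unfolding gen[OF ind(1)] gen[OF ind(2)] by simp
qed

lemma distr_eqI_nn_integral:
  fixes X Y :: "'a \<Rightarrow> 'e::topological_space"
  assumes "X \<in> borel_measurable M" "Y \<in> borel_measurable M"
    and "\<And>S. S \<in> sets borel \<Longrightarrow> (\<integral>\<^sup>+\<omega>. indicator S (X \<omega>) \<partial>M) = (\<integral>\<^sup>+\<omega>. indicator S (Y \<omega>) \<partial>M)"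
  shows "distr M borel X = distr M borel Y"
proof (rule measure_eqI)
  have *: "emeasure (distr M borel Z) S = (\<integral>\<^sup>+\<omega>. indicator S (Z \<omega>) \<partial>M)"
    if "Z \<in> borel_measurable M" "S \<in> sets borel" for Z :: "'a \<Rightarrow> 'e" and S
  proof -
    have "(\<integral>\<^sup>+\<omega>. indicator S (Z \<omega>) \<partial>M) = (\<integral>\<^sup>+x. indicator S x \<partial>distr M borel Z)"
      using that by (subst nn_integral_distr) auto
    thus ?thesis using that by simp
  qed
  show "emeasure (distr M borel X) S = emeasure (distr M borel Y) S" if "S \<in> sets (distr M borel X)" for S
    using that assms by (simp add: *)
qed simp

end

section \<open>The estimator as a sum of independent samples\<close>

lemma fst_borel [measurable]: "fst \<in> borel_measurable (borel :: ('a::topological_space \<times> 'b::topological_space) measure)"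
  by (intro borel_measurable_continuous_onI continuous_intros)

lemma snd_borel [measurable]: "snd \<in> borel_measurable (borel :: ('a::topological_space \<times> 'b::topological_space) measure)"
  by (intro borel_measurable_continuous_onI continuous_intros)

locale mlp_est = mlp_input \<Omega> T \<alpha> \<sigma> W \<rr>
  for \<Omega> :: "'w measure" and T \<alpha> \<sigma> :: real and W :: "int list \<Rightarrow> real \<Rightarrow> 'w \<Rightarrow> real ^ 'd" and \<rr> +
  fixes g :: "real ^ 'd \<Rightarrow> real" and F :: "real \<times> (real ^ 'd) \<Rightarrow> real \<Rightarrow> real ^ 'd \<Rightarrow> real" and M :: nat
  assumes g_meas: "g \<in> borel_measurable borel"
    and F_meas: "(\<lambda>q. F (fst q) (fst (snd q)) (snd (snd q))) \<in> borel_measurable borel"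
    and M: "1 \<le> M"
begin

definition V :: "nat \<Rightarrow> int list \<Rightarrow> real \<Rightarrow> real ^ 'd \<Rightarrow> 'w \<Rightarrow> real \<times> (real ^ 'd)" where
  "V n \<theta> t x \<omega> = mlp T \<sigma> \<alpha> Wc \<rr> g F M n \<theta> t x \<omega>"

text \<open>In sets of random inputs, \<open>Inl \<theta>\<close> refers to \<open>W \<theta>\<close> and \<open>Inr \<theta>\<close> to \<open>\<rr> \<theta>\<close>.\<close>

definition Ext :: "int list \<Rightarrow> (int list + int list) set" where
  "Ext \<theta> = {j. \<exists>\<eta>. \<eta> \<noteq> [] \<and> (j = Inl (\<theta> @ \<eta>) \<or> j = Inr (\<theta> @ \<eta>))}"

text \<open>A level sample with tuple \<theta> uses the inputs at \<theta> for its random point, in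
  addition to those of the nested estimator, which lie at proper extensions. Hence the two
  variants.\<close>

definition Sub :: "int list \<Rightarrow> (int list + int list) set" where
  "Sub \<theta> = {j. \<exists>\<eta>. j = Inl (\<theta> @ \<eta>) \<or> j = Inr (\<theta> @ \<eta>)}"

lemma Theta_append [simp]: "\<theta> @ [a, b] \<in> Theta"
  by (simp add: Theta_def)

lemma Sub_child: "Sub (\<theta> @ [a, b]) \<subseteq> Ext \<theta>"
  by (auto simp: Sub_def Ext_def)

lemma Ext_Sub: "Ext \<theta> \<subseteq> Sub \<theta>"
  by (auto simp: Sub_def Ext_def)

lemma Sub_self: "Inl \<theta> \<in> Sub \<theta>" "Inr \<theta> \<in> Sub \<theta>"
  by (auto simp: Sub_def)

lemma Sub_Ind: "\<theta> \<in> Theta \<Longrightarrow> Sub \<theta> \<subseteq> Ind"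
  by (auto simp: Sub_def Theta_def)

lemma Ext_Ind: "\<theta> \<in> Theta \<Longrightarrow> Ext \<theta> \<subseteq> Ind"
  using Ext_Sub Sub_Ind by blast

lemma not_Ext_self: "Inl \<theta> \<notin> Ext \<theta>" "Inr \<theta> \<notin> Ext \<theta>"
  by (auto simp: Ext_def)

text \<open>The weight of a sample with random time \<open>r\<close> and increment \<open>z\<close>:
  division by the sampling density, and the Bismut weight \<open>z / (r - t)\<close> for the
  gradient. The scalar \<open>c\<close> is kept apart because it alone carries the error.\<close>

definition bvec :: "real \<Rightarrow> real \<Rightarrow> real \<Rightarrow> real ^ 'd \<Rightarrow> real \<times> (real ^ 'd)" where
  "bvec t c r z = (c / varrho \<alpha> T t r) *\<^sub>R (1, (1 / (r - t)) *\<^sub>R z)"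

definition gvec :: "real \<Rightarrow> real ^ 'd \<Rightarrow> real ^ 'd \<Rightarrow> real \<times> (real ^ 'd)" where
  "gvec t x z = (g (x + \<sigma> *\<^sub>R z) - g x) *\<^sub>R (1, (1 / (T - t)) *\<^sub>R z)"

text \<open>At level 0 the value 0 is a placeholder that \<open>diffF\<close> discards. In this way
  all levels are functions of two random fields.\<close>

definition prevV :: "nat \<Rightarrow> int list \<Rightarrow> real \<Rightarrow> real ^ 'd \<Rightarrow> 'w \<Rightarrow> real \<times> (real ^ 'd)" where
  "prevV l \<theta> s y \<omega> = (if l \<ge> 1 then V (l - 1) \<theta> s y \<omega> else 0)"

definition diffF :: "nat \<Rightarrow> real \<times> (real ^ 'd) \<Rightarrow> real \<times> (real ^ 'd) \<Rightarrow> real \<Rightarrow> real ^ 'd \<Rightarrow> real" where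
  "diffF l a b r y = F a r y - (if l \<ge> 1 then F b r y else 0)"

definition level :: "nat \<Rightarrow> int list \<Rightarrow> int list \<Rightarrow> real \<Rightarrow> real ^ 'd \<Rightarrow> 'w \<Rightarrow> real \<times> (real ^ 'd)" where
  "level l \<theta>a \<theta>b t x \<omega> = (let r = Rt t \<theta>a \<omega>; z = Dt t \<theta>a \<omega>; y = x + \<sigma> *\<^sub>R z in
     bvec t (diffF l (V l \<theta>a r y \<omega>) (prevV l \<theta>b r y \<omega>) r y) r z)"

definition terminal :: "int list \<Rightarrow> real \<Rightarrow> real ^ 'd \<Rightarrow> 'w \<Rightarrow> real \<times> (real ^ 'd)" where
  "terminal \<theta> t x \<omega> = gvec t x (Wc \<theta> T \<omega> - Wc \<theta> t \<omega>)"

text \<open>\<open>Inl i\<close> stands for the \<open>i\<close>-th terminal sample and \<open>Inr (l, i)\<close> for the \<open>i\<close>-th sample on level \<open>l\<close>;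
  \<open>Dom \<theta> k\<close> contains the indices of the random inputs that the summand \<open>k\<close> depends on.\<close>

definition Keys :: "nat \<Rightarrow> (nat + nat \<times> nat) set" where
  "Keys n = {1..M ^ n} <+> (SIGMA l:{..<n}. {1..M ^ (n - l)})"

definition summand :: "nat \<Rightarrow> int list \<Rightarrow> real \<Rightarrow> real ^ 'd \<Rightarrow> nat + nat \<times> nat \<Rightarrow> 'w \<Rightarrow> real \<times> (real ^ 'd)" where
  "summand n \<theta> t x k \<omega> = (case k of
      Inl i \<Rightarrow> (1 / real M ^ n) *\<^sub>R terminal (\<theta> @ [0, - int i]) t x \<omega>
    | Inr (l, i) \<Rightarrow> (1 / real M ^ (n - l)) *\<^sub>R level l (\<theta> @ [int l, int i]) (\<theta> @ [- int l, int i]) t x \<omega>)"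

definition Dom :: "int list \<Rightarrow> nat + nat \<times> nat \<Rightarrow> (int list + int list) set" where
  "Dom \<theta> k = (case k of Inl i \<Rightarrow> Sub (\<theta> @ [0, - int i])
    | Inr (l, i) \<Rightarrow> Sub (\<theta> @ [int l, int i]) \<union> Sub (\<theta> @ [- int l, int i]))"

lemma Keys_finite: "finite (Keys n)" by (simp add: Keys_def)

lemma Keys_nonempty: "Keys n \<noteq> {}"
  using M by (auto simp: Keys_def)

lemma Dom_Ext: "Dom \<theta> k \<subseteq> Ext \<theta>"
  using Sub_child by (auto simp: Dom_def split: sum.splits)

text \<open>The two appended entries separate the samples: terminal ones append 0 and a negative
  number, level 0 appends 0 and a positive one, and on a level \<open>l \<ge> 1\<close> the first
  entry is \<open>l\<close> or \<open>- l\<close>, which determines the level.\<close>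

lemma Dom_disjoint: "disjoint_family_on (Dom \<theta>) (Keys n)"
  unfolding disjoint_family_on_def
proof (intro ballI impI)
  fix k k' assume k: "k \<in> Keys n" "k' \<in> Keys n" "k \<noteq> k'"
  thus "Dom \<theta> k \<inter> Dom \<theta> k' = {}"
    unfolding Dom_def Keys_def Sub_def by (auto split: sum.splits prod.splits)
qed

lemma V_0: "V 0 \<theta> t x \<omega> = 0"
  by (simp add: V_def mlp.simps)

lemma V_rec:
  assumes "n \<noteq> 0"
  shows "V n \<theta> t x \<omega> = (g x, 0) + (\<Sum>k\<in>Keys n. summand n \<theta> t x k \<omega>)"
proof -
  have lev: "level l \<theta>a \<theta>b t x \<omega> = (let R = t + (T - t) * \<rr> \<theta>a \<omega>; \<Delta> = Wc \<theta>a R \<omega> - Wc \<theta>a t \<omega>; Y = x + \<sigma> *\<^sub>R \<Delta>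
          in ((F (mlp T \<sigma> \<alpha> Wc \<rr> g F M l \<theta>a R Y \<omega>) R Y
                - (if l \<ge> 1 then F (mlp T \<sigma> \<alpha> Wc \<rr> g F M (l - 1) \<theta>b R Y \<omega>) R Y
                   else 0))
               / varrho \<alpha> T t R) *\<^sub>R (1, (1 / (R - t)) *\<^sub>R \<Delta>))" for l \<theta>a \<theta>b
    by (simp add: level_def bvec_def diffF_def prevV_def V_def Rt_def Dt_def Let_def)
  have "(\<Sum>k\<in>Keys n. summand n \<theta> t x k \<omega>) = (\<Sum>i=1..M ^ n. (1 / real M ^ n) *\<^sub>R terminal (\<theta> @ [0, - int i]) t x \<omega>)
     + (\<Sum>l<n. \<Sum>i=1..M ^ (n - l). (1 / real M ^ (n - l)) *\<^sub>R level l (\<theta> @ [int l, int i]) (\<theta> @ [- int l, int i]) t x \<omega>)"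
    unfolding Keys_def by (subst sum.Plus) (auto simp: summand_def sum.Sigma o_def intro!: sum.cong)
  thus ?thesis using assms
    unfolding V_def by (subst mlp.simps) (simp add: scaleR_sum_right lev terminal_def gvec_def Let_def)
qed

text \<open>Joint measurability in time, space and randomness is required because fields are
  evaluated at random points; \<open>J\<close> records the inputs on which the field
  depends.\<close>

definition field_meas :: "(int list + int list) set \<Rightarrow> (real \<Rightarrow> real ^ 'd \<Rightarrow> 'w \<Rightarrow> real \<times> (real ^ 'd)) \<Rightarrow> bool" where
  "field_meas J A \<longleftrightarrow> (\<lambda>q. A (fst (fst q)) (snd (fst q)) (snd q)) \<in> borel_measurable (borel \<Otimes>\<^sub>M sigma_of J)"

lemma field_comp:
  assumes "field_meas J A" "a \<in> borel_measurable N" "b \<in> borel_measurable N" "c \<in> measurable N (sigma_of J)"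
  shows "(\<lambda>p. A (a p) (b p) (c p)) \<in> borel_measurable N"
proof -
  have "(\<lambda>p. ((a p, b p), c p)) \<in> measurable N (borel \<Otimes>\<^sub>M sigma_of J)"
    using assms by (intro measurable_Pair borel_measurable_Pair)
  from measurable_compose[OF this assms(1)[unfolded field_meas_def]] show ?thesis by simp
qed

lemma field_const: "field_meas J (\<lambda>_ _ _. c)"
  by (simp add: field_meas_def)

lemma field_slice: "field_meas J A \<Longrightarrow> A s y \<in> borel_measurable (sigma_of J)"
  using field_comp[of J A "\<lambda>_. s" "sigma_of J" "\<lambda>_. y" "\<lambda>\<omega>. \<omega>"] by simp

lemma F_comp:
  assumes "a \<in> borel_measurable N" "b \<in> borel_measurable N" "c \<in> borel_measurable N"
  shows "(\<lambda>p. F (a p) (b p) (c p)) \<in> borel_measurable N"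
proof -
  have "(\<lambda>p. (a p, (b p, c p))) \<in> borel_measurable N"
    using assms by (intro borel_measurable_Pair)
  from measurable_compose[OF this F_meas] show ?thesis by simp
qed

lemma diffF_comp:
  assumes "a \<in> borel_measurable N" "a' \<in> borel_measurable N" "b \<in> borel_measurable N" "c \<in> borel_measurable N"
  shows "(\<lambda>p. diffF l (a p) (a' p) (b p) (c p)) \<in> borel_measurable N"
  using F_comp[OF assms(1,3,4)] F_comp[OF assms(2,3,4)] by (simp add: diffF_def)

lemma bvec_comp:
  assumes [measurable]: "t \<in> borel_measurable N" "c \<in> borel_measurable N" "r \<in> borel_measurable N" "z \<in> borel_measurable N"
  shows "(\<lambda>p. bvec (t p) (c p) (r p) (z p)) \<in> borel_measurable N"
  unfolding bvec_def varrho_def rho_def by (intro borel_measurable_scaleR borel_measurable_Pair) measurable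

lemma gvec_comp:
  assumes [measurable]: "t \<in> borel_measurable N" "x \<in> borel_measurable N" "z \<in> borel_measurable N"
  shows "(\<lambda>p. gvec (t p) (x p) (z p)) \<in> borel_measurable N"
proof -
  note [measurable] = g_meas
  show ?thesis unfolding gvec_def by (intro borel_measurable_scaleR borel_measurable_Pair) measurable
qed

lemma Wc_comp:
  assumes "\<theta> \<in> Theta" "Inl \<theta> \<in> J" "a \<in> borel_measurable N" "c \<in> measurable N (sigma_of J)"
  shows "(\<lambda>p. Wc \<theta> (a p) (c p)) \<in> borel_measurable N"
proof -
  have "(\<lambda>p. (a p, c p)) \<in> measurable N (borel \<Otimes>\<^sub>M sigma_of J)" using assms by (intro measurable_Pair)
  from measurable_compose[OF this Wc_pair[OF assms(1,2)]] show ?thesis by simp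
qed

lemma r_comp:
  assumes "Inr \<theta> \<in> J" "c \<in> measurable N (sigma_of J)"
  shows "(\<lambda>p. \<rr> \<theta> (c p)) \<in> borel_measurable N"
  by (rule measurable_compose[OF assms(2) r_measurable[OF assms(1)]])

lemma Rt_comp:
  assumes "Inr \<theta> \<in> J" "t \<in> borel_measurable N" "c \<in> measurable N (sigma_of J)"
  shows "(\<lambda>p. Rt (t p) \<theta> (c p)) \<in> borel_measurable N"
  using r_comp[OF assms(1,3)] assms(2) unfolding Rt_def by measurable

lemma Dt_comp:
  assumes "\<theta> \<in> Theta" "Inl \<theta> \<in> J" "Inr \<theta> \<in> J" "t \<in> borel_measurable N" "c \<in> measurable N (sigma_of J)"
  shows "(\<lambda>p. Dt (t p) \<theta> (c p)) \<in> borel_measurable N"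
  unfolding Dt_def by (intro borel_measurable_diff Wc_comp[OF assms(1,2)] Rt_comp[OF assms(3)] assms)

lemma level_meas:
  assumes \<theta>: "\<theta>a \<in> Theta" "Inl \<theta>a \<in> J" "Inr \<theta>a \<in> J" and V: "field_meas J (V l \<theta>a)" "field_meas J (prevV l \<theta>b)"
  shows "field_meas J (level l \<theta>a \<theta>b)"
  unfolding field_meas_def level_def Let_def
  by (intro bvec_comp diffF_comp field_comp[OF V(1)] field_comp[OF V(2)] Rt_comp[OF \<theta>(3)] Dt_comp[OF \<theta>]
      borel_measurable_add borel_measurable_scaleR borel_measurable_const
      measurable_compose[OF measurable_fst fst_borel] measurable_compose[OF measurable_fst snd_borel] measurable_snd)

lemma terminal_meas:
  assumes "\<theta> \<in> Theta" "Inl \<theta> \<in> J"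
  shows "field_meas J (terminal \<theta>)"
  unfolding field_meas_def terminal_def
  by (intro gvec_comp borel_measurable_diff Wc_comp[OF assms] borel_measurable_const
      measurable_compose[OF measurable_fst fst_borel] measurable_compose[OF measurable_fst snd_borel] measurable_snd)

lemma field_mono: "field_meas J A \<Longrightarrow> J \<subseteq> J' \<Longrightarrow> field_meas J' A"
  unfolding field_meas_def
proof (erule measurable_from_subalg[rotated])
  assume J: "J \<subseteq> J'"
  show "subalgebra (borel \<Otimes>\<^sub>M sigma_of J') (borel \<Otimes>\<^sub>M sigma_of J)"
    unfolding subalgebra_def
  proof
    show "sets (borel \<Otimes>\<^sub>M sigma_of J) \<subseteq> sets (borel \<Otimes>\<^sub>M sigma_of J')"
      using sigma_of_mono[OF J] unfolding subalgebra_def by (intro sets_pair_in_sets) auto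
  qed (simp add: space_pair_measure)
qed

text \<open>The recursion only ever appends to the tuple, so proper extensions suffice. The inputs
  at \<theta> itself stay free to produce the random point of the enclosing level, independently of
  the nested estimator.\<close>

lemma V_meas: "\<theta> \<in> Theta \<Longrightarrow> field_meas (Ext \<theta>) (V n \<theta>)"
proof (induction n arbitrary: \<theta> rule: less_induct)
  case (less n)
  show ?case
  proof (cases "n = 0")
    case True
    thus ?thesis by (simp add: V_0 field_meas_def)
  next
    case False
    have S: "field_meas (Ext \<theta>) (\<lambda>t x. summand n \<theta> t x k)" if k: "k \<in> Keys n" for k
    proof (cases k)
      case (Inl i)
      have "field_meas (Ext \<theta>) (terminal (\<theta> @ [0, - int i]))"
        by (intro terminal_meas) (auto simp: Ext_def)
      thus ?thesis unfolding Inl summand_def field_meas_def by simp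
    next
      case (Inr li)
      then obtain l i where li: "k = Inr (l, i)" by (cases li) auto
      hence l: "l < n" using k by (auto simp: Keys_def)
      have "field_meas (Ext \<theta>) (V l (\<theta> @ [int l, int i]))"
        by (rule field_mono[OF less.IH[OF l]]) (auto simp: Ext_def)
      moreover have "field_meas (Ext \<theta>) (prevV l (\<theta> @ [- int l, int i]))"
      proof (cases "l \<ge> 1")
        case True
        have "field_meas (Ext \<theta>) (V (l - 1) (\<theta> @ [- int l, int i]))"
          by (rule field_mono[OF less.IH]) (use l in \<open>auto simp: Ext_def\<close>)
        thus ?thesis using True by (simp add: field_meas_def prevV_def)
      qed (simp add: field_meas_def prevV_def)
      ultimately have "field_meas (Ext \<theta>) (level l (\<theta> @ [int l, int i]) (\<theta> @ [- int l, int i]))"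
        by (intro level_meas) (auto simp: Ext_def)
      thus ?thesis unfolding li summand_def field_meas_def by simp
    qed
    have "(\<lambda>q. (g (snd (fst q)), 0) + (\<Sum>k\<in>Keys n. summand n \<theta> (fst (fst q)) (snd (fst q)) k (snd q))) \<in> borel_measurable (borel \<Otimes>\<^sub>M sigma_of (Ext \<theta>))"
      by (intro borel_measurable_add borel_measurable_sum borel_measurable_Pair borel_measurable_const
          measurable_compose[OF _ g_meas] measurable_compose[OF measurable_fst snd_borel] S[unfolded field_meas_def])
    thus ?thesis unfolding field_meas_def V_rec[OF False] .
  qed
qed

lemma prevV_meas: "\<theta> \<in> Theta \<Longrightarrow> field_meas (if l \<ge> 1 then Ext \<theta> else {}) (prevV l \<theta>)"
  using V_meas[of \<theta> "l - 1"] by (simp add: field_meas_def prevV_def)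

lemma summand_meas:
  assumes k: "k \<in> Keys n"
  shows "summand n \<theta> t x k \<in> borel_measurable (sigma_of (Dom \<theta> k))"
proof (cases k)
  case (Inl i)
  have "field_meas (Dom \<theta> k) (terminal (\<theta> @ [0, - int i]))"
    using Sub_self by (intro terminal_meas) (auto simp: Dom_def Inl)
  from field_slice[OF this] show ?thesis unfolding Inl summand_def by simp
next
  case (Inr li)
  then obtain l i where li: "k = Inr (l, i)" by (cases li) auto
  have "field_meas (Dom \<theta> k) (V l (\<theta> @ [int l, int i]))"
    using Ext_Sub by (intro field_mono[OF V_meas]) (auto simp: Dom_def li)
  moreover have "field_meas (Dom \<theta> k) (prevV l (\<theta> @ [- int l, int i]))"
    using Ext_Sub by (intro field_mono[OF prevV_meas]) (auto simp: Dom_def li)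
  ultimately have "field_meas (Dom \<theta> k) (level l (\<theta> @ [int l, int i]) (\<theta> @ [- int l, int i]))"
    using Sub_self by (intro level_meas) (auto simp: Dom_def li)
  from field_slice[OF this] show ?thesis unfolding li summand_def by simp
qed

lemma Dom_Ind: "\<theta> \<in> Theta \<Longrightarrow> Dom \<theta> k \<subseteq> Ind"
  using Dom_Ext Ext_Ind by blast

lemma indep_vars_SA:
  assumes "\<And>k. k \<in> K \<Longrightarrow> J k \<subseteq> Ind" "disjoint_family_on J K" "\<And>k. k \<in> K \<Longrightarrow> X k \<in> measurable (sigma_of (J k)) N"
  shows "indep_vars (\<lambda>_. N) X K"
  unfolding indep_vars_def2
proof (intro conjI ballI)
  show "X k \<in> measurable \<Omega> N" if "k \<in> K" for k
    using sigma_of_measurable_events[OF assms(3)[OF that] assms(1)[OF that]] .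
  show "indep_sets (\<lambda>k. {X k -` A \<inter> space \<Omega> |A. A \<in> sets N}) K"
  proof (rule indep_sets_mono_sets[OF sigma_of_indep_sets[OF assms(1,2)]])
    fix k assume "k \<in> K"
    from measurable_sets[OF assms(3)[OF this]]
    show "{X k -` A \<inter> space \<Omega> |A. A \<in> sets N} \<subseteq> sets (sigma_of (J k))" by auto
  qed auto
qed

lemma summand_indep:
  assumes "\<theta> \<in> Theta" shows "indep_vars (\<lambda>_. borel) (summand n \<theta> t x) (Keys n)"
  by (rule indep_vars_SA[OF Dom_Ind[OF assms] Dom_disjoint summand_meas])

text \<open>Given the random time and increment, both fields are read at a deterministic point, and
  their disjoint inputs make them independent. Hence only one-point laws enter, and no joint law of
  a field at several points.\<close>

lemma sample_law:
  assumes \<theta>: "\<theta> \<in> Theta" and t: "t \<in> {0..<T}"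
    and J: "JA \<subseteq> Ind" "JB \<subseteq> Ind" "JA \<inter> JB = {}" "Inl \<theta> \<notin> JA \<union> JB" "Inr \<theta> \<notin> JA \<union> JB"
    and A: "field_meas JA A" and B: "field_meas JB B"
    and \<psi>: "\<psi> \<in> borel_measurable (borel :: ((real \<times> (real^'d)) \<times> ((real \<times> (real^'d)) \<times> (real \<times> (real^'d)))) measure)"
  shows "(\<integral>\<^sup>+\<omega>. \<psi> ((Rt t \<theta> \<omega>, Dt t \<theta> \<omega>), (A (Rt t \<theta> \<omega>) (Yt x t \<theta> \<omega>) \<omega>, B (Rt t \<theta> \<omega>) (Yt x t \<theta> \<omega>) \<omega>)) \<partial>\<Omega>)
    = (\<integral>\<^sup>+q. ennreal (rho \<alpha> q) * indicator {0<..<1} q *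
        (\<integral>\<^sup>+z. ennreal (gauss ((T - t) * q) z) *
          (\<integral>\<^sup>+a. \<integral>\<^sup>+b. \<psi> ((t + (T - t) * q, z), (a, b)) \<partial>distr \<Omega> borel (B (t + (T - t) * q) (x + \<sigma> *\<^sub>R z))
             \<partial>distr \<Omega> borel (A (t + (T - t) * q) (x + \<sigma> *\<^sub>R z))) \<partial>lborel) \<partial>lborel)"
proof -
  define \<Phi> where "\<Phi> p = \<psi> (fst p, (A (fst (fst p)) (x + \<sigma> *\<^sub>R snd (fst p)) (snd p), B (fst (fst p)) (x + \<sigma> *\<^sub>R snd (fst p)) (snd p)))" for p
  have AB: "field_meas (JA \<union> JB) A" "field_meas (JA \<union> JB) B"
    using field_mono[OF A] field_mono[OF B] by auto
  have "(\<lambda>p. (fst p, (A (fst (fst p)) (x + \<sigma> *\<^sub>R snd (fst p)) (snd p), B (fst (fst p)) (x + \<sigma> *\<^sub>R snd (fst p)) (snd p))))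
     \<in> borel_measurable (borel \<Otimes>\<^sub>M sigma_of (JA \<union> JB))"
    by (intro borel_measurable_Pair field_comp[OF AB(1)] field_comp[OF AB(2)] borel_measurable_add borel_measurable_scaleR
      borel_measurable_const measurable_compose[OF measurable_fst fst_borel] measurable_compose[OF measurable_fst snd_borel] measurable_snd measurable_fst)
  from measurable_compose[OF this \<psi>] have \<Phi>: "\<Phi> \<in> borel_measurable (borel \<Otimes>\<^sub>M sigma_of (JA \<union> JB))"
    unfolding \<Phi>_def[abs_def] .
  \<comment> \<open>At a fixed point the value of \<open>A\<close> is frozen against the inputs of
    \<open>B\<close>, which yields the product of the two one-point laws.\<close>
  have inner: "(\<integral>\<^sup>+\<omega>. \<psi> (rz, (A s y \<omega>, B s y \<omega>)) \<partial>\<Omega>)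
      = (\<integral>\<^sup>+a. \<integral>\<^sup>+b. \<psi> (rz, (a, b)) \<partial>distr \<Omega> borel (B s y) \<partial>distr \<Omega> borel (A s y))" for rz s y
  proof -
    define \<Phi>' where "\<Phi>' p = \<psi> (rz, (fst p, B s y (snd p)))" for p
    have mA: "A s y \<in> borel_measurable (sigma_of JA)" and mB: "B s y \<in> borel_measurable (sigma_of JB)"
      using field_slice A B by auto
    hence mA': "A s y \<in> borel_measurable \<Omega>" and mB': "B s y \<in> borel_measurable \<Omega>"
      using sigma_of_measurable_events J by auto
    have "(\<lambda>p::(real \<times> (real^'d)) \<times> 'w. (rz, (fst p, B s y (snd p)))) \<in> borel_measurable (borel \<Otimes>\<^sub>M sigma_of JB)"
      by (intro borel_measurable_Pair borel_measurable_const measurable_fst measurable_compose[OF measurable_snd mB])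
    from measurable_compose[OF this \<psi>] have \<Phi>': "\<Phi>' \<in> borel_measurable (borel \<Otimes>\<^sub>M sigma_of JB)"
      unfolding \<Phi>'_def[abs_def] .
    have "(\<integral>\<^sup>+\<omega>. \<psi> (rz, (A s y \<omega>, B s y \<omega>)) \<partial>\<Omega>) = (\<integral>\<^sup>+\<omega>. \<Phi>' (A s y \<omega>, \<omega>) \<partial>\<Omega>)"
      by (simp add: \<Phi>'_def)
    also have "\<dots> = (\<integral>\<^sup>+\<omega>'. \<integral>\<^sup>+\<omega>. \<Phi>' (A s y \<omega>', \<omega>) \<partial>\<Omega> \<partial>\<Omega>)"
      by (rule sigma_of_freeze[OF J(1-3) mA \<Phi>'])
    also have "\<dots> = (\<integral>\<^sup>+\<omega>'. \<integral>\<^sup>+b. \<psi> (rz, (A s y \<omega>', b)) \<partial>distr \<Omega> borel (B s y) \<partial>\<Omega>)"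
    proof (intro nn_integral_cong)
      fix \<omega>'
      have "(\<lambda>b::real \<times> (real^'d). (rz, (A s y \<omega>', b))) \<in> borel_measurable borel"
        by (intro borel_measurable_Pair borel_measurable_const measurable_ident_sets[OF refl])
      from measurable_compose[OF this \<psi>]
      show "(\<integral>\<^sup>+\<omega>. \<Phi>' (A s y \<omega>', \<omega>) \<partial>\<Omega>) = (\<integral>\<^sup>+b. \<psi> (rz, (A s y \<omega>', b)) \<partial>distr \<Omega> borel (B s y))"
        by (subst nn_integral_distr[OF mB']) (simp_all add: \<Phi>'_def)
    qed
    also have "\<dots> = (\<integral>\<^sup>+a. \<integral>\<^sup>+b. \<psi> (rz, (a, b)) \<partial>distr \<Omega> borel (B s y) \<partial>distr \<Omega> borel (A s y))"
    proof (rule nn_integral_distr[OF mA', symmetric])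
      interpret PB: prob_space "distr \<Omega> borel (B s y)" by (rule prob_space_distr[OF mB'])
      have "(\<lambda>p::(real \<times> (real^'d)) \<times> (real \<times> (real^'d)). (rz, p)) \<in> borel_measurable borel"
        by (intro borel_measurable_Pair borel_measurable_const measurable_ident_sets[OF refl])
      from measurable_compose[OF this \<psi>] have "(\<lambda>p. \<psi> (rz, p)) \<in> borel_measurable (borel \<Otimes>\<^sub>M borel)"
        by (simp add: borel_prod)
      hence "(\<lambda>p. \<psi> (rz, p)) \<in> borel_measurable (distr \<Omega> borel (A s y) \<Otimes>\<^sub>M distr \<Omega> borel (B s y))"
        by (simp cong: measurable_cong_sets sets_pair_measure_cong)
      from PB.borel_measurable_nn_integral_fst[OF this]
      show "(\<lambda>a. \<integral>\<^sup>+b. \<psi> (rz, (a, b)) \<partial>distr \<Omega> borel (B s y)) \<in> borel_measurable (distr \<Omega> borel (A s y))" .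
    qed
    finally show ?thesis .
  qed
  have "(\<integral>\<^sup>+\<omega>. \<psi> ((Rt t \<theta> \<omega>, Dt t \<theta> \<omega>), (A (Rt t \<theta> \<omega>) (Yt x t \<theta> \<omega>) \<omega>, B (Rt t \<theta> \<omega>) (Yt x t \<theta> \<omega>) \<omega>)) \<partial>\<Omega>)
     = (\<integral>\<^sup>+\<omega>. \<Phi> ((Rt t \<theta> \<omega>, Dt t \<theta> \<omega>), \<omega>) \<partial>\<Omega>)"
    by (simp add: \<Phi>_def)
  also note sample_formula[OF \<theta> t _ _ _ \<Phi>]
  finally show ?thesis using J by (simp add: \<Phi>_def inner)
qed

text \<open>By \<open>sample_law\<close> the tuples matter only through one-point laws, and testing
  with indicators of Borel sets gives equality of the laws of the samples. Only times strictly
  between \<open>t\<close> and \<open>T\<close> are met, which is the range of the induction in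
  \<open>V_law\<close>.\<close>

lemma sample_law_eq:
  fixes A A' B B' :: "real \<Rightarrow> real ^ 'd \<Rightarrow> 'w \<Rightarrow> real \<times> (real ^ 'd)"
    and \<psi> :: "real \<Rightarrow> real ^ 'd \<Rightarrow> real \<times> (real ^ 'd) \<Rightarrow> real \<times> (real ^ 'd) \<Rightarrow> real \<times> (real ^ 'd)"
  assumes t: "t \<in> {0..<T}" and \<theta>: "\<theta> \<in> Theta" "\<theta>' \<in> Theta"
    and J: "JA \<subseteq> Ind" "JB \<subseteq> Ind" "JA \<inter> JB = {}" "Inl \<theta> \<notin> JA \<union> JB" "Inr \<theta> \<notin> JA \<union> JB"
    and J': "JA' \<subseteq> Ind" "JB' \<subseteq> Ind" "JA' \<inter> JB' = {}" "Inl \<theta>' \<notin> JA' \<union> JB'" "Inr \<theta>' \<notin> JA' \<union> JB'"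
    and A: "field_meas JA A" "field_meas JB B" and A': "field_meas JA' A'" "field_meas JB' B'"
    and \<psi>: "(\<lambda>p. \<psi> (fst (fst p)) (snd (fst p)) (fst (snd p)) (snd (snd p))) \<in> borel_measurable borel"
    and eq: "\<And>s y. t < s \<Longrightarrow> s < T \<Longrightarrow> distr \<Omega> borel (A s y) = distr \<Omega> borel (A' s y)"
      "\<And>s y. t < s \<Longrightarrow> s < T \<Longrightarrow> distr \<Omega> borel (B s y) = distr \<Omega> borel (B' s y)"
  shows "distr \<Omega> borel (\<lambda>\<omega>. \<psi> (Rt t \<theta> \<omega>) (Dt t \<theta> \<omega>) (A (Rt t \<theta> \<omega>) (Yt x t \<theta> \<omega>) \<omega>) (B (Rt t \<theta> \<omega>) (Yt x t \<theta> \<omega>) \<omega>))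
    = distr \<Omega> borel (\<lambda>\<omega>. \<psi> (Rt t \<theta>' \<omega>) (Dt t \<theta>' \<omega>) (A' (Rt t \<theta>' \<omega>) (Yt x t \<theta>' \<omega>) \<omega>) (B' (Rt t \<theta>' \<omega>) (Yt x t \<theta>' \<omega>) \<omega>))"
proof (rule distr_eqI_nn_integral)
  have m: "(\<lambda>\<omega>. \<psi> (Rt t \<theta> \<omega>) (Dt t \<theta> \<omega>) (A (Rt t \<theta> \<omega>) (Yt x t \<theta> \<omega>) \<omega>) (B (Rt t \<theta> \<omega>) (Yt x t \<theta> \<omega>) \<omega>)) \<in> borel_measurable \<Omega>"
    if \<theta>: "\<theta> \<in> Theta" and J: "JA \<subseteq> Ind" "JB \<subseteq> Ind" and A: "field_meas JA A" "field_meas JB B" for \<theta> JA JB A B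
  proof (rule sigma_of_measurable_events)
    let ?J = "{Inl \<theta>, Inr \<theta>} \<union> JA \<union> JB"
    show "?J \<subseteq> Ind" using \<theta> J by auto
    have AB: "field_meas ?J A" "field_meas ?J B" by (rule field_mono[OF A(1)], blast) (rule field_mono[OF A(2)], blast)
    have "(\<lambda>\<omega>. ((Rt t \<theta> \<omega>, Dt t \<theta> \<omega>), (A (Rt t \<theta> \<omega>) (Yt x t \<theta> \<omega>) \<omega>, B (Rt t \<theta> \<omega>) (Yt x t \<theta> \<omega>) \<omega>))) \<in> borel_measurable (sigma_of ?J)"
      using \<theta> by (intro borel_measurable_Pair field_comp[OF AB(1)] field_comp[OF AB(2)] Rt_measurable Dt_measurable
          borel_measurable_add borel_measurable_scaleR borel_measurable_const measurable_ident_sets[OF refl]) auto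
    from measurable_compose[OF this \<psi>]
    show "(\<lambda>\<omega>. \<psi> (Rt t \<theta> \<omega>) (Dt t \<theta> \<omega>) (A (Rt t \<theta> \<omega>) (Yt x t \<theta> \<omega>) \<omega>) (B (Rt t \<theta> \<omega>) (Yt x t \<theta> \<omega>) \<omega>)) \<in> borel_measurable (sigma_of ?J)"
      by simp
  qed
  note m1 = m[OF \<theta>(1) J(1,2) A] and m2 = m[OF \<theta>(2) J'(1,2) A']
  show "(\<lambda>\<omega>. \<psi> (Rt t \<theta> \<omega>) (Dt t \<theta> \<omega>) (A (Rt t \<theta> \<omega>) (Yt x t \<theta> \<omega>) \<omega>) (B (Rt t \<theta> \<omega>) (Yt x t \<theta> \<omega>) \<omega>)) \<in> borel_measurable \<Omega>"
    by (rule m1)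
  show "(\<lambda>\<omega>. \<psi> (Rt t \<theta>' \<omega>) (Dt t \<theta>' \<omega>) (A' (Rt t \<theta>' \<omega>) (Yt x t \<theta>' \<omega>) \<omega>) (B' (Rt t \<theta>' \<omega>) (Yt x t \<theta>' \<omega>) \<omega>)) \<in> borel_measurable \<Omega>"
    by (rule m2)
  fix S :: "(real \<times> (real ^ 'd)) set" assume S: "S \<in> sets borel"
  define \<zeta> where "\<zeta> p = (indicator S (\<psi> (fst (fst p)) (snd (fst p)) (fst (snd p)) (snd (snd p))) :: ennreal)" for p
  have \<zeta>: "\<zeta> \<in> borel_measurable borel"
    unfolding \<zeta>_def by (rule measurable_compose[OF \<psi> borel_measurable_indicator[OF S]])
  have "(\<integral>\<^sup>+q. ennreal (rho \<alpha> q) * indicator {0<..<1} q *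
        (\<integral>\<^sup>+z. ennreal (gauss ((T - t) * q) z) *
          (\<integral>\<^sup>+a. \<integral>\<^sup>+b. \<zeta> ((t + (T - t) * q, z), (a, b)) \<partial>distr \<Omega> borel (B (t + (T - t) * q) (x + \<sigma> *\<^sub>R z))
             \<partial>distr \<Omega> borel (A (t + (T - t) * q) (x + \<sigma> *\<^sub>R z))) \<partial>lborel) \<partial>lborel)
   = (\<integral>\<^sup>+q. ennreal (rho \<alpha> q) * indicator {0<..<1} q *
        (\<integral>\<^sup>+z. ennreal (gauss ((T - t) * q) z) *
          (\<integral>\<^sup>+a. \<integral>\<^sup>+b. \<zeta> ((t + (T - t) * q, z), (a, b)) \<partial>distr \<Omega> borel (B' (t + (T - t) * q) (x + \<sigma> *\<^sub>R z))
             \<partial>distr \<Omega> borel (A' (t + (T - t) * q) (x + \<sigma> *\<^sub>R z))) \<partial>lborel) \<partial>lborel)" (is "(\<integral>\<^sup>+q. ?l q \<partial>lborel) = (\<integral>\<^sup>+q. ?r q \<partial>lborel)")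
  proof (intro nn_integral_cong)
    fix q
    show "?l q = ?r q"
    proof (cases "q \<in> {0<..<1::real}")
      case True
      have "0 < (T - t) * q" using True t by simp
      moreover have "(T - t) * q < (T - t) * 1" using True t by (intro mult_strict_left_mono) auto
      ultimately have s: "t < t + (T - t) * q" "t + (T - t) * q < T" by auto
      show ?thesis unfolding eq[OF s] ..
    qed simp
  qed
  thus "(\<integral>\<^sup>+\<omega>. indicator S (\<psi> (Rt t \<theta> \<omega>) (Dt t \<theta> \<omega>) (A (Rt t \<theta> \<omega>) (Yt x t \<theta> \<omega>) \<omega>) (B (Rt t \<theta> \<omega>) (Yt x t \<theta> \<omega>) \<omega>)) \<partial>\<Omega>)
    = (\<integral>\<^sup>+\<omega>. indicator S (\<psi> (Rt t \<theta>' \<omega>) (Dt t \<theta>' \<omega>) (A' (Rt t \<theta>' \<omega>) (Yt x t \<theta>' \<omega>) \<omega>) (B' (Rt t \<theta>' \<omega>) (Yt x t \<theta>' \<omega>) \<omega>)) \<partial>\<Omega>)"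
    using sample_law[OF \<theta>(1) t J A \<zeta>, of x] sample_law[OF \<theta>(2) t J' A' \<zeta>, of x]
    by (simp add: \<zeta>_def)
qed

end

section \<open>Laws and second moments of the samples\<close>

text \<open>Enlarging the interval to the half line and scaling by \<open>c\<close> gives the Gamma
  integral. The decay \<open>c powr (- a)\<close> is the gain that the exponential weight will
  bring.\<close>

lemma nn_integral_powr_exp:
  fixes a c :: real
  assumes a: "0 < a" and c: "0 < c"
  shows "(\<integral>\<^sup>+q. ennreal (q powr (a - 1) * exp (- (c * q))) * indicator {0<..<1} q \<partial>lborel) \<le> ennreal (Gamma a * c powr (- a))"
proof -
  define f where "f s = ennreal (s powr (a - 1) / exp s) * indicator {0..} s" for s :: real
  have fm: "f \<in> borel_measurable borel" unfolding f_def by measurable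
  have "ennreal (Gamma a) = (\<integral>\<^sup>+s. f s \<partial>lborel)"
    unfolding f_def by (rule nn_integral_has_integral_lebesgue'[symmetric, OF _ Gamma_integral_real[OF a]]) simp
  also have "\<dots> = ennreal c * (\<integral>\<^sup>+q. f (0 + c * q) \<partial>lborel)"
    using nn_integral_real_affine[OF fm, of c 0] c by simp
  also have "\<dots> = (\<integral>\<^sup>+q. ennreal c * f (c * q) \<partial>lborel)"
    using fm by (subst nn_integral_cmult) auto
  finally have G: "ennreal (Gamma a) = (\<integral>\<^sup>+q. ennreal c * f (c * q) \<partial>lborel)" .
  have "(\<integral>\<^sup>+q. ennreal (q powr (a - 1) * exp (- (c * q))) * indicator {0<..<1} q \<partial>lborel)
     \<le> (\<integral>\<^sup>+q. ennreal (c powr (- a)) * (ennreal c * f (c * q)) \<partial>lborel)"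
  proof (intro nn_integral_mono)
    fix q :: real
    show "ennreal (q powr (a - 1) * exp (- (c * q))) * indicator {0<..<1} q \<le> ennreal (c powr (- a)) * (ennreal c * f (c * q))"
    proof (cases "q \<in> {0<..<1}")
      case True
      have "c powr (- a) * (c * ((c * q) powr (a - 1) / exp (c * q))) = (c powr (- a) * c powr 1 * c powr (a - 1)) * (q powr (a - 1) / exp (c * q))"
        using True c by (simp add: powr_mult)
      also have "c powr (- a) * c powr 1 * c powr (a - 1) = 1"
        using c unfolding powr_add[symmetric] by simp
      finally have "c powr (- a) * (c * ((c * q) powr (a - 1) / exp (c * q))) = q powr (a - 1) * exp (- (c * q))"
        by (simp add: exp_minus divide_inverse)
      thus ?thesis using True c by (simp add: f_def ennreal_mult[symmetric])
    qed simp
  qed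
  also have "\<dots> = ennreal (c powr (- a)) * ennreal (Gamma a)"
    unfolding G using fm by (subst nn_integral_cmult) auto
  also have "\<dots> = ennreal (Gamma a * c powr (- a))"
    using Gamma_real_pos[OF a] by (simp add: ennreal_mult[symmetric] mult.commute)
  finally show ?thesis .
qed

context mlp_est begin

text \<open>On level 0 the tuples ending in \<open>int l\<close> and in \<open>- int l\<close>
  coincide. No previous estimator occurs there, and the empty set keeps the two domains
  disjoint.\<close>

definition JB :: "nat \<Rightarrow> int list \<Rightarrow> (int list + int list) set" where
  "JB l \<theta> = (if l \<ge> 1 then Ext \<theta> else {})"

lemma level_domains:
  shows "Ext (\<theta> @ [int l, int i]) \<inter> JB l (\<theta> @ [- int l, int i]) = {}"
    "Inl (\<theta> @ [int l, int i]) \<notin> Ext (\<theta> @ [int l, int i]) \<union> JB l (\<theta> @ [- int l, int i])"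
    "Inr (\<theta> @ [int l, int i]) \<notin> Ext (\<theta> @ [int l, int i]) \<union> JB l (\<theta> @ [- int l, int i])"
    "Ext (\<theta> @ [int l, int i]) \<subseteq> Ind" "JB l (\<theta> @ [- int l, int i]) \<subseteq> Ind"
  using Ext_Ind[OF Theta_append] by (auto simp: JB_def Ext_def split: if_splits)

lemma prevV_field: "\<theta> \<in> Theta \<Longrightarrow> field_meas (JB l \<theta>) (prevV l \<theta>)"
  using prevV_meas unfolding JB_def .

lemma terminal_nn_integral:
  assumes "\<theta> \<in> Theta" "t \<in> {0..<T}" and h: "h \<in> borel_measurable borel"
  shows "(\<integral>\<^sup>+\<omega>. h (terminal \<theta> t x \<omega>) \<partial>\<Omega>) = (\<integral>\<^sup>+z. ennreal (gauss (T - t) z) * h (gvec t x z) \<partial>lborel)"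
proof -
  have "distributed \<Omega> lborel (\<lambda>\<omega>. Wc \<theta> T \<omega> - Wc \<theta> t \<omega>) (\<lambda>y. ennreal (gauss (T - t) y))"
    using assms by (intro Wc_increment_distributed) auto
  moreover have "(\<lambda>z. h (gvec t x z)) \<in> borel_measurable lborel"
    by (rule measurable_compose[OF _ h]) (simp, intro gvec_comp borel_measurable_const measurable_ident_sets[OF refl])
  ultimately show ?thesis unfolding terminal_def by (rule distributed_nn_integral[symmetric])
qed

lemma terminal_random: "\<theta> \<in> Theta \<Longrightarrow> terminal \<theta> t x \<in> borel_measurable \<Omega>"
  by (rule sigma_of_measurable_events[OF field_slice[OF terminal_meas[of \<theta> "{Inl \<theta>}"]]]) auto

lemma distr_scaleR:
  fixes X Y :: "'w \<Rightarrow> real \<times> (real ^ 'd)"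
  assumes "distr \<Omega> borel X = distr \<Omega> borel Y" "X \<in> borel_measurable \<Omega>" "Y \<in> borel_measurable \<Omega>"
  shows "distr \<Omega> borel (\<lambda>\<omega>. c *\<^sub>R X \<omega>) = distr \<Omega> borel (\<lambda>\<omega>. c *\<^sub>R Y \<omega>)"
proof -
  have m: "(\<lambda>v. c *\<^sub>R v) \<in> borel_measurable (borel :: (real \<times> (real ^ 'd)) measure)" by measurable
  have "distr \<Omega> borel (\<lambda>\<omega>. c *\<^sub>R Z \<omega>) = distr (distr \<Omega> borel Z) borel (\<lambda>v. c *\<^sub>R v)"
    if "Z \<in> borel_measurable \<Omega>" for Z :: "'w \<Rightarrow> real \<times> (real ^ 'd)"
    using distr_distr[OF m that] by (simp add: o_def)
  thus ?thesis using assms by simp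
qed

lemma terminal_law:
  assumes "\<theta> \<in> Theta" "\<theta>' \<in> Theta" "t \<in> {0..<T}"
  shows "distr \<Omega> borel (terminal \<theta> t x) = distr \<Omega> borel (terminal \<theta>' t x)"
  using assms
  by (intro distr_eqI_nn_integral terminal_random) (simp_all add: terminal_nn_integral borel_measurable_indicator)

lemma V_random: "\<theta> \<in> Theta \<Longrightarrow> V n \<theta> t x \<in> borel_measurable \<Omega>"
  by (rule sigma_of_measurable_events[OF field_slice[OF V_meas] Ext_Ind])

lemma level_random:
  assumes "\<theta>a \<in> Theta" "\<theta>b \<in> Theta"
  shows "level l \<theta>a \<theta>b t x \<in> borel_measurable \<Omega>"
proof -
  have "field_meas Ind (level l \<theta>a \<theta>b)"
    using assms Ext_Ind
    by (intro level_meas field_mono[OF V_meas] field_mono[OF prevV_field]) (auto simp: JB_def)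
  from sigma_of_measurable_events[OF field_slice[OF this]] show ?thesis by simp
qed

lemma level_fun: "level l \<theta>a \<theta>b t x = (\<lambda>\<omega>. bvec t (diffF l (V l \<theta>a (Rt t \<theta>a \<omega>) (Yt x t \<theta>a \<omega>) \<omega>)
     (prevV l \<theta>b (Rt t \<theta>a \<omega>) (Yt x t \<theta>a \<omega>) \<omega>) (Rt t \<theta>a \<omega>) (Yt x t \<theta>a \<omega>)) (Rt t \<theta>a \<omega>) (Dt t \<theta>a \<omega>))"
  by (simp add: level_def Let_def fun_eq_iff)

text \<open>Lower estimators determine the laws of the summands through their own laws, and
  independence passes the equality on to the sum. It will let the second half of one level cancel
  the first half of the level below in the mean.\<close>

lemma V_law:
  assumes "\<theta> \<in> Theta" "\<theta>' \<in> Theta" "t \<in> {0..<T}"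
  shows "distr \<Omega> borel (V n \<theta> t x) = distr \<Omega> borel (V n \<theta>' t x)"
  using assms
proof (induction n arbitrary: \<theta> \<theta>' t x rule: less_induct)
  case (less n)
  show ?case
  proof (cases "n = 0")
    case True
    thus ?thesis by (simp add: V_0[abs_def])
  next
    case False
    have "distr \<Omega> borel (\<lambda>\<omega>. (g x, 0) + (\<Sum>k\<in>Keys n. summand n \<theta> t x k \<omega>))
      = distr \<Omega> borel (\<lambda>\<omega>. (g x, 0) + (\<Sum>k\<in>Keys n. summand n \<theta>' t x k \<omega>))"
    proof (intro distr_sum_indep_eq Keys_finite Keys_nonempty summand_indep less.prems)
      fix k assume k: "k \<in> Keys n"
      show "distr \<Omega> borel (summand n \<theta> t x k) = distr \<Omega> borel (summand n \<theta>' t x k)"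
      proof (cases k)
        case (Inl i)
        show ?thesis unfolding Inl summand_def sum.case
          by (intro distr_scaleR terminal_law terminal_random) (use less.prems in auto)
      next
        case (Inr li)
        then obtain l i where li: "k = Inr (l, i)" by (cases li) auto
        hence l: "l < n" using k by (auto simp: Keys_def)
        show ?thesis unfolding li summand_def sum.case prod.case
        proof (intro distr_scaleR level_random)
          have pv: "distr \<Omega> borel (prevV l \<theta>1 s y) = distr \<Omega> borel (prevV l \<theta>2 s y)"
            if "\<theta>1 \<in> Theta" "\<theta>2 \<in> Theta" "s \<in> {0..<T}" for \<theta>1 \<theta>2 s y
            using less.IH[of "l - 1" \<theta>1 \<theta>2 s y] l that by (cases "l \<ge> 1") (auto simp: prevV_def[abs_def])
          have meas: "(\<lambda>p. bvec t (diffF l (fst (snd p)) (snd (snd p)) (fst (fst p)) (x + \<sigma> *\<^sub>R snd (fst p))) (fst (fst p)) (snd (fst p)))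
              \<in> borel_measurable (borel :: ((real \<times> (real^'d)) \<times> ((real \<times> (real^'d)) \<times> (real \<times> (real^'d)))) measure)"
            by (intro bvec_comp diffF_comp borel_measurable_add borel_measurable_scaleR borel_measurable_const
                measurable_compose[OF fst_borel fst_borel] measurable_compose[OF fst_borel snd_borel]
                measurable_compose[OF snd_borel fst_borel] measurable_compose[OF snd_borel snd_borel])
          show "distr \<Omega> borel (level l (\<theta> @ [int l, int i]) (\<theta> @ [- int l, int i]) t x)
             = distr \<Omega> borel (level l (\<theta>' @ [int l, int i]) (\<theta>' @ [- int l, int i]) t x)"
            unfolding level_fun
            by (rule sample_law_eq[where \<psi>="\<lambda>r z a b. bvec t (diffF l a b r (x + \<sigma> *\<^sub>R z)) r z",
                  OF less.prems(3) Theta_append Theta_append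
                  level_domains(4,5,1,2,3) level_domains(4,5,1,2,3) V_meas[OF Theta_append] prevV_field[OF Theta_append]
                  V_meas[OF Theta_append] prevV_field[OF Theta_append] meas])
               (use less.prems l in \<open>auto intro!: less.IH pv\<close>)
        qed auto
      qed
    qed
    thus ?thesis using V_rec[OF False, of \<theta>] V_rec[OF False, of \<theta>'] by (simp add: fun_eq_iff)
  qed
qed

text \<open>One half of a level sample. The tuple \<open>\<theta>s\<close> of the random point and
  the tuple \<open>\<theta>a\<close> of the nested estimator are separate because the second half
  reuses the point of the first with an estimator on other inputs.\<close>

definition single :: "nat \<Rightarrow> int list \<Rightarrow> int list \<Rightarrow> real \<Rightarrow> real ^ 'd \<Rightarrow> 'w \<Rightarrow> real \<times> (real ^ 'd)" where
  "single l \<theta>s \<theta>a t x \<omega> = bvec t (F (V l \<theta>a (Rt t \<theta>s \<omega>) (Yt x t \<theta>s \<omega>) \<omega>) (Rt t \<theta>s \<omega>) (Yt x t \<theta>s \<omega>)) (Rt t \<theta>s \<omega>) (Dt t \<theta>s \<omega>)"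

lemma single_random:
  assumes "\<theta>s \<in> Theta" "\<theta>a \<in> Theta"
  shows "single l \<theta>s \<theta>a t x \<in> borel_measurable \<Omega>"
proof -
  have 1: "field_meas Ind (V l \<theta>a)" by (rule field_mono[OF V_meas[OF assms(2)] Ext_Ind[OF assms(2)]])
  have \<theta>: "\<theta>s \<in> Theta" "Inl \<theta>s \<in> Ind" "Inr \<theta>s \<in> Ind" using assms by auto
  have "(\<lambda>\<omega>. single l \<theta>s \<theta>a t x \<omega>) \<in> borel_measurable (sigma_of Ind)"
    unfolding single_def
    by (intro bvec_comp F_comp field_comp[OF 1] Rt_measurable Dt_measurable borel_measurable_add borel_measurable_scaleR
       borel_measurable_const measurable_ident_sets[OF refl] \<theta>)
  thus ?thesis by (rule sigma_of_measurable_events) simp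
qed

lemma single_law:
  assumes t: "t \<in> {0..<T}" and \<theta>: "\<theta>s \<in> Theta" "\<theta>a \<in> Theta" "Inl \<theta>s \<notin> Ext \<theta>a" "Inr \<theta>s \<notin> Ext \<theta>a"
    and \<theta>': "\<theta>s' \<in> Theta" "\<theta>a' \<in> Theta" "Inl \<theta>s' \<notin> Ext \<theta>a'" "Inr \<theta>s' \<notin> Ext \<theta>a'"
  shows "distr \<Omega> borel (single l \<theta>s \<theta>a t x) = distr \<Omega> borel (single l \<theta>s' \<theta>a' t x)"
proof -
  have meas: "(\<lambda>p. bvec t (F (fst (snd p)) (fst (fst p)) (x + \<sigma> *\<^sub>R snd (fst p))) (fst (fst p)) (snd (fst p)))
      \<in> borel_measurable (borel :: ((real \<times> (real^'d)) \<times> ((real \<times> (real^'d)) \<times> (real \<times> (real^'d)))) measure)"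
    by (intro bvec_comp F_comp borel_measurable_add borel_measurable_scaleR borel_measurable_const
        measurable_compose[OF fst_borel fst_borel] measurable_compose[OF fst_borel snd_borel]
        measurable_compose[OF snd_borel fst_borel] measurable_compose[OF snd_borel snd_borel])
  show ?thesis unfolding single_def[abs_def]
    \<comment> \<open>The second field is the constant 0, which depends on no inputs.\<close>
    by (rule sample_law_eq[where \<psi>="\<lambda>r z a b. bvec t (F a r (x + \<sigma> *\<^sub>R z)) r z" and JB="{}" and JB'="{}" and JA="Ext \<theta>a" and JA'="Ext \<theta>a'"
        and B="\<lambda>_ _ _. 0" and B'="\<lambda>_ _ _. 0",
        OF t \<theta>(1) \<theta>'(1) Ext_Ind[OF \<theta>(2)] _ _ _ _ Ext_Ind[OF \<theta>'(2)] _ _ _ _ V_meas[OF \<theta>(2)] field_const V_meas[OF \<theta>'(2)] field_const meas])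
      (use \<theta> \<theta>' t in \<open>auto intro!: V_law\<close>)
qed

lemma integral_distr_eq:
  fixes X Y :: "'w \<Rightarrow> real \<times> (real ^ 'd)"
  assumes "distr \<Omega> borel X = distr \<Omega> borel Y" "X \<in> borel_measurable \<Omega>" "Y \<in> borel_measurable \<Omega>"
  shows "(\<integral>\<omega>. X \<omega> \<partial>\<Omega>) = (\<integral>\<omega>. Y \<omega> \<partial>\<Omega>)"
  using integral_distr[OF assms(2), of "\<lambda>v. v"] integral_distr[OF assms(3), of "\<lambda>v. v"] assms(1) by simp

lemma bvec_norm: "(norm (bvec t c r z))\<^sup>2 = c\<^sup>2 * (norm (bvec t 1 r z))\<^sup>2"
  by (simp add: bvec_def power_mult_distrib power_divide del: scaleR_Pair)

lemma bvec_norm1: "(norm (bvec t 1 r z))\<^sup>2 = (1 / varrho \<alpha> T t r)\<^sup>2 * (1 + (norm z)\<^sup>2 / (r - t)\<^sup>2)"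
proof -
  have "(norm (1::real, (1 / (r - t)) *\<^sub>R z))\<^sup>2 = 1 + (norm z)\<^sup>2 / (r - t)\<^sup>2"
    by (simp add: norm_prod_def power_mult_distrib power_divide)
  thus ?thesis by (simp add: bvec_def power_mult_distrib power_divide del: scaleR_Pair)
qed

lemma bvec_diff: "bvec t (a - b) r z = bvec t a r z - bvec t b r z"
  by (simp add: bvec_def diff_divide_distrib scaleR_diff_left)

text \<open>With \<tau> = T - t and time t + \<tau> q, the density cancels one of the two divisions
  by \<open>varrho\<close>, which leaves (\<tau>^2 q^\<alpha> + d \<tau> q^(\<alpha>-1)) / (1 -
  \<alpha>). The Gamma factor is that of \<open>nn_integral_powr_exp\<close>, which also brings in
  \<open>\<tau> powr (- \<alpha>)\<close>; \<tau> is finally replaced by \<open>T\<close>.\<close>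

definition kernel_const :: real where
  "kernel_const = (T powr (2 - \<alpha>) + real CARD('d) * T powr (1 - \<alpha>)) * Gamma \<alpha> / (1 - \<alpha>)"

lemma kernel_const_nonneg: "0 \<le> kernel_const"
  using alpha Gamma_real_pos[OF alpha(1)] by (simp add: kernel_const_def)

lemma gauss_bvec:
  assumes \<tau>: "0 < r - t"
  shows "(\<integral>\<^sup>+z. ennreal (gauss (r - t) z) * ennreal ((norm (bvec t 1 r z))\<^sup>2) \<partial>lborel)
     = ennreal ((1 / varrho \<alpha> T t r)\<^sup>2 * (1 + real CARD('d) / (r - t)))"
proof -
  define w where "w = (1 / varrho \<alpha> T t r)\<^sup>2"
  have w: "0 \<le> w" by (simp add: w_def)
  have "(\<integral>\<^sup>+z. ennreal (gauss (r - t) z) * ennreal ((norm (bvec t 1 r z))\<^sup>2) \<partial>lborel)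
    = (\<integral>\<^sup>+z. ennreal w * ennreal (gauss (r - t) (z::real^'d)) + ennreal (w / (r - t)\<^sup>2) * ennreal ((norm z)\<^sup>2 * gauss (r - t) z) \<partial>lborel)"
    unfolding bvec_norm1 w_def[symmetric]
    using w by (intro nn_integral_cong)
      (simp add: gauss_nonneg ennreal_mult[symmetric] ennreal_plus[symmetric] algebra_simps del: ennreal_plus)
  also have "\<dots> = ennreal w + ennreal (w / (r - t)\<^sup>2) * ennreal (real CARD('d) * (r - t))"
    by (subst nn_integral_add, simp, simp, subst nn_integral_cmult, simp, subst nn_integral_cmult, simp)
       (simp add: gauss_nn_integral[OF \<tau>] gauss_norm_moment2[OF \<tau>])
  also have "\<dots> = ennreal (w * (1 + real CARD('d) / (r - t)))"
  proof -
    have "w / (r - t)\<^sup>2 * (real CARD('d) * (r - t)) = w * (real CARD('d) / (r - t))"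
      using \<tau> by (simp add: power2_eq_square)
    thus ?thesis using w \<tau> by (simp add: ennreal_mult[symmetric] ennreal_plus[symmetric] distrib_left del: ennreal_plus)
  qed
  finally show ?thesis unfolding w_def .
qed

text \<open>The bound \<open>bd\<close> is uniform in space, so field and weight separate once the
  sample is frozen. Integrating the exponential against the singular kernel gains
  \<open>\<kappa> powr (- \<alpha>)\<close> and reproduces the same exponential at time
  \<open>t\<close>, ready for the next application.\<close>

lemma kernel_bound:
  assumes \<theta>: "\<theta> \<in> Theta" and t: "t \<in> {0..<T}" and \<kappa>: "0 < \<kappa>" and a: "0 \<le> a"
    and J: "J \<subseteq> Ind" "Inl \<theta> \<notin> J" "Inr \<theta> \<notin> J"
    and \<Phi>: "\<Phi> \<in> borel_measurable (borel \<Otimes>\<^sub>M sigma_of J)"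
    and bd: "\<And>s y. t < s \<Longrightarrow> s < T \<Longrightarrow> (\<integral>\<^sup>+\<omega>. \<Phi> ((s, y), \<omega>) \<partial>\<Omega>) \<le> ennreal (a * exp (\<kappa> * (T - s)))"
  shows "(\<integral>\<^sup>+\<omega>. \<Phi> ((Rt t \<theta> \<omega>, Yt x t \<theta> \<omega>), \<omega>) * ennreal ((norm (bvec t 1 (Rt t \<theta> \<omega>) (Dt t \<theta> \<omega>)))\<^sup>2) \<partial>\<Omega>)
    \<le> ennreal (kernel_const * \<kappa> powr (- \<alpha>) * a * exp (\<kappa> * (T - t)))"
proof -
  define \<tau> where "\<tau> = T - t"
  have \<tau>: "0 < \<tau>" "\<tau> \<le> T" using t by (auto simp: \<tau>_def)
  define \<Phi>' where "\<Phi>' p = \<Phi> ((fst (fst p), x + \<sigma> *\<^sub>R snd (fst p)), snd p) * ennreal ((norm (bvec t 1 (fst (fst p)) (snd (fst p))))\<^sup>2)" for p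
  have m1: "(\<lambda>p::(real \<times> (real^'d)) \<times> 'w. ((fst (fst p), x + \<sigma> *\<^sub>R snd (fst p)), snd p)) \<in> measurable (borel \<Otimes>\<^sub>M sigma_of J) (borel \<Otimes>\<^sub>M sigma_of J)"
    by (intro measurable_Pair borel_measurable_Pair borel_measurable_add borel_measurable_scaleR borel_measurable_const
      measurable_compose[OF measurable_fst fst_borel] measurable_compose[OF measurable_fst snd_borel] measurable_snd)
  have m2: "(\<lambda>p::(real \<times> (real^'d)) \<times> 'w. bvec t 1 (fst (fst p)) (snd (fst p))) \<in> borel_measurable (borel \<Otimes>\<^sub>M sigma_of J)"
    by (intro bvec_comp borel_measurable_const measurable_compose[OF measurable_fst fst_borel] measurable_compose[OF measurable_fst snd_borel])
  have \<Phi>': "\<Phi>' \<in> borel_measurable (borel \<Otimes>\<^sub>M sigma_of J)"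
    unfolding \<Phi>'_def[abs_def] using measurable_compose[OF m1 \<Phi>] m2 by measurable
  have K: "0 \<le> a * exp (\<kappa> * \<tau>) / (1 - \<alpha>) * (\<tau>\<^sup>2 + real CARD('d) * \<tau>)" using a alpha \<tau> by simp
  have "(\<integral>\<^sup>+\<omega>. \<Phi> ((Rt t \<theta> \<omega>, Yt x t \<theta> \<omega>), \<omega>) * ennreal ((norm (bvec t 1 (Rt t \<theta> \<omega>) (Dt t \<theta> \<omega>)))\<^sup>2) \<partial>\<Omega>)
    = (\<integral>\<^sup>+\<omega>. \<Phi>' ((Rt t \<theta> \<omega>, Dt t \<theta> \<omega>), \<omega>) \<partial>\<Omega>)" by (simp add: \<Phi>'_def)
  also have "\<dots> = (\<integral>\<^sup>+q. ennreal (rho \<alpha> q) * indicator {0<..<1} q *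
        (\<integral>\<^sup>+z. ennreal (gauss (\<tau> * q) z) * (\<integral>\<^sup>+\<omega>. \<Phi>' ((t + \<tau> * q, z), \<omega>) \<partial>\<Omega>) \<partial>lborel) \<partial>lborel)"
    using sample_formula[OF \<theta> t J \<Phi>'] unfolding \<tau>_def .
  also have "\<dots> \<le> (\<integral>\<^sup>+q. ennreal (a * exp (\<kappa> * \<tau>) / (1 - \<alpha>) * (\<tau>\<^sup>2 + real CARD('d) * \<tau>)) * (ennreal (q powr (\<alpha> - 1) * exp (- ((\<kappa> * \<tau>) * q))) * indicator {0<..<1} q) \<partial>lborel)"
  proof (intro nn_integral_mono)
    fix q :: real
    show "ennreal (rho \<alpha> q) * indicator {0<..<1} q *
        (\<integral>\<^sup>+z. ennreal (gauss (\<tau> * q) z) * (\<integral>\<^sup>+\<omega>. \<Phi>' ((t + \<tau> * q, z), \<omega>) \<partial>\<Omega>) \<partial>lborel)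
      \<le> ennreal (a * exp (\<kappa> * \<tau>) / (1 - \<alpha>) * (\<tau>\<^sup>2 + real CARD('d) * \<tau>)) * (ennreal (q powr (\<alpha> - 1) * exp (- ((\<kappa> * \<tau>) * q))) * indicator {0<..<1} q)"
    proof (cases "q \<in> {0<..<1}")
      case True
      hence q: "0 < q" "q < 1" by auto
      define r where "r = t + \<tau> * q"
      have "\<tau> * q < \<tau> * 1" using q \<tau> by (intro mult_strict_left_mono) auto
      moreover have "0 < \<tau> * q" using q \<tau> by simp
      ultimately have r: "t < r" "r < T" "r - t = \<tau> * q" using \<tau>_def unfolding r_def by linarith+
      have "(\<integral>\<^sup>+\<omega>. \<Phi>' ((r, z), \<omega>) \<partial>\<Omega>) \<le> ennreal (a * exp (\<kappa> * (T - r))) * ennreal ((norm (bvec t 1 r z))\<^sup>2)" for z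
      proof -
        have "(\<lambda>\<omega>. \<Phi> ((r, x + \<sigma> *\<^sub>R z), \<omega>)) \<in> borel_measurable (sigma_of J)"
          using \<Phi> by (rule measurable_Pair2) simp
        hence "(\<lambda>\<omega>. \<Phi> ((r, x + \<sigma> *\<^sub>R z), \<omega>)) \<in> borel_measurable \<Omega>" using sigma_of_measurable_events J by blast
        hence "(\<integral>\<^sup>+\<omega>. \<Phi>' ((r, z), \<omega>) \<partial>\<Omega>) = (\<integral>\<^sup>+\<omega>. \<Phi> ((r, x + \<sigma> *\<^sub>R z), \<omega>) \<partial>\<Omega>) * ennreal ((norm (bvec t 1 r z))\<^sup>2)"
          unfolding \<Phi>'_def by (simp add: nn_integral_multc)
        also have "\<dots> \<le> ennreal (a * exp (\<kappa> * (T - r))) * ennreal ((norm (bvec t 1 r z))\<^sup>2)"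
          by (intro mult_right_mono bd r) simp
        finally show ?thesis .
      qed
      hence "(\<integral>\<^sup>+z. ennreal (gauss (\<tau> * q) z) * (\<integral>\<^sup>+\<omega>. \<Phi>' ((r, z), \<omega>) \<partial>\<Omega>) \<partial>lborel)
        \<le> (\<integral>\<^sup>+z. ennreal (a * exp (\<kappa> * (T - r))) * (ennreal (gauss (r - t) z) * ennreal ((norm (bvec t 1 r z))\<^sup>2)) \<partial>lborel)"
        unfolding r(3) by (intro nn_integral_mono) (simp add: mult_left_mono mult.left_commute)
      also have "\<dots> = ennreal (a * exp (\<kappa> * (T - r))) * ennreal ((1 / varrho \<alpha> T t r)\<^sup>2 * (1 + real CARD('d) / (r - t)))"
      proof -
        have "(\<lambda>z. bvec t 1 r z) \<in> borel_measurable borel"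
          by (intro bvec_comp borel_measurable_const measurable_ident_sets[OF refl])
        moreover have "0 < r - t" using r by simp
        ultimately show ?thesis by (subst nn_integral_cmult) (simp_all only: gauss_bvec, measurable)
      qed
      also have "\<dots> = ennreal (a * exp (\<kappa> * (T - r)) * ((1 / varrho \<alpha> T t r)\<^sup>2 * (1 + real CARD('d) / (r - t))))"
        using a by (simp add: ennreal_mult')
      finally have I: "(\<integral>\<^sup>+z. ennreal (gauss (\<tau> * q) z) * (\<integral>\<^sup>+\<omega>. \<Phi>' ((r, z), \<omega>) \<partial>\<Omega>) \<partial>lborel)
         \<le> ennreal (a * exp (\<kappa> * (T - r)) * ((1 / varrho \<alpha> T t r)\<^sup>2 * (1 + real CARD('d) / (r - t))))" .
      have rho: "0 < rho \<alpha> q" using q alpha by (simp add: rho_def)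
      have vr: "varrho \<alpha> T t r = rho \<alpha> q / \<tau>"
        using \<tau> r by (simp add: varrho_def \<tau>_def[symmetric])
      \<comment> \<open>The weight at time \<open>t\<close> is split off; the other factor decays in
        \<open>q\<close> with rate \<open>\<kappa> * \<tau>\<close>.\<close>
      have e: "exp (\<kappa> * (T - r)) = exp (\<kappa> * \<tau>) * exp (- ((\<kappa> * \<tau>) * q))"
        by (simp add: exp_add[symmetric] r_def \<tau>_def algebra_simps)
      have "rho \<alpha> q * (a * exp (\<kappa> * (T - r)) * ((1 / varrho \<alpha> T t r)\<^sup>2 * (1 + real CARD('d) / (r - t))))
         = a * exp (\<kappa> * \<tau>) * exp (- ((\<kappa> * \<tau>) * q)) * ((rho \<alpha> q * (\<tau> / rho \<alpha> q)\<^sup>2) * (1 + real CARD('d) / (\<tau> * q)))"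
        unfolding vr e r(3) by simp
      also have "rho \<alpha> q * (\<tau> / rho \<alpha> q)\<^sup>2 = \<tau>\<^sup>2 * (1 / rho \<alpha> q)" using rho by (simp add: power2_eq_square)
      also have "1 / rho \<alpha> q = q powr \<alpha> / (1 - \<alpha>)" using q alpha by (simp add: rho_def powr_minus field_simps)
      also have "\<tau>\<^sup>2 * (q powr \<alpha> / (1 - \<alpha>)) * (1 + real CARD('d) / (\<tau> * q)) = (\<tau>\<^sup>2 * q powr \<alpha> + real CARD('d) * \<tau> * (q powr \<alpha> / q)) / (1 - \<alpha>)"
        using \<tau> q alpha by (simp add: field_simps power2_eq_square)
      also have "q powr \<alpha> / q = q powr (\<alpha> - 1)" using q by (simp add: powr_diff)
      \<comment> \<open>Since \<open>q < 1\<close>, the value part is absorbed by the more singular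
        gradient part, and a single Gamma integral suffices.\<close>
      also have "a * exp (\<kappa> * \<tau>) * exp (- ((\<kappa> * \<tau>) * q)) * ((\<tau>\<^sup>2 * q powr \<alpha> + real CARD('d) * \<tau> * q powr (\<alpha> - 1)) / (1 - \<alpha>))
         \<le> a * exp (\<kappa> * \<tau>) * exp (- ((\<kappa> * \<tau>) * q)) * ((\<tau>\<^sup>2 * q powr (\<alpha> - 1) + real CARD('d) * \<tau> * q powr (\<alpha> - 1)) / (1 - \<alpha>))"
        using a alpha q by (intro mult_left_mono divide_right_mono add_right_mono powr_mono') auto
      also have "\<dots> = a * exp (\<kappa> * \<tau>) / (1 - \<alpha>) * (\<tau>\<^sup>2 + real CARD('d) * \<tau>) * (q powr (\<alpha> - 1) * exp (- ((\<kappa> * \<tau>) * q)))"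
        by (simp add: algebra_simps add_divide_distrib)
      finally have R: "rho \<alpha> q * (a * exp (\<kappa> * (T - r)) * ((1 / varrho \<alpha> T t r)\<^sup>2 * (1 + real CARD('d) / (r - t))))
         \<le> a * exp (\<kappa> * \<tau>) / (1 - \<alpha>) * (\<tau>\<^sup>2 + real CARD('d) * \<tau>) * (q powr (\<alpha> - 1) * exp (- ((\<kappa> * \<tau>) * q)))" .
      have "ennreal (rho \<alpha> q) * (\<integral>\<^sup>+z. ennreal (gauss (\<tau> * q) z) * (\<integral>\<^sup>+\<omega>. \<Phi>' ((r, z), \<omega>) \<partial>\<Omega>) \<partial>lborel)
         \<le> ennreal (rho \<alpha> q) * ennreal (a * exp (\<kappa> * (T - r)) * ((1 / varrho \<alpha> T t r)\<^sup>2 * (1 + real CARD('d) / (r - t))))"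
        by (intro mult_left_mono I) simp
      also have "\<dots> = ennreal (rho \<alpha> q * (a * exp (\<kappa> * (T - r)) * ((1 / varrho \<alpha> T t r)\<^sup>2 * (1 + real CARD('d) / (r - t)))))"
        using rho by (subst ennreal_mult') auto
      also have "\<dots> \<le> ennreal (a * exp (\<kappa> * \<tau>) / (1 - \<alpha>) * (\<tau>\<^sup>2 + real CARD('d) * \<tau>) * (q powr (\<alpha> - 1) * exp (- ((\<kappa> * \<tau>) * q))))"
        by (rule ennreal_leI[OF R])
      also have "\<dots> = ennreal (a * exp (\<kappa> * \<tau>) / (1 - \<alpha>) * (\<tau>\<^sup>2 + real CARD('d) * \<tau>)) * ennreal (q powr (\<alpha> - 1) * exp (- ((\<kappa> * \<tau>) * q)))"
        by (rule ennreal_mult'[OF K])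
      finally show ?thesis using True unfolding r_def by simp
    qed simp
  qed
  also have "\<dots> = ennreal (a * exp (\<kappa> * \<tau>) / (1 - \<alpha>) * (\<tau>\<^sup>2 + real CARD('d) * \<tau>)) * (\<integral>\<^sup>+q. ennreal (q powr (\<alpha> - 1) * exp (- ((\<kappa> * \<tau>) * q))) * indicator {0<..<1} q \<partial>lborel)"
    by (rule nn_integral_cmult) measurable
  also have "\<dots> \<le> ennreal (a * exp (\<kappa> * \<tau>) / (1 - \<alpha>) * (\<tau>\<^sup>2 + real CARD('d) * \<tau>)) * ennreal (Gamma \<alpha> * (\<kappa> * \<tau>) powr (- \<alpha>))"
    using \<kappa> \<tau> by (intro mult_left_mono nn_integral_powr_exp alpha) auto
  also have "\<dots> = ennreal (a * exp (\<kappa> * \<tau>) / (1 - \<alpha>) * (\<tau>\<^sup>2 + real CARD('d) * \<tau>) * (Gamma \<alpha> * (\<kappa> * \<tau>) powr (- \<alpha>)))"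
    by (rule ennreal_mult'[OF K, symmetric])
  also have "\<dots> \<le> ennreal (kernel_const * \<kappa> powr (- \<alpha>) * a * exp (\<kappa> * (T - t)))"
  proof (rule ennreal_leI)
    have G: "0 < Gamma \<alpha>" by (rule Gamma_real_pos[OF alpha(1)])
    have "(\<tau>\<^sup>2 + real CARD('d) * \<tau>) * \<tau> powr (- \<alpha>) = \<tau> powr (2 - \<alpha>) + real CARD('d) * \<tau> powr (1 - \<alpha>)"
    proof -
      have a1: "\<tau> powr (2 - \<alpha>) = \<tau>\<^sup>2 * \<tau> powr (- \<alpha>)"
        using powr_add[of \<tau> 2 "- \<alpha>"] \<tau> by simp
      have a2: "\<tau> powr (1 - \<alpha>) = \<tau> * \<tau> powr (- \<alpha>)"
        using powr_add[of \<tau> 1 "- \<alpha>"] \<tau> by simp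
      show ?thesis unfolding a1 a2 by (simp only: distrib_right mult.assoc)
    qed
    \<comment> \<open>Both exponents are positive because \<open>\<alpha> < 1\<close>; hence nothing
      blows up as \<open>t\<close> approaches \<open>T\<close>.\<close>
    also have "\<dots> \<le> T powr (2 - \<alpha>) + real CARD('d) * T powr (1 - \<alpha>)"
      using \<tau> alpha by (intro add_mono mult_left_mono powr_mono2) auto
    finally have le: "(\<tau>\<^sup>2 + real CARD('d) * \<tau>) * \<tau> powr (- \<alpha>) \<le> T powr (2 - \<alpha>) + real CARD('d) * T powr (1 - \<alpha>)" .
    have "a * exp (\<kappa> * \<tau>) / (1 - \<alpha>) * (\<tau>\<^sup>2 + real CARD('d) * \<tau>) * (Gamma \<alpha> * (\<kappa> * \<tau>) powr (- \<alpha>))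
       = a * exp (\<kappa> * \<tau>) / (1 - \<alpha>) * Gamma \<alpha> * \<kappa> powr (- \<alpha>) * ((\<tau>\<^sup>2 + real CARD('d) * \<tau>) * \<tau> powr (- \<alpha>))"
    proof -
      have pm: "(\<kappa> * \<tau>) powr (- \<alpha>) = \<kappa> powr (- \<alpha>) * \<tau> powr (- \<alpha>)"
        by (rule powr_mult)
      show ?thesis unfolding pm by (simp only: mult_ac)
    qed
    also have "\<dots> \<le> a * exp (\<kappa> * \<tau>) / (1 - \<alpha>) * Gamma \<alpha> * \<kappa> powr (- \<alpha>) * (T powr (2 - \<alpha>) + real CARD('d) * T powr (1 - \<alpha>))"
      using a alpha G by (intro mult_left_mono le) auto
    also have "\<dots> = kernel_const * \<kappa> powr (- \<alpha>) * a * exp (\<kappa> * (T - t))" by (simp add: kernel_const_def \<tau>_def)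
    finally show "a * exp (\<kappa> * \<tau>) / (1 - \<alpha>) * (\<tau>\<^sup>2 + real CARD('d) * \<tau>) * (Gamma \<alpha> * (\<kappa> * \<tau>) powr (- \<alpha>))
       \<le> kernel_const * \<kappa> powr (- \<alpha>) * a * exp (\<kappa> * (T - t))" .
  qed
  finally show ?thesis .
qed

end

section \<open>Recursion for the mean square error\<close>

text \<open>\<open>E0\<close>, \<open>Eg\<close> and \<open>Eu\<close> will be multiples of the
  surrogate error, \<open>Lc\<close> will not. Error bounds that are quadratic in the first three
  are what brings the squared surrogate error into the final estimate.\<close>

locale mlp_lip = mlp_est \<Omega> T \<alpha> \<sigma> W \<rr> g F M
  for \<Omega> :: "'w measure" and T \<alpha> \<sigma> :: real and W :: "int list \<Rightarrow> real \<Rightarrow> 'w \<Rightarrow> real ^ 'd" and \<rr> g F M +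
  fixes U :: "real \<Rightarrow> real ^ 'd \<Rightarrow> real \<times> (real ^ 'd)" and Lc E0 Eg Eu :: real
  assumes U_meas: "(\<lambda>q. U (fst q) (snd q)) \<in> borel_measurable borel"
    and const_nonneg: "0 \<le> Lc" "0 \<le> E0" "0 \<le> Eg" "0 \<le> Eu"
    and F_lip: "\<And>w w' s y. \<bar>F w s y - F w' s y\<bar> \<le> Lc * norm (w - w')"
    and F_zero: "\<And>s y. \<bar>F 0 s y\<bar> \<le> E0"
    and U_bd: "\<And>s y. s \<in> {0..<T} \<Longrightarrow> norm (U s y) \<le> Eu"
    and g_lip: "\<And>x y. \<bar>g x - g y\<bar> \<le> Eg * norm (x - y)"
begin

text \<open>The squared increment of \<open>g\<close> is at most Eg^2 \<sigma>^2 |z|^2. Multiplied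
  by the weight 1 + |z|^2/\<tau>^2 it requires the moments d \<tau> and 3 d^2 \<tau>^2, and the
  latter cancels the singularity in \<tau>. Subtracting \<open>g x\<close> in the estimator is what
  makes this cancellation possible.\<close>

definition terminal_const :: real where
  "terminal_const = Eg\<^sup>2 * \<sigma>\<^sup>2 * (real CARD('d) * T + 3 * (real CARD('d))\<^sup>2)"

lemma terminal_const_nonneg: "0 \<le> terminal_const" using T_pos by (simp add: terminal_const_def)

lemma terminal_square:
  assumes \<theta>: "\<theta> \<in> Theta" and t: "t \<in> {0..<T}"
  shows "(\<integral>\<^sup>+\<omega>. ennreal ((norm (terminal \<theta> t x \<omega>))\<^sup>2) \<partial>\<Omega>) \<le> ennreal terminal_const"
proof -
  define \<tau> where "\<tau> = T - t"
  have \<tau>: "0 < \<tau>" "\<tau> \<le> T" using t by (auto simp: \<tau>_def)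
  define c where "c = Eg\<^sup>2 * \<sigma>\<^sup>2"
  have c: "0 \<le> c" by (simp add: c_def)
  have pt: "(norm (gvec t x z))\<^sup>2 \<le> c * (norm z)\<^sup>2 + c / \<tau>\<^sup>2 * (norm z)^4" for z
  proof -
    have "\<bar>g (x + \<sigma> *\<^sub>R z) - g x\<bar> \<le> Eg * (\<bar>\<sigma>\<bar> * norm z)" using g_lip[of "x + \<sigma> *\<^sub>R z" x] by simp
    hence "\<bar>g (x + \<sigma> *\<^sub>R z) - g x\<bar>\<^sup>2 \<le> (Eg * (\<bar>\<sigma>\<bar> * norm z))\<^sup>2" by (intro power_mono) auto
    hence g2: "(g (x + \<sigma> *\<^sub>R z) - g x)\<^sup>2 \<le> c * (norm z)\<^sup>2" by (simp add: c_def power_mult_distrib mult.assoc)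
    have n: "(norm (1::real, (1 / \<tau>) *\<^sub>R z))\<^sup>2 = 1 + (norm z)\<^sup>2 / \<tau>\<^sup>2"
      by (simp add: norm_prod_def power_mult_distrib power_divide)
    have "(norm (gvec t x z))\<^sup>2 = (g (x + \<sigma> *\<^sub>R z) - g x)\<^sup>2 * (1 + (norm z)\<^sup>2 / \<tau>\<^sup>2)"
      unfolding gvec_def \<tau>_def[symmetric] norm_scaleR power_mult_distrib n by simp
    also have "\<dots> \<le> c * (norm z)\<^sup>2 * (1 + (norm z)\<^sup>2 / \<tau>\<^sup>2)" by (intro mult_right_mono g2) simp
    also have "\<dots> = c * (norm z)\<^sup>2 + c / \<tau>\<^sup>2 * ((norm z)\<^sup>2 * (norm z)\<^sup>2)" by (simp add: algebra_simps)
    also have "(norm z)\<^sup>2 * (norm z)\<^sup>2 = (norm z)^4" by (simp flip: power_add)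
    finally show ?thesis .
  qed
  have "(\<integral>\<^sup>+\<omega>. ennreal ((norm (terminal \<theta> t x \<omega>))\<^sup>2) \<partial>\<Omega>)
     = (\<integral>\<^sup>+z. ennreal (gauss (T - t) z) * ennreal ((norm (gvec t x z))\<^sup>2) \<partial>lborel)"
    by (rule terminal_nn_integral[OF \<theta> t, where h="\<lambda>v. ennreal ((norm v)\<^sup>2)"]) measurable
  also have "\<dots> \<le> (\<integral>\<^sup>+z. ennreal c * ennreal ((norm z)\<^sup>2 * gauss \<tau> (z::real^'d)) + ennreal (c / \<tau>\<^sup>2) * ennreal ((norm z)^4 * gauss \<tau> z) \<partial>lborel)"
  proof (intro nn_integral_mono)
    fix z :: "real^'d"
    have "gauss \<tau> z * (norm (gvec t x z))\<^sup>2 \<le> gauss \<tau> z * (c * (norm z)\<^sup>2 + c / \<tau>\<^sup>2 * (norm z)^4)"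
      by (intro mult_left_mono pt gauss_nonneg)
    also have "\<dots> = c * ((norm z)\<^sup>2 * gauss \<tau> z) + c / \<tau>\<^sup>2 * ((norm z)^4 * gauss \<tau> z)" by (simp add: algebra_simps)
    finally show "ennreal (gauss (T - t) z) * ennreal ((norm (gvec t x z))\<^sup>2)
      \<le> ennreal c * ennreal ((norm z)\<^sup>2 * gauss \<tau> z) + ennreal (c / \<tau>\<^sup>2) * ennreal ((norm z)^4 * gauss \<tau> z)"
      unfolding \<tau>_def[symmetric] using c
      by (simp add: gauss_nonneg ennreal_mult[symmetric] ennreal_plus[symmetric] del: ennreal_plus)
  qed
  also have "\<dots> = ennreal c * (\<integral>\<^sup>+z. ennreal ((norm z)\<^sup>2 * gauss \<tau> (z::real^'d)) \<partial>lborel) + ennreal (c / \<tau>\<^sup>2) * (\<integral>\<^sup>+z. ennreal ((norm z)^4 * gauss \<tau> (z::real^'d)) \<partial>lborel)"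
    by (subst nn_integral_add, measurable, subst nn_integral_cmult, measurable, subst nn_integral_cmult, measurable)
  also have "\<dots> \<le> ennreal c * ennreal (real CARD('d) * \<tau>) + ennreal (c / \<tau>\<^sup>2) * ennreal (3 * real CARD('d) ^ 2 * \<tau>\<^sup>2)"
    by (intro add_mono mult_left_mono gauss_norm_moment4[OF \<tau>(1)] order.refl) (simp_all add: gauss_norm_moment2[OF \<tau>(1)])
  also have "\<dots> = ennreal (c * (real CARD('d) * \<tau>) + c / \<tau>\<^sup>2 * (3 * real CARD('d) ^ 2 * \<tau>\<^sup>2))"
    using c \<tau> by (simp add: ennreal_mult[symmetric] ennreal_plus[symmetric] del: ennreal_plus)
  also have "\<dots> \<le> ennreal terminal_const"
  proof (rule ennreal_leI)
    have "c / \<tau>\<^sup>2 * (3 * real CARD('d) ^ 2 * \<tau>\<^sup>2) = c * (3 * (real CARD('d))\<^sup>2)" using \<tau> by simp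
    moreover have "c * (real CARD('d) * \<tau>) \<le> c * (real CARD('d) * T)" using c \<tau> by (intro mult_left_mono) auto
    ultimately show "c * (real CARD('d) * \<tau>) + c / \<tau>\<^sup>2 * (3 * real CARD('d) ^ 2 * \<tau>\<^sup>2) \<le> terminal_const"
      unfolding terminal_const_def c_def[symmetric] by (simp add: distrib_left)
  qed
  finally show ?thesis .
qed

lemma U_comp:
  assumes "a \<in> borel_measurable N" "b \<in> borel_measurable N"
  shows "(\<lambda>p. U (a p) (b p)) \<in> borel_measurable N"
  using measurable_compose[OF borel_measurable_Pair[OF assms] U_meas] by simp

text \<open>The sample with the exact vector in place of the nested estimator; its mean is the
  integral term of the fixed-point equation. It shares its random point with
  \<open>single\<close>.\<close>

definition exact :: "int list \<Rightarrow> real \<Rightarrow> real ^ 'd \<Rightarrow> 'w \<Rightarrow> real \<times> (real ^ 'd)" where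
  "exact \<theta> t x \<omega> = bvec t (F (U (Rt t \<theta> \<omega>) (Yt x t \<theta> \<omega>)) (Rt t \<theta> \<omega>) (Yt x t \<theta> \<omega>)) (Rt t \<theta> \<omega>) (Dt t \<theta> \<omega>)"

lemma exact_random:
  assumes \<theta>: "\<theta> \<in> Theta"
  shows "exact \<theta> t x \<in> borel_measurable \<Omega>"
proof -
  have \<theta>': "\<theta> \<in> Theta" "Inl \<theta> \<in> Ind" "Inr \<theta> \<in> Ind" using assms by auto
  have "(\<lambda>\<omega>. exact \<theta> t x \<omega>) \<in> borel_measurable (sigma_of Ind)"
    unfolding exact_def
    by (intro bvec_comp F_comp U_comp Rt_measurable Dt_measurable borel_measurable_add borel_measurable_scaleR
       borel_measurable_const \<theta>')
  thus ?thesis by (rule sigma_of_measurable_events) simp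
qed

lemma exact_integrable:
  assumes \<theta>: "\<theta> \<in> Theta" and t: "t \<in> {0..<T}"
  shows "integrable \<Omega> (exact \<theta> t x)"
proof -
  define a where "a = (E0 + Lc * Eu)\<^sup>2"
  have a: "0 \<le> a" by (simp add: a_def)
  have "(\<integral>\<^sup>+\<omega>. ennreal ((norm (exact \<theta> t x \<omega>))\<^sup>2) \<partial>\<Omega>)
     \<le> (\<integral>\<^sup>+\<omega>. (\<lambda>_. ennreal a) ((Rt t \<theta> \<omega>, Yt x t \<theta> \<omega>), \<omega>) * ennreal ((norm (bvec t 1 (Rt t \<theta> \<omega>) (Dt t \<theta> \<omega>)))\<^sup>2) \<partial>\<Omega>)"
  proof (intro nn_integral_mono)
    fix \<omega> assume \<omega>: "\<omega> \<in> space \<Omega>"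
    define r y where "r = Rt t \<theta> \<omega>" and "y = x + \<sigma> *\<^sub>R Dt t \<theta> \<omega>"
    have r: "r \<in> {0..<T}" using Rt_bounds[OF \<theta> t \<omega>] t by (auto simp: r_def)
    have "\<bar>F (U r y) r y\<bar> \<le> \<bar>F 0 r y\<bar> + \<bar>F (U r y) r y - F 0 r y\<bar>" by simp
    also have "\<dots> \<le> E0 + Lc * norm (U r y - 0)" by (intro add_mono F_zero F_lip)
    also have "\<dots> \<le> E0 + Lc * Eu" using U_bd[OF r, of y] const_nonneg by (intro add_left_mono mult_left_mono) auto
    finally have "\<bar>F (U r y) r y\<bar>\<^sup>2 \<le> (E0 + Lc * Eu)\<^sup>2" by (intro power_mono) auto
    hence "(F (U r y) r y)\<^sup>2 \<le> a" by (simp add: a_def)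
    hence "(norm (exact \<theta> t x \<omega>))\<^sup>2 \<le> a * (norm (bvec t 1 r (Dt t \<theta> \<omega>)))\<^sup>2"
      unfolding exact_def r_def[symmetric] y_def[symmetric] bvec_norm[of t "F (U r y) r y"] by (intro mult_right_mono) auto
    thus "ennreal ((norm (exact \<theta> t x \<omega>))\<^sup>2) \<le> (\<lambda>_. ennreal a) ((Rt t \<theta> \<omega>, Yt x t \<theta> \<omega>), \<omega>) * ennreal ((norm (bvec t 1 (Rt t \<theta> \<omega>) (Dt t \<theta> \<omega>)))\<^sup>2)"
      using a by (simp add: r_def ennreal_mult[symmetric])
  qed
  \<comment> \<open>Only finiteness is at stake here. The field is constant, so its set of inputs is
    empty, and the weight exponent is set to 1.\<close>
  also have "\<dots> \<le> ennreal (kernel_const * 1 powr (- \<alpha>) * a * exp (1 * (T - t)))"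
  proof (rule kernel_bound[OF \<theta> t _ a, where J="{}"])
    show "(\<integral>\<^sup>+ \<omega>. ennreal a \<partial>\<Omega>) \<le> ennreal (a * exp (1 * (T - s)))" if "s < T" for s
    proof -
      have "a * 1 \<le> a * exp (1 * (T - s))" using that a by (intro mult_left_mono) auto
      thus ?thesis by (simp add: emeasure_space_1 ennreal_leI)
    qed
  qed auto
  finally have B: "(\<integral>\<^sup>+\<omega>. ennreal ((norm (exact \<theta> t x \<omega>))\<^sup>2) \<partial>\<Omega>) \<le> ennreal (kernel_const * 1 powr (- \<alpha>) * a * exp (1 * (T - t)))" .
  have nn: "0 \<le> kernel_const * 1 powr (- \<alpha>) * a * exp (1 * (T - t))" using a kernel_const_nonneg by simp
  show ?thesis by (rule square_integrable_bound(1)[OF exact_random[OF \<theta>] B nn])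
qed

text \<open>The weight \<open>exp (\<kappa> * (T - t))\<close> makes the convolution with \<open>(s - t) powr (\<alpha> - 1)\<close> contract by the factor
  \<open>\<kappa> powr (- \<alpha>)\<close>, so no iterated integrals appear in the recursion over the levels.\<close>

definition err_le :: "real \<Rightarrow> nat \<Rightarrow> real \<Rightarrow> bool" where
  "err_le \<kappa> l A \<longleftrightarrow> (\<forall>\<theta>\<in>Theta. \<forall>t\<in>{0..<T}. \<forall>x.
      (\<integral>\<^sup>+\<omega>. ennreal ((norm (V l \<theta> t x \<omega> - U t x))\<^sup>2) \<partial>\<Omega>) \<le> ennreal (A * exp (\<kappa> * (T - t))))"

lemma V_minus_U_meas:
  assumes "field_meas J (V l \<theta>)"
  shows "(\<lambda>p. ennreal ((norm (V l \<theta> (fst (fst p)) (snd (fst p)) (snd p) - U (fst (fst p)) (snd (fst p))))\<^sup>2)) \<in> borel_measurable (borel \<Otimes>\<^sub>M sigma_of J)"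
proof -
  have "(\<lambda>p. V l \<theta> (fst (fst p)) (snd (fst p)) (snd p) - U (fst (fst p)) (snd (fst p))) \<in> borel_measurable (borel \<Otimes>\<^sub>M sigma_of J)"
    using assms unfolding field_meas_def
    by (intro borel_measurable_diff U_comp measurable_compose[OF measurable_fst fst_borel] measurable_compose[OF measurable_fst snd_borel])
  thus ?thesis by measurable
qed

text \<open>Both samples use the same random time and increment, so their difference is the weight
  times a difference of values of \<open>F\<close>, where the Lipschitz bound applies pointwise.
  \<open>kernel_bound\<close> controls its second moment and Jensen's inequality the difference of
  the means.\<close>

lemma single_exact:
  assumes \<kappa>: "0 < \<kappa>" and A: "0 \<le> A" "err_le \<kappa> l A"
    and \<theta>: "\<theta>s \<in> Theta" "\<theta>a \<in> Theta" "Inl \<theta>s \<notin> Ext \<theta>a" "Inr \<theta>s \<notin> Ext \<theta>a" and t: "t \<in> {0..<T}"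
  shows "integrable \<Omega> (single l \<theta>s \<theta>a t x)"
    and "(norm ((\<integral>\<omega>. single l \<theta>s \<theta>a t x \<omega> \<partial>\<Omega>) - (\<integral>\<omega>. exact \<theta>s t x \<omega> \<partial>\<Omega>)))\<^sup>2 \<le> kernel_const * \<kappa> powr (- \<alpha>) * (Lc\<^sup>2 * A) * exp (\<kappa> * (T - t))"
proof -
  define \<Phi> where "\<Phi> p = ennreal (Lc\<^sup>2) * ennreal ((norm (V l \<theta>a (fst (fst p)) (snd (fst p)) (snd p) - U (fst (fst p)) (snd (fst p))))\<^sup>2)" for p
  have \<Phi>: "\<Phi> \<in> borel_measurable (borel \<Otimes>\<^sub>M sigma_of (Ext \<theta>a))"
    unfolding \<Phi>_def[abs_def] by (intro borel_measurable_times_ennreal borel_measurable_const V_minus_U_meas V_meas \<theta>)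
  define X where "X \<omega> = single l \<theta>s \<theta>a t x \<omega> - exact \<theta>s t x \<omega>" for \<omega>
  have X: "X \<in> borel_measurable \<Omega>"
    unfolding X_def[abs_def] by (intro borel_measurable_diff single_random exact_random \<theta>)
  have "(\<integral>\<^sup>+\<omega>. ennreal ((norm (X \<omega>))\<^sup>2) \<partial>\<Omega>)
     \<le> (\<integral>\<^sup>+\<omega>. \<Phi> ((Rt t \<theta>s \<omega>, Yt x t \<theta>s \<omega>), \<omega>) * ennreal ((norm (bvec t 1 (Rt t \<theta>s \<omega>) (Dt t \<theta>s \<omega>)))\<^sup>2) \<partial>\<Omega>)"
  proof (intro nn_integral_mono)
    fix \<omega>
    define r y where "r = Rt t \<theta>s \<omega>" and "y = x + \<sigma> *\<^sub>R Dt t \<theta>s \<omega>"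
    have "X \<omega> = bvec t (F (V l \<theta>a r y \<omega>) r y - F (U r y) r y) r (Dt t \<theta>s \<omega>)"
      by (simp add: X_def single_def exact_def bvec_diff r_def y_def)
    hence "(norm (X \<omega>))\<^sup>2 = (F (V l \<theta>a r y \<omega>) r y - F (U r y) r y)\<^sup>2 * (norm (bvec t 1 r (Dt t \<theta>s \<omega>)))\<^sup>2"
      by (simp only: bvec_norm[of t "F (V l \<theta>a r y \<omega>) r y - F (U r y) r y"])
    also have "\<bar>F (V l \<theta>a r y \<omega>) r y - F (U r y) r y\<bar>\<^sup>2 \<le> (Lc * norm (V l \<theta>a r y \<omega> - U r y))\<^sup>2"
      by (intro power_mono F_lip) auto
    hence "(F (V l \<theta>a r y \<omega>) r y - F (U r y) r y)\<^sup>2 * (norm (bvec t 1 r (Dt t \<theta>s \<omega>)))\<^sup>2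
       \<le> Lc\<^sup>2 * (norm (V l \<theta>a r y \<omega> - U r y))\<^sup>2 * (norm (bvec t 1 r (Dt t \<theta>s \<omega>)))\<^sup>2"
      by (intro mult_right_mono) (auto simp: power_mult_distrib)
    finally have "(norm (X \<omega>))\<^sup>2 \<le> Lc\<^sup>2 * (norm (V l \<theta>a r y \<omega> - U r y))\<^sup>2 * (norm (bvec t 1 r (Dt t \<theta>s \<omega>)))\<^sup>2" .
    thus "ennreal ((norm (X \<omega>))\<^sup>2) \<le> \<Phi> ((Rt t \<theta>s \<omega>, Yt x t \<theta>s \<omega>), \<omega>) * ennreal ((norm (bvec t 1 (Rt t \<theta>s \<omega>) (Dt t \<theta>s \<omega>)))\<^sup>2)"
      by (simp add: \<Phi>_def r_def y_def ennreal_mult[symmetric] ennreal_leI)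
  qed
  also have "\<dots> \<le> ennreal (kernel_const * \<kappa> powr (- \<alpha>) * (Lc\<^sup>2 * A) * exp (\<kappa> * (T - t)))"
  proof (rule kernel_bound[OF \<theta>(1) t \<kappa> _ Ext_Ind[OF \<theta>(2)] \<theta>(3,4) \<Phi>])
    show "0 \<le> Lc\<^sup>2 * A" using A by simp
    fix s y assume s: "t < s" "s < T"
    have m: "(\<lambda>\<omega>. V l \<theta>a s y \<omega> - U s y) \<in> borel_measurable \<Omega>"
      by (intro borel_measurable_diff V_random \<theta> borel_measurable_const)
    have "(\<integral>\<^sup>+\<omega>. \<Phi> ((s, y), \<omega>) \<partial>\<Omega>) = ennreal (Lc\<^sup>2) * (\<integral>\<^sup>+\<omega>. ennreal ((norm (V l \<theta>a s y \<omega> - U s y))\<^sup>2) \<partial>\<Omega>)"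
      unfolding \<Phi>_def fst_conv snd_conv by (rule nn_integral_cmult) (use m in measurable)
    also have "\<dots> \<le> ennreal (Lc\<^sup>2) * ennreal (A * exp (\<kappa> * (T - s)))"
      using A(2) \<theta>(2) s t unfolding err_le_def by (intro mult_left_mono) auto
    also have "\<dots> = ennreal (Lc\<^sup>2 * A * exp (\<kappa> * (T - s)))" using A by (simp add: ennreal_mult[symmetric] mult.assoc)
    finally show "(\<integral>\<^sup>+\<omega>. \<Phi> ((s, y), \<omega>) \<partial>\<Omega>) \<le> ennreal (Lc\<^sup>2 * A * exp (\<kappa> * (T - s)))" .
  qed
  finally have B: "(\<integral>\<^sup>+\<omega>. ennreal ((norm (X \<omega>))\<^sup>2) \<partial>\<Omega>) \<le> ennreal (kernel_const * \<kappa> powr (- \<alpha>) * (Lc\<^sup>2 * A) * exp (\<kappa> * (T - t)))" .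
  have nn: "0 \<le> kernel_const * \<kappa> powr (- \<alpha>) * (Lc\<^sup>2 * A) * exp (\<kappa> * (T - t))" using A kernel_const_nonneg by simp
  note sq = square_integrable_bound[OF X B nn]
  \<comment> \<open>The sample inherits integrability from the difference just estimated and from
    \<open>exact\<close>.\<close>
  have e: "single l \<theta>s \<theta>a t x = (\<lambda>\<omega>. X \<omega> + exact \<theta>s t x \<omega>)" by (simp add: X_def fun_eq_iff)
  show i: "integrable \<Omega> (single l \<theta>s \<theta>a t x)"
    unfolding e by (intro Bochner_Integration.integrable_add sq(1) exact_integrable \<theta> t)
  have "(\<integral>\<omega>. single l \<theta>s \<theta>a t x \<omega> \<partial>\<Omega>) - (\<integral>\<omega>. exact \<theta>s t x \<omega> \<partial>\<Omega>) = (\<integral>\<omega>. X \<omega> \<partial>\<Omega>)"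
    unfolding X_def by (rule Bochner_Integration.integral_diff[symmetric, OF i exact_integrable[OF \<theta>(1) t]])
  thus "(norm ((\<integral>\<omega>. single l \<theta>s \<theta>a t x \<omega> \<partial>\<Omega>) - (\<integral>\<omega>. exact \<theta>s t x \<omega> \<partial>\<Omega>)))\<^sup>2 \<le> kernel_const * \<kappa> powr (- \<alpha>) * (Lc\<^sup>2 * A) * exp (\<kappa> * (T - t))"
    using sq(4) by simp
qed

text \<open>Mean square of the bracket in a level sample, up to the exponential weight. At level 0
  only \<open>F 0\<close> remains; above it the exact vector is inserted between the two estimators,
  and (p + q)^2 is at most 2 (p^2 + q^2).\<close>

definition Blev :: "(nat \<Rightarrow> real) \<Rightarrow> nat \<Rightarrow> real" where
  "Blev A l = (if l = 0 then E0\<^sup>2 else 2 * Lc\<^sup>2 * (A l + A (l - 1)))"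

lemma level_square:
  fixes \<theta> :: "int list" and i l :: nat
  assumes \<kappa>: "0 < \<kappa>" and A: "\<And>j. j \<le> l \<Longrightarrow> 0 \<le> A j" "\<And>j. j \<le> l \<Longrightarrow> err_le \<kappa> j (A j)" and t: "t \<in> {0..<T}"
  defines "\<theta>a \<equiv> \<theta> @ [int l, int i]" and "\<theta>b \<equiv> \<theta> @ [- int l, int i]"
  shows "(\<integral>\<^sup>+\<omega>. ennreal ((norm (level l \<theta>a \<theta>b t x \<omega>))\<^sup>2) \<partial>\<Omega>) \<le> ennreal (kernel_const * \<kappa> powr (- \<alpha>) * Blev A l * exp (\<kappa> * (T - t)))"
proof -
  have \<theta>: "\<theta>a \<in> Theta" "\<theta>b \<in> Theta" by (simp_all add: \<theta>a_def \<theta>b_def)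
  define J where "J = Ext \<theta>a \<union> JB l \<theta>b"
  have J: "J \<subseteq> Ind" "Inl \<theta>a \<notin> J" "Inr \<theta>a \<notin> J"
    using level_domains[where \<theta>=\<theta> and l=l and i=i] by (auto simp: J_def \<theta>a_def \<theta>b_def)
  define \<Phi> where "\<Phi> p = (if l = 0 then ennreal (E0\<^sup>2) else
      ennreal (2 * Lc\<^sup>2) * (ennreal ((norm (V l \<theta>a (fst (fst p)) (snd (fst p)) (snd p) - U (fst (fst p)) (snd (fst p))))\<^sup>2)
        + ennreal ((norm (V (l - 1) \<theta>b (fst (fst p)) (snd (fst p)) (snd p) - U (fst (fst p)) (snd (fst p))))\<^sup>2)))" for p
  have \<Phi>: "\<Phi> \<in> borel_measurable (borel \<Otimes>\<^sub>M sigma_of J)"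
  proof (cases "l = 0")
    case True
    thus ?thesis by (simp add: \<Phi>_def[abs_def])
  next
    case False
    have "field_meas J (V l \<theta>a)" "field_meas J (V (l - 1) \<theta>b)"
      using False by (auto intro!: field_mono[OF V_meas] \<theta> simp: J_def JB_def)
    thus ?thesis using False
      unfolding \<Phi>_def[abs_def] by (simp, intro borel_measurable_times_ennreal borel_measurable_const borel_measurable_add V_minus_U_meas)
  qed
  have "(\<integral>\<^sup>+\<omega>. ennreal ((norm (level l \<theta>a \<theta>b t x \<omega>))\<^sup>2) \<partial>\<Omega>)
     \<le> (\<integral>\<^sup>+\<omega>. \<Phi> ((Rt t \<theta>a \<omega>, Yt x t \<theta>a \<omega>), \<omega>) * ennreal ((norm (bvec t 1 (Rt t \<theta>a \<omega>) (Dt t \<theta>a \<omega>)))\<^sup>2) \<partial>\<Omega>)"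
  proof (intro nn_integral_mono)
    fix \<omega>
    define r y where "r = Rt t \<theta>a \<omega>" and "y = x + \<sigma> *\<^sub>R Dt t \<theta>a \<omega>"
    define c where "c = diffF l (V l \<theta>a r y \<omega>) (prevV l \<theta>b r y \<omega>) r y"
    have "level l \<theta>a \<theta>b t x \<omega> = bvec t c r (Dt t \<theta>a \<omega>)"
      by (simp add: level_def Let_def c_def r_def y_def)
    hence e: "ennreal ((norm (level l \<theta>a \<theta>b t x \<omega>))\<^sup>2) = ennreal (c\<^sup>2) * ennreal ((norm (bvec t 1 r (Dt t \<theta>a \<omega>)))\<^sup>2)"
      using bvec_norm[of t c] by (simp add: ennreal_mult[symmetric])
    have "ennreal (c\<^sup>2) \<le> \<Phi> ((r, y), \<omega>)"
    proof (cases "l = 0")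
      case True
      have "\<bar>c\<bar>\<^sup>2 \<le> E0\<^sup>2" unfolding c_def diffF_def using True by (intro power_mono) (auto simp: V_0 F_zero)
      thus ?thesis using True by (simp add: \<Phi>_def ennreal_leI)
    next
      case False
      define p q where "p = norm (V l \<theta>a r y \<omega> - U r y)" and "q = norm (V (l - 1) \<theta>b r y \<omega> - U r y)"
      have "\<bar>c\<bar> \<le> Lc * norm (V l \<theta>a r y \<omega> - V (l - 1) \<theta>b r y \<omega>)"
        using False F_lip by (simp add: c_def diffF_def prevV_def)
      also have "norm (V l \<theta>a r y \<omega> - V (l - 1) \<theta>b r y \<omega>) \<le> p + q"
        unfolding p_def q_def by (metis norm_minus_commute norm_triangle_le_diff order.refl norm_diff_triangle_ineq norm_diff_triangle_le)
      finally have "\<bar>c\<bar> \<le> Lc * (p + q)" using const_nonneg by (simp add: mult_left_mono)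
      hence "\<bar>c\<bar>\<^sup>2 \<le> (Lc * (p + q))\<^sup>2" by (intro power_mono) auto
      also have "\<dots> = Lc\<^sup>2 * (p + q)\<^sup>2" by (simp add: power_mult_distrib)
      also have "\<dots> \<le> Lc\<^sup>2 * (2 * (p\<^sup>2 + q\<^sup>2))"
      proof (intro mult_left_mono)
        have "0 \<le> (p - q)\<^sup>2" by simp
        thus "(p + q)\<^sup>2 \<le> 2 * (p\<^sup>2 + q\<^sup>2)" by (simp add: power2_eq_square algebra_simps)
      qed simp
      finally have "c\<^sup>2 \<le> 2 * Lc\<^sup>2 * (p\<^sup>2 + q\<^sup>2)" by (simp add: algebra_simps)
      hence "ennreal (c\<^sup>2) \<le> ennreal (2 * Lc\<^sup>2 * (p\<^sup>2 + q\<^sup>2))" by (rule ennreal_leI)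
      also have "\<dots> = ennreal (2 * Lc\<^sup>2) * (ennreal (p\<^sup>2) + ennreal (q\<^sup>2))"
        by (subst ennreal_mult) (auto simp: ennreal_plus)
      finally show ?thesis using False by (simp add: \<Phi>_def p_def q_def)
    qed
    thus "ennreal ((norm (level l \<theta>a \<theta>b t x \<omega>))\<^sup>2) \<le> \<Phi> ((Rt t \<theta>a \<omega>, Yt x t \<theta>a \<omega>), \<omega>) * ennreal ((norm (bvec t 1 (Rt t \<theta>a \<omega>) (Dt t \<theta>a \<omega>)))\<^sup>2)"
      unfolding e r_def[symmetric] y_def[symmetric] by (rule mult_right_mono) simp
  qed
  also have "\<dots> \<le> ennreal (kernel_const * \<kappa> powr (- \<alpha>) * Blev A l * exp (\<kappa> * (T - t)))"
  proof (rule kernel_bound[OF \<theta>(1) t \<kappa> _ J \<Phi>])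
    show "0 \<le> Blev A l" using A(1)[of l] A(1)[of "l - 1"] by (auto simp: Blev_def)
    fix s y assume s: "t < s" "s < T"
    show "(\<integral>\<^sup>+\<omega>. \<Phi> ((s, y), \<omega>) \<partial>\<Omega>) \<le> ennreal (Blev A l * exp (\<kappa> * (T - s)))"
    proof (cases "l = 0")
      case True
      have "E0\<^sup>2 * 1 \<le> E0\<^sup>2 * exp (\<kappa> * (T - s))" using s \<kappa> by (intro mult_left_mono) auto
      thus ?thesis using True by (simp add: \<Phi>_def Blev_def emeasure_space_1 ennreal_leI)
    next
      case False
      have m: "(\<lambda>\<omega>. V j \<theta>' s y \<omega> - U s y) \<in> borel_measurable \<Omega>" if "\<theta>' \<in> Theta" for j \<theta>'
        by (intro borel_measurable_diff V_random that borel_measurable_const)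
      note [measurable] = m[OF \<theta>(1)] m[OF \<theta>(2)]
      have "(\<integral>\<^sup>+\<omega>. \<Phi> ((s, y), \<omega>) \<partial>\<Omega>) = ennreal (2 * Lc\<^sup>2) * ((\<integral>\<^sup>+\<omega>. ennreal ((norm (V l \<theta>a s y \<omega> - U s y))\<^sup>2) \<partial>\<Omega>)
          + (\<integral>\<^sup>+\<omega>. ennreal ((norm (V (l - 1) \<theta>b s y \<omega> - U s y))\<^sup>2) \<partial>\<Omega>))"
        using False unfolding \<Phi>_def by (simp, subst nn_integral_cmult, measurable, subst nn_integral_add, measurable)
      also have "\<dots> \<le> ennreal (2 * Lc\<^sup>2) * (ennreal (A l * exp (\<kappa> * (T - s))) + ennreal (A (l - 1) * exp (\<kappa> * (T - s))))"
        using A(2)[of l] A(2)[of "l - 1"] \<theta> s t unfolding err_le_def by (intro mult_left_mono add_mono) auto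
      also have "\<dots> = ennreal (Blev A l * exp (\<kappa> * (T - s)))"
        using A(1)[of l] A(1)[of "l - 1"] False
        by (simp add: Blev_def ennreal_mult[symmetric] ennreal_plus[symmetric] algebra_simps del: ennreal_plus)
      finally show ?thesis .
    qed
  qed
  finally show ?thesis .
qed

end

section \<open>Telescoping means and the recursion over the levels\<close>

lemma sum_telescope_pred:
  fixes h :: "nat \<Rightarrow> 'e::real_vector"
  shows "(\<Sum>l<Suc m. h l - (if l \<ge> 1 then h (l - 1) else 0)) = h m"
  by (induction m) auto

lemma sum_geometric_levels:
  "(\<Sum>l<Suc m. if l = 0 then a else b * 2 ^ (l - 1)) = a + b * (2 ^ m - 1 :: real)"
  by (induction m) (auto simp: algebra_simps)

context mlp_lip begin

lemma sum_Keys: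
  fixes f :: "nat + nat \<times> nat \<Rightarrow> 'e::comm_monoid_add"
  shows "(\<Sum>k\<in>Keys n. f k) = (\<Sum>i=1..M ^ n. f (Inl i)) + (\<Sum>l<n. \<Sum>i=1..M ^ (n - l). f (Inr (l, i)))"
  unfolding Keys_def by (subst sum.Plus) (simp_all add: sum.Sigma case_prod_unfold)

lemma level_single:
  "level l \<theta>a \<theta>b t x \<omega> = single l \<theta>a \<theta>a t x \<omega> - (if l \<ge> 1 then single (l - 1) \<theta>a \<theta>b t x \<omega> else 0)"
proof (cases "l \<ge> 1")
  case True
  thus ?thesis by (simp add: level_def Let_def single_def diffF_def prevV_def bvec_diff)
qed (simp add: level_def Let_def single_def diffF_def)

lemma terminal_mean:
  assumes "\<theta> \<in> Theta" "t \<in> {0..<T}"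
  shows "(\<integral>\<omega>. terminal \<theta> t x \<omega> \<partial>\<Omega>) = (\<integral>\<omega>. terminal [0] t x \<omega> \<partial>\<Omega>)"
  using assms by (intro integral_distr_eq terminal_law terminal_random) (auto simp: Theta_def)

text \<open>By \<open>single_law\<close> every mean on a level depends on the level alone and can be
  taken at the reference tuple \<open>[0]\<close>. The averages over equal means disappear and the
  levels telescope to the top one. The error assumptions enter through the integrability of the
  samples.\<close>

lemma summand_mean_sum:
  assumes n: "n \<noteq> 0" and \<kappa>: "0 < \<kappa>" and A: "\<And>j. j < n \<Longrightarrow> 0 \<le> A j" "\<And>j. j < n \<Longrightarrow> err_le \<kappa> j (A j)"
    and \<theta>: "\<theta> \<in> Theta" and t: "t \<in> {0..<T}"
  shows "(\<Sum>k\<in>Keys n. \<integral>\<omega>. summand n \<theta> t x k \<omega> \<partial>\<Omega>) = (\<integral>\<omega>. terminal [0] t x \<omega> \<partial>\<Omega>) + (\<integral>\<omega>. single (n - 1) [0] [0] t x \<omega> \<partial>\<Omega>)"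
proof -
  define h where "h l = (\<integral>\<omega>. single l [0] [0] t x \<omega> \<partial>\<Omega>)" for l
  have T0: "[0] \<in> Theta" by (simp add: Theta_def)
  have sm: "(\<integral>\<omega>. single l \<theta>s \<theta>a t x \<omega> \<partial>\<Omega>) = h l"
    if "\<theta>s \<in> Theta" "\<theta>a \<in> Theta" "Inl \<theta>s \<notin> Ext \<theta>a" "Inr \<theta>s \<notin> Ext \<theta>a" for l \<theta>s \<theta>a
    unfolding h_def by (intro integral_distr_eq single_law single_random t that T0 not_Ext_self)
  have lev: "(\<integral>\<omega>. level l (\<theta> @ [int l, int i]) (\<theta> @ [- int l, int i]) t x \<omega> \<partial>\<Omega>) = h l - (if l \<ge> 1 then h (l - 1) else 0)"
    if l: "l < n" for l i
  proof -
    have i1: "integrable \<Omega> (single l (\<theta> @ [int l, int i]) (\<theta> @ [int l, int i]) t x)"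
      by (rule single_exact(1)[OF \<kappa> A(1)[OF l] A(2)[OF l] Theta_append Theta_append not_Ext_self t])
    show ?thesis
    proof (cases "l \<ge> 1")
      case True
      have ne: "Inl (\<theta> @ [int l, int i]) \<notin> Ext (\<theta> @ [- int l, int i])" "Inr (\<theta> @ [int l, int i]) \<notin> Ext (\<theta> @ [- int l, int i])"
        using True by (auto simp: Ext_def)
      have l': "l - 1 < n" using l by simp
      have i2: "integrable \<Omega> (single (l - 1) (\<theta> @ [int l, int i]) (\<theta> @ [- int l, int i]) t x)"
        by (rule single_exact(1)[OF \<kappa> A(1)[OF l'] A(2)[OF l'] Theta_append Theta_append ne t])
      show ?thesis unfolding level_single using True i1 i2
        by (simp add: sm[OF Theta_append Theta_append not_Ext_self] sm[OF Theta_append Theta_append ne])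
    next
      case False
      thus ?thesis unfolding level_single by (simp add: sm[OF Theta_append Theta_append not_Ext_self])
    qed
  qed
  have M0: "0 < M" using M by simp
  have "(\<Sum>k\<in>Keys n. \<integral>\<omega>. summand n \<theta> t x k \<omega> \<partial>\<Omega>)
    = (\<Sum>i=1..M ^ n. (1 / real M ^ n) *\<^sub>R (\<integral>\<omega>. terminal (\<theta> @ [0, - int i]) t x \<omega> \<partial>\<Omega>))
     + (\<Sum>l<n. \<Sum>i=1..M ^ (n - l). (1 / real M ^ (n - l)) *\<^sub>R (\<integral>\<omega>. level l (\<theta> @ [int l, int i]) (\<theta> @ [- int l, int i]) t x \<omega> \<partial>\<Omega>))"
    unfolding sum_Keys by (simp add: summand_def[abs_def])
  also have "(\<Sum>i=1..M ^ n. (1 / real M ^ n) *\<^sub>R (\<integral>\<omega>. terminal (\<theta> @ [0, - int i]) t x \<omega> \<partial>\<Omega>)) = (\<integral>\<omega>. terminal [0] t x \<omega> \<partial>\<Omega>)"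
    unfolding terminal_mean[OF Theta_append t] using M0 by (simp add: sum_constant_scaleR)
  also have "(\<Sum>l<n. \<Sum>i=1..M ^ (n - l). (1 / real M ^ (n - l)) *\<^sub>R (\<integral>\<omega>. level l (\<theta> @ [int l, int i]) (\<theta> @ [- int l, int i]) t x \<omega> \<partial>\<Omega>))
     = (\<Sum>l<n. h l - (if l \<ge> 1 then h (l - 1) else 0))"
    using M0 by (intro sum.cong refl) (simp add: lev sum_constant_scaleR)
  also have "\<dots> = h (n - 1)"
    using sum_telescope_pred[of h "n - 1"] n by simp
  finally show ?thesis by (simp add: h_def)
qed

end

text \<open>The assumption \<open>rep\<close> is Feynman-Kac and Bismut-Elworthy-Li in one equation:
  the exact vector is a fixed point of the Picard map, written with means of samples. It is
  discharged by \<open>representation\<close>.\<close>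

locale mlp_error = mlp_lip \<Omega> T \<alpha> \<sigma> W \<rr> g F M U Lc E0 Eg Eu
  for \<Omega> :: "'w measure" and T \<alpha> \<sigma> :: real and W :: "int list \<Rightarrow> real \<Rightarrow> 'w \<Rightarrow> real ^ 'd"
    and \<rr> g F M U Lc E0 Eg Eu +
  assumes rep: "\<And>t x. t \<in> {0..<T} \<Longrightarrow> U t x = (g x, 0) + (\<integral>\<omega>. terminal [0] t x \<omega> \<partial>\<Omega>) + (\<integral>\<omega>. exact [0] t x \<omega> \<partial>\<Omega>)"
begin

text \<open>Averaging \<open>M ^ j\<close> independent copies leaves the fraction
  \<open>1 / real M ^ j\<close> of a second moment. The mean of the estimator is the Picard map at
  estimator \<open>n - 1\<close>, while \<open>U\<close> is its own image by \<open>rep\<close>; so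
  the bias is the difference of means in \<open>single_exact\<close>.\<close>

lemma error_step:
  assumes n: "n \<noteq> 0" and \<kappa>: "0 < \<kappa>" and A: "\<And>j. j < n \<Longrightarrow> 0 \<le> A j" "\<And>j. j < n \<Longrightarrow> err_le \<kappa> j (A j)"
  defines "D \<equiv> kernel_const * \<kappa> powr (- \<alpha>)"
  shows "err_le \<kappa> n (terminal_const / real M ^ n + (\<Sum>l<n. D * Blev A l / real M ^ (n - l)) + D * (Lc\<^sup>2 * A (n - 1)))"
  unfolding err_le_def
proof (intro ballI allI)
  fix \<theta> t x assume \<theta>: "\<theta> \<in> Theta" and t: "t \<in> {0..<T}"
  define e where "e = exp (\<kappa> * (T - t))"
  \<comment> \<open>Lets the terminal bound, which comes without an exponential, take the common
    weight.\<close>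
  have e: "1 \<le> e" using \<kappa> t by (simp add: e_def)
  have M0: "0 < real M ^ j" for j using M by simp
  have D: "0 \<le> D" using kernel_const_nonneg by (simp add: D_def)
  have Bl: "0 \<le> Blev A l" if "l < n" for l
    using A(1)[of l] A(1)[of "l - 1"] that by (auto simp: Blev_def)
  define b where "b k = (case k of Inl i \<Rightarrow> (1 / real M ^ n)\<^sup>2 * (terminal_const * e)
     | Inr (l, i) \<Rightarrow> (1 / real M ^ (n - l))\<^sup>2 * (D * Blev A l * e))" for k :: "nat + nat \<times> nat"
  define c :: "real \<times> (real ^ 'd)" where "c = (g x, 0)"
  have sc: "(\<integral>\<^sup>+\<omega>. ennreal ((norm (a *\<^sub>R X \<omega>))\<^sup>2) \<partial>\<Omega>) \<le> ennreal (a\<^sup>2 * B)"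
    if "X \<in> borel_measurable \<Omega>" "(\<integral>\<^sup>+\<omega>. ennreal ((norm (X \<omega>))\<^sup>2) \<partial>\<Omega>) \<le> ennreal B" "0 \<le> B" for a B and X :: "'w \<Rightarrow> real \<times> (real ^ 'd)"
  proof -
    note [measurable] = that(1)
    have "(\<integral>\<^sup>+\<omega>. ennreal ((norm (a *\<^sub>R X \<omega>))\<^sup>2) \<partial>\<Omega>) = (\<integral>\<^sup>+\<omega>. ennreal (a\<^sup>2) * ennreal ((norm (X \<omega>))\<^sup>2) \<partial>\<Omega>)"
      by (intro nn_integral_cong) (simp add: power_mult_distrib ennreal_mult[symmetric])
    also have "\<dots> = ennreal (a\<^sup>2) * (\<integral>\<^sup>+\<omega>. ennreal ((norm (X \<omega>))\<^sup>2) \<partial>\<Omega>)"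
      by (rule nn_integral_cmult) measurable
    also have "\<dots> \<le> ennreal (a\<^sup>2) * ennreal B" by (intro mult_left_mono that) simp
    also have "\<dots> = ennreal (a\<^sup>2 * B)" using that by (simp add: ennreal_mult)
    finally show ?thesis .
  qed
  have bb: "(\<integral>\<^sup>+\<omega>. ennreal ((norm (summand n \<theta> t x k \<omega>))\<^sup>2) \<partial>\<Omega>) \<le> ennreal (b k) \<and> 0 \<le> b k" if k: "k \<in> Keys n" for k
  proof (cases k)
    case (Inl i)
    have "(\<integral>\<^sup>+\<omega>. ennreal ((norm (terminal (\<theta> @ [0, - int i]) t x \<omega>))\<^sup>2) \<partial>\<Omega>) \<le> ennreal (terminal_const * e)"
      using e terminal_const_nonneg by (intro order_trans[OF terminal_square[OF Theta_append t]] ennreal_leI) (simp add: mult_le_cancel_left1)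
    thus ?thesis using e terminal_const_nonneg unfolding Inl summand_def b_def sum.case
      by (intro conjI sc terminal_random Theta_append) auto
  next
    case (Inr li)
    then obtain l i where li: "k = Inr (l, i)" by (cases li) auto
    hence l: "l < n" using k by (auto simp: Keys_def)
    have "(\<integral>\<^sup>+\<omega>. ennreal ((norm (level l (\<theta> @ [int l, int i]) (\<theta> @ [- int l, int i]) t x \<omega>))\<^sup>2) \<partial>\<Omega>) \<le> ennreal (D * Blev A l * e)"
      unfolding D_def e_def using l by (intro level_square \<kappa> A t) auto
    thus ?thesis using e D Bl[OF l] unfolding li summand_def b_def sum.case prod.case
      by (intro conjI sc level_random Theta_append) auto
  qed
  have sumb: "(\<Sum>k\<in>Keys n. b k) = (terminal_const / real M ^ n + (\<Sum>l<n. D * Blev A l / real M ^ (n - l))) * e"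
  proof -
    have "(\<Sum>k\<in>Keys n. b k) = (\<Sum>i=1..M ^ n. (1 / real M ^ n)\<^sup>2 * (terminal_const * e)) + (\<Sum>l<n. \<Sum>i=1..M ^ (n - l). (1 / real M ^ (n - l))\<^sup>2 * (D * Blev A l * e))"
      unfolding sum_Keys by (simp add: b_def)
    also have "\<dots> = terminal_const / real M ^ n * e + (\<Sum>l<n. D * Blev A l / real M ^ (n - l) * e)"
    proof -
      have *: "real (M ^ j) * ((1 / real M ^ j)\<^sup>2 * y) = y / real M ^ j" for j y
        using M0[of j] by (simp add: power2_eq_square)
      show ?thesis using * by (simp add: sum_constant mult.assoc[symmetric])
    qed
    also have "\<dots> = (terminal_const / real M ^ n + (\<Sum>l<n. D * Blev A l / real M ^ (n - l))) * e"
      by (simp add: distrib_right sum_distrib_right)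
    finally show ?thesis .
  qed
  have T0: "[0] \<in> Theta" by (simp add: Theta_def)
  have n1: "n - 1 < n" using n by simp
  have "c + (\<Sum>k\<in>Keys n. \<integral>\<omega>. summand n \<theta> t x k \<omega> \<partial>\<Omega>) - U t x
     = (\<integral>\<omega>. single (n - 1) [0] [0] t x \<omega> \<partial>\<Omega>) - (\<integral>\<omega>. exact [0] t x \<omega> \<partial>\<Omega>)"
  proof -
    have s: "(\<Sum>k\<in>Keys n. \<integral>\<omega>. summand n \<theta> t x k \<omega> \<partial>\<Omega>) = (\<integral>\<omega>. terminal [0] t x \<omega> \<partial>\<Omega>) + (\<integral>\<omega>. single (n - 1) [0] [0] t x \<omega> \<partial>\<Omega>)"
      by (rule summand_mean_sum[OF n \<kappa> A \<theta> t])
    have u: "U t x = c + (\<integral>\<omega>. terminal [0] t x \<omega> \<partial>\<Omega>) + (\<integral>\<omega>. exact [0] t x \<omega> \<partial>\<Omega>)"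
      unfolding c_def by (rule rep[OF t])
    show ?thesis unfolding s u by simp
  qed
  hence bias: "(norm (c + (\<Sum>k\<in>Keys n. \<integral>\<omega>. summand n \<theta> t x k \<omega> \<partial>\<Omega>) - U t x))\<^sup>2 \<le> D * (Lc\<^sup>2 * A (n - 1)) * e"
    using single_exact(2)[OF \<kappa> A(1)[OF n1] A(2)[OF n1] T0 T0 not_Ext_self t] by (simp add: D_def e_def)
  have "(\<integral>\<^sup>+\<omega>. ennreal ((norm (V n \<theta> t x \<omega> - U t x))\<^sup>2) \<partial>\<Omega>)
     \<le> ennreal ((\<Sum>k\<in>Keys n. b k) + (norm (c + (\<Sum>k\<in>Keys n. \<integral>\<omega>. summand n \<theta> t x k \<omega> \<partial>\<Omega>) - U t x))\<^sup>2)"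
    unfolding V_rec[OF n] c_def[symmetric]
    using bb by (intro indep_sum_square_bound Keys_finite summand_indep \<theta>) auto
  also have "\<dots> \<le> ennreal ((terminal_const / real M ^ n + (\<Sum>l<n. D * Blev A l / real M ^ (n - l)) + D * (Lc\<^sup>2 * A (n - 1))) * e)"
    using bias sumb by (intro ennreal_leI) (simp add: distrib_right)
  finally show "(\<integral>\<^sup>+\<omega>. ennreal ((norm (V n \<theta> t x \<omega> - U t x))\<^sup>2) \<partial>\<Omega>)
     \<le> ennreal ((terminal_const / real M ^ n + (\<Sum>l<n. D * Blev A l / real M ^ (n - l)) + D * (Lc\<^sup>2 * A (n - 1))) * exp (\<kappa> * (T - t)))"
    unfolding e_def .
qed

lemma err_le_mono: "err_le \<kappa> n A \<Longrightarrow> A \<le> A' \<Longrightarrow> err_le \<kappa> n A'"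
  unfolding err_le_def
  by (meson ennreal_leI exp_ge_zero mult_right_mono order_trans)

text \<open>Let c be the bracketed constant and K = D Lc^2 c M, with D as in
  \<open>error_step\<close>. A level \<open>l \<ge> 1\<close> contributes at most 6 K 2^(l-1) / M^n
  and the bias K 2^(n-1) / M^n. In total this is at most (c + 7 K 2^(n-1)) / M^n, which is below c
  2^n / M^n as soon as 8 K is at most c. This is the 8 in \<open>D2\<close>; \<open>D1\<close> takes
  care of level 0.\<close>

lemma error_bound:
  assumes \<kappa>: "0 < \<kappa>" and D1: "kernel_const * \<kappa> powr (- \<alpha>) \<le> 1" and D2: "8 * (kernel_const * \<kappa> powr (- \<alpha>)) * Lc\<^sup>2 * real M \<le> 1"
  shows "err_le \<kappa> n ((terminal_const + E0\<^sup>2 + Eu\<^sup>2) * 2 ^ n / real M ^ n)"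
proof (induction n rule: less_induct)
  case (less n)
  define c where "c = terminal_const + E0\<^sup>2 + Eu\<^sup>2"
  define D where "D = kernel_const * \<kappa> powr (- \<alpha>)"
  have c: "0 \<le> c" "Eu\<^sup>2 \<le> c" using terminal_const_nonneg by (auto simp: c_def)
  have D: "0 \<le> D" using kernel_const_nonneg by (simp add: D_def)
  have M1: "1 \<le> real M" using M by simp
  show ?case
  proof (cases n)
    case 0
    show ?thesis unfolding 0 err_le_def
    proof (intro ballI allI)
      fix \<theta> t x assume "\<theta> \<in> Theta" and t: "t \<in> {0..<T}"
      have "(norm (U t x))\<^sup>2 \<le> Eu\<^sup>2" using U_bd[OF t, of x] by (intro power_mono) auto
      also have "\<dots> \<le> c * 1" using c by simp
      also have "\<dots> \<le> c * exp (\<kappa> * (T - t))" using c \<kappa> t by (intro mult_left_mono) auto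
      finally show "(\<integral>\<^sup>+\<omega>. ennreal ((norm (V 0 \<theta> t x \<omega> - U t x))\<^sup>2) \<partial>\<Omega>)
         \<le> ennreal ((terminal_const + E0\<^sup>2 + Eu\<^sup>2) * 2 ^ 0 / real M ^ 0 * exp (\<kappa> * (T - t)))"
        by (simp add: V_0 emeasure_space_1 c_def ennreal_leI)
    qed
  next
    case (Suc m)
    define A where "A l = c * 2 ^ l / real M ^ l" for l :: nat
    have A: "0 \<le> A l" for l using c by (simp add: A_def)
    have IH: "err_le \<kappa> l (A l)" if "l < n" for l
      using less.IH[OF that] by (simp add: A_def c_def)
    have "err_le \<kappa> n (terminal_const / real M ^ n + (\<Sum>l<n. D * Blev A l / real M ^ (n - l)) + D * (Lc\<^sup>2 * A (n - 1)))"
      unfolding D_def using Suc by (intro error_step \<kappa> A IH) auto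
    moreover have "terminal_const / real M ^ n + (\<Sum>l<n. D * Blev A l / real M ^ (n - l)) + D * (Lc\<^sup>2 * A (n - 1)) \<le> c * 2 ^ n / real M ^ n"
    proof -
      define K where "K = D * Lc\<^sup>2 * c * real M"
      have K: "0 \<le> K" using D c by (simp add: K_def)
      have lev: "D * Blev A l / real M ^ (n - l) \<le> (if l = 0 then E0\<^sup>2 else 6 * K * 2 ^ (l - 1)) / real M ^ n" if l: "l < n" for l
      proof (cases "l = 0")
        case True
        have "D * E0\<^sup>2 \<le> 1 * E0\<^sup>2" using D1 by (intro mult_right_mono) (auto simp: D_def)
        thus ?thesis using True M1 by (simp add: Blev_def divide_right_mono)
      next
        case False
        then obtain j where j: "l = Suc j" by (cases l) auto
        have Mn: "real M ^ n = real M ^ (n - l) * real M ^ l" using l by (simp flip: power_add)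
        have "D * Blev A l / real M ^ (n - l) = (2 * D * Lc\<^sup>2 * c) * (2 ^ l / real M ^ l + 2 ^ j / real M ^ j) / real M ^ (n - l)"
          using j by (simp add: Blev_def A_def algebra_simps)
        also have "2 ^ l / real M ^ l + 2 ^ j / real M ^ j = (2 ^ l + real M * 2 ^ j) / real M ^ l"
          using M1 by (simp add: j add_divide_distrib)
        also have "(2 * D * Lc\<^sup>2 * c) * ((2 ^ l + real M * 2 ^ j) / real M ^ l) / real M ^ (n - l) = (2 * D * Lc\<^sup>2 * c) * (2 ^ l + real M * 2 ^ j) / real M ^ n"
          unfolding Mn by simp
        \<comment> \<open>A factor \<open>M \<ge> 1\<close> is added to the finer term so that both
          terms agree; then 2 (2 + 1) = 6.\<close>
        also have "\<dots> \<le> (2 * D * Lc\<^sup>2 * c) * (real M * 2 ^ l + real M * 2 ^ j) / real M ^ n"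
          using M1 D c by (intro divide_right_mono mult_left_mono add_right_mono) auto
        also have "\<dots> = 6 * K * 2 ^ j / real M ^ n" by (simp add: j K_def algebra_simps)
        finally show ?thesis using j by simp
      qed
      have "(\<Sum>l<n. D * Blev A l / real M ^ (n - l)) \<le> (\<Sum>l<n. (if l = 0 then E0\<^sup>2 else 6 * K * 2 ^ (l - 1)) / real M ^ n)"
        by (intro sum_mono lev) auto
      also have "\<dots> = (E0\<^sup>2 + 6 * K * (2 ^ m - 1)) / real M ^ n"
        unfolding Suc sum_divide_distrib[symmetric] sum_geometric_levels ..
      finally have S: "(\<Sum>l<n. D * Blev A l / real M ^ (n - l)) \<le> (E0\<^sup>2 + 6 * K * (2 ^ m - 1)) / real M ^ n" .
      have B: "D * (Lc\<^sup>2 * A (n - 1)) = K * 2 ^ m / real M ^ n"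
        using M1 by (simp add: Suc A_def K_def)
      have "8 * K = (8 * D * Lc\<^sup>2 * real M) * c" by (simp add: K_def)
      also have "\<dots> \<le> 1 * c" using D2 c by (intro mult_right_mono) (auto simp: D_def)
      finally have K8: "8 * K \<le> c" by simp
      have "terminal_const + (E0\<^sup>2 + 6 * K * (2 ^ m - 1)) + K * 2 ^ m \<le> c + 7 * K * 2 ^ m"
        using K by (simp add: c_def algebra_simps)
      also have "\<dots> \<le> c * 2 ^ m + 8 * K * 2 ^ m"
      proof -
        have "c * 1 \<le> c * 2 ^ m" using c by (intro mult_left_mono) auto
        moreover have "7 * K * 2 ^ m \<le> 8 * K * 2 ^ m" using K by (intro mult_right_mono) auto
        ultimately show ?thesis by simp
      qed
      also have "\<dots> \<le> c * 2 ^ m + c * 2 ^ m" using K8 by (intro add_left_mono mult_right_mono) auto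
      also have "\<dots> = c * 2 ^ n" by (simp add: Suc)
      finally have "(terminal_const + (E0\<^sup>2 + 6 * K * (2 ^ m - 1)) + K * 2 ^ m) / real M ^ n \<le> c * 2 ^ n / real M ^ n"
        using M1 by (intro divide_right_mono) auto
      thus ?thesis using S B by (simp add: add_divide_distrib)
    qed
    ultimately show ?thesis unfolding c_def[symmetric] by (rule err_le_mono)
  qed
qed

end

section \<open>Representation of the exact solution\<close>

context mlp_lip begin

text \<open>Joint density of elapsed time and increment. Elapsed time is the variable of the heat
  kernel formulas, hence the shift by \<open>t\<close>.\<close>

definition sdens :: "real \<Rightarrow> real \<times> (real ^ 'd) \<Rightarrow> real" where
  "sdens t q = indicator {0<..<T - t} (fst q) * varrho \<alpha> T t (t + fst q) * gauss (fst q) (snd q)"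

lemma sample_distributed:
  assumes \<theta>: "\<theta> \<in> Theta" and t: "t \<in> {0..<T}"
  shows "distributed \<Omega> lborel (\<lambda>\<omega>. (Rt t \<theta> \<omega> - t, Dt t \<theta> \<omega>)) (\<lambda>q. ennreal (sdens t q))"
proof -
  define \<tau> where "\<tau> = T - t"
  have \<tau>: "0 < \<tau>" using t by (simp add: \<tau>_def)
  have Tt: "T - t = \<tau>" by (simp add: \<tau>_def)
  have \<theta>': "\<theta> \<in> Theta" "Inl \<theta> \<in> Ind" "Inr \<theta> \<in> Ind" using \<theta> by auto
  have X: "(\<lambda>\<omega>. (Rt t \<theta> \<omega> - t, Dt t \<theta> \<omega>)) \<in> borel_measurable \<Omega>"
    by (rule sigma_of_measurable_events[of _ Ind])
       (intro borel_measurable_Pair borel_measurable_diff Rt_measurable Dt_measurable borel_measurable_const \<theta>', simp)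
  have dm: "(\<lambda>q. sdens t q) \<in> borel_measurable borel"
  proof -
    note [measurable] = fst_borel snd_borel
    show ?thesis unfolding sdens_def varrho_def rho_def by measurable
  qed
  show ?thesis
    unfolding distributed_def
  proof (intro conjI)
    show "distr \<Omega> lborel (\<lambda>\<omega>. (Rt t \<theta> \<omega> - t, Dt t \<theta> \<omega>)) = density lborel (\<lambda>q. ennreal (sdens t q))"
    proof (rule measure_eqI)
      fix S assume "S \<in> sets (distr \<Omega> lborel (\<lambda>\<omega>. (Rt t \<theta> \<omega> - t, Dt t \<theta> \<omega>)))"
      hence S: "S \<in> sets borel" by simp
      define \<Phi> where "\<Phi> p = (indicator S (fst (fst p) - t, snd (fst p)) :: ennreal)" for p :: "(real \<times> (real^'d)) \<times> 'w"
      have "(\<lambda>p::(real \<times> (real^'d)) \<times> 'w. (fst (fst p) - t, snd (fst p))) \<in> borel_measurable (borel \<Otimes>\<^sub>M sigma_of {})"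
        by (intro borel_measurable_Pair borel_measurable_diff borel_measurable_const measurable_compose[OF measurable_fst fst_borel]
            measurable_compose[OF measurable_fst snd_borel])
      from measurable_compose[OF this borel_measurable_indicator[OF S]]
      have \<Phi>: "\<Phi> \<in> borel_measurable (borel \<Otimes>\<^sub>M sigma_of {})" unfolding \<Phi>_def[abs_def] .
      have iS: "(\<lambda>q. indicator S q :: ennreal) \<in> borel_measurable (borel \<Otimes>\<^sub>M borel)"
        using S by (simp add: borel_prod)
      have "emeasure (distr \<Omega> lborel (\<lambda>\<omega>. (Rt t \<theta> \<omega> - t, Dt t \<theta> \<omega>))) S
         = (\<integral>\<^sup>+q. indicator S q \<partial>distr \<Omega> lborel (\<lambda>\<omega>. (Rt t \<theta> \<omega> - t, Dt t \<theta> \<omega>)))" using S by simp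
      also have "\<dots> = (\<integral>\<^sup>+\<omega>. \<Phi> ((Rt t \<theta> \<omega>, Dt t \<theta> \<omega>), \<omega>) \<partial>\<Omega>)"
        using X S by (subst nn_integral_distr) (auto simp: \<Phi>_def)
      also have "\<dots> = (\<integral>\<^sup>+q. ennreal (rho \<alpha> q) * indicator {0<..<1} q *
          (\<integral>\<^sup>+z. ennreal (gauss (\<tau> * q) z) * indicator S (\<tau> * q, z) \<partial>lborel) \<partial>lborel)"
        using sample_formula[OF \<theta> t _ _ _ \<Phi>] by (simp add: \<Phi>_def Tt emeasure_space_1)
      \<comment> \<open>Prepares the substitution s = \<tau> q. Dividing \<open>sdens\<close> by the
        positive value of the Gaussian at the origin isolates its factor in time.\<close>
      also have "\<dots> = (\<integral>\<^sup>+q. ennreal \<tau> * (\<lambda>s. ennreal (sdens t (s, 0) / gauss s (0::real^'d)) * (\<integral>\<^sup>+z. ennreal (gauss s z) * indicator S (s, z) \<partial>lborel)) (0 + \<tau> * q) \<partial>lborel)"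
      proof (intro nn_integral_cong)
        fix q :: real
        have "ennreal (rho \<alpha> q) * indicator {0<..<1} q = ennreal \<tau> * ennreal (sdens t (\<tau> * q, 0) / gauss (\<tau> * q) (0::real^'d))"
        proof (cases "q \<in> {0<..<1}")
          case True
          hence p: "0 < \<tau> * q" "\<tau> * q < \<tau>" using \<tau> by auto
          have "gauss (\<tau> * q) (0::real^'d) > 0" using gauss_exp[OF p(1), of "0::real^'d"] by simp
          hence "sdens t (\<tau> * q, 0) / gauss (\<tau> * q) (0::real^'d) = rho \<alpha> q / \<tau>"
            using p \<tau> by (simp add: sdens_def Tt varrho_def)
          thus ?thesis using True \<tau> by (simp add: ennreal_mult'[symmetric])
        next
          case False
          hence "\<tau> * q \<notin> {0<..<\<tau>}" using \<tau> by (auto simp: mult_less_cancel_left1 zero_less_mult_iff)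
          hence z: "indicator {0<..<\<tau>} (\<tau> * q) = (0::real)" by (simp del: greaterThanLessThan_iff)
          have "indicator {0<..<1} q = (0::ennreal)" using False by (simp del: greaterThanLessThan_iff)
          thus ?thesis by (simp add: sdens_def Tt z)
        qed
        thus "ennreal (rho \<alpha> q) * indicator {0<..<1} q * (\<integral>\<^sup>+z. ennreal (gauss (\<tau> * q) z) * indicator S (\<tau> * q, z) \<partial>lborel)
          = ennreal \<tau> * (\<lambda>s. ennreal (sdens t (s, 0) / gauss s (0::real^'d)) * (\<integral>\<^sup>+z. ennreal (gauss s z) * indicator S (s, z) \<partial>lborel)) (0 + \<tau> * q)"
          by (simp add: mult.assoc)
      qed
      also have "\<dots> = (\<integral>\<^sup>+s. ennreal (sdens t (s, 0) / gauss s (0::real^'d)) * (\<integral>\<^sup>+z. ennreal (gauss s z) * indicator S (s, z) \<partial>lborel) \<partial>lborel)"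
      proof -
        have m1: "(\<lambda>q::real \<times> (real^'d). ennreal (gauss (fst q) (snd q)) * indicator S q) \<in> borel_measurable (borel \<Otimes>\<^sub>M lborel)"
          using iS by measurable
        have m2: "(\<lambda>s. \<integral>\<^sup>+z. ennreal (gauss s z) * indicator S (s, z) \<partial>lborel) \<in> borel_measurable borel"
          using lborel.borel_measurable_nn_integral_fst[OF m1] by simp
        have "(\<lambda>s::real. (s, 0::real^'d)) \<in> borel_measurable borel" by (intro borel_measurable_Pair measurable_ident_sets[OF refl] borel_measurable_const)
        from measurable_compose[OF this dm] have m3: "(\<lambda>s. sdens t (s, 0)) \<in> borel_measurable borel" .
        have m: "(\<lambda>s. ennreal (sdens t (s, 0) / gauss s (0::real^'d)) * (\<integral>\<^sup>+z. ennreal (gauss s z) * indicator S (s, z) \<partial>lborel)) \<in> borel_measurable borel"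
          using m2 m3 by measurable
        have m': "(\<lambda>q. (\<lambda>s. ennreal (sdens t (s, 0) / gauss s (0::real^'d)) * (\<integral>\<^sup>+z. ennreal (gauss s z) * indicator S (s, z) \<partial>lborel)) (0 + \<tau> * q)) \<in> borel_measurable lborel"
          by (rule measurable_compose[OF _ m]) measurable
        show ?thesis
          using nn_integral_real_affine[OF m, of \<tau> 0] \<tau> nn_integral_cmult[OF m', of "ennreal \<tau>"] by simp
      qed
      also have "\<dots> = (\<integral>\<^sup>+s. \<integral>\<^sup>+z. ennreal (sdens t (s, z)) * indicator S (s, z) \<partial>lborel \<partial>lborel)"
      proof (intro nn_integral_cong)
        fix s :: real
        show "ennreal (sdens t (s, 0) / gauss s (0::real^'d)) * (\<integral>\<^sup>+z. ennreal (gauss s z) * indicator S (s, z) \<partial>lborel)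
           = (\<integral>\<^sup>+z. ennreal (sdens t (s, z)) * indicator S (s, z) \<partial>lborel)"
        proof (cases "s \<in> {0<..<\<tau>}")
          case True
          hence s: "0 < s" by simp
          have g0: "gauss s (0::real^'d) > 0" using gauss_exp[OF s, of "0::real^'d"] by simp
          have v: "0 \<le> varrho \<alpha> T t (t + s)" using alpha \<tau> by (simp add: varrho_def rho_def Tt)
          have e: "sdens t (s, 0) / gauss s (0::real^'d) = varrho \<alpha> T t (t + s)" "sdens t (s, z) = varrho \<alpha> T t (t + s) * gauss s z" for z
            using True g0 by (simp_all add: sdens_def Tt)
          have iS2: "(\<lambda>z. indicator S (s, z) :: ennreal) \<in> borel_measurable borel"
            using iS by (rule measurable_Pair2) simp
          show ?thesis unfolding e(1) unfolding e(2) using v iS2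
            by (subst nn_integral_cmult[symmetric]) (auto simp: ennreal_mult gauss_nonneg mult.assoc)
        qed (simp add: sdens_def Tt)
      qed
      also have "\<dots> = (\<integral>\<^sup>+q. ennreal (sdens t q) * indicator S q \<partial>lborel)"
      proof -
        have "(\<lambda>q. ennreal (sdens t q) * indicator S q) \<in> borel_measurable (lborel \<Otimes>\<^sub>M lborel)"
          using dm S by (simp add: lborel_prod)
        from lborel.nn_integral_fst[OF this] show ?thesis by (simp add: lborel_prod)
      qed
      also have "\<dots> = emeasure (density lborel (\<lambda>q. ennreal (sdens t q))) S"
        using dm S by (subst emeasure_density) auto
      finally show "emeasure (distr \<Omega> lborel (\<lambda>\<omega>. (Rt t \<theta> \<omega> - t, Dt t \<theta> \<omega>))) S = emeasure (density lborel (\<lambda>q. ennreal (sdens t q))) S" .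
    qed simp
  qed (use X dm in auto)
qed

lemma sdens_nonneg: "t \<in> {0..<T} \<Longrightarrow> 0 \<le> sdens t q"
  using alpha by (simp add: sdens_def varrho_def rho_def gauss_nonneg)

lemma terminal_integrable:
  assumes "\<theta> \<in> Theta" "t \<in> {0..<T}"
  shows "integrable \<Omega> (terminal \<theta> t x)"
  by (rule square_integrable_bound(1)[OF terminal_random terminal_square terminal_const_nonneg]) (use assms in auto)

text \<open>A sample divides by the density of the time at which it is taken, so its mean is an
  integral against the bare kernel, as in Duhamel's formula. The first component comes from
  \<open>duhamel_value\<close>, the others from \<open>duhamel_gradient\<close>; the minus sign in
  \<open>src\<close> turns the difference there into the sum here.\<close>

lemma representation:
  assumes t: "t \<in> {0..<T}" and H: "heat_sol (T - t) B y yt yi yii"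
    and yT: "\<And>z. y (T - t) z = g (x + \<sigma> *\<^sub>R z) - g x"
    and y0: "y 0 0 = fst (U t x) - g x" "\<And>j. yi j 0 0 = snd (U t x) $ j"
    and src: "\<And>s z. 0 < s \<Longrightarrow> s < T - t \<Longrightarrow> yt s z + 1/2 * (\<Sum>i\<in>UNIV. yii i s z) = - F (U (t + s) (x + \<sigma> *\<^sub>R z)) (t + s) (x + \<sigma> *\<^sub>R z)"
  shows "U t x = (g x, 0) + (\<integral>\<omega>. terminal [0] t x \<omega> \<partial>\<Omega>) + (\<integral>\<omega>. exact [0] t x \<omega> \<partial>\<Omega>)"
proof -
  interpret H: heat_sol "T - t" B y yt yi yii by (rule H)
  define \<tau> where "\<tau> = T - t"
  have \<tau>: "0 < \<tau>" using t by (simp add: \<tau>_def)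
  have T0: "[0] \<in> Theta" by (simp add: Theta_def)
  have dT: "distributed \<Omega> lborel (\<lambda>\<omega>. Wc [0] T \<omega> - Wc [0] t \<omega>) (\<lambda>z. ennreal (gauss \<tau> z))"
    unfolding \<tau>_def using t by (intro Wc_increment_distributed T0) auto
  note dS = sample_distributed[OF T0 t]
  define f where "f q = F (U (t + fst q) (x + \<sigma> *\<^sub>R snd q)) (t + fst q) (x + \<sigma> *\<^sub>R snd q)" for q
  have f: "f \<in> borel_measurable borel"
    unfolding f_def[abs_def]
    by (intro F_comp U_comp borel_measurable_add borel_measurable_scaleR borel_measurable_const fst_borel snd_borel)
  \<comment> \<open>The equation is available before the final time only, whereas Duhamel's integral
    includes it; the slice at \<tau> is a null set.\<close>
  have ind_eq: "AE q in lborel. indicator ({0<..T - t} \<times> UNIV) q * (H.src q * k q) = indicator {0<..<\<tau>} (fst q) * (- f q * k q)"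
    for k :: "real \<times> (real^'d) \<Rightarrow> real"
  proof -
    have "emeasure (lborel \<Otimes>\<^sub>M lborel) ({\<tau>} \<times> (UNIV :: (real^'d) set)) = emeasure lborel {\<tau>} * emeasure lborel (UNIV :: (real^'d) set)"
      by (rule lborel.emeasure_pair_measure_Times) auto
    hence "emeasure lborel ({\<tau>} \<times> (UNIV :: (real^'d) set)) = 0" by (simp add: lborel_prod)
    hence "{\<tau>} \<times> (UNIV :: (real^'d) set) \<in> null_sets lborel" by (intro null_setsI) (auto simp: borel_Times)
    hence "AE q in lborel. q \<notin> {\<tau>} \<times> (UNIV :: (real^'d) set)" by (rule AE_not_in)
    thus ?thesis
    proof eventually_elim
      case (elim q)
      obtain s z where q: "q = (s, z)" by force
      show ?case
      proof (cases "0 < s \<and> s < \<tau>")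
        case True
        have "H.src q = - f q" unfolding H.src_def f_def using src[of s z] True by (simp add: q \<tau>_def)
        thus ?thesis using True by (simp add: q \<tau>_def)
      next
        case False
        thus ?thesis using elim by (auto simp: q \<tau>_def indicator_def)
      qed
    qed
  qed
  have km: "k \<in> borel_measurable borel \<Longrightarrow> (\<lambda>q. indicator {0<..<\<tau>} (fst q) * (- f q * k q)) \<in> borel_measurable borel" for k
  proof -
    assume k: "k \<in> borel_measurable borel"
    note [measurable] = k f fst_borel
    show ?thesis by measurable
  qed
  \<comment> \<open>Shared by both components: \<open>c\<close> is 1 for the value and
    \<open>z $ j / s\<close> for the gradient, and \<open>varrho\<close> cancels between sample and
    density.\<close>
  have tgt: "(\<integral>\<omega>. h (Rt t [0] \<omega> - t, Dt t [0] \<omega>) \<partial>\<Omega>) = - (\<integral>q. indicator ({0<..T - t} \<times> UNIV) q * (H.src q * k q) \<partial>lborel)"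
    if h: "\<And>q. h q = f q / varrho \<alpha> T t (t + fst q) * c q" and k: "\<And>q. k q = c q * gauss (fst q) (snd q)"
      and c: "c \<in> borel_measurable borel"
      and i: "integrable lborel (\<lambda>q. indicator ({0<..T - t} \<times> UNIV) q * (H.src q * k q))" for h k c
  proof -
    note [measurable] = fst_borel snd_borel f c
    have hm: "h \<in> borel_measurable borel"
      unfolding h[abs_def] varrho_def rho_def by measurable
    have kmm: "k \<in> borel_measurable borel" unfolding k[abs_def] by measurable
    have "(\<integral>\<omega>. h (Rt t [0] \<omega> - t, Dt t [0] \<omega>) \<partial>\<Omega>) = (\<integral>q. sdens t q * h q \<partial>lborel)"
      by (rule distributed_integral[OF dS, symmetric]) (use hm sdens_nonneg t in auto)
    also have "\<dots> = (\<integral>q. - (indicator {0<..<\<tau>} (fst q) * (- f q * k q)) \<partial>lborel)"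
    proof (intro Bochner_Integration.integral_cong refl)
      fix q :: "real \<times> (real^'d)"
      show "sdens t q * h q = - (indicator {0<..<\<tau>} (fst q) * (- f q * k q))"
      proof (cases "fst q \<in> {0<..<\<tau>}")
        case True
        have "varrho \<alpha> T t (t + fst q) \<noteq> 0" using True alpha \<tau> by (simp add: varrho_def rho_def \<tau>_def)
        thus ?thesis using True by (simp add: sdens_def h k \<tau>_def)
      qed (simp add: sdens_def \<tau>_def)
    qed
    also have "\<dots> = - (\<integral>q. indicator {0<..<\<tau>} (fst q) * (- f q * k q) \<partial>lborel)"
      by (rule Bochner_Integration.integral_minus)
    also have "(\<integral>q. indicator {0<..<\<tau>} (fst q) * (- f q * k q) \<partial>lborel) = (\<integral>q. indicator ({0<..T - t} \<times> UNIV) q * (H.src q * k q) \<partial>lborel)"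
      by (rule integral_cong_AE[symmetric]) (use borel_measurable_integrable[OF i] km[OF kmm] ind_eq in auto)
    finally show ?thesis .
  qed
  have ti: "integrable \<Omega> (terminal [0] t x)" and ei: "integrable \<Omega> (exact [0] t x)"
    by (intro terminal_integrable exact_integrable T0 t)+
  note gm = gvec_comp[OF borel_measurable_const borel_measurable_const measurable_ident_sets[OF refl]]
  note [measurable] = g_meas
  have one: "fst (U t x) = g x + fst (\<integral>\<omega>. terminal [0] t x \<omega> \<partial>\<Omega>) + fst (\<integral>\<omega>. exact [0] t x \<omega> \<partial>\<Omega>)"
  proof -
    have "fst (\<integral>\<omega>. terminal [0] t x \<omega> \<partial>\<Omega>) = (\<integral>\<omega>. fst (terminal [0] t x \<omega>) \<partial>\<Omega>)"
      by (rule integral_bounded_linear[OF bounded_linear_fst ti, symmetric])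
    also have "\<dots> = (\<integral>\<omega>. (\<lambda>z. g (x + \<sigma> *\<^sub>R z) - g x) (Wc [0] T \<omega> - Wc [0] t \<omega>) \<partial>\<Omega>)"
      by (simp add: terminal_def gvec_def)
    also have "\<dots> = (\<integral>z. gauss \<tau> z * (g (x + \<sigma> *\<^sub>R z) - g x) \<partial>lborel)"
      by (rule distributed_integral[OF dT, symmetric]) (auto simp: gauss_nonneg)
    also have "\<dots> = (\<integral>z. y (T - t) z * gauss (T - t) z \<partial>lborel)" by (simp add: yT \<tau>_def mult.commute)
    finally have a: "fst (\<integral>\<omega>. terminal [0] t x \<omega> \<partial>\<Omega>) = (\<integral>z. y (T - t) z * gauss (T - t) z \<partial>lborel)" .
    have "fst (\<integral>\<omega>. exact [0] t x \<omega> \<partial>\<Omega>) = (\<integral>\<omega>. fst (exact [0] t x \<omega>) \<partial>\<Omega>)"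
      by (rule integral_bounded_linear[OF bounded_linear_fst ei, symmetric])
    also have "\<dots> = (\<integral>\<omega>. (\<lambda>q. f q / varrho \<alpha> T t (t + fst q) * 1) (Rt t [0] \<omega> - t, Dt t [0] \<omega>) \<partial>\<Omega>)"
      by (simp add: exact_def bvec_def f_def)
    also have "\<dots> = - (\<integral>q. indicator ({0<..T - t} \<times> UNIV) q * (H.src q * gauss (fst q) (snd q)) \<partial>lborel)"
      by (rule tgt[of _ "\<lambda>_. 1"]) (use H.duhamel_value in auto)
    finally show ?thesis using a H.duhamel_value(2) y0 by simp
  qed
  have two: "snd (U t x) $ j = snd (\<integral>\<omega>. terminal [0] t x \<omega> \<partial>\<Omega>) $ j + snd (\<integral>\<omega>. exact [0] t x \<omega> \<partial>\<Omega>) $ j" for j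
  proof -
    have bl: "bounded_linear (\<lambda>v::real \<times> (real^'d). snd v $ j)"
      by (rule bounded_linear_compose[OF bounded_linear_vec_nth bounded_linear_snd])
    have "snd (\<integral>\<omega>. terminal [0] t x \<omega> \<partial>\<Omega>) $ j = (\<integral>\<omega>. snd (terminal [0] t x \<omega>) $ j \<partial>\<Omega>)"
      by (rule integral_bounded_linear[OF bl ti, symmetric])
    also have "\<dots> = (\<integral>\<omega>. (\<lambda>z. (g (x + \<sigma> *\<^sub>R z) - g x) * (z $ j / \<tau>)) (Wc [0] T \<omega> - Wc [0] t \<omega>) \<partial>\<Omega>)"
      by (simp add: terminal_def gvec_def \<tau>_def)
    also have "\<dots> = (\<integral>z. gauss \<tau> z * ((g (x + \<sigma> *\<^sub>R z) - g x) * (z $ j / \<tau>)) \<partial>lborel)"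
      by (rule distributed_integral[OF dT, symmetric]) (auto simp: gauss_nonneg)
    also have "\<dots> = (\<integral>z. y (T - t) z * (z $ j / (T - t) * gauss (T - t) z) \<partial>lborel)"
      by (simp add: yT \<tau>_def mult.commute mult.left_commute mult.assoc)
    finally have a: "snd (\<integral>\<omega>. terminal [0] t x \<omega> \<partial>\<Omega>) $ j = (\<integral>z. y (T - t) z * (z $ j / (T - t) * gauss (T - t) z) \<partial>lborel)" .
    have "snd (\<integral>\<omega>. exact [0] t x \<omega> \<partial>\<Omega>) $ j = (\<integral>\<omega>. snd (exact [0] t x \<omega>) $ j \<partial>\<Omega>)"
      by (rule integral_bounded_linear[OF bl ei, symmetric])
    also have "\<dots> = (\<integral>\<omega>. (\<lambda>q. f q / varrho \<alpha> T t (t + fst q) * (snd q $ j / fst q)) (Rt t [0] \<omega> - t, Dt t [0] \<omega>) \<partial>\<Omega>)"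
      by (simp add: exact_def bvec_def f_def)
    also have "\<dots> = - (\<integral>q. indicator ({0<..T - t} \<times> UNIV) q * (H.src q * (snd q $ j / fst q * gauss (fst q) (snd q))) \<partial>lborel)"
    proof (rule tgt[of _ "\<lambda>q. snd q $ j / fst q"])
      note [measurable] = fst_borel snd_borel
      show "(\<lambda>q::real \<times> (real^'d). snd q $ j / fst q) \<in> borel_measurable borel" by measurable
    qed (use H.duhamel_gradient in auto)
    finally show ?thesis using a H.duhamel_gradient(2)[of j] y0 by simp
  qed
  show ?thesis
    by (rule prod_eqI) (use one two in \<open>auto simp: vec_eq_iff\<close>)
qed

end

section \<open>Functions of class \<open>C\<^sup>1\<^sup>,\<^sup>2\<close>\<close>

lemma C12D:
  assumes "C12 T v"
  shows C12_time: "s \<in> {0..T} \<Longrightarrow> ((\<lambda>s. v s x) has_vector_derivative time_deriv T v s x) (at s within {0..T})"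
    and C12_space: "s \<in> {0..T} \<Longrightarrow> ((\<lambda>h. v s (x + h *\<^sub>R axis i 1)) has_real_derivative partial_deriv i (v s) x) (at 0)"
    and C12_space2: "s \<in> {0..T} \<Longrightarrow> ((\<lambda>h. partial_deriv i (v s) (x + h *\<^sub>R axis j 1)) has_real_derivative partial_deriv j (partial_deriv i (v s)) x) (at 0)"
    and C12_cont: "continuous_on ({0..T} \<times> UNIV) (\<lambda>q. v (fst q) (snd q))"
    and C12_time_cont: "continuous_on ({0..T} \<times> UNIV) (\<lambda>q. time_deriv T v (fst q) (snd q))"
    and C12_space_cont: "continuous_on ({0..T} \<times> UNIV) (\<lambda>q. partial_deriv i (v (fst q)) (snd q))"
    and C12_space2_cont: "continuous_on ({0..T} \<times> UNIV) (\<lambda>q. partial_deriv j (partial_deriv i (v (fst q))) (snd q))"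
  using assms unfolding C12_def
  by (auto simp: time_deriv_def partial_deriv_def[abs_def] vector_derivative_works case_prod_unfold
      intro!: field_differentiable_derivI)

lemma partial_deriv_diff:
  assumes "C12 T u" "C12 T v" "s \<in> {0..T}"
  shows "partial_deriv i (defect u v s) x = partial_deriv i (u s) x - partial_deriv i (v s) x"
  unfolding partial_deriv_def[of _ "defect u v s"] defect_def
  by (intro DERIV_imp_deriv DERIV_diff C12_space[OF assms(1,3)] C12_space[OF assms(2,3)])

lemma partial_deriv2_diff:
  assumes "C12 T u" "C12 T v" "s \<in> {0..T}"
  shows "partial_deriv j (partial_deriv i (defect u v s)) x
    = partial_deriv j (partial_deriv i (u s)) x - partial_deriv j (partial_deriv i (v s)) x"
proof -
  have "partial_deriv i (defect u v s) = (\<lambda>x. partial_deriv i (u s) x - partial_deriv i (v s) x)"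
    using partial_deriv_diff[OF assms] by (simp add: fun_eq_iff)
  thus ?thesis unfolding partial_deriv_def[of j "partial_deriv i (defect u v s)"]
    by (simp only:) (intro DERIV_imp_deriv DERIV_diff C12_space2[OF assms(1,3)] C12_space2[OF assms(2,3)])
qed

lemma time_deriv_diff:
  assumes T: "0 < T" and "C12 T u" "C12 T v" "s \<in> {0..T}"
  shows "time_deriv T (defect u v) s x = time_deriv T u s x - time_deriv T v s x"
proof -
  have "((\<lambda>s. u s x - v s x) has_vector_derivative time_deriv T u s x - time_deriv T v s x) (at s within {0..T})"
    using assms by (intro has_vector_derivative_diff C12_time)
  thus ?thesis unfolding time_deriv_def[of T "defect u v"] defect_def
    using T assms(4) by (intro vector_derivative_within_closed_interval) auto
qed

lemma C12_defect:
  assumes T: "0 < T" and u: "C12 T u" and v: "C12 T v"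
  shows "C12 T (defect u v)"
  unfolding C12_def
proof (intro conjI ballI allI)
  fix s x i j assume s: "s \<in> {0..T}"
  show "(\<lambda>s. defect u v s x) differentiable at s within {0..T}"
    using u v s unfolding defect_def C12_def by (intro differentiable_diff) auto
  show "(\<lambda>h. defect u v s (x + h *\<^sub>R axis i 1)) field_differentiable at 0"
    using u v s unfolding defect_def C12_def by (intro field_differentiable_diff) auto
  show "(\<lambda>h. partial_deriv i (defect u v s) (x + h *\<^sub>R axis j 1)) field_differentiable at 0"
    using u v s unfolding partial_deriv_diff[OF u v s] C12_def by (intro field_differentiable_diff) auto
next
  show "continuous_on ({0..T} \<times> UNIV) (\<lambda>(s, x). defect u v s x)"
    unfolding case_prod_unfold defect_def by (intro continuous_on_diff C12_cont u v)
  have "continuous_on ({0..T} \<times> UNIV) (\<lambda>q. time_deriv T u (fst q) (snd q) - time_deriv T v (fst q) (snd q))"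
    by (intro continuous_on_diff C12_time_cont u v)
  thus "continuous_on ({0..T} \<times> UNIV) (\<lambda>(s, x). time_deriv T (defect u v) s x)"
    by (rule continuous_on_eq) (auto simp: time_deriv_diff[OF T u v])
  fix i j
  have "continuous_on ({0..T} \<times> UNIV) (\<lambda>q. partial_deriv i (u (fst q)) (snd q) - partial_deriv i (v (fst q)) (snd q))"
    by (intro continuous_on_diff C12_space_cont u v)
  thus "continuous_on ({0..T} \<times> UNIV) (\<lambda>(s, x). partial_deriv i (defect u v s) x)"
    by (rule continuous_on_eq) (auto simp: partial_deriv_diff[OF u v])
  have "continuous_on ({0..T} \<times> UNIV) (\<lambda>q. partial_deriv j (partial_deriv i (u (fst q))) (snd q) - partial_deriv j (partial_deriv i (v (fst q))) (snd q))"
    by (intro continuous_on_diff C12_space2_cont u v)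
  thus "continuous_on ({0..T} \<times> UNIV) (\<lambda>(s, x). partial_deriv j (partial_deriv i (defect u v s)) x)"
    by (rule continuous_on_eq) (auto simp: partial_deriv2_diff[OF u v])
qed

text \<open>By continuity a violation would spread to a nonempty open set, and such a set has
  positive measure.\<close>

lemma AE_le_continuous:
  fixes \<phi> :: "real ^ 'd \<Rightarrow> real"
  assumes "continuous_on UNIV \<phi>" "AE x in lborel. \<phi> x \<le> c"
  shows "\<phi> x \<le> c"
proof (rule ccontr)
  assume "\<not> \<phi> x \<le> c"
  define S where "S = {x. c < \<phi> x}"
  have o: "open S" unfolding S_def using assms(1) by (intro open_Collect_less continuous_on_const)
  have "S \<noteq> {}" using \<open>\<not> \<phi> x \<le> c\<close> by (auto simp: S_def not_le)
  hence "\<not> negligible S" by (rule open_not_negligible[OF o])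
  have "{x \<in> space lborel. \<not> \<phi> x \<le> c} = S" by (auto simp: S_def)
  moreover have "S \<in> sets lborel" using o by simp
  ultimately have "S \<in> null_sets lborel" using assms(2) by (subst (asm) AE_iff_null) auto
  hence "S \<in> null_sets lebesgue" by (simp add: null_sets_completionI)
  hence "negligible S" by (simp add: negligible_iff_null_sets)
  with \<open>\<not> negligible S\<close> show False by simp
qed

text \<open>All essential suprema in the norm are nonnegative, so each of them is at most
  \<open>b\<close>; continuity then upgrades the bound from almost everywhere to everywhere.\<close>

lemma W1inf_norm_bound:
  fixes \<phi> :: "real ^ 'd \<Rightarrow> real"
  assumes c: "continuous_on UNIV \<phi>" "\<And>i. continuous_on UNIV (partial_deriv i \<phi>)"
    and le: "W1inf_norm \<phi> \<le> ereal b"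
  shows "\<bar>\<phi> x\<bar> \<le> b" "\<bar>partial_deriv i \<phi> x\<bar> \<le> b"
proof -
  have pos: "0 \<le> esssup lborel (\<lambda>x. ereal \<bar>h x\<bar>)" for h :: "real ^ 'd \<Rightarrow> real"
  proof -
    have "esssup lborel (\<lambda>x::real^'d. 0::ereal) \<le> esssup lborel (\<lambda>x. ereal \<bar>h x\<bar>)"
      by (intro esssup_mono) auto
    thus ?thesis by (subst (asm) esssup_const) auto
  qed
  have pt: "\<bar>h x\<bar> \<le> b" if h: "continuous_on UNIV h" "esssup lborel (\<lambda>x. ereal \<bar>h x\<bar>) \<le> ereal b" for h :: "real ^ 'd \<Rightarrow> real" and x
  proof (rule AE_le_continuous[where \<phi>="\<lambda>x. \<bar>h x\<bar>"])
    show "continuous_on UNIV (\<lambda>x. \<bar>h x\<bar>)" using h(1) by (intro continuous_intros)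
    have "AE x in lborel. ereal \<bar>h x\<bar> \<le> esssup lborel (\<lambda>x. ereal \<bar>h x\<bar>)" by (rule esssup_AE)
    thus "AE x in lborel. \<bar>h x\<bar> \<le> b"
    proof eventually_elim
      case (elim x)
      hence "ereal \<bar>h x\<bar> \<le> ereal b" using h(2) by (rule order_trans)
      thus ?case by simp
    qed
  qed
  let ?s = "\<Sum>i\<in>UNIV. esssup lborel (\<lambda>x. ereal \<bar>partial_deriv i \<phi> x\<bar>)"
  have s0: "0 \<le> ?s" by (intro sum_nonneg pos)
  have "esssup lborel (\<lambda>x. ereal \<bar>\<phi> x\<bar>) + 0 \<le> W1inf_norm \<phi>" unfolding W1inf_norm_def by (intro add_left_mono s0)
  thus "\<bar>\<phi> x\<bar> \<le> b" using le by (intro pt c) simp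
  have "esssup lborel (\<lambda>x. ereal \<bar>partial_deriv i \<phi> x\<bar>) \<le> ?s"
  proof -
    have "esssup lborel (\<lambda>x. ereal \<bar>partial_deriv i \<phi> x\<bar>) + 0 \<le> esssup lborel (\<lambda>x. ereal \<bar>partial_deriv i \<phi> x\<bar>)
        + (\<Sum>i\<in>UNIV - {i}. esssup lborel (\<lambda>x. ereal \<bar>partial_deriv i \<phi> x\<bar>))"
      by (intro add_left_mono sum_nonneg pos)
    thus ?thesis by (simp add: sum.remove[of UNIV i])
  qed
  also have "0 + ?s \<le> W1inf_norm \<phi>" unfolding W1inf_norm_def by (intro add_right_mono pos)
  hence "?s \<le> W1inf_norm \<phi>" by simp
  finally show "\<bar>partial_deriv i \<phi> x\<bar> \<le> b" using le by (intro pt c) simp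
qed

lemma l1_norm_le: "l1_norm (z :: real ^ 'd) \<le> real CARD('d) * norm z"
proof -
  have "l1_norm z \<le> (\<Sum>i\<in>(UNIV::'d set). norm z)" unfolding l1_norm_def by (intro sum_mono component_le_norm_cart)
  thus ?thesis by simp
qed

text \<open>One coordinate is changed at a time, with a mean value bound on each axis-parallel
  segment, so partial derivatives suffice. The path has the length of the l1 distance, whence the
  dimension factor.\<close>

lemma lipschitz_of_partials:
  fixes \<phi> :: "real ^ 'd \<Rightarrow> real"
  assumes d: "\<And>x i. ((\<lambda>h. \<phi> (x + h *\<^sub>R axis i 1)) has_real_derivative D i x) (at 0)" and b: "\<And>x i. \<bar>D i x\<bar> \<le> b"
  shows "\<bar>\<phi> y - \<phi> x\<bar> \<le> b * real CARD('d) * norm (y - x)"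
proof -
  have line: "\<bar>\<phi> (p + c *\<^sub>R axis i 1) - \<phi> p\<bar> \<le> b * \<bar>c\<bar>" for p c i
  proof -
    have dl: "((\<lambda>h. \<phi> (p + h *\<^sub>R axis i 1)) has_real_derivative D i (p + h *\<^sub>R axis i 1)) (at h)" for h
      using DERIV_shift[of "\<lambda>h. \<phi> (p + h *\<^sub>R axis i 1)" _ 0 h] d[of "p + h *\<^sub>R axis i 1" i]
      by (simp add: algebra_simps)
    have "norm (\<phi> (p + c *\<^sub>R axis i 1) - \<phi> (p + 0 *\<^sub>R axis i 1)) \<le> b * norm (c - 0)"
      by (rule field_differentiable_bound[of UNIV "\<lambda>h. \<phi> (p + h *\<^sub>R axis i 1)" "\<lambda>h. D i (p + h *\<^sub>R axis i 1)"])
         (use dl b in auto)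
    thus ?thesis by simp
  qed
  have "\<bar>\<phi> (x + (\<Sum>i\<in>S. (y - x) $ i *\<^sub>R axis i 1)) - \<phi> x\<bar> \<le> (\<Sum>i\<in>S. b * \<bar>(y - x) $ i\<bar>)" for S :: "'d set"
  proof (induction S rule: infinite_finite_induct)
    case (insert i S)
    have e: "x + (\<Sum>i\<in>insert i S. (y - x) $ i *\<^sub>R axis i 1) = (x + (\<Sum>i\<in>S. (y - x) $ i *\<^sub>R axis i 1)) + (y - x) $ i *\<^sub>R axis i 1"
      using insert by (simp add: algebra_simps)
    have e': "(\<Sum>i\<in>insert i S. b * \<bar>(y - x) $ i\<bar>) = b * \<bar>(y - x) $ i\<bar> + (\<Sum>i\<in>S. b * \<bar>(y - x) $ i\<bar>)"
      using insert by simp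
    show ?case
      unfolding e e' using line[of "x + (\<Sum>i\<in>S. (y - x) $ i *\<^sub>R axis i 1)" "(y - x) $ i" i] insert.IH by linarith
  qed auto
  from this[of UNIV] have "\<bar>\<phi> y - \<phi> x\<bar> \<le> b * l1_norm (y - x)"
    using basis_expansion[of "y - x"] by (simp add: l1_norm_def sum_distrib_left scalar_mult_eq_scaleR)
  also have "\<dots> \<le> b * (real CARD('d) * norm (y - x))"
    using b[of undefined undefined] by (intro mult_left_mono l1_norm_le) linarith
  finally show ?thesis by (simp add: mult.assoc)
qed

text \<open>Freezing time outside \<open>[0,T]\<close> makes functions continuous on \<open>[0,T] \<times> \<real>\<^sup>d\<close> globally measurable.\<close>

definition clamp_time :: "real \<Rightarrow> real \<Rightarrow> real" where
  "clamp_time T s = max 0 (min T s)"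

lemma clamp_time_eq: "s \<in> {0..T} \<Longrightarrow> clamp_time T s = s"
  by (simp add: clamp_time_def)

lemma clamp_time_mem: "0 \<le> T \<Longrightarrow> clamp_time T s \<in> {0..T}"
  by (simp add: clamp_time_def)

lemma continuous_clamp:
  fixes h :: "real \<Rightarrow> real ^ 'd \<Rightarrow> real"
  assumes "0 \<le> T" "continuous_on ({0..T} \<times> UNIV) (\<lambda>q. h (fst q) (snd q))"
  shows "continuous_on UNIV (\<lambda>q. h (clamp_time T (fst q)) (snd q))"
proof -
  have "continuous_on UNIV (\<lambda>q::real \<times> (real^'d). (clamp_time T (fst q), snd q))"
    unfolding clamp_time_def by (intro continuous_intros)
  moreover have "(\<lambda>q::real \<times> (real^'d). (clamp_time T (fst q), snd q)) ` UNIV \<subseteq> {0..T} \<times> UNIV"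
    using clamp_time_mem[OF assms(1)] by auto
  ultimately show ?thesis using continuous_on_compose2[OF assms(2)] by fastforce
qed

lemma sol_vec_clamp_measurable:
  assumes T: "0 \<le> T" and v: "C12 T v"
  shows "(\<lambda>q. sol_vec \<sigma> v (clamp_time T (fst q)) (snd q)) \<in> borel_measurable borel"
proof (rule borel_measurable_continuous_onI)
  have c: "continuous_on UNIV (\<lambda>q. partial_deriv i (v (clamp_time T (fst q))) (snd q))" for i
    by (rule continuous_clamp[OF T, where h="\<lambda>s. partial_deriv i (v s)"]) (rule C12_space_cont[OF v])
  have g: "grad (v s) x = (\<chi> i. partial_deriv i (v s) x)" for s x by (simp add: grad_def)
  show "continuous_on UNIV (\<lambda>q. sol_vec \<sigma> v (clamp_time T (fst q)) (snd q))"
    unfolding sol_vec_def g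
    by (intro continuous_on_Pair continuous_on_scaleR continuous_on_const continuous_on_vec_lambda
        continuous_clamp[OF T C12_cont[OF v]] c)
qed

lemma residual_clamp_measurable:
  assumes T: "0 \<le> T" and v: "C12 T v" and F: "F \<in> borel_measurable borel"
  shows "(\<lambda>q. pde_residual T \<sigma> F v (clamp_time T (fst q)) (snd q)) \<in> borel_measurable borel"
proof -
  have 1: "(\<lambda>q. time_deriv T v (clamp_time T (fst q)) (snd q)) \<in> borel_measurable borel"
    by (intro borel_measurable_continuous_onI continuous_clamp T C12_time_cont v)
  have "continuous_on ({0..T} \<times> UNIV) (\<lambda>q. laplacian (v (fst q)) (snd q))"
    unfolding laplacian_def by (intro continuous_on_sum C12_space2_cont v)
  hence 2: "(\<lambda>q. laplacian (v (clamp_time T (fst q))) (snd q)) \<in> borel_measurable borel"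
    by (intro borel_measurable_continuous_onI continuous_clamp[OF T, where h="\<lambda>s. laplacian (v s)"])
  have 3: "(\<lambda>q. F (sol_vec \<sigma> v (clamp_time T (fst q)) (snd q))) \<in> borel_measurable borel"
    by (rule measurable_compose[OF sol_vec_clamp_measurable[OF T v] F])
  show ?thesis unfolding pde_residual_def using 1 2 3 by measurable
qed

lemma defect_F_measurable:
  assumes T: "0 \<le> T" and v: "C12 T v" and F: "F \<in> borel_measurable borel"
  shows "(\<lambda>q. defect_F T \<sigma> F v (fst q) (clamp_time T (fst (snd q))) (snd (snd q))) \<in> borel_measurable borel"
proof -
  have s: "snd \<in> borel_measurable (borel :: ((real \<times> (real^'d)) \<times> (real \<times> (real^'d))) measure)" by (rule snd_borel)
  note 1 = measurable_compose[OF s sol_vec_clamp_measurable[OF T v, of \<sigma>]]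
  note 2 = measurable_compose[OF s residual_clamp_measurable[OF T v F, of \<sigma>]]
  have 3: "(\<lambda>q. F (sol_vec \<sigma> v (clamp_time T (fst (snd q))) (snd (snd q)) + fst q)) \<in> borel_measurable borel"
    by (rule measurable_compose[OF _ F]) (intro borel_measurable_add 1 fst_borel)
  show ?thesis unfolding defect_F_def
    by (intro borel_measurable_add borel_measurable_diff 3 2 measurable_compose[OF 1 F])
qed

text \<open>The substitution \<open>x + \<sigma> *\<^sub>R z\<close> normalises the diffusion to 1/2
  and turns the gradient into \<sigma> times the gradient, the quantity that is estimated.
  Subtracting \<open>w T x\<close> matches the subtraction of \<open>g x\<close> in the terminal
  samples. The constant covers 2 b for this difference, |\<sigma>| b for the gradient and b for the
  source.\<close>

lemma heat_sol_of_C12: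
  fixes w :: "real \<Rightarrow> real ^ 'd \<Rightarrow> real"
  assumes T: "0 < T" and t: "t \<in> {0..<T}" and w: "C12 T w"
    and bd: "\<And>s x. s \<in> {0..T} \<Longrightarrow> \<bar>w s x\<bar> \<le> b" "\<And>s x i. s \<in> {0..T} \<Longrightarrow> \<bar>partial_deriv i (w s) x\<bar> \<le> b"
    and heat: "\<And>s x. s \<in> {0..<T} \<Longrightarrow> \<bar>time_deriv T w s x + \<sigma>\<^sup>2 / 2 * laplacian (w s) x\<bar> \<le> b"
  shows "heat_sol (T - t) ((3 + \<bar>\<sigma>\<bar>) * b) (\<lambda>s z. w (t + s) (x + \<sigma> *\<^sub>R z) - w T x)
      (\<lambda>s z. time_deriv T w (t + s) (x + \<sigma> *\<^sub>R z)) (\<lambda>i s z. \<sigma> * partial_deriv i (w (t + s)) (x + \<sigma> *\<^sub>R z))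
      (\<lambda>i s z. \<sigma>\<^sup>2 * partial_deriv i (partial_deriv i (w (t + s))) (x + \<sigma> *\<^sub>R z))"
proof unfold_locales
  have b: "0 \<le> b" using bd(1)[of 0 0] T by force
  have mem: "t + s \<in> {0..T}" if "s \<in> {0..T - t}" for s using that t by auto
  show "0 < T - t" using t by simp
  have chain: "((\<lambda>h. f (x + \<sigma> *\<^sub>R (z + h *\<^sub>R axis i 1))) has_real_derivative \<sigma> * D) (at 0)"
    if "((\<lambda>h. f (x + \<sigma> *\<^sub>R z + h *\<^sub>R axis i 1)) has_real_derivative D) (at 0)" for f :: "real ^ 'd \<Rightarrow> real" and D z i
  proof -
    have "((\<lambda>h. \<sigma> * h) has_real_derivative \<sigma>) (at 0)" by (auto intro!: derivative_eq_intros)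
    moreover have "((\<lambda>h. f (x + \<sigma> *\<^sub>R z + h *\<^sub>R axis i 1)) has_real_derivative D) (at (\<sigma> * 0))" using that by simp
    ultimately have "((\<lambda>h. f (x + \<sigma> *\<^sub>R z + (\<sigma> * h) *\<^sub>R axis i 1)) has_real_derivative D * \<sigma>) (at 0)"
      by (rule DERIV_chain2[rotated])
    thus ?thesis by (simp add: scaleR_add_right add.assoc mult.commute)
  qed
  have cont: "continuous_on ({0..T - t} \<times> UNIV) (\<lambda>q. h (t + fst q) (x + \<sigma> *\<^sub>R snd q))"
    if "continuous_on ({0..T} \<times> UNIV) (\<lambda>q. h (fst q) (snd q))" for h :: "real \<Rightarrow> real ^ 'd \<Rightarrow> real"
  proof -
    have c: "continuous_on ({0..T - t} \<times> UNIV) (\<lambda>q::real \<times> (real^'d). (t + fst q, x + \<sigma> *\<^sub>R snd q))"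
      by (intro continuous_intros)
    have r: "(\<lambda>q::real \<times> (real^'d). (t + fst q, x + \<sigma> *\<^sub>R snd q)) ` ({0..T - t} \<times> UNIV) \<subseteq> {0..T} \<times> UNIV"
      using t by auto
    from continuous_on_compose2[OF that c r] show ?thesis by simp
  qed
  show "continuous_on ({0..T - t} \<times> UNIV) (\<lambda>q. w (t + fst q) (x + \<sigma> *\<^sub>R snd q) - w T x)"
    by (intro continuous_on_diff continuous_on_const cont C12_cont w)
  show ct: "continuous_on ({0..T - t} \<times> UNIV) (\<lambda>q. time_deriv T w (t + fst q) (x + \<sigma> *\<^sub>R snd q))"
    by (intro cont C12_time_cont w)
  show "continuous_on ({0..T - t} \<times> UNIV) (\<lambda>q. \<sigma> * partial_deriv i (w (t + fst q)) (x + \<sigma> *\<^sub>R snd q))" for i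
    by (intro continuous_on_mult continuous_on_const cont[where h="\<lambda>s. partial_deriv i (w s)"] C12_space_cont w)
  show cii: "continuous_on ({0..T - t} \<times> UNIV) (\<lambda>q. \<sigma>\<^sup>2 * partial_deriv i (partial_deriv i (w (t + fst q))) (x + \<sigma> *\<^sub>R snd q))" for i
    by (intro continuous_on_mult continuous_on_const cont[where h="\<lambda>s. partial_deriv i (partial_deriv i (w s))"] C12_space2_cont w)
  fix s :: real and z :: "real ^ 'd" and i assume s: "s \<in> {0..T - t}"
  have e: "b \<le> (3 + \<bar>\<sigma>\<bar>) * b" "2 * b \<le> (3 + \<bar>\<sigma>\<bar>) * b" "\<bar>\<sigma>\<bar> * b \<le> (3 + \<bar>\<sigma>\<bar>) * b"
    using b by (auto simp: distrib_right intro: mult_right_mono)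
  show "\<bar>w (t + s) (x + \<sigma> *\<^sub>R z) - w T x\<bar> \<le> (3 + \<bar>\<sigma>\<bar>) * b"
    using bd(1)[OF mem[OF s], of "x + \<sigma> *\<^sub>R z"] bd(1)[of T x] T e(2) by (simp add: abs_le_iff)
  have "\<bar>\<sigma>\<bar> * \<bar>partial_deriv i (w (t + s)) (x + \<sigma> *\<^sub>R z)\<bar> \<le> \<bar>\<sigma>\<bar> * b"
    by (intro mult_left_mono bd(2) mem s) simp
  thus "\<bar>\<sigma> * partial_deriv i (w (t + s)) (x + \<sigma> *\<^sub>R z)\<bar> \<le> (3 + \<bar>\<sigma>\<bar>) * b"
    using e(3) by (simp add: abs_mult)
  show "((\<lambda>h. w (t + s) (x + \<sigma> *\<^sub>R (z + h *\<^sub>R axis i 1)) - w T x) has_real_derivative \<sigma> * partial_deriv i (w (t + s)) (x + \<sigma> *\<^sub>R z)) (at 0)"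
    using DERIV_diff[OF chain[OF C12_space[OF w mem[OF s]]] DERIV_const] by simp
  show "((\<lambda>h. \<sigma> * partial_deriv i (w (t + s)) (x + \<sigma> *\<^sub>R (z + h *\<^sub>R axis i 1))) has_real_derivative \<sigma>\<^sup>2 * partial_deriv i (partial_deriv i (w (t + s))) (x + \<sigma> *\<^sub>R z)) (at 0)"
    using DERIV_cmult[OF chain[OF C12_space2[OF w mem[OF s]]], of \<sigma>] by (simp add: power2_eq_square mult.assoc)
  show "((\<lambda>s. w (t + s) (x + \<sigma> *\<^sub>R z) - w T x) has_vector_derivative time_deriv T w (t + s) (x + \<sigma> *\<^sub>R z)) (at s within {0..T - t})"
  proof -
    have 1: "((\<lambda>s. t + s) has_vector_derivative 1) (at s within {0..T - t})"
      by (auto intro!: derivative_eq_intros)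
    have "(\<lambda>s. t + s) ` {0..T - t} \<subseteq> {0..T}" using t by auto
    hence "((\<lambda>s. w s (x + \<sigma> *\<^sub>R z)) has_vector_derivative time_deriv T w (t + s) (x + \<sigma> *\<^sub>R z)) (at (t + s) within (\<lambda>s. t + s) ` {0..T - t})"
      using C12_time[OF w mem[OF s]] by (rule has_vector_derivative_within_subset[rotated])
    from vector_diff_chain_within[OF 1 this]
    have "((\<lambda>s. w (t + s) (x + \<sigma> *\<^sub>R z)) has_vector_derivative time_deriv T w (t + s) (x + \<sigma> *\<^sub>R z)) (at s within {0..T - t})"
      by (simp add: o_def)
    from has_vector_derivative_diff[OF this has_vector_derivative_const] show ?thesis by simp
  qed
  txt \<open>The equation is only known before \<open>T\<close>; the bound extends to \<open>T\<close> by continuity.\<close>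
  define src where "src s = time_deriv T w (t + s) (x + \<sigma> *\<^sub>R z) + 1/2 * (\<Sum>i\<in>UNIV. \<sigma>\<^sup>2 * partial_deriv i (partial_deriv i (w (t + s))) (x + \<sigma> *\<^sub>R z))" for s
  have cl: "closure {0..<T - t} = {0..T - t}" using t by (intro closure_atLeastLessThan) auto
  have "continuous_on {0..T - t} src"
    unfolding src_def
    by (intro continuous_on_add continuous_on_mult continuous_on_const continuous_on_sum
        continuous_on_fst_slice[OF ct[unfolded scaleR_conv_of_real], unfolded scaleR_conv_of_real[symmetric]]
        continuous_on_fst_slice[where w="\<lambda>s z. time_deriv T w (t + s) (x + \<sigma> *\<^sub>R z)"]
        continuous_on_fst_slice[where w="\<lambda>s z. partial_deriv _ (partial_deriv _ (w (t + s))) (x + \<sigma> *\<^sub>R z)"]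
        cont[where h="\<lambda>s. partial_deriv _ (partial_deriv _ (w s))"] C12_space2_cont w ct)
  hence "norm (src s) \<le> b"
  proof (rule continuous_on_closure_norm_le[of "{0..<T - t}" src, unfolded cl])
    show "\<forall>s\<in>{0..<T - t}. norm (src s) \<le> b"
    proof
      fix s assume "s \<in> {0..<T - t}"
      hence "t + s \<in> {0..<T}" using t by auto
      from heat[OF this, of "x + \<sigma> *\<^sub>R z"] show "norm (src s) \<le> b"
        by (simp add: src_def laplacian_def sum_distrib_left)
    qed
  qed (use s in auto)
  thus "\<bar>time_deriv T w (t + s) (x + \<sigma> *\<^sub>R z) + 1/2 * (\<Sum>i\<in>UNIV. \<sigma>\<^sup>2 * partial_deriv i (partial_deriv i (w (t + s))) (x + \<sigma> *\<^sub>R z))\<bar> \<le> (3 + \<bar>\<sigma>\<bar>) * b"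
    using e(1) by (simp add: src_def)
qed

text \<open>Started in \<open>[0,T)\<close>, the recursion visits only \<open>t\<close>,
  \<open>T\<close> and random times strictly between them, where freezing time changes nothing. The
  equality holds for every sample point.\<close>

lemma (in mlp_input) mlp_clamp:
  assumes F: "\<And>w s y. s \<in> {0..<T} \<Longrightarrow> F' w s y = F w s y"
    and \<theta>: "\<theta> \<in> Theta" and t: "t \<in> {0..<T}" and \<omega>: "\<omega> \<in> space \<Omega>"
  shows "mlp T \<sigma> \<alpha> W \<rr> g F' M n \<theta> t x \<omega> = mlp T \<sigma> \<alpha> Wc \<rr> g F M n \<theta> t x \<omega>"
  using \<theta> t
proof (induction n arbitrary: \<theta> t x rule: less_induct)
  case (less n)
  have Th: "\<theta> @ [a, b] \<in> Theta" for a b by (simp add: Theta_def)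
  have W: "Wc \<theta>' T = W \<theta>' T" "Wc \<theta>' t = W \<theta>' t" for \<theta>' using less.prems T_pos by (auto intro: Wc_eq)
  have R: "t + (T - t) * \<rr> \<theta>' \<omega> \<in> {0..<T}" if "\<theta>' \<in> Theta" for \<theta>'
    using Rt_bounds[OF that less.prems(2) \<omega>] less.prems by (auto simp: Rt_def)
  have WR: "Wc \<theta>' (t + (T - t) * \<rr> \<theta>' \<omega>) = W \<theta>' (t + (T - t) * \<rr> \<theta>' \<omega>)" if "\<theta>' \<in> Theta" for \<theta>'
    using R[OF that] by (intro Wc_eq) auto
  note L = mlp.simps[where T=T and \<sigma>=\<sigma> and \<alpha>=\<alpha> and W=W and F=F' and n=n and \<theta>=\<theta> and t=t and x=x and \<omega>=\<omega> and g=g and M=M]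
    and Rr = mlp.simps[where T=T and \<sigma>=\<sigma> and \<alpha>=\<alpha> and W=Wc and F=F and n=n and \<theta>=\<theta> and t=t and x=x and \<omega>=\<omega> and g=g and M=M]
  show ?case
    unfolding L Rr Let_def W
    by (intro if_cong refl arg_cong2[where f="(+)"] sum.cong arg_cong2[where f=scaleR])
       (auto simp: WR[OF Th] F[OF R[OF Th]] less.IH[OF _ Th R[OF Th]])
qed

text \<open>A coordinate in an orthonormal basis is dominated by the norm, so one mean square bound
  for the vector serves all d + 1 components.\<close>

lemma L2_norm_rv_le:
  assumes P: "prob_space \<Omega>" and X: "X \<in> borel_measurable \<Omega>" and eq: "\<And>\<omega>. \<omega> \<in> space \<Omega> \<Longrightarrow> Z \<omega> = X \<omega> \<bullet> b"
    and b: "b \<in> (Basis :: 'e::euclidean_space set)" and le: "(\<integral>\<^sup>+\<omega>. ennreal ((norm (X \<omega>))\<^sup>2) \<partial>\<Omega>) \<le> ennreal c" "0 \<le> c"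
  shows "L2_norm_rv \<Omega> Z \<le> ennreal (sqrt c)"
proof -
  interpret prob_space \<Omega> by (rule P)
  note [measurable] = X
  have Z: "Z \<in> borel_measurable \<Omega>" using eq by (subst measurable_cong) auto
  note sq = square_integrable_bound[OF X le]
  have pt: "(X \<omega> \<bullet> b)\<^sup>2 \<le> (norm (X \<omega>))\<^sup>2" for \<omega>
    using Basis_le_norm[OF b, of "X \<omega>"] by (metis abs_ge_zero power2_abs power_mono)
  have i: "integrable \<Omega> (\<lambda>\<omega>. (X \<omega> \<bullet> b)\<^sup>2)"
    by (rule Bochner_Integration.integrable_bound[OF sq(2)]) (use pt in auto)
  have "(\<integral>\<omega>. (X \<omega> \<bullet> b)\<^sup>2 \<partial>\<Omega>) \<le> (\<integral>\<omega>. (norm (X \<omega>))\<^sup>2 \<partial>\<Omega>)"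
    by (intro integral_mono i sq(2) pt)
  also have "\<dots> \<le> c" by (rule sq(3))
  finally have "sqrt (\<integral>\<omega>. (X \<omega> \<bullet> b)\<^sup>2 \<partial>\<Omega>) \<le> sqrt c" by simp
  moreover have "(\<integral>\<omega>. (Z \<omega>)\<^sup>2 \<partial>\<Omega>) = (\<integral>\<omega>. (X \<omega> \<bullet> b)\<^sup>2 \<partial>\<Omega>)"
    using eq by (intro Bochner_Integration.integral_cong) auto
  moreover have "integrable \<Omega> (\<lambda>\<omega>. (Z \<omega>)\<^sup>2)"
    using i eq by (subst Bochner_Integration.integrable_cong[OF refl, where g="\<lambda>\<omega>. (X \<omega> \<bullet> b)\<^sup>2"]) auto
  ultimately show ?thesis using Z by (simp add: L2_norm_rv_def ennreal_leI)
qed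

section \<open>Error bounds for a surrogate and for the sequence\<close>

text \<open>The constants of the locale become \<open>C\<^sub>1 * e\<close> for the source at 0,
  \<open>C\<^sub>2 * e\<close> times d for the Lipschitz constant of the terminal defect, and
  \<open>(1 + \<bar>\<sigma>\<bar> * d) * C\<^sub>2 * e\<close> for the exact vector. The three
  summands of \<open>Kc\<close> are their contributions to \<open>error_bound\<close> after division
  by the square of \<open>e\<close>.\<close>

lemma surrogate_error:
  fixes F :: "real \<times> (real ^ 'd) \<Rightarrow> real" and g :: "real ^ 'd \<Rightarrow> real" and u v :: "real \<Rightarrow> real ^ 'd \<Rightarrow> real"
    and W :: "int list \<Rightarrow> real \<Rightarrow> 'w \<Rightarrow> real ^ 'd" and \<theta>\<^sub>0 :: int
  assumes T: "0 < T" and F_borel: "F \<in> borel_measurable borel"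
    and L: "0 \<le> L"
    and F_lipschitz: "\<And>v\<^sub>1 z\<^sub>1 v\<^sub>2 z\<^sub>2. \<bar>F (v\<^sub>1, z\<^sub>1) - F (v\<^sub>2, z\<^sub>2)\<bar> \<le> L * (\<bar>v\<^sub>1 - v\<^sub>2\<bar> + l1_norm (z\<^sub>1 - z\<^sub>2))"
    and u: "C12 T u" and v: "C12 T v"
    and pde: "\<And>t x. t \<in> {0..<T} \<Longrightarrow> time_deriv T u t x + \<sigma>\<^sup>2 / 2 * laplacian (u t) x + F (u t x, \<sigma> *\<^sub>R grad (u t) x) = 0"
    and terminal: "\<And>x. u T x = g x"
    and alpha: "0 < \<alpha>" "\<alpha> < 1" and prob: "prob_space \<Omega>" and input: "mlp_random_input \<Omega> T \<alpha> W \<rr>"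
    and e: "0 \<le> e" and C: "0 < C\<^sub>1" "0 < C\<^sub>2"
    and residual: "\<And>t x. t \<in> {0..T} \<Longrightarrow> \<bar>pde_residual T \<sigma> F v t x\<bar> \<le> C\<^sub>1 * e"
    and W1inf: "(SUP t\<in>{0..T}. W1inf_norm (defect u v t)) \<le> ereal (C\<^sub>2 * e)"
    and M: "1 \<le> M"
    and \<kappa>: "0 < \<kappa>" and Lc: "Lc = L * (1 + real CARD('d))"
    and c0: "c0 = (T powr (2 - \<alpha>) + real CARD('d) * T powr (1 - \<alpha>)) * Gamma \<alpha> / (1 - \<alpha>)"
    and D: "c0 * \<kappa> powr (- \<alpha>) \<le> 1" "8 * (c0 * \<kappa> powr (- \<alpha>)) * Lc\<^sup>2 * real M \<le> 1"
    and Kc: "Kc = (C\<^sub>2 * real CARD('d))\<^sup>2 * \<sigma>\<^sup>2 * (real CARD('d) * T + 3 * (real CARD('d))\<^sup>2) + C\<^sub>1\<^sup>2 + ((1 + \<bar>\<sigma>\<bar> * real CARD('d)) * C\<^sub>2)\<^sup>2"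
    and t: "t \<in> {0..<T}" and b: "b \<in> Basis"
  shows "L2_norm_rv \<Omega> (\<lambda>\<omega>. (mlp T \<sigma> \<alpha> W \<rr> (defect_g T g v) (defect_F T \<sigma> F v) M n [\<theta>\<^sub>0] t x \<omega>
            - sol_vec \<sigma> (defect u v) t x) \<bullet> b) \<le> ennreal (sqrt (Kc * e\<^sup>2 * 2 ^ n / real M ^ n * exp (\<kappa> * T)))"
proof -
  define w where "w = defect u v"
  define gc where "gc = defect_g T g v"
  define Fc where "Fc a s y = defect_F T \<sigma> F v a (clamp_time T s) y" for a s y
  define Uc where "Uc s y = sol_vec \<sigma> w (clamp_time T s) y" for s y
  define bb where "bb = C\<^sub>2 * e"
  have bb: "0 \<le> bb" using e C by (simp add: bb_def)
  have w: "C12 T w" unfolding w_def by (rule C12_defect[OF T u v])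
  have T0: "0 \<le> T" using T by simp
  txt \<open>The terminal defect is estimated through \<open>W1inf\<close>: its Lipschitz constant in the hypotheses on surrogates is not
    controlled by \<open>e\<close>.\<close>
  have W1: "W1inf_norm (w s) \<le> ereal bb" if "s \<in> {0..T}" for s
    using order_trans[OF SUP_upper[OF that, of "\<lambda>t. W1inf_norm (defect u v t)"] W1inf] unfolding w_def bb_def .
  have wb: "\<bar>w s x\<bar> \<le> bb" "\<bar>partial_deriv i (w s) x\<bar> \<le> bb" if s: "s \<in> {0..T}" for s x i
    by (rule W1inf_norm_bound[OF continuous_on_snd_slice[OF C12_cont[OF w] s]
          continuous_on_snd_slice[where w="\<lambda>s. partial_deriv _ (w s)", OF C12_space_cont[OF w] s] W1[OF s]])+
  have gcw: "gc x = w T x" for x by (simp add: gc_def defect_g_def w_def defect_def terminal)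
  have lapl: "laplacian (w s) x = laplacian (u s) x - laplacian (v s) x" if "s \<in> {0..T}" for s x
    unfolding laplacian_def w_def by (simp add: partial_deriv2_diff[OF u v that] sum_subtractf)
  have gradd: "grad (w s) x = grad (u s) x - grad (v s) x" if "s \<in> {0..T}" for s x
    unfolding grad_def w_def by (simp add: partial_deriv_diff[OF u v that] vec_eq_iff)
  have vec: "sol_vec \<sigma> v s x + sol_vec \<sigma> w s x = sol_vec \<sigma> u s x" if "s \<in> {0..T}" for s x
    unfolding sol_vec_def gradd[OF that] by (simp add: w_def defect_def scaleR_diff_right)
  \<comment> \<open>Surrogate plus defect is the exact solution. So in \<open>defect_F\<close> at
    the defect the values of \<open>F\<close> at the surrogate cancel, and what is left is
    \<open>F\<close> at \<open>u\<close> plus the linear part of the residual.\<close>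
  have heat: "time_deriv T w s x + \<sigma>\<^sup>2 / 2 * laplacian (w s) x = - defect_F T \<sigma> F v (sol_vec \<sigma> w s x) s x"
    if s: "s \<in> {0..<T}" for s x
  proof -
    have s': "s \<in> {0..T}" using s by simp
    show ?thesis
      unfolding defect_F_def vec[OF s'] lapl[OF s'] unfolding w_def time_deriv_diff[OF T u v s'] pde_residual_def
      using pde[OF s, of x] by (simp add: sol_vec_def algebra_simps diff_divide_distrib)
  qed
  have fs: "norm (fst r) \<le> norm r" "norm (snd r) \<le> norm r" for r :: "real \<times> (real ^ 'd)"
    by (metis norm_fst_le prod.collapse) (metis norm_snd_le prod.collapse)
  have Fl: "\<bar>F p - F q\<bar> \<le> Lc * norm (p - q)" for p q
  proof -
    have "\<bar>F p - F q\<bar> \<le> L * (\<bar>fst p - fst q\<bar> + l1_norm (snd p - snd q))"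
      using F_lipschitz[of "fst p" "snd p" "fst q" "snd q"] by simp
    also have "\<dots> \<le> L * (norm (p - q) + real CARD('d) * norm (p - q))"
    proof (intro mult_left_mono add_mono L)
      show "\<bar>fst p - fst q\<bar> \<le> norm (p - q)" using fs(1)[of "p - q"] by simp
      have "l1_norm (snd p - snd q) \<le> real CARD('d) * norm (snd p - snd q)" by (rule l1_norm_le)
      also have "\<dots> \<le> real CARD('d) * norm (p - q)"
        using fs(2)[of "p - q"] by (intro mult_left_mono) auto
      finally show "l1_norm (snd p - snd q) \<le> real CARD('d) * norm (p - q)" .
    qed
    finally show ?thesis by (simp add: Lc algebra_simps)
  qed
  interpret I: mlp_input \<Omega> T \<alpha> \<sigma> W \<rr>
    by (intro mlp_input.intro mlp_input_axioms.intro prob T alpha input)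
  interpret E: mlp_lip \<Omega> T \<alpha> \<sigma> W \<rr> gc Fc M Uc Lc "C\<^sub>1 * e" "C\<^sub>2 * e * real CARD('d)" "(1 + \<bar>\<sigma>\<bar> * real CARD('d)) * bb"
  proof unfold_locales
    have "continuous_on UNIV gc"
      unfolding gcw[abs_def] by (rule continuous_on_snd_slice[OF C12_cont[OF w]]) (use T in auto)
    thus "gc \<in> borel_measurable borel" by (rule borel_measurable_continuous_onI)
    show "(\<lambda>q. Fc (fst q) (fst (snd q)) (snd (snd q))) \<in> borel_measurable borel"
      unfolding Fc_def by (rule defect_F_measurable[OF T0 v F_borel])
    show "1 \<le> M" by (rule M)
    show "(\<lambda>q. Uc (fst q) (snd q)) \<in> borel_measurable borel"
      unfolding Uc_def by (rule sol_vec_clamp_measurable[OF T0 w])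
    show "0 \<le> Lc" using L by (simp add: Lc)
    show "0 \<le> C\<^sub>1 * e" "0 \<le> C\<^sub>2 * e * real CARD('d)" "0 \<le> (1 + \<bar>\<sigma>\<bar> * real CARD('d)) * bb"
      using e C bb by auto
    show "\<bar>Fc a s y - Fc a' s y\<bar> \<le> Lc * norm (a - a')" for a a' s y
      using Fl[of "sol_vec \<sigma> v (clamp_time T s) y + a" "sol_vec \<sigma> v (clamp_time T s) y + a'"] by (simp add: Fc_def defect_F_def)
    show "\<bar>Fc 0 s y\<bar> \<le> C\<^sub>1 * e" for s y
      using residual[OF clamp_time_mem[OF T0]] by (simp add: Fc_def defect_F_def)
    show "norm (Uc s y) \<le> (1 + \<bar>\<sigma>\<bar> * real CARD('d)) * bb" if s: "s \<in> {0..<T}" for s y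
    proof -
      have s': "s \<in> {0..T}" using s by simp
      have "norm (grad (w s) y) \<le> (\<Sum>i\<in>UNIV. \<bar>grad (w s) y $ i\<bar>)" by (rule norm_le_l1_cart)
      also have "\<dots> \<le> (\<Sum>i\<in>(UNIV::'d set). bb)" by (intro sum_mono) (simp add: grad_def wb[OF s'])
      finally have gr: "norm (grad (w s) y) \<le> real CARD('d) * bb" by simp
      have "norm (Uc s y) \<le> norm (w s y) + norm (\<sigma> *\<^sub>R grad (w s) y)"
        unfolding Uc_def sol_vec_def clamp_time_eq[OF s'] by (rule norm_Pair_le)
      also have "\<dots> \<le> bb + \<bar>\<sigma>\<bar> * (real CARD('d) * bb)"
        using wb(1)[OF s', of y] gr by (auto intro!: add_mono mult_left_mono)
      finally show ?thesis by (simp add: algebra_simps)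
    qed
    show "\<bar>gc x - gc y\<bar> \<le> C\<^sub>2 * e * real CARD('d) * norm (x - y)" for x y
      unfolding gcw bb_def[symmetric]
      by (rule lipschitz_of_partials[where D="\<lambda>i. partial_deriv i (w T)"]) (use T in \<open>auto intro!: C12_space[OF w] wb(2)\<close>)
  qed
  interpret E: mlp_error \<Omega> T \<alpha> \<sigma> W \<rr> gc Fc M Uc Lc "C\<^sub>1 * e" "C\<^sub>2 * e * real CARD('d)" "(1 + \<bar>\<sigma>\<bar> * real CARD('d)) * bb"
  proof unfold_locales
    fix t x assume t: "t \<in> {0..<T}"
    \<comment> \<open>One bound for the defect, its derivatives and the source; the source is at
      most its value at 0 plus a Lipschitz term.\<close>
    define hb where "hb = bb + (C\<^sub>1 * e + Lc * ((1 + \<bar>\<sigma>\<bar> * real CARD('d)) * bb))"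
    have F_eq: "defect_F T \<sigma> F v (sol_vec \<sigma> w s y) s y = Fc (Uc s y) s y" if "s \<in> {0..<T}" for s y
      using that by (simp add: Fc_def Uc_def clamp_time_eq)
    have nn: "0 \<le> C\<^sub>1 * e + Lc * ((1 + \<bar>\<sigma>\<bar> * real CARD('d)) * bb)"
      using E.const_nonneg by simp
    have "heat_sol (T - t) ((3 + \<bar>\<sigma>\<bar>) * hb) (\<lambda>s z. w (t + s) (x + \<sigma> *\<^sub>R z) - w T x)
      (\<lambda>s z. time_deriv T w (t + s) (x + \<sigma> *\<^sub>R z)) (\<lambda>i s z. \<sigma> * partial_deriv i (w (t + s)) (x + \<sigma> *\<^sub>R z))
      (\<lambda>i s z. \<sigma>\<^sup>2 * partial_deriv i (partial_deriv i (w (t + s))) (x + \<sigma> *\<^sub>R z))"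
    proof (rule heat_sol_of_C12[OF T t w])
      show "\<bar>w s x\<bar> \<le> hb" "\<bar>partial_deriv i (w s) x\<bar> \<le> hb" if "s \<in> {0..T}" for s x i
        using wb(1)[OF that, of x] wb(2)[OF that, of i x] nn by (auto simp: hb_def)
      show "\<bar>time_deriv T w s y + \<sigma>\<^sup>2 / 2 * laplacian (w s) y\<bar> \<le> hb" if s: "s \<in> {0..<T}" for s y
      proof -
        have "\<bar>Fc (Uc s y) s y\<bar> \<le> \<bar>Fc 0 s y\<bar> + \<bar>Fc (Uc s y) s y - Fc 0 s y\<bar>" by simp
        also have "\<dots> \<le> C\<^sub>1 * e + Lc * norm (Uc s y - 0)" by (intro add_mono E.F_zero E.F_lip)
        also have "\<dots> \<le> C\<^sub>1 * e + Lc * ((1 + \<bar>\<sigma>\<bar> * real CARD('d)) * bb)"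
          using E.U_bd[OF s, of y] E.const_nonneg by (intro add_left_mono mult_left_mono) auto
        finally show ?thesis unfolding heat[OF s] F_eq[OF s] using bb by (simp add: hb_def)
      qed
    qed
    thus "Uc t x = (gc x, 0) + I.expectation (E.terminal [0] t x) + I.expectation (E.exact [0] t x)"
    proof (rule E.representation[OF t])
      fix z :: "real ^ 'd"
      show "w (t + (T - t)) (x + \<sigma> *\<^sub>R z) - w T x = gc (x + \<sigma> *\<^sub>R z) - gc x" by (simp add: gcw)
    next
      show "w (t + 0) (x + \<sigma> *\<^sub>R 0) - w T x = fst (Uc t x) - gc x"
        using t by (simp add: gcw Uc_def clamp_time_eq sol_vec_def)
      show "\<sigma> * partial_deriv j (w (t + 0)) (x + \<sigma> *\<^sub>R 0) = snd (Uc t x) $ j" for j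
        using t by (simp add: Uc_def clamp_time_eq sol_vec_def grad_def)
      fix s :: real and z :: "real ^ 'd" assume s: "0 < s" "s < T - t"
      hence ts: "t + s \<in> {0..<T}" using t by auto
      have "time_deriv T w (t + s) (x + \<sigma> *\<^sub>R z) + 1/2 * (\<Sum>i\<in>UNIV. \<sigma>\<^sup>2 * partial_deriv i (partial_deriv i (w (t + s))) (x + \<sigma> *\<^sub>R z))
        = time_deriv T w (t + s) (x + \<sigma> *\<^sub>R z) + \<sigma>\<^sup>2 / 2 * laplacian (w (t + s)) (x + \<sigma> *\<^sub>R z)"
        by (simp add: laplacian_def sum_distrib_left)
      thus "time_deriv T w (t + s) (x + \<sigma> *\<^sub>R z) + 1/2 * (\<Sum>i\<in>UNIV. \<sigma>\<^sup>2 * partial_deriv i (partial_deriv i (w (t + s))) (x + \<sigma> *\<^sub>R z))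
        = - Fc (Uc (t + s) (x + \<sigma> *\<^sub>R z)) (t + s) (x + \<sigma> *\<^sub>R z)"
        unfolding heat[OF ts] F_eq[OF ts] .
    qed
  qed
  have kernel_const: "E.kernel_const = c0" by (simp add: E.kernel_const_def c0)
  have "E.err_le \<kappa> n ((E.terminal_const + (C\<^sub>1 * e)\<^sup>2 + ((1 + \<bar>\<sigma>\<bar> * real CARD('d)) * bb)\<^sup>2) * 2 ^ n / real M ^ n)"
    by (rule E.error_bound[OF \<kappa>]) (use D in \<open>simp_all add: kernel_const\<close>)
  moreover have "E.terminal_const + (C\<^sub>1 * e)\<^sup>2 + ((1 + \<bar>\<sigma>\<bar> * real CARD('d)) * bb)\<^sup>2 = Kc * e\<^sup>2"
    unfolding E.terminal_const_def Kc bb_def power_mult_distrib by (simp add: algebra_simps)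
  ultimately have err: "E.err_le \<kappa> n (Kc * e\<^sup>2 * 2 ^ n / real M ^ n)" by simp
  have Th: "[\<theta>\<^sub>0] \<in> Theta" by (simp add: Theta_def)
  have Kc0: "0 \<le> Kc" using T by (simp add: Kc)
  have nn: "0 \<le> Kc * e\<^sup>2 * 2 ^ n / real M ^ n" using Kc0 by simp
  show ?thesis
  proof (rule L2_norm_rv_le[OF prob _ _ b, where X="\<lambda>\<omega>. E.V n [\<theta>\<^sub>0] t x \<omega> - Uc t x"])
    show "(\<lambda>\<omega>. E.V n [\<theta>\<^sub>0] t x \<omega> - Uc t x) \<in> borel_measurable \<Omega>"
      by (intro borel_measurable_diff E.V_random Th borel_measurable_const)
    show "(mlp T \<sigma> \<alpha> W \<rr> (defect_g T g v) (defect_F T \<sigma> F v) M n [\<theta>\<^sub>0] t x \<omega> - sol_vec \<sigma> (defect u v) t x) \<bullet> b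
       = (E.V n [\<theta>\<^sub>0] t x \<omega> - Uc t x) \<bullet> b" if \<omega>: "\<omega> \<in> space \<Omega>" for \<omega>
    proof -
      have "mlp T \<sigma> \<alpha> W \<rr> (defect_g T g v) (defect_F T \<sigma> F v) M n [\<theta>\<^sub>0] t x \<omega> = E.V n [\<theta>\<^sub>0] t x \<omega>"
        unfolding E.V_def gc_def[symmetric] by (rule I.mlp_clamp[OF _ Th t \<omega>]) (simp add: Fc_def clamp_time_eq)
      moreover have "sol_vec \<sigma> (defect u v) t x = Uc t x" using t by (simp add: Uc_def w_def clamp_time_eq)
      ultimately show ?thesis by simp
    qed
    have "(\<integral>\<^sup>+\<omega>. ennreal ((norm (E.V n [\<theta>\<^sub>0] t x \<omega> - Uc t x))\<^sup>2) \<partial>\<Omega>) \<le> ennreal (Kc * e\<^sup>2 * 2 ^ n / real M ^ n * exp (\<kappa> * (T - t)))"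
      using err Th t unfolding E.err_le_def by blast
    also have "\<dots> \<le> ennreal (Kc * e\<^sup>2 * 2 ^ n / real M ^ n * exp (\<kappa> * T))"
      using t \<kappa> by (intro ennreal_leI mult_left_mono nn) auto
    finally show "(\<integral>\<^sup>+\<omega>. ennreal ((norm (E.V n [\<theta>\<^sub>0] t x \<omega> - Uc t x))\<^sup>2) \<partial>\<Omega>) \<le> ennreal (Kc * e\<^sup>2 * 2 ^ n / real M ^ n * exp (\<kappa> * T))" .
    show "0 \<le> Kc * e\<^sup>2 * 2 ^ n / real M ^ n * exp (\<kappa> * T)" by (intro mult_nonneg_nonneg nn) simp
  qed
qed

section \<open>Choice of the weight and conversion to powers of \<open>m N\<close>\<close>

theorem corollaryE8:
  fixes T \<sigma> L K \<alpha> \<beta> \<gamma> C\<^sub>1 C\<^sub>2 :: real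
    and p :: nat
    and F :: "real \<times> (real ^ 'd) \<Rightarrow> real"
    and g :: "real ^ 'd \<Rightarrow> real"
    and u :: "real \<Rightarrow> real ^ 'd \<Rightarrow> real"
    and S :: "(real \<Rightarrow> real ^ 'd \<Rightarrow> real) set"
    and e :: "(real \<Rightarrow> real ^ 'd \<Rightarrow> real) \<Rightarrow> real"
    and \<Omega> :: "'w measure"
    and B :: "real \<Rightarrow> 'w \<Rightarrow> real ^ 'd"
    and W :: "int list \<Rightarrow> real \<Rightarrow> 'w \<Rightarrow> real ^ 'd"
    and \<rr> :: "int list \<Rightarrow> 'w \<Rightarrow> real"
    and \<theta>\<^sub>0 :: int
    and uh :: "nat \<Rightarrow> real \<Rightarrow> real ^ 'd \<Rightarrow> real"
    and M :: "nat \<Rightarrow> nat"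
    and m :: "nat \<Rightarrow> real"
    and err :: "nat \<Rightarrow> ennreal"
  assumes T_pos: "0 < T"
    and sigma: "\<sigma> \<noteq> 0"
    \<comment> \<open>PDE\<close>
    and F_borel: "F \<in> borel_measurable borel"
    and g_borel: "g \<in> borel_measurable borel"
    and L_nonneg: "0 \<le> L"
    and F_lipschitz: "\<And>v\<^sub>1 z\<^sub>1 v\<^sub>2 z\<^sub>2.
          \<bar>F (v\<^sub>1, z\<^sub>1) - F (v\<^sub>2, z\<^sub>2)\<bar> \<le> L * (\<bar>v\<^sub>1 - v\<^sub>2\<bar> + l1_norm (z\<^sub>1 - z\<^sub>2))"
    and K_nonneg: "0 \<le> K"
    and g_lipschitz: "\<And>x y. \<bar>g x - g y\<bar> \<le> K * l1_norm (x - y)"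
    and u_C12: "C12 T u"
    and u_pde: "\<And>t x. t \<in> {0..<T} \<Longrightarrow>
          time_deriv T u t x + \<sigma>\<^sup>2 / 2 * laplacian (u t) x + F (u t x, \<sigma> *\<^sub>R grad (u t) x) = 0"
    and u_terminal: "\<And>x. u T x = g x"
    \<comment> \<open>parameters\<close>
    and p_ge: "2 \<le> p"
    and alpha: "\<alpha> \<in> {(real p - 2) / (2 * (real p - 1)) <..< real p / (2 * (real p - 1))}"
    and beta: "\<beta> = \<alpha> / 2 - (1 - \<alpha>) * (real p - 2) / (2 * real p)"
    and gamma: "0 < \<gamma>"
    \<comment> \<open>probability space and random input\<close>
    and prob: "prob_space \<Omega>"
    and B_brownian: "std_brownian_motion \<Omega> T B"
    and random_input: "mlp_random_input \<Omega> T \<alpha> W \<rr>"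
    \<comment> \<open>surrogates\<close>
    and S_C12: "\<And>v. v \<in> S \<Longrightarrow> C12 T v"
    and e_nonneg: "\<And>v. v \<in> S \<Longrightarrow> 0 \<le> e v"
    and S_lipschitz: "\<And>v. v \<in> S \<Longrightarrow>
          \<exists>Kh\<ge>0. \<forall>x y. \<bar>v T x - v T y\<bar> \<le> Kh * l1_norm (x - y)"
    and C_pos: "0 < C\<^sub>1" "0 < C\<^sub>2"
    and S_W1inf_finite: "\<And>v. v \<in> S \<Longrightarrow> (SUP t\<in>{0..T}. W1inf_norm (defect u v t)) < \<infinity>"
    and S_residual: "\<And>v t x. v \<in> S \<Longrightarrow> t \<in> {0..T} \<Longrightarrow> \<bar>pde_residual T \<sigma> F v t x\<bar> \<le> C\<^sub>1 * e v"
    and S_W1inf: "\<And>v. v \<in> S \<Longrightarrow> (SUP t\<in>{0..T}. W1inf_norm (defect u v t)) \<le> ereal (C\<^sub>2 * e v)"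
    and S_moments: "\<And>v t x q. v \<in> S \<Longrightarrow> t \<in> {0..<T} \<Longrightarrow> q \<in> {1..<real p} \<Longrightarrow>
          (\<integral>\<^sup>+ r\<in>{0<..<1}. ennreal (1 / (r powr (q / 2) * rho \<alpha> r powr (q - 1))) \<partial>lborel)
          + (SUP s\<in>{t..<T}. \<integral>\<^sup>+ \<omega>.
               ennreal (\<bar>pde_residual T \<sigma> F v t (x + \<sigma> *\<^sub>R B s \<omega> - \<sigma> *\<^sub>R B t \<omega>)\<bar> powr q) \<partial>\<Omega>) < \<infinity>"
    \<comment> \<open>the sequence of surrogates\<close>
    and M_eq: "\<And>N. M N = nat \<lfloor>real N powr (2 * \<beta>)\<rfloor>"
    and m_eq: "\<And>N. m N = real (CARD('d) + 1) * 5 ^ N * real N powr (2 * \<beta> * real N)"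
    and uh_in_S: "\<And>N. 2 \<le> N \<Longrightarrow> uh N \<in> S"
    and uh_rate: "(\<lambda>N. e (uh N)) \<in> O(\<lambda>N. m N powr (- \<gamma>))"
    \<comment> \<open>the worst-case component-wise root mean square error\<close>
    and err_eq: "\<And>N. err N = (SUP (t, x)\<in>{0..<T} \<times> UNIV. MAX b\<in>Basis.
        L2_norm_rv \<Omega> (\<lambda>\<omega>.
          (mlp T \<sigma> \<alpha> W \<rr> (defect_g T g (uh N)) (defect_F T \<sigma> F (uh N)) (M N) N [\<theta>\<^sub>0] t x \<omega>
            - sol_vec \<sigma> (defect u (uh N)) t x) \<bullet> b))"
  shows "(\<forall>\<^sub>F N in sequentially. err N < \<infinity>) \<and>
         (\<exists>\<delta> \<in> o(\<lambda>_. 1). (\<lambda>N. enn2real (err N)) \<in> O(\<lambda>N. m N powr (- \<gamma> - 1 / 2 + \<delta> N)))"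
proof -
  define d where "d = real CARD('d)"
  have d: "0 < d" by (simp add: d_def)
  have p: "2 \<le> real p" using p_ge by simp
  have al: "0 < \<alpha>" "\<alpha> < 1"
  proof -
    have "0 \<le> (real p - 2) / (2 * (real p - 1))" using p by simp
    thus "0 < \<alpha>" using alpha by simp
    have "real p / (2 * (real p - 1)) \<le> 1" using p by (simp add: field_simps)
    thus "\<alpha> < 1" using alpha by simp
  qed
  \<comment> \<open>The lower end of the interval for \<alpha> is precisely where \<beta> becomes
    positive.\<close>
  have beta0: "0 < \<beta>"
  proof -
    have "(real p - 2) / (2 * (real p - 1)) < \<alpha>" using alpha by simp
    hence "real p - 2 < \<alpha> * (2 * (real p - 1))" using p by (simp add: pos_divide_less_eq)
    hence "(1 - \<alpha>) * (real p - 2) < \<alpha> * real p" by (simp add: algebra_simps)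
    hence "(1 - \<alpha>) * (real p - 2) / (2 * real p) < \<alpha> * real p / (2 * real p)"
      using p by (intro divide_strict_right_mono) auto
    thus ?thesis using p by (simp add: beta)
  qed
  \<comment> \<open>The term subtracted in \<beta> is nonnegative. This inequality makes the weight
    exponent grow at most linearly in \<open>N\<close>.\<close>
  have beta1: "2 * \<beta> \<le> \<alpha>"
  proof -
    define X where "X = (1 - \<alpha>) * (real p - 2) / (2 * real p)"
    have "0 \<le> X" unfolding X_def using p al by (intro divide_nonneg_nonneg mult_nonneg_nonneg) auto
    moreover have "\<beta> = \<alpha> / 2 - X" unfolding X_def by (rule beta)
    ultimately show ?thesis by linarith
  qed
  define Lc where "Lc = L * (1 + real CARD('d))"
  define c0 where "c0 = (T powr (2 - \<alpha>) + real CARD('d) * T powr (1 - \<alpha>)) * Gamma \<alpha> / (1 - \<alpha>)"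
  define Kc where "Kc = (C\<^sub>2 * real CARD('d))\<^sup>2 * \<sigma>\<^sup>2 * (real CARD('d) * T + 3 * (real CARD('d))\<^sup>2) + C\<^sub>1\<^sup>2 + ((1 + \<bar>\<sigma>\<bar> * real CARD('d)) * C\<^sub>2)\<^sup>2"
  have c0: "0 \<le> c0" using al Gamma_real_pos[OF al(1)] by (simp add: c0_def)
  have Kc: "0 \<le> Kc" using T_pos by (simp add: Kc_def)
  \<comment> \<open>The choice of \<kappa> below means
    \<open>\<kappa> N powr (- \<alpha>) = 1 / (P * real (M N))\<close>. The first two summands of
    \<open>P\<close> then give the two smallness conditions of \<open>error_bound\<close>, and the
    last keeps \<open>P\<close> positive.\<close>
  define P where "P = 8 * c0 * Lc\<^sup>2 + c0 + 1"
  have P: "1 \<le> P" using c0 by (simp add: P_def)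
  define \<kappa> where "\<kappa> N = (P * real (M N)) powr (1 / \<alpha>)" for N
  \<comment> \<open>After the square root, \<open>ln 2\<close> accounts for two factors
    \<open>2 ^ N\<close>, one from the error bound and one from rounding \<open>M N\<close>; the
    other summand is half of \<kappa> T per unit of \<open>N\<close>.\<close>
  define C where "C = ln 2 + T / 2 * P powr (1 / \<alpha>)"
  have key: "err N \<le> ennreal (sqrt Kc * e (uh N) * exp (C * real N) * real N powr (- \<beta> * real N))" if N: "2 \<le> N" for N
  proof -
    have N1: "1 \<le> real N" using N by simp
    define y where "y = real N powr (2 * \<beta>)"
    have y1: "1 \<le> y" unfolding y_def using N1 beta0 by (intro ge_one_powr_ge_zero) auto
    \<comment> \<open>Rounding down loses at most a factor 2 because \<open>y\<close> is at least 1;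
      to the power \<open>N\<close> this loss is only exponential.\<close>
    have My: "real (M N) \<le> y" "y \<le> 2 * real (M N)" "1 \<le> M N"
    proof -
      have f: "1 \<le> \<lfloor>y\<rfloor>" using y1 by simp
      have e: "real (M N) = real_of_int \<lfloor>y\<rfloor>" using f by (simp add: M_eq y_def)
      show "real (M N) \<le> y" unfolding e by simp
      have "1 \<le> real (M N)" unfolding e using f by simp
      thus "1 \<le> M N" by simp
      have "y < real_of_int \<lfloor>y\<rfloor> + 1" by linarith
      thus "y \<le> 2 * real (M N)" using \<open>1 \<le> real (M N)\<close> unfolding e by linarith
    qed
    have M0: "0 < real (M N)" using My(3) by simp
    have \<kappa>: "0 < \<kappa> N" using P M0 by (simp add: \<kappa>_def)
    have \<kappa>p: "\<kappa> N powr (- \<alpha>) = 1 / (P * real (M N))"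
    proof -
      have "\<kappa> N powr (- \<alpha>) = (P * real (M N)) powr (1 / \<alpha> * (- \<alpha>))" unfolding \<kappa>_def by (rule powr_powr)
      also have "1 / \<alpha> * (- \<alpha>) = - 1" using al by simp
      also have "(P * real (M N)) powr (- 1) = 1 / (P * real (M N))" using P M0 by (simp add: powr_minus_divide)
      finally show ?thesis .
    qed
    have D1: "c0 * \<kappa> N powr (- \<alpha>) \<le> 1"
    proof -
      have "c0 \<le> P" using c0 by (simp add: P_def)
      also have "P * 1 \<le> P * real (M N)" using P My(3) by (intro mult_left_mono) auto
      finally show ?thesis unfolding \<kappa>p using P M0 by (simp add: divide_le_eq)
    qed
    have D2: "8 * (c0 * \<kappa> N powr (- \<alpha>)) * Lc\<^sup>2 * real (M N) \<le> 1"
    proof -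
      have "8 * (c0 * \<kappa> N powr (- \<alpha>)) * Lc\<^sup>2 * real (M N) = 8 * c0 * Lc\<^sup>2 / P"
        unfolding \<kappa>p using M0 by simp
      also have "8 * c0 * Lc\<^sup>2 \<le> P" using c0 by (simp add: P_def)
      hence "8 * c0 * Lc\<^sup>2 / P \<le> 1" using P by simp
      finally show ?thesis .
    qed
    define En where "En = e (uh N)"
    have En: "0 \<le> En" unfolding En_def by (rule e_nonneg[OF uh_in_S[OF N]])
    note S = uh_in_S[OF N]
    have "err N \<le> ennreal (sqrt (Kc * En\<^sup>2 * 2 ^ N / real (M N) ^ N * exp (\<kappa> N * T)))"
      unfolding err_eq
    proof (rule SUP_least, clarify)
      fix t x assume t: "t \<in> {0..<T}"
      have "L2_norm_rv \<Omega> (\<lambda>\<omega>. (mlp T \<sigma> \<alpha> W \<rr> (defect_g T g (uh N)) (defect_F T \<sigma> F (uh N)) (M N) N [\<theta>\<^sub>0] t x \<omega>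
            - sol_vec \<sigma> (defect u (uh N)) t x) \<bullet> b) \<le> ennreal (sqrt (Kc * En\<^sup>2 * 2 ^ N / real (M N) ^ N * exp (\<kappa> N * T)))"
        if b: "b \<in> Basis" for b
        by (rule surrogate_error[OF T_pos F_borel L_nonneg F_lipschitz u_C12 S_C12[OF S] u_pde u_terminal al prob random_input
              En C_pos S_residual[OF S, folded En_def] S_W1inf[OF S, folded En_def] My(3) \<kappa> Lc_def c0_def D1 D2 Kc_def t b])
      thus "(MAX b\<in>Basis. L2_norm_rv \<Omega> (\<lambda>\<omega>. (mlp T \<sigma> \<alpha> W \<rr> (defect_g T g (uh N)) (defect_F T \<sigma> F (uh N)) (M N) N [\<theta>\<^sub>0] t x \<omega>
            - sol_vec \<sigma> (defect u (uh N)) t x) \<bullet> b)) \<le> ennreal (sqrt (Kc * En\<^sup>2 * 2 ^ N / real (M N) ^ N * exp (\<kappa> N * T)))"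
        by (intro Max.boundedI) auto
    qed
    also have "sqrt (Kc * En\<^sup>2 * 2 ^ N / real (M N) ^ N * exp (\<kappa> N * T)) \<le> sqrt Kc * En * exp (C * real N) * real N powr (- \<beta> * real N)"
    proof (rule real_le_lsqrt)
      show "0 \<le> sqrt Kc * En * exp (C * real N) * real N powr (- \<beta> * real N)" using Kc En by simp
      have \<kappa>N: "\<kappa> N \<le> P powr (1 / \<alpha>) * real N"
      proof -
        have "real (M N) \<le> real N powr \<alpha>"
          using My(1) powr_mono[OF beta1 N1] unfolding y_def by linarith
        hence "real (M N) powr (1 / \<alpha>) \<le> (real N powr \<alpha>) powr (1 / \<alpha>)" using al by (intro powr_mono2) auto
        also have "\<dots> = real N" unfolding powr_powr using al N1 by simp
        finally have "P powr (1 / \<alpha>) * real (M N) powr (1 / \<alpha>) \<le> P powr (1 / \<alpha>) * real N" by (intro mult_left_mono) auto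
        thus ?thesis unfolding \<kappa>_def by (simp only: powr_mult)
      qed
      have inv: "1 / real (M N) ^ N \<le> 2 ^ N * real N powr (- \<beta> * real N * 2)"
      proof -
        have "y ^ N \<le> (2 * real (M N)) ^ N" using My y1 by (intro power_mono) auto
        hence "y ^ N \<le> 2 ^ N * real (M N) ^ N" by (simp add: power_mult_distrib)
        hence "1 / real (M N) ^ N \<le> 2 ^ N / y ^ N" using M0 y1 by (simp add: field_simps)
        also have "y ^ N = real N powr (2 * \<beta> * real N)"
          unfolding y_def using N1 by (subst powr_realpow[symmetric]) (auto simp: powr_powr)
        also have "2 ^ N / real N powr (2 * \<beta> * real N) = 2 ^ N * real N powr (- \<beta> * real N * 2)"
          using powr_minus_divide[of "real N" "2 * \<beta> * real N"] by (simp add: mult.commute mult.left_commute)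
        finally show ?thesis .
      qed
      have "Kc * En\<^sup>2 * 2 ^ N / real (M N) ^ N * exp (\<kappa> N * T) = Kc * En\<^sup>2 * 2 ^ N * exp (\<kappa> N * T) * (1 / real (M N) ^ N)" by simp
      also have "\<dots> \<le> Kc * En\<^sup>2 * 2 ^ N * exp (P powr (1 / \<alpha>) * real N * T) * (2 ^ N * real N powr (- \<beta> * real N * 2))"
        using Kc T_pos \<kappa>N M0 by (intro mult_mono inv mult_left_mono) auto
      also have "\<dots> = Kc * En\<^sup>2 * (2 ^ N * 2 ^ N * exp (P powr (1 / \<alpha>) * real N * T)) * real N powr (- \<beta> * real N * 2)"
        by (simp add: mult_ac)
      also have "2 ^ N * 2 ^ N * exp (P powr (1 / \<alpha>) * real N * T) = (exp (C * real N))\<^sup>2"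
      proof -
        have two: "(2::real) ^ N = exp (ln 2 * real N)" by (simp add: exp_of_nat2_mult)
        show ?thesis unfolding two exp_add[symmetric] power2_eq_square by (simp add: C_def algebra_simps)
      qed
      also have "real N powr (- \<beta> * real N * 2) = (real N powr (- \<beta> * real N))\<^sup>2"
        unfolding power2_eq_square powr_add[symmetric] by (simp add: mult.commute)
      also have "Kc * En\<^sup>2 * (exp (C * real N))\<^sup>2 * (real N powr (- \<beta> * real N))\<^sup>2 = (sqrt Kc * En * exp (C * real N) * real N powr (- \<beta> * real N))\<^sup>2"
        using Kc by (simp add: power_mult_distrib)
      finally show "Kc * En\<^sup>2 * 2 ^ N / real (M N) ^ N * exp (\<kappa> N * T) \<le> (sqrt Kc * En * exp (C * real N) * real N powr (- \<beta> * real N))\<^sup>2" .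
    qed
    finally show ?thesis unfolding En_def by (simp add: ennreal_leI)
  qed
  \<comment> \<open>The square root of \<open>m N\<close> contains 5^(N/2) besides N^(\<beta> N) and
    a constant; the added half of \<open>ln 5\<close> compensates it.\<close>
  define A where "A = C + ln 5 / 2"
  have A: "0 < A" using P T_pos by (simp add: A_def C_def add_pos_pos)
  \<comment> \<open>Chosen such that \<open>m N powr \<delta> N = exp (A * real N)\<close>, which
    moves the whole exponential loss into the exponent.\<close>
  define \<delta> where "\<delta> N = A * real N / ln (m N)" for N
  \<comment> \<open>The logarithm of \<open>m N\<close> is at least of order N ln N, so \<delta>
    decays at least like 1 / ln N.\<close>
  have m_pos: "0 < m N" "2 * \<beta> * real N * ln (real N) \<le> ln (m N)" "0 < ln (m N)" if N: "2 \<le> N" for N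
  proof -
    have N1: "1 < real N" using N by simp
    show m0: "0 < m N" using N1 by (simp add: m_eq)
    have "ln (m N) = ln (real (CARD('d) + 1)) + real N * ln 5 + 2 * \<beta> * real N * ln (real N)"
      unfolding m_eq using N1 by (simp add: ln_mult ln_powr ln_realpow)
    moreover have "0 < ln (real (CARD('d) + 1))" by (intro ln_gt_zero) simp
    moreover have "0 \<le> real N * ln 5" by simp
    ultimately show le: "2 * \<beta> * real N * ln (real N) \<le> ln (m N)" by linarith
    have "0 < 2 * \<beta> * real N * ln (real N)" using N1 beta0 by simp
    thus "0 < ln (m N)" using le by linarith
  qed
  have N_ge: "\<forall>\<^sub>F N in sequentially. 2 \<le> N" by (rule eventually_ge_at_top)
  have \<delta>0: "\<delta> \<in> o(\<lambda>_. 1)"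
  proof (rule smalloI_tendsto)
    have "\<delta> \<longlonglongrightarrow> 0"
    proof (rule real_tendsto_sandwich[of "\<lambda>_. 0" _ _ "\<lambda>N. A / (2 * \<beta> * ln (real N))"])
      show "\<forall>\<^sub>F N in sequentially. 0 \<le> \<delta> N"
        using N_ge by eventually_elim (use A m_pos in \<open>auto simp: \<delta>_def intro!: divide_nonneg_pos\<close>)
      show "\<forall>\<^sub>F N in sequentially. \<delta> N \<le> A / (2 * \<beta> * ln (real N))"
        using N_ge
      proof eventually_elim
        case (elim N)
        have N1: "1 < real N" using elim by simp
        have "0 < 2 * \<beta> * real N * ln (real N)" using N1 beta0 by simp
        hence "A * real N / ln (m N) \<le> A * real N / (2 * \<beta> * real N * ln (real N))"
          using m_pos[OF elim] A by (intro divide_left_mono) auto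
        also have "\<dots> = A / (2 * \<beta> * ln (real N))" using N1 by simp
        finally show ?case by (simp add: \<delta>_def)
      qed
      show "(\<lambda>N. A / (2 * \<beta> * ln (real N))) \<longlonglongrightarrow> 0" using beta0 by real_asymp
    qed simp
    thus "((\<lambda>N. \<delta> N / 1) \<longlongrightarrow> 0) sequentially" by simp
  qed simp
  have fin: "\<forall>\<^sub>F N in sequentially. err N < \<infinity>"
    by (rule eventually_mono[OF N_ge], rule le_less_trans[OF key]) simp_all
  have "(\<lambda>N. enn2real (err N)) \<in> O(\<lambda>N. e (uh N) * m N powr (- 1 / 2 + \<delta> N))"
  proof (rule bigoI)
    show "\<forall>\<^sub>F N in sequentially. norm (enn2real (err N)) \<le> sqrt Kc * sqrt (real (CARD('d) + 1)) * norm (e (uh N) * m N powr (- 1 / 2 + \<delta> N))"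
      using N_ge
    proof eventually_elim
      case (elim N)
      have N1: "1 < real N" using elim by simp
      have en: "0 \<le> e (uh N)" by (rule e_nonneg[OF uh_in_S[OF elim]])
      have r0: "0 \<le> sqrt Kc * e (uh N) * exp (C * real N) * real N powr (- \<beta> * real N)" using Kc en by simp
      have "enn2real (err N) \<le> sqrt Kc * e (uh N) * exp (C * real N) * real N powr (- \<beta> * real N)"
        using enn2real_mono[OF key[OF elim]] r0 by simp
      also have "exp (C * real N) * real N powr (- \<beta> * real N) = sqrt (real (CARD('d) + 1)) * m N powr (- 1 / 2 + \<delta> N)"
      proof -
        define q where "q = real (CARD('d) + 1)"
        have q: "0 < q" by (simp add: q_def)
        have lnm: "ln (m N) = ln q + real N * ln 5 + 2 * \<beta> * real N * ln (real N)"
          unfolding m_eq q_def[symmetric] using N1 q by (simp add: ln_mult ln_powr ln_realpow)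
        have "m N powr (- 1 / 2 + \<delta> N) = exp ((- 1 / 2 + \<delta> N) * ln (m N))"
          using m_pos(1)[OF elim] by (simp add: powr_def)
        also have "(- 1 / 2 + \<delta> N) * ln (m N) = - (1 / 2) * ln (m N) + A * real N"
          unfolding distrib_right \<delta>_def using m_pos(3)[OF elim] by simp
        also have "\<dots> = - (1 / 2) * ln q + C * real N + - \<beta> * real N * ln (real N)"
          unfolding lnm A_def by (simp add: algebra_simps)
        also have "exp \<dots> = exp (- (1 / 2) * ln q) * (exp (C * real N) * real N powr (- \<beta> * real N))"
          unfolding exp_add using N1 by (simp add: powr_def)
        finally have "sqrt q * m N powr (- 1 / 2 + \<delta> N) = (sqrt q * exp (- (1 / 2) * ln q)) * (exp (C * real N) * real N powr (- \<beta> * real N))"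
          by simp
        also have "sqrt q * exp (- (1 / 2) * ln q) = 1"
        proof -
          have "sqrt q = exp (1 / 2 * ln q)" using q powr_half_sqrt[of q] by (simp add: powr_def)
          thus ?thesis by (simp add: exp_add[symmetric])
        qed
        finally show ?thesis by (simp add: q_def)
      qed
      hence "sqrt Kc * e (uh N) * exp (C * real N) * real N powr (- \<beta> * real N)
          = sqrt Kc * sqrt (real (CARD('d) + 1)) * (e (uh N) * m N powr (- 1 / 2 + \<delta> N))"
        by (simp only: mult_ac)
      also have "\<dots> = sqrt Kc * sqrt (real (CARD('d) + 1)) * norm (e (uh N) * m N powr (- 1 / 2 + \<delta> N))"
        using en by simp
      finally show ?case by simp
    qed
  qed
  also have "(\<lambda>N. e (uh N) * m N powr (- 1 / 2 + \<delta> N)) \<in> O(\<lambda>N. m N powr (- \<gamma>) * m N powr (- 1 / 2 + \<delta> N))"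
    by (intro landau_o.big.mult uh_rate landau_o.big_refl)
  also have "(\<lambda>N. m N powr (- \<gamma>) * m N powr (- 1 / 2 + \<delta> N)) = (\<lambda>N. m N powr (- \<gamma> - 1 / 2 + \<delta> N))"
    by (simp add: powr_add[symmetric] algebra_simps)
  finally show ?thesis using fin \<delta>0 by blast
qed

end
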